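(* Let $L$ be a complex Lie group of dimension $n$ with Lie algebra $\mathfrak{l}$. There is a one-to-one correspondence between the set of left invariant flat complex projective structures (complex IFPSs) on $L$ and the set $$\{(f\otimes\Lambda_1,v)\mid (\mathfrak{l}\oplus\mathfrak{gl}(1),f\otimes\Lambda_1,V)\text{ is a PV of type IFPS, } v \text{ is a generic point of } V\}/\sim .$$
   Context: Lie algebras and representations are finite dimensional over $\mathbb{C}$. $L_a$ denotes left translation by $a$. Complex IFPS: let $G=PGL(\mathbb{C}^{n+1})$ and $X=P(\mathbb{C}^{n+1})$. A flat complex projective structure on $L$ is a maximal atlas $\{(U_\alpha,\varphi_\alpha)\}$ of $L$, with $\varphi_\alpha$ biholomorphic onto an open subset of $X$, such that on each connected component of $U_\alpha\cap U_\beta$ the coordinate change $\varphi_\beta\circ\varphi_\alpha^{-1}$ is the restriction of an element of $G$. It is left invariant (a complex IFPS) if for all $a\in L$, all $\alpha,\beta$ and each connected component $C$ of $U_\alpha\cap L_a^{-1}(U_\beta)$, the map $\varphi_\beta\circ L_a\circ\varphi_\alpha^{-1}|_{\varphi_\alpha(C)}$ is the restriction of an element of $G$. PVs: a triplet $(\mathfrak{g},\rho,V)$ (a Lie algebra with a representation $\rho$ on $V$) is a prehomogeneous vector space (PV) if there is $v\in V$ with $\rho(\mathfrak{g})v=V$; such a $v$ is called a generic point. $\Lambda_1$ denotes the identity representation of $\mathfrak{gl}(1)$, and for $f:\mathfrak{l}\to\mathfrak{gl}(V)$ the representation $f\otimes\Lambda_1$ of $\mathfrak{l}\oplus\mathfrak{gl}(1)$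 on $V\otimes\mathbb{C}\cong V$ is $(X,\lambda)\mapsto f(X)+\lambda I_V$. A PV $(\mathfrak{l}\oplus\mathfrak{gl}(1),f\otimes\Lambda_1,V)$ is of type IFPS if $\dim\mathfrak{l}+1=\dim V$. Here $V=\mathbb{C}^{n+1}$. Equivalence: let $\pi:\mathfrak{gl}(\mathbb{C}^{n+1})\to\mathfrak{gl}(\mathbb{C}^{n+1})/\mathbb{C}I_{n+1}$ be the projection, and let bars denote images in $PGL(\mathbb{C}^{n+1})$, resp. $P(\mathbb{C}^{n+1})$. Then $(f\otimes\Lambda_1,v)\sim(g\otimes\Lambda_1,w)$ means $(f,v)\sim(g,w)$, i.e. there is $P\in GL(\mathbb{C}^{n+1})$ with $\pi\circ g=\mathrm{Ad}(\overline{P})(\pi\circ f)$ and $\overline{w}=\overline{P}\,\overline{v}$. The correspondence in question: given a complex IFPS, choose a chart $\varphi$ near the unit $e$ with $\varphi(e)=o=[0,\dots,0,1]$. For $a$ near $e$ let $h(a)\in G$ be the element agreeing with $\varphi\circ L_a\circ\varphi^{-1}$ near $o$, and let $f=dh_e:\mathfrak{l}\to\mathrm{Lie}(G)\cong\mathfrak{sl}(\mathbb{C}^{n+1})\subset\mathfrak{gl}(\mathbb{C}^{n+1})$. The IFPS corresponds to the class of $(f\otimes\Lambda_1,e_{n+1})$, where $e_{n+1}$ is the last standard basis vector. *)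

theory Defs
  imports "HOL-Analysis.Analysis" "HOL-Algebra.Group" "HOL-Library.Function_Algebras"
    "HOL-Combinatorics.Transposition"
begin

section \<open>Complex manifolds\<close>

text \<open>
  Throughout, the index type \<open>'m\<close> has \<open>n + 1\<close> elements, so \<open>complex^'m\<close> is the space
  \<open>V\<close> of complex dimension \<open>n + 1\<close>. The index \<open>k\<close> plays the role of the last index
  \<open>n + 1\<close>. The model space of \<open>n\<close>-dimensional manifolds is the coordinate hyperplane
  \<open>Cn k\<close>; unlike a type \<open>complex^'n\<close> it also makes sense for \<open>n = 0\<close>.
\<close>

definition Cn :: "'m::finite \<Rightarrow> (complex^'m) set" where
  "Cn k = {x. x $ k = 0}"

text \<open>
  Complex differentiability on \<open>S\<close>; \<open>s\<close> and \<open>t\<close> are the multiplications by complex scalars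
  on the source and on the target. It is only used for \<open>S\<close> relatively open in \<open>Cn k\<close>
  (or in \<open>Cn k \<times> Cn k\<close>). The derivative is taken within \<open>S\<close>, so its values off the
  hyperplane are irrelevant.
\<close>

definition holo ::
  "(complex \<Rightarrow> 'b \<Rightarrow> 'b) \<Rightarrow> (complex \<Rightarrow> 'c \<Rightarrow> 'c) \<Rightarrow>
   ('b::real_normed_vector \<Rightarrow> 'c::real_normed_vector) \<Rightarrow> 'b set \<Rightarrow> bool" where
  "holo s t f S \<longleftrightarrow>
     (\<forall>x\<in>S. \<exists>D. (f has_derivative D) (at x within S) \<and> (\<forall>c v. D (s c v) = t c (D v)))"

definition pair_scale :: "complex \<Rightarrow> (complex^'m) \<times> (complex^'m) \<Rightarrow> (complex^'m) \<times> (complex^'m)" where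
  "pair_scale c p = (c *s fst p, c *s snd p)"

type_synonym ('a, 'b) chart = "'a set \<times> ('a \<Rightarrow> 'b)"

definition complex_manifold ::
  "'m::finite \<Rightarrow> 'a topology \<Rightarrow> ('a, complex^'m) chart set \<Rightarrow> bool" where
  "complex_manifold k T \<Phi> \<longleftrightarrow>
     Hausdorff_space T \<and> second_countable T \<and>
     (\<Union>(U, \<phi>)\<in>\<Phi>. U) = topspace T \<and>
     (\<forall>(U, \<phi>)\<in>\<Phi>. openin T U \<and> openin (top_of_set (Cn k)) (\<phi> ` U) \<and>
        homeomorphic_map (subtopology T U) (top_of_set (\<phi> ` U)) \<phi>) \<and>
     (\<forall>(U, \<phi>)\<in>\<Phi>. \<forall>(W, \<psi>)\<in>\<Phi>. holo (*s) (*s) (\<lambda>x. \<psi> (inv_into U \<phi> x)) (\<phi> ` (U \<inter> W)))"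

definition holo_map ::
  "'a topology \<Rightarrow> ('a, complex^'m::finite) chart set \<Rightarrow> 'b topology \<Rightarrow> ('b, complex^'m) chart set \<Rightarrow>
   'a set \<Rightarrow> ('a \<Rightarrow> 'b) \<Rightarrow> bool" where
  "holo_map T \<Phi> T' \<Psi> S F \<longleftrightarrow>
     openin T S \<and> continuous_map (subtopology T S) T' F \<and>
     (\<forall>(U, \<phi>)\<in>\<Phi>. \<forall>(W, \<psi>)\<in>\<Psi>.
        holo (*s) (*s) (\<lambda>x. \<psi> (F (inv_into U \<phi> x))) (\<phi> ` {p \<in> S \<inter> U. F p \<in> W}))"

definition biholomorphic_onto_open ::
  "'a topology \<Rightarrow> ('a, complex^'m::finite) chart set \<Rightarrow> 'b topology \<Rightarrow> ('b, complex^'m) chart set \<Rightarrow>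
   'a set \<Rightarrow> ('a \<Rightarrow> 'b) \<Rightarrow> bool" where
  "biholomorphic_onto_open T \<Phi> T' \<Psi> S F \<longleftrightarrow>
     inj_on F S \<and> holo_map T \<Phi> T' \<Psi> S F \<and> holo_map T' \<Psi> T \<Phi> (F ` S) (inv_into S F)"

text \<open>Complex valued functions holomorphic on \<open>S\<close>, and near \<open>p\<close>.\<close>

definition holo_fun ::
  "'a topology \<Rightarrow> ('a, complex^'m::finite) chart set \<Rightarrow> 'a set \<Rightarrow> ('a \<Rightarrow> complex) \<Rightarrow> bool" where
  "holo_fun T \<Phi> S g \<longleftrightarrow>
     openin T S \<and> (\<forall>(U, \<phi>)\<in>\<Phi>. holo (*s) (*) (\<lambda>x. g (inv_into U \<phi> x)) (\<phi> ` (S \<inter> U)))"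

definition holo_near ::
  "'a topology \<Rightarrow> ('a, complex^'m::finite) chart set \<Rightarrow> 'a \<Rightarrow> ('a \<Rightarrow> complex) set" where
  "holo_near T \<Phi> p = {g. \<exists>S. p \<in> S \<and> holo_fun T \<Phi> S g}"

text \<open>
  Tangent vectors are derivations of the algebra of germs of holomorphic functions. A derivation
  is encoded as a functional on all functions, with value \<open>0\<close> on those not holomorphic near \<open>p\<close>,
  so that equality of tangent vectors is equality of functionals.
\<close>

definition tangent_space ::
  "'a topology \<Rightarrow> ('a, complex^'m::finite) chart set \<Rightarrow> 'a \<Rightarrow> (('a \<Rightarrow> complex) \<Rightarrow> complex) set" where
  "tangent_space T \<Phi> p = {\<xi>.
     (\<forall>g. g \<notin> holo_near T \<Phi> p \<longrightarrow> \<xi> g = 0) \<and>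
     (\<forall>g\<in>holo_near T \<Phi> p. \<forall>h\<in>holo_near T \<Phi> p.
        (\<exists>S. openin T S \<and> p \<in> S \<and> (\<forall>x\<in>S. g x = h x)) \<longrightarrow> \<xi> g = \<xi> h) \<and>
     (\<forall>g\<in>holo_near T \<Phi> p. \<forall>h\<in>holo_near T \<Phi> p. \<xi> (\<lambda>x. g x + h x) = \<xi> g + \<xi> h) \<and>
     (\<forall>c. \<forall>g\<in>holo_near T \<Phi> p. \<xi> (\<lambda>x. c * g x) = c * \<xi> g) \<and>
     (\<forall>g\<in>holo_near T \<Phi> p. \<forall>h\<in>holo_near T \<Phi> p. \<xi> (\<lambda>x. g x * h x) = g p * \<xi> h + h p * \<xi> g)}"


section \<open>Lie algebras and prehomogeneous vector spaces\<close>

record 'g lie_data =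
  lie_carrier :: "'g set"
  lie_scale :: "complex \<Rightarrow> 'g \<Rightarrow> 'g"
  lie_bracket :: "'g \<Rightarrow> 'g \<Rightarrow> 'g"

text \<open>
  The carrier is a finite-dimensional complex subspace of the ambient type, whose addition is
  used.
\<close>

definition lie_algebra :: "('g::ab_group_add) lie_data \<Rightarrow> bool" where
  "lie_algebra \<gg> \<longleftrightarrow>
     vector_space (lie_scale \<gg>) \<and>
     module.subspace (lie_scale \<gg>) (lie_carrier \<gg>) \<and>
     (\<exists>B. finite B \<and> B \<subseteq> lie_carrier \<gg> \<and> module.span (lie_scale \<gg>) B = lie_carrier \<gg>) \<and>
     (\<forall>x\<in>lie_carrier \<gg>. \<forall>y\<in>lie_carrier \<gg>. lie_bracket \<gg> x y \<in> lie_carrier \<gg>) \<and>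
     (\<forall>x\<in>lie_carrier \<gg>. \<forall>y\<in>lie_carrier \<gg>. \<forall>z\<in>lie_carrier \<gg>.
        lie_bracket \<gg> (x + y) z = lie_bracket \<gg> x z + lie_bracket \<gg> y z \<and>
        lie_bracket \<gg> z (x + y) = lie_bracket \<gg> z x + lie_bracket \<gg> z y) \<and>
     (\<forall>c. \<forall>x\<in>lie_carrier \<gg>. \<forall>y\<in>lie_carrier \<gg>.
        lie_bracket \<gg> (lie_scale \<gg> c x) y = lie_scale \<gg> c (lie_bracket \<gg> x y) \<and>
        lie_bracket \<gg> x (lie_scale \<gg> c y) = lie_scale \<gg> c (lie_bracket \<gg> x y)) \<and>
     (\<forall>x\<in>lie_carrier \<gg>. lie_bracket \<gg> x x = 0) \<and>
     (\<forall>x\<in>lie_carrier \<gg>. \<forall>y\<in>lie_carrier \<gg>. \<forall>z\<in>lie_carrier \<gg>.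
        lie_bracket \<gg> x (lie_bracket \<gg> y z) + lie_bracket \<gg> y (lie_bracket \<gg> z x) +
        lie_bracket \<gg> z (lie_bracket \<gg> x y) = 0)"

definition lie_dim :: "('g::ab_group_add) lie_data \<Rightarrow> nat" where
  "lie_dim \<gg> = vector_space.dim (lie_scale \<gg>) (lie_carrier \<gg>)"

definition gl_lie :: "(complex^'m::finite^'m) lie_data" where
  "gl_lie = \<lparr> lie_carrier = UNIV,
              lie_scale = (\<lambda>c. map_matrix ((*) c)),
              lie_bracket = (\<lambda>A B. A ** B - B ** A) \<rparr>"

text \<open>\<open>gl(1)\<close>, with 1-by-1 matrices written as complex numbers.\<close>

definition gl1_lie :: "complex lie_data" where
  "gl1_lie = \<lparr> lie_carrier = UNIV,
               lie_scale = (*),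
               lie_bracket = (\<lambda>a b. a * b - b * a) \<rparr>"

definition lie_sum :: "'g lie_data \<Rightarrow> 'h lie_data \<Rightarrow> ('g \<times> 'h) lie_data" where
  "lie_sum \<gg> \<hh> =
     \<lparr> lie_carrier = lie_carrier \<gg> \<times> lie_carrier \<hh>,
       lie_scale = (\<lambda>c p. (lie_scale \<gg> c (fst p), lie_scale \<hh> c (snd p))),
       lie_bracket = (\<lambda>p q. (lie_bracket \<gg> (fst p) (fst q), lie_bracket \<hh> (snd p) (snd q))) \<rparr>"

definition lie_hom ::
  "('g::ab_group_add) lie_data \<Rightarrow> ('h::ab_group_add) lie_data \<Rightarrow> ('g \<Rightarrow> 'h) \<Rightarrow> bool" where
  "lie_hom \<gg> \<hh> \<rho> \<longleftrightarrow>
     (\<forall>x\<in>lie_carrier \<gg>. \<rho> x \<in> lie_carrier \<hh>) \<and>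
     (\<forall>x\<in>lie_carrier \<gg>. \<forall>y\<in>lie_carrier \<gg>. \<rho> (x + y) = \<rho> x + \<rho> y) \<and>
     (\<forall>c. \<forall>x\<in>lie_carrier \<gg>. \<rho> (lie_scale \<gg> c x) = lie_scale \<hh> c (\<rho> x)) \<and>
     (\<forall>x\<in>lie_carrier \<gg>. \<forall>y\<in>lie_carrier \<gg>.
        \<rho> (lie_bracket \<gg> x y) = lie_bracket \<hh> (\<rho> x) (\<rho> y))"

text \<open>
  Representations on \<open>V\<close>, extended by \<open>undefined\<close> outside the carrier, so that distinct functions
  are distinct representations.
\<close>

definition lie_rep ::
  "('g::ab_group_add) lie_data \<Rightarrow> ('g \<Rightarrow> complex^'m::finite^'m) \<Rightarrow> bool" where
  "lie_rep \<gg> \<rho> \<longleftrightarrow> \<rho> \<in> extensional (lie_carrier \<gg>) \<and> lie_hom \<gg> gl_lie \<rho>"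

definition generic_point ::
  "'g lie_data \<Rightarrow> ('g \<Rightarrow> complex^'m::finite^'m) \<Rightarrow> complex^'m \<Rightarrow> bool" where
  "generic_point \<gg> \<rho> v \<longleftrightarrow> (\<lambda>X. \<rho> X *v v) ` lie_carrier \<gg> = UNIV"

definition is_PV ::
  "('g::ab_group_add) lie_data \<Rightarrow> ('g \<Rightarrow> complex^'m::finite^'m) \<Rightarrow> bool" where
  "is_PV \<gg> \<rho> \<longleftrightarrow> lie_algebra \<gg> \<and> lie_rep \<gg> \<rho> \<and> (\<exists>v. generic_point \<gg> \<rho> v)"

definition tensor_Lambda1 ::
  "'g lie_data \<Rightarrow> ('g \<Rightarrow> complex^'m::finite^'m) \<Rightarrow> 'g \<times> complex \<Rightarrow> complex^'m^'m" where
  "tensor_Lambda1 \<ll> f = restrict (\<lambda>(X, c). f X + mat c) (lie_carrier (lie_sum \<ll> gl1_lie))"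

definition PV_type_IFPS ::
  "('g::ab_group_add) lie_data \<Rightarrow> ('g \<Rightarrow> complex^'m::finite^'m) \<Rightarrow> bool" where
  "PV_type_IFPS \<ll> f \<longleftrightarrow>
     lie_algebra \<ll> \<and> lie_rep \<ll> f \<and>
     is_PV (lie_sum \<ll> gl1_lie) (tensor_Lambda1 \<ll> f) \<and>
     lie_dim \<ll> + 1 = vec.dim (UNIV :: (complex^'m) set)"


section \<open>Projective space and the projective linear group\<close>

text \<open>Points of projective space are the lines through the origin, as subsets of \<open>V\<close>.\<close>

definition proj_pt :: "complex^'m::finite \<Rightarrow> (complex^'m) set" where
  "proj_pt v = vec.span {v}"

definition proj_space :: "(complex^'m::finite) set set" where
  "proj_space = proj_pt ` (UNIV - {0})"

text \<open>Quotient topology of \<open>V - {0}\<close>.\<close>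

definition proj_topology :: "(complex^'m::finite) set topology" where
  "proj_topology = topology (\<lambda>W. W \<subseteq> proj_space \<and> open {v. v \<noteq> 0 \<and> proj_pt v \<in> W})"

lemma openin_proj_topology:
  fixes W :: "(complex^'m::finite) set set"
  shows "openin proj_topology W \<longleftrightarrow> W \<subseteq> proj_space \<and> open {v. v \<noteq> 0 \<and> proj_pt v \<in> W}"
proof -
  have "istopology (\<lambda>W. W \<subseteq> proj_space \<and> open {v::complex^'m. v \<noteq> 0 \<and> proj_pt v \<in> W})"
    unfolding istopology_def
  proof (intro conjI allI impI)
    fix S T :: "(complex^'m) set set"
    assume S: "S \<subseteq> proj_space \<and> open {v. v \<noteq> 0 \<and> proj_pt v \<in> S}"
      and T: "T \<subseteq> proj_space \<and> open {v. v \<noteq> 0 \<and> proj_pt v \<in> T}"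
    show "S \<inter> T \<subseteq> proj_space" using S by blast
    have "{v. v \<noteq> 0 \<and> proj_pt v \<in> S \<inter> T}
            = {v. v \<noteq> 0 \<and> proj_pt v \<in> S} \<inter> {v. v \<noteq> 0 \<and> proj_pt v \<in> T}" by blast
    then show "open {v. v \<noteq> 0 \<and> proj_pt v \<in> S \<inter> T}" using S T by (simp only: open_Int)
  next
    fix \<K> :: "(complex^'m) set set set"
    assume K: "\<forall>K\<in>\<K>. K \<subseteq> proj_space \<and> open {v. v \<noteq> 0 \<and> proj_pt v \<in> K}"
    show "\<Union> \<K> \<subseteq> proj_space" using K by blast
    have "{v. v \<noteq> 0 \<and> proj_pt v \<in> \<Union> \<K>} = (\<Union>K\<in>\<K>. {v. v \<noteq> 0 \<and> proj_pt v \<in> K})" by blast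
    then show "open {v. v \<noteq> 0 \<and> proj_pt v \<in> \<Union> \<K>}" using K by (auto intro: open_UN)
  qed
  then show ?thesis by (simp only: proj_topology_def topology_inverse')
qed

text \<open>
  The affine charts \<open>[x] \<mapsto> (x$j / x$i)\<close> for \<open>j \<noteq> i\<close>, defined on \<open>x$i \<noteq> 0\<close>. To
  take values in the model space \<open>Cn k\<close>, the coordinates \<open>i\<close> and \<open>k\<close> are swapped before the
  one that is constantly \<open>1\<close> is replaced by \<open>0\<close>.
\<close>

definition affine_chart ::
  "'m::finite \<Rightarrow> 'm \<Rightarrow> ((complex^'m) set, complex^'m) chart" where
  "affine_chart k i =
     (proj_pt ` {x. x $ i \<noteq> 0},
      \<lambda>p. let x = (THE x. x \<in> p \<and> x $ i = 1)
           in (\<chi> j. if j = k then 0 else x $ (Transposition.transpose i k j)))"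

definition proj_atlas :: "'m::finite \<Rightarrow> ((complex^'m) set, complex^'m) chart set" where
  "proj_atlas k = range (affine_chart k)"

text \<open>Elements of the projective linear group are identified with transformations of \<open>proj_space\<close>.\<close>

definition pgl_of :: "complex^'m::finite^'m \<Rightarrow> (complex^'m) set \<Rightarrow> (complex^'m) set" where
  "pgl_of A = restrict (\<lambda>p. (*v) A ` p) proj_space"

definition PGL :: "((complex^'m::finite) set \<Rightarrow> (complex^'m) set) set" where
  "PGL = pgl_of ` {A. invertible A}"

text \<open>
  The projection \<open>gl(V) \<rightarrow> gl(V)/\<complex>I\<close>, classes being cosets, and the adjoint action on the
  quotient of the class of \<open>P\<close>.
\<close>

definition gl_class :: "complex^'m::finite^'m \<Rightarrow> (complex^'m^'m) set" where
  "gl_class A = {A + mat c | c. True}"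

definition Ad_class :: "complex^'m::finite^'m \<Rightarrow> (complex^'m^'m) set \<Rightarrow> (complex^'m^'m) set" where
  "Ad_class P Q = (\<lambda>A. P ** A ** matrix_inv P) ` Q"


section \<open>The set of prehomogeneous vector spaces with generic points, and its equivalence\<close>

definition IFPS_pairs ::
  "('g::ab_group_add) lie_data \<Rightarrow> (('g \<times> complex \<Rightarrow> complex^'m::finite^'m) \<times> (complex^'m)) set" where
  "IFPS_pairs \<ll> = {(tensor_Lambda1 \<ll> f, v) | f v.
     PV_type_IFPS \<ll> f \<and> generic_point (lie_sum \<ll> gl1_lie) (tensor_Lambda1 \<ll> f) v}"

definition rep_equiv ::
  "'g lie_data \<Rightarrow> ('g \<Rightarrow> complex^'m::finite^'m) \<Rightarrow> complex^'m \<Rightarrow>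
   ('g \<Rightarrow> complex^'m^'m) \<Rightarrow> complex^'m \<Rightarrow> bool" where
  "rep_equiv \<ll> f v g w \<longleftrightarrow>
     (\<exists>P. invertible P \<and>
        (\<forall>X\<in>lie_carrier \<ll>. gl_class (g X) = Ad_class P (gl_class (f X))) \<and>
        proj_pt w = pgl_of P (proj_pt v))"

definition IFPS_equiv ::
  "('g::ab_group_add) lie_data \<Rightarrow> ((('g \<times> complex \<Rightarrow> complex^'m::finite^'m) \<times> (complex^'m)) \<times>
     (('g \<times> complex \<Rightarrow> complex^'m^'m) \<times> (complex^'m))) set" where
  "IFPS_equiv \<ll> = {((tensor_Lambda1 \<ll> f, v), (tensor_Lambda1 \<ll> g, w)) | f v g w.
     PV_type_IFPS \<ll> f \<and> generic_point (lie_sum \<ll> gl1_lie) (tensor_Lambda1 \<ll> f) v \<and>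
     PV_type_IFPS \<ll> g \<and> generic_point (lie_sum \<ll> gl1_lie) (tensor_Lambda1 \<ll> g) w \<and>
     rep_equiv \<ll> f v g w}"


section \<open>Complex Lie groups and their left invariant flat projective structures\<close>

definition complex_lie_group ::
  "'m::finite \<Rightarrow> ('a, 'b) monoid_scheme \<Rightarrow> 'a topology \<Rightarrow> ('a, complex^'m) chart set \<Rightarrow> bool" where
  "complex_lie_group k L T \<Phi> \<longleftrightarrow>
     group L \<and> carrier L = topspace T \<and> complex_manifold k T \<Phi> \<and>
     continuous_map (prod_topology T T) T (\<lambda>(a, b). a \<otimes>\<^bsub>L\<^esub> b) \<and>
     (\<forall>(U, \<phi>)\<in>\<Phi>. \<forall>(W, \<psi>)\<in>\<Phi>. \<forall>(Z, \<zeta>)\<in>\<Phi>.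
        holo pair_scale (*s)
          (\<lambda>(x, y). \<zeta> (inv_into U \<phi> x \<otimes>\<^bsub>L\<^esub> inv_into W \<psi> y))
          {(\<phi> a, \<psi> b) | a b. a \<in> U \<and> b \<in> W \<and> a \<otimes>\<^bsub>L\<^esub> b \<in> Z}) \<and>
     holo_map T \<Phi> T \<Phi> (topspace T) (\<lambda>a. inv\<^bsub>L\<^esub> a)"

text \<open>
  The Lie algebra: the tangent space at the unit. A tangent vector \<open>\<xi>\<close> extends to the left invariant
  vector field \<open>g \<mapsto> (\<lambda>a. \<xi> (g \<circ> L_a))\<close>, and the bracket is the commutator of these vector
  fields, evaluated at the unit.
\<close>

definition lie_algebra_of ::
  "('a, 'b) monoid_scheme \<Rightarrow> 'a topology \<Rightarrow> ('a, complex^'m::finite) chart set \<Rightarrow>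
   (('a \<Rightarrow> complex) \<Rightarrow> complex) lie_data" where
  "lie_algebra_of L T \<Phi> =
     \<lparr> lie_carrier = tangent_space T \<Phi> \<one>\<^bsub>L\<^esub>,
       lie_scale = (\<lambda>c \<xi> g. c * \<xi> g),
       lie_bracket = (\<lambda>\<xi> \<eta> g.
         if g \<in> holo_near T \<Phi> \<one>\<^bsub>L\<^esub>
         then \<xi> (\<lambda>a. \<eta> (\<lambda>b. g (a \<otimes>\<^bsub>L\<^esub> b))) - \<eta> (\<lambda>a. \<xi> (\<lambda>b. g (a \<otimes>\<^bsub>L\<^esub> b)))
         else 0) \<rparr>"

definition proj_chart ::
  "'m::finite \<Rightarrow> 'a topology \<Rightarrow> ('a, complex^'m) chart set \<Rightarrow> ('a, (complex^'m) set) chart \<Rightarrow> bool" where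
  "proj_chart k T \<Phi> = (\<lambda>(U, \<phi>).
     \<phi> \<in> extensional U \<and> biholomorphic_onto_open T \<Phi> proj_topology (proj_atlas k) U \<phi>)"

definition proj_atlas_on ::
  "'m::finite \<Rightarrow> 'a topology \<Rightarrow> ('a, complex^'m) chart set \<Rightarrow>
   ('a, (complex^'m) set) chart set \<Rightarrow> bool" where
  "proj_atlas_on k T \<Phi> \<A> \<longleftrightarrow>
     (\<forall>c\<in>\<A>. proj_chart k T \<Phi> c) \<and> (\<Union>(U, \<phi>)\<in>\<A>. U) = topspace T \<and>
     (\<forall>(U, \<phi>)\<in>\<A>. \<forall>(W, \<psi>)\<in>\<A>. \<forall>C\<in>connected_components_of (subtopology T (U \<inter> W)).
        \<exists>g\<in>PGL. \<forall>y\<in>\<phi> ` C. \<psi> (inv_into U \<phi> y) = g y)"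

definition flat_proj_structure ::
  "'m::finite \<Rightarrow> 'a topology \<Rightarrow> ('a, complex^'m) chart set \<Rightarrow>
   ('a, (complex^'m) set) chart set \<Rightarrow> bool" where
  "flat_proj_structure k T \<Phi> \<A> \<longleftrightarrow>
     proj_atlas_on k T \<Phi> \<A> \<and> (\<forall>\<B>. proj_atlas_on k T \<Phi> \<B> \<longrightarrow> \<A> \<subseteq> \<B> \<longrightarrow> \<B> = \<A>)"

definition left_invariant ::
  "('a, 'b) monoid_scheme \<Rightarrow> 'a topology \<Rightarrow> ('a, (complex^'m::finite) set) chart set \<Rightarrow> bool" where
  "left_invariant L T \<A> \<longleftrightarrow>
     (\<forall>a\<in>carrier L. \<forall>(U, \<phi>)\<in>\<A>. \<forall>(W, \<psi>)\<in>\<A>.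
        \<forall>C\<in>connected_components_of (subtopology T (U \<inter> {x \<in> carrier L. a \<otimes>\<^bsub>L\<^esub> x \<in> W})).
          \<exists>g\<in>PGL. \<forall>y\<in>\<phi> ` C. \<psi> (a \<otimes>\<^bsub>L\<^esub> inv_into U \<phi> y) = g y)"

definition complex_IFPSs ::
  "'m::finite \<Rightarrow> ('a, 'b) monoid_scheme \<Rightarrow> 'a topology \<Rightarrow> ('a, complex^'m) chart set \<Rightarrow>
   ('a, (complex^'m) set) chart set set" where
  "complex_IFPSs k L T \<Phi> = {\<A>. flat_proj_structure k T \<Phi> \<A> \<and> left_invariant L T \<A>}"

text \<open>
  \<open>f\<close> is the differential at the unit of a local map \<open>h\<close> into \<open>PGL\<close> with \<open>h(e) = 1\<close>: lift \<open>h\<close>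
  near the unit to a holomorphic map \<open>H\<close> into \<open>GL(V)\<close> with \<open>H(e) = I\<close>, differentiate the entries
  of \<open>H\<close> along \<open>\<xi>\<close>, and represent the class of the resulting matrix in
  \<open>gl(V)/\<complex>I = Lie(PGL)\<close> by its unique traceless element.
\<close>

definition differential_at_unit ::
  "('a, 'b) monoid_scheme \<Rightarrow> 'a topology \<Rightarrow> ('a, complex^'m::finite) chart set \<Rightarrow>
   ('a \<Rightarrow> (complex^'m) set \<Rightarrow> (complex^'m) set) \<Rightarrow>
   ((('a \<Rightarrow> complex) \<Rightarrow> complex) \<Rightarrow> complex^'m^'m) \<Rightarrow> bool" where
  "differential_at_unit L T \<Phi> h f \<longleftrightarrow>
     f \<in> extensional (lie_carrier (lie_algebra_of L T \<Phi>)) \<and>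
     (\<exists>N H. openin T N \<and> \<one>\<^bsub>L\<^esub> \<in> N \<and>
        (\<forall>a\<in>N. invertible (H a) \<and> pgl_of (H a) = h a) \<and> H \<one>\<^bsub>L\<^esub> = mat 1 \<and>
        (\<forall>i j. holo_fun T \<Phi> N (\<lambda>a. H a $ i $ j)) \<and>
        (\<forall>\<xi>\<in>lie_carrier (lie_algebra_of L T \<Phi>).
           trace (f \<xi>) = 0 \<and>
           gl_class (f \<xi>) = gl_class (\<chi> i j. \<xi> (\<lambda>a. H a $ i $ j))))"

text \<open>
  \<open>f\<close> arises from the structure \<open>\<A>\<close> by the construction of the correspondence, for some choice of
  a chart \<open>\<phi>\<close> with \<open>\<phi>(e) = o = [e_k]\<close>.
\<close>

definition induces_rep ::
  "'m::finite \<Rightarrow> ('a, 'b) monoid_scheme \<Rightarrow> 'a topology \<Rightarrow> ('a, complex^'m) chart set \<Rightarrow>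
   ('a, (complex^'m) set) chart set \<Rightarrow>
   ((('a \<Rightarrow> complex) \<Rightarrow> complex) \<Rightarrow> complex^'m^'m) \<Rightarrow> bool" where
  "induces_rep k L T \<Phi> \<A> f \<longleftrightarrow>
     (\<exists>U \<phi> N h. (U, \<phi>) \<in> \<A> \<and> \<one>\<^bsub>L\<^esub> \<in> U \<and> \<phi> \<one>\<^bsub>L\<^esub> = proj_pt (axis k 1) \<and>
        openin T N \<and> \<one>\<^bsub>L\<^esub> \<in> N \<and>
        (\<forall>a\<in>N. h a \<in> PGL \<and>
           (\<exists>W. openin proj_topology W \<and> proj_pt (axis k 1) \<in> W \<and> W \<subseteq> \<phi> ` U \<and>
              (\<forall>y\<in>W. a \<otimes>\<^bsub>L\<^esub> inv_into U \<phi> y \<in> U \<and>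
                 \<phi> (a \<otimes>\<^bsub>L\<^esub> inv_into U \<phi> y) = h a y))) \<and>
        differential_at_unit L T \<Phi> h f)"

end

theory Submission
  imports Defs "HOL-Complex_Analysis.Cauchy_Integral_Formula"
begin

text \<open>
  Let \<open>\<phi>\<close> be a chart of a left invariant structure with \<open>\<phi>(e) = [e\<^sub>k]\<close>. Near the unit,
  \<open>\<phi>(a x) = [H(a)] \<phi>(x)\<close> for a matrix \<open>H(a)\<close> that is unique up to a factor and can be chosen
  holomorphic in \<open>a\<close>, since it can be read off from the images of the points \<open>[e\<^sub>k \<plusminus> s e\<^sub>j]\<close>. So \<open>H(a b)\<close> is
  proportional to \<open>H(a) H(b)\<close>, and the traceless part \<open>f\<close> of \<open>dH\<close> is a representation. As
  \<open>\<phi>(a) = [H(a) e\<^sub>k]\<close> is a local coordinate, \<open>(f \<otimes> \<Lambda>\<^sub>1, e\<^sub>k)\<close> is prehomogeneous with generic point \<open>e\<^sub>k\<close>.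
  A projective homomorphism \<open>H\<close> is determined near the unit by \<open>dH\<close> modulo scalars, hence equivalent pairs
  give the same germ of charts up to \<open>PGL\<close>, and by left invariance the same maximal atlas.

  Conversely, a representation \<open>f\<close> integrates to a local homomorphism \<open>H\<close>. In coordinates
  at the unit one solves the radial equation \<open>DH(x) x = H(x) \<Omega>(x, x)\<close> by Picard iteration, and flatness of
  \<open>\<Omega>\<close> extends it to all directions. If \<open>e\<^sub>k\<close> is generic, \<open>a \<mapsto> [H(a) e\<^sub>k]\<close> is a chart, and the charts
  whose left translates are germwise \<open>PGL\<close>-equivalent to it at the unit form the required structure.
\<close>

section \<open>Complex calculus on normed spaces\<close>

text \<open>\<open>holo\<close> only says that a real derivative exists and commutes with complex
  scalars, so even continuity of the derivative has to be earned: restriction to complex lines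
  brings in the one-variable Cauchy estimates, and from these come limits, second derivatives and
  their symmetry. The model space \<open>Cn k\<close> is a hyperplane, with empty interior in V.
  Near the unit, functions are therefore made constant in direction k by \<open>pr\<close>, or the
  group law receives an additive coordinate k, and calculus takes place on open balls of V. The
  spare direction later carries the parameter of gl(1), so that genericity becomes injectivity of an
  endomorphism of V. On the projective side the obstacle is the scalar factor:
  \<open>H (a \<otimes> b)\<close> and \<open>H a ** H b\<close> are proportional with a factor
  about which no regularity is known. Proportionality is differentiated through vanishing 2 x 2
  minors or ratios of entries, never through the factor. Derivatives are then known modulo scalars,
  and traceless representatives turn such congruences into equations.\<close>

definition cscale :: "(complex \<Rightarrow> 'b \<Rightarrow> 'b::real_normed_vector) \<Rightarrow> bool" where
  "cscale s \<longleftrightarrow> (\<forall>c x y. s c (x + y) = s c x + s c y) \<and> (\<forall>c d x. s (c + d) x = s c x + s d x) \<and>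
     (\<forall>c d x. s c (s d x) = s (c * d) x) \<and> (\<forall>r x. s (of_real r) x = r *\<^sub>R x) \<and>
     (\<forall>c x. norm (s c x) = cmod c * norm x)"

lemma norm_vec_cmult: "norm (c *s (x::complex^'m::finite)) = cmod c * norm x"
proof -
  have "norm (c *s x) = L2_set (\<lambda>i. cmod c * norm (x $ i)) UNIV"
    by (simp add: norm_vec_def norm_mult)
  then show ?thesis by (simp add: norm_vec_def L2_set_right_distrib)
qed

text \<open>With this interface one proof serves functions of one variable on V and of two variables
  on V x V, the latter being needed for the group multiplication.\<close>

lemma cscale_vec: "cscale ((*s) :: complex \<Rightarrow> complex^'m::finite \<Rightarrow> _)"
  unfolding cscale_def
  by (auto simp: norm_vec_cmult vec_eq_iff algebra_simps) (simp add: scaleR_conv_of_real)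

lemma cscale_pair: "cscale (pair_scale :: complex \<Rightarrow> (complex^'m::finite) \<times> _ \<Rightarrow> _)"
proof -
  have "norm (pair_scale c p) = cmod c * norm p" for c and p :: "(complex^'m) \<times> (complex^'m)"
    by (simp add: pair_scale_def norm_Pair norm_prod_def norm_vec_cmult power_mult_distrib
        distrib_left [symmetric] real_sqrt_mult)
  then show ?thesis
    using cscale_vec [where 'm='m] unfolding cscale_def pair_scale_def by auto
qed

lemma cscale_zero [simp]: "cscale s \<Longrightarrow> s c 0 = 0"
  unfolding cscale_def by (metis add_cancel_right_right)

lemma cscale_zero_left [simp]: "cscale s \<Longrightarrow> s 0 x = 0"
  unfolding cscale_def by (metis add_cancel_right_right)

lemma cscale_bounded_linear: "cscale s \<Longrightarrow> bounded_linear (\<lambda>\<zeta>. s \<zeta> v)"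
proof (rule bounded_linear_intro [where K="norm v"])
  fix r :: real and x assume s: "cscale s"
  have "s (r *\<^sub>R x) v = s (of_real r) (s x v)"
    using s unfolding cscale_def scaleR_conv_of_real by metis
  also have "\<dots> = r *\<^sub>R s x v" using s unfolding cscale_def by blast
  finally show "s (r *\<^sub>R x) v = r *\<^sub>R s x v" .
qed (simp_all add: cscale_def)

abbreviation dd :: "('b::real_normed_vector \<Rightarrow> 'c::real_normed_vector) \<Rightarrow> 'b \<Rightarrow> 'b \<Rightarrow> 'c" where
  "dd f x \<equiv> frechet_derivative f (at x)"

lemma holo_dd:
  assumes "holo s t f S" "open S" "x \<in> S"
  shows "(f has_derivative dd f x) (at x)" "dd f x (s c v) = t c (dd f x v)"
proof -
  obtain D where D: "(f has_derivative D) (at x)" "\<And>c v. D (s c v) = t c (D v)"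
    using assms unfolding holo_def by (metis at_within_open)
  then have "D = dd f x" by (simp add: frechet_derivative_at)
  with D show "(f has_derivative dd f x) (at x)"
    "dd f x (s c v) = t c (dd f x v)" by auto
qed

lemma holo_subset: "holo s t f S \<Longrightarrow> S' \<subseteq> S \<Longrightarrow> holo s t f S'"
  unfolding holo_def by (meson has_derivative_subset subsetD)

lemma holo_continuous_on: "holo s t f S \<Longrightarrow> continuous_on S f"
  unfolding holo_def continuous_on_eq_continuous_within
  by (metis has_derivative_continuous)

lemma holo_cong: "holo s t f S \<Longrightarrow> (\<And>x. x \<in> S \<Longrightarrow> f x = g x) \<Longrightarrow> holo s t g S"
  unfolding holo_def by (metis has_derivative_transform)

lemma holo_compose:
  assumes "holo s t f A" "holo t u g B" "f ` A \<subseteq> B"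
  shows "holo s u (\<lambda>x. g (f x)) A"
  unfolding holo_def
proof
  fix x assume x: "x \<in> A"
  obtain D where D: "(f has_derivative D) (at x within A)" "\<forall>c v. D (s c v) = t c (D v)"
    using assms(1) x unfolding holo_def by blast
  obtain E where E: "(g has_derivative E) (at (f x) within B)" "\<forall>c v. E (t c v) = u c (E v)"
    using assms(2,3) x unfolding holo_def by blast
  have "((\<lambda>x. g (f x)) has_derivative (\<lambda>x. E (D x))) (at x within A)"
    using has_derivative_in_compose [OF D(1) has_derivative_subset [OF E(1) assms(3)]] .
  then show "\<exists>D. ((\<lambda>x. g (f x)) has_derivative D) (at x within A) \<and> (\<forall>c v. D (s c v) = u c (D v))"
    using D E by auto
qed

lemma holo_local:
  assumes "\<And>x. x \<in> S \<Longrightarrow> \<exists>O'. open O' \<and> x \<in> O' \<and> holo s t f (S \<inter> O')"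
  shows "holo s t f S"
  unfolding holo_def
proof
  fix x assume x: "x \<in> S"
  obtain O' where O: "open O'" "x \<in> O'" "holo s t f (S \<inter> O')" using assms x by blast
  have "at x within (S \<inter> O') = at x within S"
    using O by (intro at_within_nhd [of x O']) auto
  then show "\<exists>D. (f has_derivative D) (at x within S) \<and> (\<forall>c v. D (s c v) = t c (D v))"
    using O(2,3) x unfolding holo_def by (metis IntI)
qed

lemma holo_linear:
  assumes "bounded_linear f" "\<And>c v. f (s c v) = t c (f v)"
  shows "holo s t f S"
  unfolding holo_def using assms bounded_linear_imp_has_derivative by blast

lemma holo_nth: "holo (*s) (*) (\<lambda>x::complex^'m::finite. x $ j) S"
  by (rule holo_linear) (auto intro: bounded_linear_vec_nth)

lemma holo_const: "holo s (*) (\<lambda>x. c) S"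
  unfolding holo_def by (intro ballI exI [where x="\<lambda>x. 0"]) auto

lemma holo_add:
  fixes f g :: "'b::real_normed_vector \<Rightarrow> complex"
  assumes "holo s (*) f S" "holo s (*) g S"
  shows "holo s (*) (\<lambda>x. f x + g x) S"
  unfolding holo_def
proof
  fix x assume "x \<in> S"
  then obtain D E where "(f has_derivative D) (at x within S)" "\<forall>c v. D (s c v) = c * D v"
    "(g has_derivative E) (at x within S)" "\<forall>c v. E (s c v) = c * E v"
    using assms unfolding holo_def by blast
  then show "\<exists>D. ((\<lambda>x. f x + g x) has_derivative D) (at x within S) \<and> (\<forall>c v. D (s c v) = c * D v)"
    by (intro exI [where x="\<lambda>x. D x + E x"]) (auto intro: has_derivative_add simp: algebra_simps)
qed

lemma holo_mult:
  fixes f g :: "'b::real_normed_vector \<Rightarrow> complex"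
  assumes "holo s (*) f S" "holo s (*) g S"
  shows "holo s (*) (\<lambda>x. f x * g x) S"
  unfolding holo_def
proof
  fix x assume "x \<in> S"
  then obtain D E where "(f has_derivative D) (at x within S)" "\<forall>c v. D (s c v) = c * D v"
    "(g has_derivative E) (at x within S)" "\<forall>c v. E (s c v) = c * E v"
    using assms unfolding holo_def by blast
  then show "\<exists>D. ((\<lambda>x. f x * g x) has_derivative D) (at x within S) \<and> (\<forall>c v. D (s c v) = c * D v)"
    by (intro exI [where x="\<lambda>h. f x * E h + D h * g x"] conjI has_derivative_mult) (auto simp: algebra_simps)
qed

lemma holo_cmult: "holo s (*) f S \<Longrightarrow> holo s (*) (\<lambda>x. c * f x) S"
  for f :: "'b::real_normed_vector \<Rightarrow> complex"
  by (intro holo_mult holo_const)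

lemma holo_minus: "holo s (*) f S \<Longrightarrow> holo s (*) (\<lambda>x. - f x) S"
  for f :: "'b::real_normed_vector \<Rightarrow> complex"
  using holo_cmult [of s f S "-1"] by simp

lemma holo_diff:
  fixes f g :: "'b::real_normed_vector \<Rightarrow> complex"
  assumes "holo s (*) f S" "holo s (*) g S"
  shows "holo s (*) (\<lambda>x. f x - g x) S"
  using holo_add [OF assms(1) holo_minus [OF assms(2)]] by simp

lemma holo_sum:
  fixes f :: "'i \<Rightarrow> 'b::real_normed_vector \<Rightarrow> complex"
  assumes "\<And>i. i \<in> I \<Longrightarrow> holo s (*) (f i) S"
  shows "holo s (*) (\<lambda>x. \<Sum>i\<in>I. f i x) S"
  using assms by (induct I rule: infinite_finite_induct) (auto intro: holo_const holo_add)

lemma holo_prod: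
  fixes f :: "'i \<Rightarrow> 'b::real_normed_vector \<Rightarrow> complex"
  assumes "\<And>i. i \<in> I \<Longrightarrow> holo s (*) (f i) S"
  shows "holo s (*) (\<lambda>x. \<Prod>i\<in>I. f i x) S"
  using assms by (induct I rule: infinite_finite_induct) (auto intro: holo_const holo_mult)

lemma holo_inverse:
  fixes f :: "'b::real_normed_vector \<Rightarrow> complex"
  assumes "holo s (*) f S" "\<And>x. x \<in> S \<Longrightarrow> f x \<noteq> 0"
  shows "holo s (*) (\<lambda>x. inverse (f x)) S"
  unfolding holo_def
proof
  fix x assume x: "x \<in> S"
  then obtain D where "(f has_derivative D) (at x within S)" "\<forall>c v. D (s c v) = c * D v"
    using assms unfolding holo_def by blast
  then show "\<exists>D. ((\<lambda>x. inverse (f x)) has_derivative D) (at x within S) \<and> (\<forall>c v. D (s c v) = c * D v)"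
    using x assms(2)
    by (intro exI [where x="\<lambda>h. - (inverse (f x) * D h * inverse (f x))"])
       (auto intro!: has_derivative_inverse)
qed

lemma holo_divide:
  fixes f g :: "'b::real_normed_vector \<Rightarrow> complex"
  assumes "holo s (*) f S" "holo s (*) g S" "\<And>x. x \<in> S \<Longrightarrow> g x \<noteq> 0"
  shows "holo s (*) (\<lambda>x. f x / g x) S"
  using holo_mult [OF assms(1) holo_inverse [OF assms(2,3)]] by (simp add: divide_inverse)

lemma holo_det:
  fixes F :: "'b::real_normed_vector \<Rightarrow> complex^'n::finite^'n"
  assumes "\<And>i j. holo s (*) (\<lambda>x. F x $ i $ j) S"
  shows "holo s (*) (\<lambda>x. det (F x)) S"
  unfolding det_def by (intro holo_sum holo_mult holo_const holo_prod assms)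

lemma bounded_linear_axis: "bounded_linear (axis i :: 'a::real_normed_vector \<Rightarrow> 'a^'n::finite)"
proof (rule bounded_linear_intro [where K=1])
  show "norm (axis i x :: 'a^'n) \<le> norm x * 1" for x :: 'a
  proof -
    have "norm (axis i x :: 'a^'n) \<le> (\<Sum>j\<in>UNIV. norm ((axis i x :: 'a^'n) $ j))"
      unfolding norm_vec_def by (rule L2_set_le_sum) auto
    also have "\<dots> = (\<Sum>j\<in>UNIV. if j = i then norm x else 0)"
      by (rule sum.cong) (auto simp: axis_def)
    finally show ?thesis by simp
  qed
qed (auto simp: axis_def vec_eq_iff)

lemma has_derivative_vec_iff:
  fixes f :: "'b::real_normed_vector \<Rightarrow> 'a::real_normed_vector^'n::finite"
  shows "(f has_derivative f') F \<longleftrightarrow> (\<forall>i. ((\<lambda>x. f x $ i) has_derivative (\<lambda>x. f' x $ i)) F)"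
proof
  assume "\<forall>i. ((\<lambda>x. f x $ i) has_derivative (\<lambda>x. f' x $ i)) F"
  then have "((\<lambda>x. \<Sum>i\<in>UNIV. axis i (f x $ i)) has_derivative (\<lambda>x. \<Sum>i\<in>UNIV. axis i (f' x $ i))) F"
    by (intro has_derivative_sum bounded_linear.has_derivative [OF bounded_linear_axis]) auto
  moreover have "(\<Sum>i\<in>UNIV. axis i (y $ i)) = y" for y :: "'a^'n"
  unfolding vec_eq_iff
  proof
    fix j
    have "(\<Sum>i\<in>UNIV. axis i (y $ i)) $ j = (\<Sum>i\<in>UNIV. if i = j then y $ j else 0)"
      unfolding sum_component by (rule sum.cong) (auto simp: axis_def)
    then show "(\<Sum>i\<in>UNIV. axis i (y $ i)) $ j = y $ j" by simp
  qed
  ultimately show "(f has_derivative f') F" by simp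
qed (auto intro: bounded_linear.has_derivative [OF bounded_linear_vec_nth])

lemma holo_vec_iff: "holo s (*s) F S \<longleftrightarrow> (\<forall>j. holo s (*) (\<lambda>x. F x $ j) S)"
  for F :: "'b::real_normed_vector \<Rightarrow> complex^'m::finite"
proof
  assume F: "holo s (*s) F S"
  show "\<forall>j. holo s (*) (\<lambda>x. F x $ j) S"
  proof
    fix j
    from holo_compose [OF F holo_nth [where S=UNIV]] show "holo s (*) (\<lambda>x. F x $ j) S" by auto
  qed
next
  assume F: "\<forall>j. holo s (*) (\<lambda>x. F x $ j) S"
  show "holo s (*s) F S" unfolding holo_def
  proof
    fix x assume "x \<in> S"
    then have "\<forall>j. \<exists>D. ((\<lambda>x. F x $ j) has_derivative D) (at x within S) \<and> (\<forall>c v. D (s c v) = c * D v)"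
      using F unfolding holo_def by blast
    then obtain D where "\<And>j. ((\<lambda>x. F x $ j) has_derivative D j) (at x within S)"
      "\<And>j c v. D j (s c v) = c * D j v" by metis
    then show "\<exists>D. (F has_derivative D) (at x within S) \<and> (\<forall>c v. D (s c v) = c *s D v)"
      by (intro exI [where x="\<lambda>v. \<chi> j. D j v"]) (auto simp: has_derivative_vec_iff vec_eq_iff)
  qed
qed

lemma holo_embed:
  fixes a :: "complex^'m::finite"
  shows "holo (*s) pair_scale (\<lambda>x. (x, a)) S" "holo (*s) pair_scale (\<lambda>x. (a, x)) S"
proof -
  have "((\<lambda>x. (x, a)) has_derivative (\<lambda>v. (v, 0))) (at x within S)"
    "((\<lambda>x. (a, x)) has_derivative (\<lambda>v. (0, v))) (at x within S)" for x
    by (intro has_derivative_Pair has_derivative_ident has_derivative_const)+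
  then show "holo (*s) pair_scale (\<lambda>x. (x, a)) S" "holo (*s) pair_scale (\<lambda>x. (a, x)) S"
    unfolding holo_def by (force simp: pair_scale_def)+
qed

lemma scaleR_ball_0:
  fixes x :: "'b::real_normed_vector"
  assumes "x \<in> ball 0 r" "t \<in> {0..1}"
  shows "t *\<^sub>R x \<in> ball 0 r"
proof -
  have "\<bar>t\<bar> * norm x \<le> 1 * norm x" using assms by (intro mult_right_mono) auto
  then show ?thesis using assms by simp
qed

text \<open>On a complex line a complex-linear derivative is multiplication by a number, so the
  slice is holomorphic in the sense of one variable. This is the only passage from
  \<open>holo\<close> to the Cauchy theory.\<close>

lemma holo_slice:
  assumes s: "cscale s" and f: "holo s (*) f S" "open S"
    and D: "open D" "\<And>\<zeta>. \<zeta> \<in> D \<Longrightarrow> x + s \<zeta> v \<in> S"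
  shows "(\<lambda>\<zeta>. f (x + s \<zeta> v)) holomorphic_on D"
    and "\<zeta> \<in> D \<Longrightarrow> deriv (\<lambda>\<zeta>. f (x + s \<zeta> v)) \<zeta> = dd f (x + s \<zeta> v) v"
proof -
  have *: "((\<lambda>\<zeta>. f (x + s \<zeta> v)) has_field_derivative dd f (x + s \<zeta> v) v) (at \<zeta>)" if "\<zeta> \<in> D" for \<zeta>
  proof -
    have fd: "(f has_derivative dd f (x + s \<zeta> v)) (at (x + s \<zeta> v))"
      by (rule holo_dd [OF f D(2) [OF that]])
    have "((\<lambda>\<zeta>. x + s \<zeta> v) has_derivative (\<lambda>\<zeta>. s \<zeta> v)) (at \<zeta>)"
      by (auto intro!: derivative_eq_intros bounded_linear.has_derivative [OF cscale_bounded_linear [OF s]] simp: fun_eq_iff)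
    from has_derivative_compose [OF this fd]
    have "((\<lambda>\<zeta>. f (x + s \<zeta> v)) has_derivative (\<lambda>w. dd f (x + s \<zeta> v) (s w v))) (at \<zeta>)" .
    moreover have "(\<lambda>w. dd f (x + s \<zeta> v) (s w v)) = (*) (dd f (x + s \<zeta> v) v)"
      using holo_dd(2) [OF f D(2) [OF that]] by (auto simp: fun_eq_iff)
    ultimately show ?thesis by (simp add: has_field_derivative_def)
  qed
  show "(\<lambda>\<zeta>. f (x + s \<zeta> v)) holomorphic_on D"
    using * D(1) by (auto simp: holomorphic_on_open)
  show "\<zeta> \<in> D \<Longrightarrow> deriv (\<lambda>\<zeta>. f (x + s \<zeta> v)) \<zeta> = dd f (x + s \<zeta> v) v"
    using * DERIV_imp_deriv by blast
qed

lemma has_derivative_ray: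
  assumes "(g has_derivative g') (at (t *\<^sub>R x))"
  shows "((\<lambda>t. g (t *\<^sub>R x)) has_derivative (\<lambda>a. g' (a *\<^sub>R x))) (at t within S)"
proof -
  have "((\<lambda>t. t *\<^sub>R x) has_derivative (\<lambda>a. a *\<^sub>R x)) (at t within S)" by (auto intro!: derivative_eq_intros)
  from has_derivative_compose [where f="\<lambda>t. t *\<^sub>R x" and f'="\<lambda>a. a *\<^sub>R x", OF this assms] show ?thesis .
qed

lemma has_derivative_dilate:
  assumes "(g has_derivative g') (at (t *\<^sub>R x))"
  shows "((\<lambda>x. g (t *\<^sub>R x)) has_derivative (\<lambda>a. g' (t *\<^sub>R a))) (at x within S)"
proof -
  have "((\<lambda>x. t *\<^sub>R x) has_derivative (\<lambda>a. t *\<^sub>R a)) (at x within S)" by (auto intro!: derivative_eq_intros)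
  from has_derivative_compose [where f="\<lambda>x. t *\<^sub>R x" and f'="\<lambda>a. t *\<^sub>R a", OF this assms] show ?thesis .
qed

lemma has_derivative_shift:
  assumes "(g has_derivative g') (at (x + w))"
  shows "((\<lambda>x. g (x + w)) has_derivative g') (at x within S)"
proof -
  have "((\<lambda>x. x + w) has_derivative (\<lambda>a. a)) (at x within S)" by (auto intro!: derivative_eq_intros)
  from has_derivative_compose [where f="\<lambda>x. x + w" and f'="\<lambda>a. a", OF this assms] show ?thesis .
qed

section \<open>Cauchy estimates, limits and second derivatives\<close>

lemma Cauchy_estimates:
  assumes u: "u holomorphic_on ball 0 R" and R: "0 < R" and M: "\<And>z. z \<in> ball 0 R \<Longrightarrow> cmod (u z) \<le> M"
  shows "cmod (deriv u 0) \<le> 2 * M / R"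
    and "cmod z \<le> R / 4 \<Longrightarrow> cmod (u z - u 0 - deriv u 0 * z) \<le> 32 * M / R\<^sup>2 * (cmod z)\<^sup>2"
proof -
  have sub: "cball w (R/4) \<subseteq> ball 0 R" if "w \<in> cball 0 (R/4)" for w :: complex
  proof
    fix y assume "y \<in> cball w (R/4)"
    then have "norm y \<le> norm w + R/4"
      using norm_triangle_ineq2 [of y w] by (auto simp: dist_norm norm_minus_commute)
    then show "y \<in> ball 0 R" using that R by auto
  qed
  have "cmod ((deriv ^^ 1) u 0) \<le> fact 1 * M / (R/2)^1"
  proof (rule Cauchy_inequality)
    show "u holomorphic_on ball 0 (R/2)" using u by (rule holomorphic_on_subset) (use R in auto)
    show "continuous_on (cball 0 (R/2)) u"
      by (rule continuous_on_subset [OF holomorphic_on_imp_continuous_on [OF u]]) (use R in auto)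
    show "cmod (u x) \<le> M" if "norm (0 - x) = R/2" for x using M [of x] R that by auto
  qed (use R in auto)
  then show "cmod (deriv u 0) \<le> 2 * M / R" by (simp add: field_simps)
  have b2: "cmod ((deriv ^^ 2) u w) \<le> 32 * M / R\<^sup>2" if w: "w \<in> cball 0 (R/4)" for w
  proof -
    \<comment> \<open>Around points of the closed disc of radius R/4, circles of radius R/4 stay in
      the ball of radius R. This gives 2! M / (R/4)^2 = 32 M / R^2, the constant of the Taylor
      remainder below.\<close>
    have "cmod ((deriv ^^ 2) u w) \<le> fact 2 * M / (R/4)^2"
    proof (rule Cauchy_inequality)
      show "u holomorphic_on ball w (R/4)"
        by (rule holomorphic_on_subset [OF u]) (use sub [OF w] in auto)
      show "continuous_on (cball w (R/4)) u"
        by (rule continuous_on_subset [OF holomorphic_on_imp_continuous_on [OF u] sub [OF w]])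
      show "cmod (u x) \<le> M" if "norm (w - x) = R/4" for x
        by (rule M, rule subsetD [OF sub [OF w]]) (use that in \<open>auto simp: dist_norm\<close>)
    qed (use R in auto)
    then show ?thesis by (simp add: power_divide)
  qed
  assume z: "cmod z \<le> R / 4"
  have "cmod ((deriv ^^ 0) u z - (\<Sum>i\<le>1. (deriv ^^ i) u 0 * (z - 0) ^ i / fact i))
      \<le> 32 * M / R\<^sup>2 * cmod (z - 0) ^ Suc 1 / fact 1"
  proof (rule complex_Taylor [where S="cball 0 (R/4)"])
    fix i :: nat and x :: complex assume "x \<in> cball 0 (R/4)"
    then have x: "x \<in> ball 0 R" using R by auto
    have "(deriv ^^ i) u holomorphic_on ball 0 R"
      by (intro holomorphic_higher_deriv u open_ball)
    from holomorphic_derivI [OF this open_ball x]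
    show "((deriv ^^ i) u has_field_derivative (deriv ^^ Suc i) u x) (at x within cball 0 (R/4))"
      by (auto intro: has_field_derivative_at_within)
  next
    fix x :: complex assume "x \<in> cball 0 (R/4)"
    from b2 [OF this] show "cmod ((deriv ^^ Suc 1) u x) \<le> 32 * M / R\<^sup>2"
      by (simp add: numeral_2_eq_2)
  qed (use z R in auto)
  then show "cmod (u z - u 0 - deriv u 0 * z) \<le> 32 * M / R\<^sup>2 * (cmod z)\<^sup>2"
    by (simp add: numeral_2_eq_2 algebra_simps)
qed

text \<open>Both bounds are the one-variable estimates on the slice in direction v, whose radius is
  \<rho> divided by the length of v. The constants depend on x only through \<rho>, as uniform
  limits of derivatives require.\<close>

lemma holo_dd_bound:
  fixes x0 :: "'b::real_normed_vector"
  assumes s: "cscale s" and f: "holo s (*) f (ball x0 r)"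
    and M: "\<And>x. x \<in> ball x0 r \<Longrightarrow> cmod (f x) \<le> M" and x: "ball x \<rho> \<subseteq> ball x0 r" and \<rho>: "0 < \<rho>"
  shows "cmod (dd f x v) \<le> 2 * M / \<rho> * norm v"
    and "cmod t * (norm v + 1) \<le> \<rho> / 4 \<Longrightarrow>
      cmod (f (x + s t v) - f x - dd f x v * t) \<le> 32 * M * (norm v + 1)\<^sup>2 / \<rho>\<^sup>2 * (cmod t)\<^sup>2"
proof -
  have xin: "x \<in> ball x0 r" using x \<rho> by (meson centre_in_ball subsetD)
  then have lin: "linear (dd f x)"
    using holo_dd(1) [OF f open_ball] has_derivative_linear by blast
  have slice: "x + s \<zeta> w \<in> ball x0 r" if "cmod \<zeta> * norm w < \<rho>" for \<zeta> w
    by (rule subsetD [OF x]) (use that s in \<open>simp add: dist_norm cscale_def\<close>)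
  show "cmod (dd f x v) \<le> 2 * M / \<rho> * norm v"
  proof (cases "v = 0")
    case True
    then show ?thesis using linear_0 [OF lin] by simp
  next
    case False
    let ?R = "\<rho> / norm v"
    have R: "0 < ?R" using False \<rho> by simp
    have in1: "x + s \<zeta> v \<in> ball x0 r" if "\<zeta> \<in> ball 0 ?R" for \<zeta>
      using that False by (intro slice) (simp add: field_simps)
    note h = holo_slice [OF s f open_ball open_ball in1]
    have "cmod (deriv (\<lambda>\<zeta>. f (x + s \<zeta> v)) 0) \<le> 2 * M / ?R"
      by (rule Cauchy_estimates(1) [OF h(1) R M [OF in1]])
    moreover have "deriv (\<lambda>\<zeta>. f (x + s \<zeta> v)) 0 = dd f x v"
      using h(2) [of 0] R s by simp
    ultimately show ?thesis by simp
  qed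
  \<comment> \<open>\<open>norm v + 1\<close> in place of \<open>norm v\<close> avoids a separate
    case v = 0.\<close>
  let ?R = "\<rho> / (norm v + 1)"
  have nv: "0 < norm v + 1" by (simp add: add_nonneg_pos)
  then have R: "0 < ?R" using \<rho> by simp
  have in1: "x + s \<zeta> v \<in> ball x0 r" if "\<zeta> \<in> ball 0 ?R" for \<zeta>
  proof (rule slice)
    have "cmod \<zeta> * norm v \<le> cmod \<zeta> * (norm v + 1)" by (intro mult_left_mono) auto
    also have "\<dots> < \<rho>" using that nv by (simp add: field_simps)
    finally show "cmod \<zeta> * norm v < \<rho>" .
  qed
  note h = holo_slice [OF s f open_ball open_ball in1]
  assume t: "cmod t * (norm v + 1) \<le> \<rho> / 4"
  then have "cmod t \<le> ?R / 4" using nv by (simp add: field_simps)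
  from Cauchy_estimates(2) [OF h(1) R M [OF in1] this]
  show "cmod (f (x + s t v) - f x - dd f x v * t) \<le> 32 * M * (norm v + 1)\<^sup>2 / \<rho>\<^sup>2 * (cmod t)\<^sup>2"
    using h(2) [of 0] R s by (simp add: power_divide)
qed

text \<open>Weierstrass: \<open>holo_dd_bound\<close> applied to differences turns uniform
  convergence on the ball into uniform convergence of the derivatives on the half ball, with an
  error proportional to \<open>norm v\<close>. Differentiation then passes to the limit, which
  inherits complex linearity.\<close>

lemma holo_uniform_limit:
  fixes f :: "nat \<Rightarrow> 'b::real_normed_vector \<Rightarrow> complex"
  assumes s: "cscale s" and f: "\<And>n. holo s (*) (f n) (ball x0 r)" and r: "0 < r"
    and lim: "uniform_limit (ball x0 r) f g sequentially"
  shows "holo s (*) g (ball x0 (r/2))"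
    and "x \<in> ball x0 (r/2) \<Longrightarrow> (\<lambda>n. dd (f n) x v) \<longlonglongrightarrow> dd g x v"
proof -
  let ?B = "ball x0 (r/2)"
  have sub: "ball x (r/2) \<subseteq> ball x0 r" if "x \<in> ?B" for x
    using that by (intro subsetI) (auto, smt (verit) dist_triangle dist_commute)
  have hd: "(f n has_derivative dd (f n) x) (at x)" if "x \<in> ?B" for n x
    by (rule holo_dd(1) [OF f open_ball]) (use that r in auto)
  \<comment> \<open>The factor r/4 cancels the factor 2 / (r/2) of \<open>holo_dd_bound\<close>,
    which applies with radius r/2 at points of the half ball.\<close>
  have diff: "cmod (dd (f m) x v - dd (f n) x v) \<le> e * norm v"
    if "\<And>y. y \<in> ball x0 r \<Longrightarrow> cmod (f m y - f n y) \<le> e * r / 4" "x \<in> ?B" for m n x v e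
  proof -
    have "cmod (dd (\<lambda>y. f m y - f n y) x v) \<le> 2 * (e * r / 4) / (r/2) * norm v"
      by (rule holo_dd_bound(1) [OF s holo_diff [OF f f] that(1) sub]) (use that(2) r in auto)
    moreover have "dd (\<lambda>y. f m y - f n y) x = (\<lambda>v. dd (f m) x v - dd (f n) x v)"
      using has_derivative_diff [OF hd hd, OF that(2) that(2)] by (rule frechet_derivative_at [symmetric])
    ultimately show ?thesis using r by simp
  qed
  have unif: "\<exists>N. \<forall>m\<ge>N. \<forall>n\<ge>N. \<forall>x\<in>?B. \<forall>v. cmod (dd (f m) x v - dd (f n) x v) \<le> e * norm v"
    if e: "0 < e" for e
  proof -
    obtain N where N: "\<And>n y. n \<ge> N \<Longrightarrow> y \<in> ball x0 r \<Longrightarrow> dist (f n y) (g y) < e * r / 8"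
      using lim e r unfolding uniform_limit_iff eventually_sequentially
      by (metis divide_pos_pos mult_pos_pos zero_less_numeral)
    have "cmod (f m y - f n y) \<le> e * r / 4" if "m \<ge> N" "n \<ge> N" "y \<in> ball x0 r" for m n y
    proof -
      have "dist (f m y) (f n y) \<le> dist (f m y) (g y) + dist (f n y) (g y)"
        by (rule dist_triangle2)
      then show ?thesis using N [OF that(1,3)] N [OF that(2,3)] by (simp add: dist_norm)
    qed
    then show ?thesis using diff by blast
  qed
  have "Cauchy (\<lambda>n. dd (f n) x v)" if x: "x \<in> ?B" for x v
  proof (rule metric_CauchyI)
    fix e :: real assume e: "0 < e"
    have nv: "0 < norm v + 1" by (simp add: add_nonneg_pos)
    obtain N where N: "\<And>m n. m \<ge> N \<Longrightarrow> n \<ge> N \<Longrightarrow> cmod (dd (f m) x v - dd (f n) x v) \<le> e / (norm v + 1) * norm v"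
    proof -
      have "0 < e / (norm v + 1)" using e nv by simp
      from unif [OF this] show ?thesis using that x by blast
    qed
    have "e / (norm v + 1) * norm v < e" using e nv by (simp add: field_simps)
    then show "\<exists>N. \<forall>m\<ge>N. \<forall>n\<ge>N. dist (dd (f m) x v) (dd (f n) x v) < e"
      using N by (intro exI [of _ N]) (force simp: dist_norm)
  qed
  then have "\<forall>x v. \<exists>l. x \<in> ?B \<longrightarrow> (\<lambda>n. dd (f n) x v) \<longlonglongrightarrow> l"
    by (metis Cauchy_convergent_iff convergent_def)
  then obtain G where G: "\<And>x v. x \<in> ?B \<Longrightarrow> (\<lambda>n. dd (f n) x v) \<longlonglongrightarrow> G x v" by metis
  have ptw: "(\<lambda>n. f n x) \<longlonglongrightarrow> g x" if "x \<in> ?B" for x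
    by (rule tendsto_uniform_limitI [OF lim]) (use that r in auto)
  have "\<exists>g'. \<forall>x\<in>?B. (\<lambda>n. f n x) \<longlonglongrightarrow> g' x \<and> (g' has_derivative G x) (at x within ?B)"
  proof (rule has_derivative_sequence [OF convex_ball])
    show "(f n has_derivative dd (f n) x) (at x within ?B)" if "x \<in> ?B" for n x
      using hd [OF that] by (rule has_derivative_at_withinI)
    show "(\<lambda>n. f n x0) \<longlonglongrightarrow> g x0" using ptw r by simp
    show "x0 \<in> ?B" using r by simp
    fix e :: real assume "0 < e"
    then obtain N where N: "\<And>m n x v. m \<ge> N \<Longrightarrow> n \<ge> N \<Longrightarrow> x \<in> ?B \<Longrightarrow> cmod (dd (f m) x v - dd (f n) x v) \<le> e * norm v"
      using unif by meson
    show "\<forall>\<^sub>F n in sequentially. \<forall>x\<in>?B. \<forall>v. norm (dd (f n) x v - G x v) \<le> e * norm v"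
      unfolding eventually_sequentially
    proof (intro exI [of _ N] allI impI ballI)
      fix n x v assume n: "N \<le> n" and x: "x \<in> ?B"
      have "(\<lambda>m. cmod (dd (f n) x v - dd (f m) x v)) \<longlonglongrightarrow> cmod (dd (f n) x v - G x v)"
        by (intro tendsto_intros G x)
      then show "norm (dd (f n) x v - G x v) \<le> e * norm v"
        by (rule LIMSEQ_le_const2) (use N [OF n _ x] in auto)
    qed
  qed
  then have g: "(g has_derivative G x) (at x)" if "x \<in> ?B" for x
    using that ptw by (metis (no_types, lifting) LIMSEQ_unique at_within_open has_derivative_transform open_ball)
  have Gs: "G x (s c v) = c * G x v" if x: "x \<in> ?B" for x c v
  proof (rule LIMSEQ_unique [OF G [OF x]])
    have "dd (f n) x (s c v) = c * dd (f n) x v" for n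
      by (rule holo_dd(2) [OF f open_ball]) (use x r in auto)
    then show "(\<lambda>n. dd (f n) x (s c v)) \<longlonglongrightarrow> c * G x v"
      using tendsto_mult_left [OF G [OF x]] by simp
  qed
  show "holo s (*) g ?B"
    unfolding holo_def using g Gs has_derivative_at_withinI by blast
  show "(\<lambda>n. dd (f n) x v) \<longlonglongrightarrow> dd g x v" if "x \<in> ?B"
    using G [OF that] frechet_derivative_at [OF g [OF that]] by simp
qed

lemma holo_locally_bounded:
  assumes "holo s (*) f S" "open S" "x0 \<in> S"
  obtains r M where "0 < r" "ball x0 r \<subseteq> S" "\<And>x. x \<in> ball x0 r \<Longrightarrow> cmod (f x) \<le> M"
proof -
  have "continuous (at x0) f"
    using holo_continuous_on [OF assms(1)] assms(2,3) continuous_on_eq_continuous_at by blast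
  then obtain d where d: "0 < d" "\<And>x. dist x x0 < d \<Longrightarrow> dist (f x) (f x0) < 1"
    unfolding continuous_at_eps_delta by (metis zero_less_one)
  obtain e where e: "0 < e" "ball x0 e \<subseteq> S" using assms(2,3) open_contains_ball by blast
  show thesis
  proof (rule that [of "min d e" "cmod (f x0) + 1"])
    show "cmod (f x) \<le> cmod (f x0) + 1" if "x \<in> ball x0 (min d e)" for x
    proof -
      have "dist (f x) (f x0) < 1" using d(2) [of x] that by (simp add: dist_commute)
      then show ?thesis using norm_triangle_ineq2 [of "f x" "f x0"] by (simp add: dist_norm)
    qed
  qed (use d e in auto)
qed

lemma has_vector_derivative_tendsto:
  assumes "(f has_vector_derivative D) (at 0)"
  shows "((\<lambda>t. (f t - f 0) /\<^sub>R t) \<longlongrightarrow> D) (at 0)"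
proof -
  have "(\<lambda>h. norm (f (0 + h) - f 0 - h *\<^sub>R D) / norm h) \<midarrow>0\<rightarrow> 0"
    using assms unfolding has_vector_derivative_def has_derivative_at by blast
  moreover have "norm (f (0 + h) - f 0 - h *\<^sub>R D) / norm h = norm ((f h - f 0) /\<^sub>R h - D)" if "h \<noteq> 0" for h
  proof -
    have "(f h - f 0) /\<^sub>R h - D = (f h - f 0 - h *\<^sub>R D) /\<^sub>R h"
      using that by (simp add: scaleR_diff_right)
    then show ?thesis by (simp add: divide_inverse mult.commute)
  qed
  then have "\<forall>\<^sub>F h in at 0. norm (f (0 + h) - f 0 - h *\<^sub>R D) / norm h = norm ((f h - f 0) /\<^sub>R h - D)"
    by (auto simp: eventually_at_filter)
  ultimately have "((\<lambda>h. norm ((f h - f 0) /\<^sub>R h - D)) \<longlongrightarrow> 0) (at 0)"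
    by (rule Lim_transform_eventually)
  then show ?thesis by (simp add: tendsto_norm_zero_iff LIM_zero_iff)
qed

text \<open>The directional derivative is a locally uniform limit of difference quotients, each of which is
  holomorphic; applying another derivative to them also gives the symmetry of second derivatives.\<close>

lemma holo_dd_holo:
  fixes f :: "'b::real_normed_vector \<Rightarrow> complex"
  assumes s: "cscale s" and f: "holo s (*) f S" "open S"
  shows "holo s (*) (\<lambda>x. dd f x v) S"
    and "x0 \<in> S \<Longrightarrow> dd (\<lambda>x. dd f x v) x0 w = dd (\<lambda>x. dd f x w) x0 v"
proof -
  have sr: "s (complex_of_real a) x = a *\<^sub>R x" for a x using s unfolding cscale_def by blast
  have "\<exists>r q. 0 < r \<and> ball x0 (r/2) \<subseteq> S \<and> holo s (*) (\<lambda>x. dd f x v) (ball x0 (r/2)) \<and>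
      (\<forall>w. (\<lambda>n. (dd f (x0 + q n *\<^sub>R v) w - dd f x0 w) / q n) \<longlonglongrightarrow> dd (\<lambda>x. dd f x v) x0 w) \<and>
      (\<forall>n. 0 < q n) \<and> q \<longlonglongrightarrow> 0"
    if x0: "x0 \<in> S" for x0 v
  proof -
    obtain \<rho> M where \<rho>: "0 < \<rho>" "ball x0 \<rho> \<subseteq> S" and M: "\<And>x. x \<in> ball x0 \<rho> \<Longrightarrow> cmod (f x) \<le> M"
      using holo_locally_bounded [OF f x0] by blast
    have M0: "0 \<le> M" using M [of x0] \<rho>(1) by (meson centre_in_ball norm_ge_zero order_trans)
    have nv: "0 < norm v + 1" by (simp add: add_nonneg_pos)
    \<comment> \<open>The second bound of \<open>holo_dd_bound\<close> with radius \<rho>/2 needs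
      \<open>q n * (norm v + 1)\<close> to be at most \<rho>/8; dividing by \<open>Suc n\<close>
      keeps this and lets the steps tend to 0.\<close>
    define q where "q n = \<rho> / (8 * (norm v + 1)) / real (Suc n)" for n
    have q0: "0 < q n" for n unfolding q_def using \<rho>(1) nv by simp
    have qlim: "q \<longlonglongrightarrow> 0"
      unfolding q_def by (rule LIMSEQ_Suc [OF lim_const_over_n])
    have qle: "q n * (norm v + 1) \<le> \<rho> / 8" for n
    proof -
      have "\<rho> / (8 * a) / b * a = \<rho> / 8 / b" if "a \<noteq> 0" for a b :: real
        using that by simp
      from this [of "norm v + 1" "real (Suc n)"]
      have "q n * (norm v + 1) = \<rho> / 8 / real (Suc n)" unfolding q_def using nv by simp
      also have "\<dots> \<le> \<rho> / 8 / 1" using \<rho>(1) by (intro divide_left_mono) auto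
      finally show ?thesis by simp
    qed
    define r where "r = \<rho> / 2"
    have r: "0 < r" unfolding r_def using \<rho> by simp
    have small: "x + q n *\<^sub>R v \<in> ball x0 \<rho>" if "x \<in> ball x0 r" for x n
    proof -
      have "norm (q n *\<^sub>R v) \<le> q n * (norm v + 1)"
        using q0 [of n] by (simp add: distrib_left)
      then have "norm (q n *\<^sub>R v) \<le> \<rho> / 8" using qle [of n] by linarith
      moreover have "dist x0 (x + q n *\<^sub>R v) \<le> dist x0 x + norm (q n *\<^sub>R v)"
        using dist_triangle [of x0 "x + q n *\<^sub>R v" x] by (simp add: dist_norm)
      ultimately show ?thesis using that \<rho>(1) unfolding r_def by auto
    qed
    define g where "g n x = (f (x + q n *\<^sub>R v) - f x) / q n" for n x
    have fb: "holo s (*) f (ball x0 \<rho>)" using f(1) \<rho>(2) by (rule holo_subset)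
    have gh: "holo s (*) (g n) (ball x0 r)" for n
    proof -
      have "holo s s (\<lambda>x. x + q n *\<^sub>R v) (ball x0 r)"
        unfolding holo_def by (auto intro!: exI [where x="\<lambda>x. x"] derivative_eq_intros)
      then have "holo s (*) (\<lambda>x. f (x + q n *\<^sub>R v)) (ball x0 r)"
        by (rule holo_compose [OF _ fb]) (use small in blast)
      moreover have "holo s (*) f (ball x0 r)"
        using fb by (rule holo_subset) (use \<rho>(1) in \<open>auto simp: r_def\<close>)
      ultimately show ?thesis unfolding g_def using q0
        by (intro holo_divide holo_diff holo_const) (auto simp: less_imp_neq [THEN not_sym])
    qed
    have sub: "ball x (\<rho>/2) \<subseteq> ball x0 \<rho>" if "x \<in> ball x0 r" for x
      using that unfolding r_def by (intro subsetI) (auto, smt (verit) dist_triangle dist_commute field_sum_of_halves)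
    let ?C = "32 * M * (norm v + 1)\<^sup>2 / (\<rho>/2)\<^sup>2"
    have gd: "cmod (g n x - dd f x v) \<le> ?C * q n" if x: "x \<in> ball x0 r" for n x
    proof -
      have "cmod (f (x + s (of_real (q n)) v) - f x - dd f x v * of_real (q n)) \<le> ?C * (cmod (of_real (q n)))\<^sup>2"
        by (rule holo_dd_bound(2) [OF s fb M sub [OF x]]) (use \<rho>(1) qle [of n] q0 [of n] in auto)
      then have *: "cmod (f (x + q n *\<^sub>R v) - f x - dd f x v * of_real (q n)) \<le> ?C * (q n)\<^sup>2"
        by (simp only: sr norm_of_real power2_abs)
      have "g n x - dd f x v = (f (x + q n *\<^sub>R v) - f x - dd f x v * of_real (q n)) / of_real (q n)"
        unfolding g_def using q0 [of n] by (simp add: field_simps)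
      then have "cmod (g n x - dd f x v) = cmod (f (x + q n *\<^sub>R v) - f x - dd f x v * of_real (q n)) / q n"
        using q0 [of n] by (simp add: norm_divide)
      also have "\<dots> \<le> ?C * (q n)\<^sup>2 / q n" using * q0 [of n] by (intro divide_right_mono) auto
      finally show ?thesis using q0 [of n] by (simp add: power2_eq_square)
    qed
    have ul: "uniform_limit (ball x0 r) g (\<lambda>x. dd f x v) sequentially"
      unfolding uniform_limit_iff
    proof (intro allI impI)
      fix e :: real assume e: "0 < e"
      have "(\<lambda>n. ?C * q n) \<longlonglongrightarrow> ?C * 0" by (intro tendsto_intros qlim)
      then have "\<forall>\<^sub>F n in sequentially. ?C * q n < e" using e by (intro order_tendstoD) auto
      then show "\<forall>\<^sub>F n in sequentially. \<forall>x\<in>ball x0 r. dist (g n x) (dd f x v) < e"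
      proof (rule eventually_mono)
        fix n assume n: "?C * q n < e"
        show "\<forall>x\<in>ball x0 r. dist (g n x) (dd f x v) < e"
        proof
          fix x assume "x \<in> ball x0 r"
          from gd [OF this, of n] n show "dist (g n x) (dd f x v) < e" unfolding dist_norm by linarith
        qed
      qed
    qed
    note lim = holo_uniform_limit [OF s gh r ul]
    \<comment> \<open>Differentiating the quotient \<open>g n\<close> in direction w gives the
      difference quotient, in direction v, of the derivative along w. Its limit is thus the mixed
      second derivative in either order, which is the source of the symmetry.\<close>
    have "dd (g n) x0 w = (dd f (x0 + q n *\<^sub>R v) w - dd f x0 w) / q n" for n w
    proof -
      have 1: "(f has_derivative dd f (x0 + q n *\<^sub>R v)) (at (x0 + q n *\<^sub>R v))"
        by (rule holo_dd [OF f]) (use small [of x0 n] \<rho> r in auto)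
      have 2: "((\<lambda>x. f (x + q n *\<^sub>R v)) has_derivative dd f (x0 + q n *\<^sub>R v)) (at x0)"
        by (rule has_derivative_shift [OF 1])
      have "(g n has_derivative (\<lambda>w. (dd f (x0 + q n *\<^sub>R v) w - dd f x0 w) / q n)) (at x0)"
        unfolding g_def by (intro bounded_linear.has_derivative [OF bounded_linear_divide] has_derivative_diff 2 holo_dd(1) [OF f x0])
      then show ?thesis by (simp add: frechet_derivative_at [symmetric])
    qed
    then have "\<forall>w. (\<lambda>n. (dd f (x0 + q n *\<^sub>R v) w - dd f x0 w) / q n) \<longlonglongrightarrow> dd (\<lambda>x. dd f x v) x0 w"
      using lim(2) [of x0] r by simp
    then show ?thesis
      using lim(1) r q0 qlim \<rho>(2) unfolding r_def by (intro exI [of _ "\<rho>/2"] exI [of _ q]) auto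
  qed
  note main = this
  show h: "holo s (*) (\<lambda>x. dd f x v) S" for v
  proof (rule holo_local)
    fix x assume "x \<in> S"
    from main [OF this, of v] obtain r where "0 < r" "holo s (*) (\<lambda>x. dd f x v) (ball x (r/2))" by blast
    then show "\<exists>O'. open O' \<and> x \<in> O' \<and> holo s (*) (\<lambda>x. dd f x v) (S \<inter> O')"
      by (intro exI [of _ "ball x (r/2)"]) (auto intro: holo_subset)
  qed
  assume x0: "x0 \<in> S"
  obtain r q where q: "(\<lambda>n. (dd f (x0 + q n *\<^sub>R v) w - dd f x0 w) / of_real (q n)) \<longlonglongrightarrow> dd (\<lambda>x. dd f x v) x0 w"
    "\<And>n. 0 < q n" "q \<longlonglongrightarrow> 0" using main [OF x0, of v] by blast
  have hd: "((\<lambda>x. dd f x w) has_derivative dd (\<lambda>x. dd f x w) x0) (at x0)"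
    by (rule holo_dd [OF h f(2) x0])
  have "((\<lambda>t. dd f (x0 + t *\<^sub>R v) w) has_derivative (\<lambda>t. dd (\<lambda>x. dd f x w) x0 (t *\<^sub>R v))) (at 0)"
  proof -
    have 1: "((\<lambda>t. x0 + t *\<^sub>R v) has_derivative (\<lambda>t. t *\<^sub>R v)) (at 0)" by (auto intro!: derivative_eq_intros)
    have 2: "((\<lambda>x. dd f x w) has_derivative dd (\<lambda>x. dd f x w) x0) (at (x0 + 0 *\<^sub>R v))"
      using hd by simp
    from has_derivative_compose [OF 1 2] show ?thesis .
  qed
  moreover have "dd (\<lambda>x. dd f x w) x0 (t *\<^sub>R v) = t *\<^sub>R dd (\<lambda>x. dd f x w) x0 v" for t
    using linear_cmul [OF has_derivative_linear [OF hd]] .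
  ultimately have "((\<lambda>t. dd f (x0 + t *\<^sub>R v) w) has_vector_derivative dd (\<lambda>x. dd f x w) x0 v) (at 0)"
    unfolding has_vector_derivative_def by simp
  then have *: "((\<lambda>t. (dd f (x0 + t *\<^sub>R v) w - dd f x0 w) /\<^sub>R t) \<longlongrightarrow> dd (\<lambda>x. dd f x w) x0 v) (at 0)"
    using has_vector_derivative_tendsto by fastforce
  have "filterlim q (at 0) sequentially"
    using q(2,3) by (intro filterlim_atI) (auto simp: eventually_sequentially less_imp_neq [THEN not_sym])
  from filterlim_compose [OF * this]
  have "(\<lambda>n. (dd f (x0 + q n *\<^sub>R v) w - dd f x0 w) /\<^sub>R q n) \<longlonglongrightarrow> dd (\<lambda>x. dd f x w) x0 v" .
  then show "dd (\<lambda>x. dd f x v) x0 w = dd (\<lambda>x. dd f x w) x0 v"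
    using LIMSEQ_unique q(1) by (simp add: scaleR_conv_of_real divide_inverse mult.commute)
qed

text \<open>G(x) is the integral of g(t x) over t in [0, 1], and the equation comes from integrating
  the derivative of t g(t x). It makes the radial derivative of \<open>x $ l * G x\<close> equal to
  \<open>x $ l * g x\<close>, which is how it is used. That G obeys the same bound as g keeps the
  Picard series convergent.\<close>

lemma radial_primitive:
  fixes g :: "'b::euclidean_space \<Rightarrow> complex"
  assumes s: "cscale s" and g: "holo s (*) g (ball 0 r)"
  obtains G where "holo s (*) G (ball 0 r)" "\<And>x. x \<in> ball 0 r \<Longrightarrow> G x + dd G x x = g x"
    "\<And>M x. (\<And>y. y \<in> ball 0 r \<Longrightarrow> cmod (g y) \<le> M) \<Longrightarrow> x \<in> ball 0 r \<Longrightarrow> cmod (G x) \<le> M"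
proof -
  let ?B = "ball (0::'b) r"
  have tB: "t *\<^sub>R x \<in> ?B" if "x \<in> ?B" "t \<in> cbox 0 1" for t :: real and x
    using scaleR_ball_0 [OF that(1)] that(2) by simp
  note fd = holo_dd [OF g open_ball]
  have lin: "linear (dd g x)" if "x \<in> ?B" for x
    using fd(1) [OF that] has_derivative_linear by blast
  \<comment> \<open>The Leibniz rule for parameter integrals takes the derivative as a bounded
    linear map that depends continuously on both variables.\<close>
  define A where "A x t = Blinfun (\<lambda>v. dd g (t *\<^sub>R x) (t *\<^sub>R v))" for x t
  have bl: "bounded_linear (\<lambda>v. dd g (t *\<^sub>R x) (t *\<^sub>R v))" if "x \<in> ?B" "t \<in> cbox 0 1" for x t
    using bounded_linear_compose [OF has_derivative_bounded_linear [OF fd(1) [OF tB [OF that]]] bounded_linear_scaleR_right] .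
  have A: "blinfun_apply (A x t) v = t *\<^sub>R dd g (t *\<^sub>R x) v" if "x \<in> ?B" "t \<in> cbox 0 1" for x t v
    unfolding A_def using bounded_linear_Blinfun_apply [OF bl [OF that]] linear_cmul [OF lin [OF tB [OF that]]] by simp
  define G where "G x = integral (cbox 0 1) (\<lambda>t. g (t *\<^sub>R x))" for x
  have gc: "continuous_on (cbox 0 1) (\<lambda>t. g (t *\<^sub>R x))" if "x \<in> ?B" for x
    by (rule continuous_on_compose2 [OF holo_continuous_on [OF g]]) (use tB that in \<open>auto intro!: continuous_intros\<close>)
  have cA: "continuous_on (?B \<times> cbox 0 1) (\<lambda>(x, t). A x t)"
  proof (rule continuous_on_blinfun_componentwise)
    fix i :: 'b
    have "continuous_on (?B \<times> cbox 0 1) (\<lambda>p. snd p *\<^sub>R dd g (snd p *\<^sub>R fst p) i)"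
      by (intro continuous_intros continuous_on_compose2 [OF holo_continuous_on [OF holo_dd_holo(1) [OF s g open_ball, of i]]])
         (use tB in auto)
    then show "continuous_on (?B \<times> cbox 0 1) (\<lambda>x. blinfun_apply (case x of (x, t) \<Rightarrow> A x t) i)"
      by (rule continuous_on_eq) (auto simp: A)
  qed
  have iA: "(\<lambda>t. A x t) integrable_on cbox 0 1" if "x \<in> ?B" for x
  proof (rule integrable_continuous)
    show "continuous_on (cbox 0 1) (A x)"
    proof -
      have "continuous_on (cbox 0 1) (\<lambda>t. case (x, t) of (x, t) \<Rightarrow> A x t)"
        by (rule continuous_on_compose2 [OF cA]) (use that in \<open>auto intro!: continuous_intros\<close>)
      then show ?thesis by simp
    qed
  qed
  have G': "(G has_derivative (\<lambda>v. integral (cbox 0 1) (\<lambda>t. t *\<^sub>R dd g (t *\<^sub>R x) v))) (at x)" if x: "x \<in> ?B" for x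
  proof -
    have "((\<lambda>x. integral (cbox 0 1) (\<lambda>t. g (t *\<^sub>R x))) has_derivative blinfun_apply (integral (cbox 0 1) (A x))) (at x within ?B)"
    proof (rule leibniz_rule [OF _ _ cA x convex_ball])
      fix y t assume yt: "y \<in> ?B" "t \<in> cbox (0::real) 1"
      have "((\<lambda>y. g (t *\<^sub>R y)) has_derivative (\<lambda>v. dd g (t *\<^sub>R y) (t *\<^sub>R v))) (at y within ?B)"
        by (rule has_derivative_dilate [OF fd(1) [OF tB [OF yt]]])
      then show "((\<lambda>y. g (t *\<^sub>R y)) has_derivative blinfun_apply (A y t)) (at y within ?B)"
        unfolding A_def by (simp add: bounded_linear_Blinfun_apply [OF bl [OF yt]])
    qed (rule integrable_continuous, rule gc)
    moreover have "blinfun_apply (integral (cbox 0 1) (A x)) v = integral (cbox 0 1) (\<lambda>t. t *\<^sub>R dd g (t *\<^sub>R x) v)" for v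
    proof -
      have "blinfun_apply (integral (cbox 0 1) (A x)) v = integral (cbox 0 1) (\<lambda>t. blinfun_apply (A x t) v)"
        using integral_linear [OF iA [OF x] blinfun.bounded_linear_left [of v]] by (simp add: o_def)
      also have "\<dots> = integral (cbox 0 1) (\<lambda>t. t *\<^sub>R dd g (t *\<^sub>R x) v)"
        by (rule integral_cong) (rule A [OF x])
      finally show ?thesis .
    qed
    then have "blinfun_apply (integral (cbox 0 1) (A x)) = (\<lambda>v. integral (cbox 0 1) (\<lambda>t. t *\<^sub>R dd g (t *\<^sub>R x) v))"
      by blast
    ultimately show ?thesis unfolding G_def at_within_open [OF x open_ball] by metis
  qed
  have i1: "(\<lambda>t. t *\<^sub>R dd g (t *\<^sub>R x) v) integrable_on cbox 0 1" if "x \<in> ?B" for x v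
  proof -
    have "(\<lambda>t. blinfun_apply (A x t) v) integrable_on cbox 0 1"
      using integrable_linear [OF iA [OF that] blinfun.bounded_linear_left [of v]] by (simp add: o_def)
    then show ?thesis by (rule integrable_eq) (rule A [OF that])
  qed
  show thesis
  proof
    show "holo s (*) G ?B"
      unfolding holo_def
    proof
      fix x assume x: "x \<in> ?B"
      have "integral (cbox 0 1) (\<lambda>t. t *\<^sub>R dd g (t *\<^sub>R x) (s c v)) = c * integral (cbox 0 1) (\<lambda>t. t *\<^sub>R dd g (t *\<^sub>R x) v)" for c v
      proof -
        have "integral (cbox 0 1) (\<lambda>t. t *\<^sub>R dd g (t *\<^sub>R x) (s c v)) = integral (cbox 0 1) (\<lambda>t. c * (t *\<^sub>R dd g (t *\<^sub>R x) v))"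
          by (rule integral_cong) (simp only: fd(2) [OF tB [OF x]] mult_scaleR_right)
        also have "\<dots> = c * integral (cbox 0 1) (\<lambda>t. t *\<^sub>R dd g (t *\<^sub>R x) v)"
          by (rule integral_mult_right)
        finally show ?thesis .
      qed
      then show "\<exists>D. (G has_derivative D) (at x within ?B) \<and> (\<forall>c v. D (s c v) = c * D v)"
        using has_derivative_at_withinI [OF G' [OF x]] by blast
    qed
    show "G x + dd G x x = g x" if x: "x \<in> ?B" for x
    proof -
      have "((\<lambda>t. g (t *\<^sub>R x) + t *\<^sub>R dd g (t *\<^sub>R x) x) has_integral 1 *\<^sub>R g (1 *\<^sub>R x) - 0 *\<^sub>R g (0 *\<^sub>R x)) {0..1}"
      proof (rule fundamental_theorem_of_calculus)
        fix t :: real assume t: "t \<in> {0..1}"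
        have "((\<lambda>t. g (t *\<^sub>R x)) has_derivative (\<lambda>a. dd g (t *\<^sub>R x) (a *\<^sub>R x))) (at t within {0..1})"
          by (rule has_derivative_ray [OF fd(1) [OF tB [OF x]]]) (use t in simp)
        then have "((\<lambda>t. g (t *\<^sub>R x)) has_vector_derivative dd g (t *\<^sub>R x) x) (at t within {0..1})"
          unfolding has_vector_derivative_def
          using linear_cmul [OF lin [OF tB [OF x]]] t by (simp add: has_derivative_transform)
        then show "((\<lambda>t. t *\<^sub>R g (t *\<^sub>R x)) has_vector_derivative g (t *\<^sub>R x) + t *\<^sub>R dd g (t *\<^sub>R x) x) (at t within {0..1})"
          by (auto intro!: derivative_eq_intros)
      qed auto
      then have "integral (cbox 0 1) (\<lambda>t. g (t *\<^sub>R x) + t *\<^sub>R dd g (t *\<^sub>R x) x) = g x"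
        by (simp add: integral_unique)
      moreover have "dd G x x = integral (cbox 0 1) (\<lambda>t. t *\<^sub>R dd g (t *\<^sub>R x) x)"
        using frechet_derivative_at [OF G' [OF x]] by metis
      moreover have "integral (cbox 0 1) (\<lambda>t. g (t *\<^sub>R x) + t *\<^sub>R dd g (t *\<^sub>R x) x)
          = G x + integral (cbox 0 1) (\<lambda>t. t *\<^sub>R dd g (t *\<^sub>R x) x)"
        unfolding G_def by (intro integral_add integrable_continuous gc i1 x)
      ultimately show ?thesis by simp
    qed
    fix M x assume M: "\<And>y. y \<in> ?B \<Longrightarrow> cmod (g y) \<le> M" and x: "x \<in> ?B"
    have "norm (integral {0..1} (\<lambda>t. g (t *\<^sub>R x))) \<le> M * (1 - 0)"
      by (rule integral_bound) (use gc [OF x] M tB [OF x] in auto)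
    then show "cmod (G x) \<le> M" unfolding G_def by simp
  qed
qed

text \<open>Mean value theorem on the segment from 0 to x: at an inner point t x the derivative in
  direction x is 1/t times the radial one, hence zero.\<close>

lemma radial_constant:
  fixes h :: "'b::real_normed_vector \<Rightarrow> 'c::real_inner"
  assumes h: "\<And>x. x \<in> ball 0 r \<Longrightarrow> (h has_derivative h' x) (at x)" "\<And>x. x \<in> ball 0 r \<Longrightarrow> h' x x = 0"
    and x: "x \<in> ball 0 r"
  shows "h x = h 0"
proof -
  note tB = scaleR_ball_0 [OF x]
  have hd: "((\<lambda>t. h (t *\<^sub>R x)) has_derivative (\<lambda>a. h' (t *\<^sub>R x) (a *\<^sub>R x))) (at t)" if "t \<in> {0..1}" for t
    by (rule has_derivative_ray [OF h(1) [OF tB [OF that]]])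
  obtain t :: real where t: "t \<in> {0<..<1}" "norm (h (1 *\<^sub>R x) - h (0 *\<^sub>R x)) \<le> norm (h' (t *\<^sub>R x) ((1 - 0) *\<^sub>R x))"
  proof -
    have "\<exists>t\<in>{0<..<1}. norm (h (1 *\<^sub>R x) - h (0 *\<^sub>R x)) \<le> norm (h' (t *\<^sub>R x) ((1 - 0) *\<^sub>R x))"
    proof (rule mvt_general)
      show "continuous_on {0..1} (\<lambda>t. h (t *\<^sub>R x))"
        unfolding continuous_on_eq_continuous_within
        using hd has_derivative_continuous has_derivative_at_withinI by blast
    qed (use hd in auto)
    then show ?thesis using that by blast
  qed
  have "linear (h' (t *\<^sub>R x))" using h(1) [OF tB, of t] t(1) has_derivative_linear by auto
  from linear_cmul [OF this, of "1 / t" "t *\<^sub>R x"] have "h' (t *\<^sub>R x) x = (1 / t) *\<^sub>R h' (t *\<^sub>R x) (t *\<^sub>R x)"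
    using t(1) by simp
  then have "h' (t *\<^sub>R x) x = 0" using h(2) [OF tB, of t] t(1) by simp
  then show ?thesis using t(2) by simp
qed

section \<open>Matrix-valued holomorphic functions\<close>

definition mholo ::
  "(complex \<Rightarrow> 'b \<Rightarrow> 'b) \<Rightarrow> ('b::real_normed_vector \<Rightarrow> complex^'n::finite^'k::finite) \<Rightarrow> 'b set \<Rightarrow> bool" where
  "mholo s F S \<longleftrightarrow> (\<forall>i j. holo s (*) (\<lambda>x. F x $ i $ j) S)"

lemma bounded_bilinear_matrix_mult:
  "bounded_bilinear ((**) :: complex^'n::finite^'k::finite \<Rightarrow> complex^'p::finite^'n \<Rightarrow> _)"
proof -
  have "bilinear ((**) :: complex^'n::finite^'k::finite \<Rightarrow> complex^'p::finite^'n \<Rightarrow> _)"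
    unfolding bilinear_def
    by (auto intro!: linearI simp: matrix_matrix_mult_def vec_eq_iff algebra_simps sum.distrib scaleR_sum_right)
  then show ?thesis by (simp add: bilinear_conv_bounded_bilinear)
qed

lemma bounded_bilinear_matrix_vector_mult:
  "bounded_bilinear ((*v) :: complex^'n::finite^'k::finite \<Rightarrow> complex^'n \<Rightarrow> _)"
proof -
  have "bilinear ((*v) :: complex^'n::finite^'k::finite \<Rightarrow> complex^'n \<Rightarrow> _)"
    unfolding bilinear_def
    by (auto intro!: linearI simp: matrix_vector_mult_def vec_eq_iff algebra_simps sum.distrib scaleR_sum_right)
  then show ?thesis by (simp add: bilinear_conv_bounded_bilinear)
qed

lemma dd_eq: "(f has_derivative D) (at x) \<Longrightarrow> dd f x v = D v"
  by (simp add: frechet_derivative_at [symmetric])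

lemma has_derivative_nth:
  "(f has_derivative D) F \<Longrightarrow> ((\<lambda>x. f x $ i) has_derivative (\<lambda>v. D v $ i)) F"
  by (rule bounded_linear.has_derivative [OF bounded_linear_vec_nth])

lemma mholo_subset: "mholo s F S \<Longrightarrow> S' \<subseteq> S \<Longrightarrow> mholo s F S'"
  unfolding mholo_def using holo_subset by blast

lemma mholo_mult:
  fixes F :: "'b::real_normed_vector \<Rightarrow> complex^'n::finite^'k::finite" and G :: "'b \<Rightarrow> complex^'p::finite^'n"
  assumes "mholo s F S" "mholo s G S"
  shows "mholo s (\<lambda>x. F x ** G x) S"
  using assms unfolding mholo_def matrix_matrix_mult_def by (auto intro!: holo_sum holo_mult)

lemma mholo_mult_vec:
  fixes F :: "'b::real_normed_vector \<Rightarrow> complex^'n::finite^'k::finite" and w :: "'b \<Rightarrow> complex^'n"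
  assumes "mholo s F S" "holo s (*s) w S"
  shows "holo s (*s) (\<lambda>x. F x *v w x) S"
  using assms unfolding mholo_def holo_vec_iff matrix_vector_mult_def by (auto intro!: holo_sum holo_mult)

lemma mholo_const: "mholo s (\<lambda>x. A) S"
  unfolding mholo_def by (simp add: holo_const)

lemma matrix_inv:
  fixes A :: "complex^'n::finite^'n"
  assumes "invertible A"
  shows "A ** matrix_inv A = mat 1" "matrix_inv A ** A = mat 1"
  using someI_ex [OF assms [unfolded invertible_def]] unfolding matrix_inv_def by auto

text \<open>Cramer's rule exhibits the entries of the inverse as quotients of determinants, from
  which their holomorphy can be read off.\<close>

lemma matrix_inv_cramer:
  fixes A :: "complex^'n::finite^'n"
  assumes "det A \<noteq> 0"
  shows "matrix_inv A $ i $ j = det (\<chi> a b. if b = i then axis j 1 $ a else A $ a $ b) / det A"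
proof -
  have "A *v (matrix_inv A *v axis j 1) = axis j 1"
    using assms by (simp add: matrix_vector_mul_assoc invertible_det_nz matrix_inv)
  then have "matrix_inv A *v axis j 1 = (\<chi> k. det (\<chi> a b. if b = k then axis j 1 $ a else A $ a $ b) / det A)"
    using cramer [OF assms] by blast
  then have "(matrix_inv A *v axis j 1) $ i = det (\<chi> a b. if b = i then axis j 1 $ a else A $ a $ b) / det A"
    by simp
  moreover have "(B *v axis j 1) $ i = B $ i $ j" for B :: "complex^'n^'n"
    by (simp add: matrix_vector_mult_def axis_def if_distrib cong: if_cong)
  ultimately show ?thesis by simp
qed

lemma mholo_matrix_inv:
  fixes A :: "'b::real_normed_vector \<Rightarrow> complex^'n::finite^'n"
  assumes A: "mholo s A S" and d: "\<And>x. x \<in> S \<Longrightarrow> det (A x) \<noteq> 0"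
  shows "mholo s (\<lambda>x. matrix_inv (A x)) S"
  unfolding mholo_def
proof (intro allI)
  fix i j
  have "holo s (*) (\<lambda>x. det (\<chi> a b. if b = i then axis j 1 $ a else A x $ a $ b) / det (A x)) S"
  proof (intro holo_divide holo_det d)
    show "holo s (*) (\<lambda>x. (\<chi> a b. if b = i then axis j 1 $ a else A x $ a $ b) $ c $ e) S" for c e
      using A by (cases "e = i") (auto simp: mholo_def intro: holo_const)
  qed (use A in \<open>auto simp: mholo_def\<close>)
  then show "holo s (*) (\<lambda>x. matrix_inv (A x) $ i $ j) S"
    by (rule holo_cong) (simp add: matrix_inv_cramer d)
qed

lemma holo_vec_dd:
  fixes F :: "'b::real_normed_vector \<Rightarrow> complex^'n::finite"
  assumes s: "cscale s" and F: "holo s (*s) F S" "open S"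
  shows "x \<in> S \<Longrightarrow> dd F x v $ j = dd (\<lambda>x. F x $ j) x v"
    and "holo s (*s) (\<lambda>x. dd F x v) S"
    and "x \<in> S \<Longrightarrow> dd (\<lambda>x. dd F x v) x w = dd (\<lambda>x. dd F x w) x v"
proof -
  have Fj: "holo s (*) (\<lambda>x. F x $ j) S" for j using F(1) by (simp add: holo_vec_iff)
  show 1: "dd F x v $ j = dd (\<lambda>x. F x $ j) x v" if "x \<in> S" for x v j
    by (rule dd_eq [OF has_derivative_nth [OF holo_dd(1) [OF F that]], symmetric])
  show 2: "holo s (*s) (\<lambda>x. dd F x v) S" for v
    unfolding holo_vec_iff
    by (intro allI holo_cong [OF holo_dd_holo(1) [OF s Fj F(2), where v=v]]) (simp add: 1)
  assume x: "x \<in> S"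
  have 3: "dd (\<lambda>x. dd F x v) x w $ j = dd (\<lambda>x. dd (\<lambda>x. F x $ j) x v) x w" for j v w
  proof -
    have "((\<lambda>x. dd F x v $ j) has_derivative (\<lambda>w. dd (\<lambda>x. dd F x v) x w $ j)) (at x)"
      by (rule has_derivative_nth [OF holo_dd(1) [OF 2 F(2) x]])
    then have "((\<lambda>x. dd (\<lambda>x. F x $ j) x v) has_derivative (\<lambda>w. dd (\<lambda>x. dd F x v) x w $ j)) (at x)"
      by (rule has_derivative_transform_within_open [OF _ F(2) x]) (simp add: 1)
    then show ?thesis by (rule dd_eq [symmetric])
  qed
  show "dd (\<lambda>x. dd F x v) x w = dd (\<lambda>x. dd F x w) x v"
    unfolding vec_eq_iff 3 using holo_dd_holo(2) [OF s Fj F(2) x] by blast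
qed

lemma mholo_dd:
  fixes F :: "'b::real_normed_vector \<Rightarrow> complex^'n::finite^'k::finite"
  assumes s: "cscale s" and F: "mholo s F S" "open S"
  shows "x \<in> S \<Longrightarrow> (F has_derivative dd F x) (at x)"
    and "x \<in> S \<Longrightarrow> dd F x v $ i $ j = dd (\<lambda>x. F x $ i $ j) x v"
    and "mholo s (\<lambda>x. dd F x v) S"
    and "x \<in> S \<Longrightarrow> dd (\<lambda>x. dd F x v) x w = dd (\<lambda>x. dd F x w) x v"
proof -
  have Fi: "holo s (*s) (\<lambda>x. F x $ i) S" for i using F(1) by (simp add: holo_vec_iff mholo_def)
  have hd: "(F has_derivative (\<lambda>v. \<chi> i. dd (\<lambda>x. F x $ i) x v)) (at x)" if "x \<in> S" for x
    using holo_dd(1) [OF Fi F(2) that] by (simp add: has_derivative_vec_iff [of F])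
  have fd: "dd F x = (\<lambda>v. \<chi> i. dd (\<lambda>x. F x $ i) x v)" if "x \<in> S" for x
    by (rule frechet_derivative_at [OF hd [OF that], symmetric])
  show "x \<in> S \<Longrightarrow> (F has_derivative dd F x) (at x)" for x
    using hd [of x] by (simp only: fd)
  show 1: "x \<in> S \<Longrightarrow> dd F x v $ i $ j = dd (\<lambda>x. F x $ i $ j) x v" for x v i j
    using holo_vec_dd(1) [OF s Fi F(2)] by (simp add: fd)
  show 2: "mholo s (\<lambda>x. dd F x v) S" for v
    unfolding mholo_def
  proof (intro allI)
    fix i j
    show "holo s (*) (\<lambda>x. dd F x v $ i $ j) S"
      by (rule holo_cong [OF holo_dd_holo(1) [OF s _ F(2), of "\<lambda>x. F x $ i $ j" v]]) (use F(1) 1 in \<open>auto simp: mholo_def\<close>)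
  qed
  assume x: "x \<in> S"
  have 3: "dd (\<lambda>x. dd F x v) x w $ i = dd (\<lambda>x. dd (\<lambda>x. F x $ i) x v) x w" for i v w
  proof -
    have Gi: "holo s (*s) (\<lambda>x. dd F x v $ i) S" for i using 2 by (simp add: holo_vec_iff mholo_def)
    have "((\<lambda>x. dd F x v) has_derivative (\<lambda>w. \<chi> i. dd (\<lambda>x. dd F x v $ i) x w)) (at x)"
      using holo_dd(1) [OF Gi F(2) x] by (simp add: has_derivative_vec_iff [of "\<lambda>x. dd F x v"])
    note hd2 = this
    have "((\<lambda>x. dd F x v $ i) has_derivative (\<lambda>w. dd (\<lambda>x. dd F x v) x w $ i)) (at x)"
      using has_derivative_nth [OF hd2, of i] by (simp add: dd_eq [OF hd2])
    then have "((\<lambda>x. dd (\<lambda>x. F x $ i) x v) has_derivative (\<lambda>w. dd (\<lambda>x. dd F x v) x w $ i)) (at x)"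
      by (rule has_derivative_transform_within_open [OF _ F(2) x]) (simp add: fd)
    then show ?thesis by (rule dd_eq [symmetric])
  qed
  show "dd (\<lambda>x. dd F x v) x w = dd (\<lambda>x. dd F x w) x v"
    unfolding vec_eq_iff [of "dd (\<lambda>x. dd F x v) x w"] 3 using holo_vec_dd(3) [OF s Fi F(2) x] by blast
qed

text \<open>Product rule for a field of linear maps evaluated at a moving vector. Only derivatives
  along fixed vectors are given, so the field is expanded in a basis. It is applied with w the
  identity, to differentiate the radial equation.\<close>

lemma has_derivative_bilinear_eval:
  fixes \<Phi> :: "'a::real_normed_vector \<Rightarrow> 'b::euclidean_space \<Rightarrow> 'c::real_normed_vector"
  assumes \<Phi>: "\<And>b. ((\<lambda>y. \<Phi> y b) has_derivative \<Phi>' b) (at x)"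
    and lin: "\<And>y. y \<in> S \<Longrightarrow> linear (\<Phi> y)" and S: "open S" "x \<in> S"
    and w: "(w has_derivative w') (at x)"
  shows "((\<lambda>y. \<Phi> y (w y)) has_derivative (\<lambda>v. \<Phi>' (w x) v + \<Phi> x (w' v))) (at x)"
proof -
  have ex: "\<Phi> y u = (\<Sum>b\<in>Basis. (u \<bullet> b) *\<^sub>R \<Phi> y b)" if "y \<in> S" for y u
    using linear_sum [OF lin [OF that], of "\<lambda>b. (u \<bullet> b) *\<^sub>R b" Basis] linear_cmul [OF lin [OF that]]
    by (simp add: euclidean_representation)
  have ex': "\<Phi>' u = (\<lambda>v. \<Sum>b\<in>Basis. (u \<bullet> b) *\<^sub>R \<Phi>' b v)" for u
  proof -
    have "((\<lambda>y. \<Sum>b\<in>Basis. (u \<bullet> b) *\<^sub>R \<Phi> y b) has_derivative (\<lambda>v. \<Sum>b\<in>Basis. (u \<bullet> b) *\<^sub>R \<Phi>' b v)) (at x)"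
      by (intro has_derivative_sum has_derivative_scaleR_right \<Phi>)
    then have "((\<lambda>y. \<Phi> y u) has_derivative (\<lambda>v. \<Sum>b\<in>Basis. (u \<bullet> b) *\<^sub>R \<Phi>' b v)) (at x)"
      by (rule has_derivative_transform_within_open [OF _ S]) (simp add: ex)
    from has_derivative_unique [OF \<Phi> this] show ?thesis .
  qed
  have "((\<lambda>y. \<Sum>b\<in>Basis. (w y \<bullet> b) *\<^sub>R \<Phi> y b) has_derivative
      (\<lambda>v. \<Sum>b\<in>Basis. (w x \<bullet> b) *\<^sub>R \<Phi>' b v + (w' v \<bullet> b) *\<^sub>R \<Phi> x b)) (at x)"
    by (intro has_derivative_sum has_derivative_scaleR has_derivative_inner_left \<Phi> w)
  moreover have "(\<Sum>b\<in>Basis. (w x \<bullet> b) *\<^sub>R \<Phi>' b v + (w' v \<bullet> b) *\<^sub>R \<Phi> x b) = \<Phi>' (w x) v + \<Phi> x (w' v)" for v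
    by (simp only: sum.distrib ex' [of "w x"] ex [OF S(2), of "w' v"])
  ultimately have "((\<lambda>y. \<Sum>b\<in>Basis. (w y \<bullet> b) *\<^sub>R \<Phi> y b) has_derivative (\<lambda>v. \<Phi>' (w x) v + \<Phi> x (w' v))) (at x)"
    by simp
  then show ?thesis
    by (rule has_derivative_transform_within_open [OF _ S]) (use ex in simp)
qed

text \<open>At a maximum of \<open>norm (z t)\<close> the mean value inequality bounds the maximum
  by half of itself. The smallness of the coefficient replaces a Gronwall argument.\<close>

lemma linear_ode_zero:
  fixes z :: "real \<Rightarrow> complex^'n::finite^'n"
  assumes z: "\<And>t. t \<in> {0..1} \<Longrightarrow> (z has_vector_derivative z t ** B t) (at t within {0..1})" "z 0 = 0"
    and K: "\<And>(P :: complex^'n^'n) (Q :: complex^'n^'n). norm (P ** Q) \<le> norm P * norm Q * K" "0 \<le> K"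
    and B: "\<And>t. t \<in> {0..1} \<Longrightarrow> norm (B t) * K \<le> 1/2"
    and t: "t \<in> {0..1}"
  shows "z t = 0"
proof -
  have "continuous_on {0..1} (\<lambda>t. norm (z t))"
    using z(1) by (intro continuous_on_norm) (force simp: continuous_on_eq_continuous_within intro: has_vector_derivative_continuous)
  then obtain t0 where t0: "t0 \<in> {0..1}" "\<And>t. t \<in> {0..1} \<Longrightarrow> norm (z t) \<le> norm (z t0)"
    using continuous_attains_sup [of "{0..1::real}" "\<lambda>t. norm (z t)"] by auto
  have "norm (z t0 - z 0) \<le> (norm (z t0) / 2) * norm (t0 - 0)"
  proof (rule differentiable_bound [where S="{0..1}"])
    fix t :: real assume t: "t \<in> {0..1}"
    show "(z has_derivative (\<lambda>a. a *\<^sub>R (z t ** B t))) (at t within {0..1})"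
      using z(1) [OF t] unfolding has_vector_derivative_def .
    have "norm (z t ** B t) \<le> norm (z t) * (norm (B t) * K)"
      using K(1) [of "z t" "B t"] by (simp add: mult.assoc)
    also have "\<dots> \<le> norm (z t0) * (1/2)"
      by (intro mult_mono t0(2) t B) (use K(2) in auto)
    finally show "onorm (\<lambda>a. a *\<^sub>R (z t ** B t)) \<le> norm (z t0) / 2"
      using onorm_le [of "\<lambda>a. a *\<^sub>R (z t ** B t)" "norm (z t0) / 2"]
        mult_left_mono [of "norm (z t ** B t)" "norm (z t0) / 2" "\<bar>a\<bar>" for a] by (simp add: mult.commute)
  qed (use t0 in auto)
  also have "\<dots> \<le> (norm (z t0) / 2) * 1" using t0(1) by (intro mult_left_mono) auto
  finally have "norm (z t0) \<le> 0" using z(2) by simp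
  then show ?thesis using t0(2) [OF t] by (metis norm_le_zero_iff order_trans)
qed

lemma norm_matrix_le:
  fixes A :: "complex^'n::finite^'k::finite"
  assumes "\<And>i j. cmod (A $ i $ j) \<le> c"
  shows "norm A \<le> real CARD('k) * (real CARD('n) * c)"
proof -
  have row: "norm (A $ i) \<le> real CARD('n) * c" for i
  proof -
    have "norm (A $ i) \<le> (\<Sum>j\<in>UNIV. norm (A $ i $ j))"
      unfolding norm_vec_def [of "A $ i"] by (rule L2_set_le_sum) auto
    also have "\<dots> \<le> (\<Sum>j\<in>(UNIV::'n set). c)" by (intro sum_mono assms)
    finally show ?thesis by simp
  qed
  have "norm A \<le> (\<Sum>i\<in>UNIV. norm (A $ i))"
    unfolding norm_vec_def [of A] by (rule L2_set_le_sum) auto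
  also have "\<dots> \<le> (\<Sum>i\<in>(UNIV::'k set). real CARD('n) * c)" by (intro sum_mono row)
  finally show ?thesis by simp
qed

lemma mholo_locally_bounded:
  fixes F :: "'l \<Rightarrow> 'b::real_normed_vector \<Rightarrow> complex^'n::finite^'k::finite"
  assumes F: "\<And>l. l \<in> I \<Longrightarrow> mholo s (F l) S" and I: "finite I" and S: "open S" "z \<in> S"
  obtains r M where "0 < r" "ball z r \<subseteq> S" "0 < M"
    "\<And>l x i j. l \<in> I \<Longrightarrow> x \<in> ball z r \<Longrightarrow> cmod (F l x $ i $ j) \<le> M"
proof -
  let ?J = "I \<times> (UNIV :: 'k set) \<times> (UNIV :: 'n set)"
  have "\<forall>p\<in>?J. \<exists>r M. 0 < r \<and> ball z r \<subseteq> S \<and> (\<forall>x\<in>ball z r. cmod (F (fst p) x $ fst (snd p) $ snd (snd p)) \<le> M)"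
  proof
    fix p assume p: "p \<in> ?J"
    then have "holo s (*) (\<lambda>x. F (fst p) x $ fst (snd p) $ snd (snd p)) S" using F by (auto simp: mholo_def)
    from holo_locally_bounded [OF this S]
    show "\<exists>r M. 0 < r \<and> ball z r \<subseteq> S \<and> (\<forall>x\<in>ball z r. cmod (F (fst p) x $ fst (snd p) $ snd (snd p)) \<le> M)"
      by metis
  qed
  then obtain r M where rM: "\<And>p. p \<in> ?J \<Longrightarrow> 0 < r p \<and> ball z (r p) \<subseteq> S \<and>
      (\<forall>x\<in>ball z (r p). cmod (F (fst p) x $ fst (snd p) $ snd (snd p)) \<le> M p)"
    by metis
  obtain e where e: "0 < e" "ball z e \<subseteq> S" using S open_contains_ball by blast
  have fin: "finite (insert e (r ` ?J))" "finite (insert 1 (M ` ?J))" using I by auto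
  \<comment> \<open>Besides the radii and bounds of the finitely many entries, \<open>e\<close>
    keeps the ball inside S and 1 makes the bound positive; they also keep both sets nonempty when I
    is empty.\<close>
  define r' where "r' = Min (insert e (r ` ?J))"
  define M' where "M' = Max (insert 1 (M ` ?J))"
  show thesis
  proof
    show "0 < r'" unfolding r'_def using fin(1) e rM by (subst Min_gr_iff) auto
    have "r' \<le> e" unfolding r'_def using fin(1) by simp
    then show "ball z r' \<subseteq> S" using e(2) by auto
    have "1 \<le> M'" unfolding M'_def using fin(2) by simp
    then show "0 < M'" by simp
    fix l x i j assume "l \<in> I" and x: "x \<in> ball z r'"
    then have J: "(l, i, j) \<in> ?J" by simp
    have "r' \<le> r (l, i, j)" unfolding r'_def using fin(1) J by (intro Min_le) auto
    then have "cmod (F l x $ i $ j) \<le> M (l, i, j)" using rM [OF J] x by auto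
    also have "\<dots> \<le> M'" unfolding M'_def using fin(2) J by (intro Max_ge) auto
    finally show "cmod (F l x $ i $ j) \<le> M'" .
  qed
qed

text \<open>Picard iteration for the radial equation \<open>D H(x) x = H(x) \<Omega>(x, x)\<close>.\<close>

lemma radial_solution:
  fixes \<Omega> :: "'m::finite \<Rightarrow> complex^'m \<Rightarrow> complex^'n::finite^'n"
  assumes \<Omega>: "\<And>l. mholo (*s) (\<Omega> l) (ball 0 r)" and r: "0 < r"
  obtains \<delta> H where "0 < \<delta>" "\<delta> \<le> r" "mholo (*s) H (ball 0 \<delta>)" "H 0 = mat 1"
    "\<And>x i j. x \<in> ball 0 \<delta> \<Longrightarrow> dd H x x $ i $ j = (\<Sum>l\<in>UNIV. x $ l * (H x ** \<Omega> l x) $ i $ j)"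
proof -
  obtain r1 C where r1: "0 < r1" "ball 0 r1 \<subseteq> ball (0::complex^'m) r" "0 < C"
    and C: "\<And>l x i j. x \<in> ball 0 r1 \<Longrightarrow> cmod (\<Omega> l x $ i $ j) \<le> C"
    using mholo_locally_bounded [where I=UNIV and F=\<Omega> and s="(*s)" and z=0, OF \<Omega> finite_class.finite_UNIV open_ball] r by auto
  \<comment> \<open>One Picard step multiplies the bound on the entries by at most
    \<open>d * a\<close>: \<open>CARD('m)\<close> counts the summands over l,
    \<open>CARD('n)\<close> those of the matrix product, and C bounds \<Omega>. The radius d makes
    this factor at most 1/2.\<close>
  define a where "a = real CARD('m) * real CARD('n) * C"
  have a: "0 < a" unfolding a_def using r1(3) by simp
  define d where "d = min (min r1 r) (1 / (2 * a))"
  have d: "0 < d" "d \<le> r1" "d \<le> r" unfolding d_def using r1(1) r a by auto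
  have da: "d * a \<le> 1/2"
  proof -
    have "d * a \<le> 1 / (2 * a) * a" unfolding d_def using a by (intro mult_right_mono) auto
    then show ?thesis using a by simp
  qed
  let ?B = "ball (0::complex^'m) d"
  have \<Omega>d: "mholo (*s) (\<Omega> l) ?B" for l using \<Omega> d by (meson mholo_subset subset_ball)
  \<comment> \<open>The \<open>T n\<close> are the successive terms of the Picard series, not its
    partial sums. Each term after the first vanishes at 0 and has the radial derivative prescribed
    by its predecessor.\<close>
  let ?P = "\<lambda>n T. mholo (*s) T ?B \<and> (\<forall>x\<in>?B. \<forall>i j. cmod (T x $ i $ j) \<le> (1/2)^n)"
  let ?Q = "\<lambda>T T'. T' 0 = 0 \<and> (\<forall>x\<in>?B. \<forall>i j. dd T' x x $ i $ j = (\<Sum>l\<in>UNIV. x $ l * (T x ** \<Omega> l x) $ i $ j))"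
  have "\<exists>T. (\<forall>n. ?P n (T n)) \<and> (\<forall>n. ?Q (T n) (T (Suc n))) \<and> (T 0 = (\<lambda>x. mat 1))"
  proof -
    have step: "\<exists>T'. ?P (Suc n) T' \<and> ?Q T T'" if T: "?P n T" for n T
    proof -
      have "\<forall>l i j. \<exists>G. holo (*s) (*) G ?B \<and> (\<forall>x\<in>?B. G x + dd G x x = (T x ** \<Omega> l x) $ i $ j) \<and>
          (\<forall>x\<in>?B. cmod (G x) \<le> real CARD('n) * ((1/2)^n * C))"
      proof (intro allI)
        fix l i j
        have "holo (*s) (*) (\<lambda>x. (T x ** \<Omega> l x) $ i $ j) ?B"
          using mholo_mult [OF _ \<Omega>d] T unfolding mholo_def by blast
        then obtain G where G: "holo (*s) (*) G ?B" "\<And>x. x \<in> ?B \<Longrightarrow> G x + dd G x x = (T x ** \<Omega> l x) $ i $ j"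
          and Gb: "\<And>M x. (\<And>y. y \<in> ?B \<Longrightarrow> cmod ((T y ** \<Omega> l y) $ i $ j) \<le> M) \<Longrightarrow> x \<in> ?B \<Longrightarrow> cmod (G x) \<le> M"
          using radial_primitive [OF cscale_vec] by blast
        have "cmod ((T y ** \<Omega> l y) $ i $ j) \<le> real CARD('n) * ((1/2)^n * C)" if y: "y \<in> ?B" for y
        proof -
          have "cmod ((T y ** \<Omega> l y) $ i $ j) \<le> (\<Sum>k\<in>UNIV. cmod (T y $ i $ k * \<Omega> l y $ k $ j))"
            unfolding matrix_matrix_mult_def by (simp add: norm_sum)
          also have "\<dots> \<le> (\<Sum>k\<in>(UNIV::'n set). (1/2)^n * C)"
          proof (rule sum_mono)
            fix k
            have "cmod (T y $ i $ k) * cmod (\<Omega> l y $ k $ j) \<le> (1/2)^n * C"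
              using T y C [of y l k j] d(2) by (intro mult_mono) auto
            then show "cmod (T y $ i $ k * \<Omega> l y $ k $ j) \<le> (1/2)^n * C" by (simp add: norm_mult)
          qed
          finally show ?thesis by simp
        qed
        then show "\<exists>G. holo (*s) (*) G ?B \<and> (\<forall>x\<in>?B. G x + dd G x x = (T x ** \<Omega> l x) $ i $ j) \<and>
          (\<forall>x\<in>?B. cmod (G x) \<le> real CARD('n) * ((1/2)^n * C))" using G Gb by blast
      qed
      then obtain G where G: "\<And>l i j. holo (*s) (*) (G l i j) ?B"
        "\<And>l i j x. x \<in> ?B \<Longrightarrow> G l i j x + dd (G l i j) x x = (T x ** \<Omega> l x) $ i $ j"
        "\<And>l i j x. x \<in> ?B \<Longrightarrow> cmod (G l i j x) \<le> real CARD('n) * ((1/2)^n * C)" by metis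
      \<comment> \<open>By \<open>radial_primitive\<close> the radial derivative of
        \<open>x $ l * G l i j x\<close> is \<open>x $ l\<close> times the prescribed entry.\<close>
      define T' where "T' x = (\<chi> i j. \<Sum>l\<in>UNIV. x $ l * G l i j x)" for x
      have T'h: "mholo (*s) T' ?B" unfolding mholo_def T'_def using G(1) by (auto intro!: holo_sum holo_mult holo_nth)
      have b: "cmod (T' x $ i $ j) \<le> (1/2)^Suc n" if x: "x \<in> ?B" for x i j
      proof -
        have "cmod (T' x $ i $ j) \<le> (\<Sum>l\<in>UNIV. cmod (x $ l * G l i j x))"
          unfolding T'_def by (simp add: norm_sum)
        also have "\<dots> \<le> (\<Sum>l\<in>(UNIV::'m set). d * (real CARD('n) * ((1/2)^n * C)))"
        proof (rule sum_mono)
          fix l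
          have "cmod (x $ l) \<le> d" using x Finite_Cartesian_Product.norm_nth_le [of x l] by simp
          then have "cmod (x $ l) * cmod (G l i j x) \<le> d * (real CARD('n) * ((1/2)^n * C))"
            using G(3) [OF x] d(1) by (intro mult_mono) auto
          then show "cmod (x $ l * G l i j x) \<le> d * (real CARD('n) * ((1/2)^n * C))" by (simp add: norm_mult)
        qed
        also have "\<dots> = (d * a) * (1/2)^n" by (simp add: a_def)
        also have "\<dots> \<le> 1/2 * (1/2)^n" using da by (intro mult_right_mono) auto
        finally show ?thesis by simp
      qed
      have "dd T' x x $ i $ j = (\<Sum>l\<in>UNIV. x $ l * (T x ** \<Omega> l x) $ i $ j)" if x: "x \<in> ?B" for x i j
      proof -
        have "((\<lambda>x. \<Sum>l\<in>UNIV. x $ l * G l i j x) has_derivative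
            (\<lambda>v. \<Sum>l\<in>UNIV. x $ l * dd (G l i j) x v + v $ l * G l i j x)) (at x)"
          by (intro has_derivative_sum has_derivative_mult holo_dd(1) [OF G(1) open_ball x] bounded_linear_imp_has_derivative bounded_linear_vec_nth)
        then have "dd (\<lambda>x. T' x $ i $ j) x x = (\<Sum>l\<in>UNIV. x $ l * dd (G l i j) x x + x $ l * G l i j x)"
          unfolding T'_def by (simp add: dd_eq)
        also have "\<dots> = (\<Sum>l\<in>UNIV. x $ l * (T x ** \<Omega> l x) $ i $ j)"
          by (rule sum.cong) (simp_all add: G(2) [OF x, symmetric] algebra_simps)
        finally show ?thesis using mholo_dd(2) [OF cscale_vec T'h open_ball x] by simp
      qed
      moreover have "T' 0 = 0" by (simp add: T'_def vec_eq_iff)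
      ultimately show ?thesis using T'h b by blast
    qed
    have base: "?P 0 (\<lambda>x. mat 1)"
      by (auto simp: mholo_const mat_def)
    define T where "T = rec_nat (\<lambda>x. mat 1) (\<lambda>n T. SOME T'. ?P (Suc n) T' \<and> ?Q T T')"
    have T0: "T 0 = (\<lambda>x. mat 1)" unfolding T_def by simp
    have TS: "T (Suc n) = (SOME T'. ?P (Suc n) T' \<and> ?Q (T n) T')" for n unfolding T_def by simp
    have P: "?P n (T n)" for n
    proof (induct n)
      case (Suc n)
      show ?case using someI_ex [OF step [OF Suc]] unfolding TS by blast
    qed (unfold T0, rule base)
    have "?Q (T n) (T (Suc n))" for n using someI_ex [OF step [OF P]] unfolding TS by blast
    with P T0 show ?thesis by blast
  qed
  then obtain T where T: "\<And>n. mholo (*s) (T n) ?B" "\<And>n x i j. x \<in> ?B \<Longrightarrow> cmod (T n x $ i $ j) \<le> (1/2)^n"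
    "\<And>n. T (Suc n) 0 = 0" "\<And>n x i j. x \<in> ?B \<Longrightarrow> dd (T (Suc n)) x x $ i $ j = (\<Sum>l\<in>UNIV. x $ l * (T n x ** \<Omega> l x) $ i $ j)"
    "T 0 = (\<lambda>x. mat 1)" by blast
  define h where "h n x i j = (\<Sum>k<n. T k x $ i $ j)" for n x i j
  define H where "H x = (\<chi> i j. \<Sum>k. T k x $ i $ j)" for x
  have Th: "holo (*s) (*) (\<lambda>x. T n x $ i $ j) ?B" for n i j using T(1) unfolding mholo_def by blast
  have ul: "uniform_limit ?B (\<lambda>n x. h n x i j) (\<lambda>x. H x $ i $ j) sequentially" for i j
    unfolding h_def H_def using T(2) by (auto intro!: Weierstrass_m_test [where M="\<lambda>n. (1/2)^n"] summable_geometric)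
  have hh: "holo (*s) (*) (\<lambda>x. h n x i j) ?B" for n i j
    unfolding h_def by (intro holo_sum Th)
  note lim = holo_uniform_limit [OF cscale_vec hh d(1) ul]
  have Hh: "mholo (*s) H (ball 0 (d/2))" unfolding mholo_def using lim(1) by blast
  show thesis
  proof (rule that [OF _ _ Hh])
    show "H 0 = mat 1"
    proof -
      have "(\<lambda>k. T k 0 $ i $ j) sums (mat 1 $ i $ j)" for i j
      proof -
        have "T k 0 $ i $ j = (if k = 0 then mat 1 $ i $ j else 0)" for k
          using T(3) T(5) by (cases k) auto
        then show ?thesis using sums_single [of 0 "\<lambda>_. mat 1 $ i $ j"] by simp
      qed
      then show ?thesis unfolding H_def vec_eq_iff by (simp add: sums_unique [symmetric])
    qed
    fix x i j assume x: "x \<in> ball (0::complex^'m) (d/2)"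
    then have xB: "x \<in> ?B" using d(1) by auto
    have "(\<lambda>n. dd (\<lambda>x. h n x i j) x x) \<longlonglongrightarrow> dd (\<lambda>x. H x $ i $ j) x x" by (rule lim(2) [OF x])
    then have 1: "(\<lambda>n. dd (\<lambda>x. h (Suc n) x i j) x x) \<longlonglongrightarrow> dd (\<lambda>x. H x $ i $ j) x x" by (rule LIMSEQ_Suc)
    \<comment> \<open>The partial sum with one more term has the radial derivative prescribed by the
      current one, because the constant first term drops out.\<close>
    have eq: "dd (\<lambda>x. h (Suc n) x i j) x x = (\<Sum>l\<in>UNIV. x $ l * (\<Sum>k\<in>UNIV. h n x i k * \<Omega> l x $ k $ j))" for n
    proof -
      have "((\<lambda>x. h (Suc n) x i j) has_derivative (\<lambda>v. \<Sum>k<Suc n. dd (\<lambda>x. T k x $ i $ j) x v)) (at x)"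
        unfolding h_def by (intro has_derivative_sum holo_dd(1) [OF Th open_ball xB])
      then have "dd (\<lambda>x. h (Suc n) x i j) x x = (\<Sum>k<Suc n. dd (\<lambda>x. T k x $ i $ j) x x)" by (rule dd_eq)
      also have "\<dots> = (\<Sum>k<n. dd (T (Suc k)) x x $ i $ j)"
        using mholo_dd(2) [OF cscale_vec T(1) open_ball xB] by (simp only: sum.lessThan_Suc_shift) (simp add: T(5) frechet_derivative_const)
      also have "\<dots> = (\<Sum>k<n. \<Sum>l\<in>UNIV. x $ l * (\<Sum>p\<in>UNIV. T k x $ i $ p * \<Omega> l x $ p $ j))"
        by (simp add: T(4) [OF xB] matrix_matrix_mult_def)
      also have "\<dots> = (\<Sum>l\<in>UNIV. x $ l * (\<Sum>p\<in>UNIV. h n x i p * \<Omega> l x $ p $ j))"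
        unfolding h_def sum_distrib_left sum_distrib_right
        by (subst sum.swap) (intro sum.cong refl sum.swap)
      finally show ?thesis .
    qed
    have "(\<lambda>n. \<Sum>l\<in>UNIV. x $ l * (\<Sum>k\<in>UNIV. h n x i k * \<Omega> l x $ k $ j)) \<longlonglongrightarrow>
        (\<Sum>l\<in>UNIV. x $ l * (\<Sum>k\<in>UNIV. H x $ i $ k * \<Omega> l x $ k $ j))"
      by (intro tendsto_intros tendsto_uniform_limitI [OF ul xB])
    with 1 have "dd (\<lambda>x. H x $ i $ j) x x = (\<Sum>l\<in>UNIV. x $ l * (\<Sum>k\<in>UNIV. H x $ i $ k * \<Omega> l x $ k $ j))"
      unfolding eq using LIMSEQ_unique by blast
    then show "dd H x x $ i $ j = (\<Sum>l\<in>UNIV. x $ l * (H x ** \<Omega> l x) $ i $ j)"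
      using mholo_dd(2) [OF cscale_vec Hh open_ball x] by (simp add: matrix_matrix_mult_def)
  qed (use d in auto)
qed

section \<open>Local groups and the integration of Lie algebra homomorphisms\<close>

lemmas matrix_bilinear_simps =
  bounded_bilinear.add_left [OF bounded_bilinear_matrix_mult]
  bounded_bilinear.add_right [OF bounded_bilinear_matrix_mult]
  bounded_bilinear.diff_left [OF bounded_bilinear_matrix_mult]
  bounded_bilinear.diff_right [OF bounded_bilinear_matrix_mult]
  bounded_bilinear.minus_left [OF bounded_bilinear_matrix_mult]
  bounded_bilinear.minus_right [OF bounded_bilinear_matrix_mult]

lemmas matrix_vector_bilinear_simps =
  bounded_bilinear.add_left [OF bounded_bilinear_matrix_vector_mult]
  bounded_bilinear.add_right [OF bounded_bilinear_matrix_vector_mult]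
  bounded_bilinear.diff_left [OF bounded_bilinear_matrix_vector_mult]
  bounded_bilinear.diff_right [OF bounded_bilinear_matrix_vector_mult]
  bounded_bilinear.minus_left [OF bounded_bilinear_matrix_vector_mult]
  bounded_bilinear.minus_right [OF bounded_bilinear_matrix_vector_mult]

text \<open>Models the multiplication of a Lie group in coordinates centred at the unit. Products
  may leave the ball, hence the premises of \<open>m_assoc\<close>. Invertibility of the Jacobian
  \<open>A\<close> near 0 takes the place of inverses.\<close>

locale local_group =
  fixes m :: "complex^'m::finite \<Rightarrow> complex^'m \<Rightarrow> complex^'m" and R :: real
  assumes R: "0 < R"
    and holo_m: "holo pair_scale (*s) (\<lambda>p. m (fst p) (snd p)) (ball 0 R \<times> ball 0 R)"
    and m_0_right: "x \<in> ball 0 R \<Longrightarrow> m x 0 = x"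
    and m_0_left: "x \<in> ball 0 R \<Longrightarrow> m 0 x = x"
    and m_assoc: "x \<in> ball 0 R \<Longrightarrow> y \<in> ball 0 R \<Longrightarrow> z \<in> ball 0 R \<Longrightarrow>
      m x y \<in> ball 0 R \<Longrightarrow> m y z \<in> ball 0 R \<Longrightarrow> m (m x y) z = m x (m y z)"
begin

definition J :: "(complex^'m) \<times> (complex^'m) \<Rightarrow> complex^'m^'m" where
  "J p = (\<chi> i j. dd (\<lambda>p. m (fst p) (snd p)) p (0, axis j 1) $ i)"

definition A :: "complex^'m \<Rightarrow> complex^'m^'m" where
  "A x = J (x, 0)"

text \<open>\<open>A x *v v\<close> is the left invariant vector field with value v at 0, so this is
  the commutator of two such fields at 0, where \<open>A\<close> is the identity matrix.\<close>

definition bracket :: "complex^'m \<Rightarrow> complex^'m \<Rightarrow> complex^'m" where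
  "bracket u v = dd A 0 u *v v - dd A 0 v *v u"

lemma open_BB: "open (ball (0::complex^'m) R \<times> ball (0::complex^'m) R)"
  by (intro open_Times open_ball)

lemma zero_ball: "0 \<in> ball (0::complex^'m) R"
  using R by simp

lemma J_apply:
  assumes "p \<in> ball 0 R \<times> ball 0 R"
  shows "J p *v w = dd (\<lambda>p. m (fst p) (snd p)) p (0, w)"
proof -
  let ?D = "dd (\<lambda>p. m (fst p) (snd p)) p"
  have lin: "linear ?D" using holo_dd(1) [OF holo_m open_BB assms] has_derivative_linear by blast
  have "(0, w) = (\<Sum>j\<in>UNIV. pair_scale (w $ j) (0, axis j 1))"
    by (simp add: prod_eq_iff fst_sum snd_sum pair_scale_def basis_expansion)
  then have "?D (0, w) = (\<Sum>j\<in>UNIV. w $ j *s ?D (0, axis j 1))"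
    using linear_sum [OF lin, of "\<lambda>j. pair_scale (w $ j) (0, axis j 1)" UNIV]
    by (simp add: holo_dd(2) [OF holo_m open_BB assms])
  then show ?thesis
    by (simp add: vec_eq_iff matrix_vector_mult_def J_def mult.commute)
qed

lemma J_mholo: "mholo pair_scale J (ball 0 R \<times> ball 0 R)"
  using holo_vec_dd(2) [OF cscale_pair holo_m open_BB] by (simp add: mholo_def J_def holo_vec_iff)

lemma m_deriv_right:
  assumes "x \<in> ball 0 R" "y \<in> ball 0 R"
  shows "(m x has_derivative (\<lambda>w. J (x, y) *v w)) (at y)"
proof -
  have p: "(x, y) \<in> ball 0 R \<times> ball 0 R" using assms by simp
  have "((\<lambda>y. (x, y)) has_derivative (\<lambda>w. (0, w))) (at y)"
    by (intro has_derivative_Pair has_derivative_ident has_derivative_const)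
  from has_derivative_compose [OF this holo_dd(1) [OF holo_m open_BB p]]
  have "(m x has_derivative (\<lambda>w. dd (\<lambda>p. m (fst p) (snd p)) (x, y) (0, w))) (at y)"
    unfolding fst_conv snd_conv .
  then show ?thesis unfolding J_apply [OF p] .
qed

lemma A_mholo: "mholo (*s) A (ball 0 R)"
  unfolding mholo_def A_def
proof (intro allI)
  fix i j
  show "holo (*s) (*) (\<lambda>x. J (x, 0) $ i $ j) (ball 0 R)"
    by (rule holo_compose [OF holo_embed(1)])
       (use J_mholo R in \<open>auto simp: mholo_def\<close>)
qed

lemma A_0: "A 0 = mat 1"
proof -
  have "((\<lambda>x. x) has_derivative (\<lambda>w. J (0, 0) *v w)) (at 0)"
    by (rule has_derivative_transform_within_open [OF m_deriv_right [OF zero_ball zero_ball] open_ball zero_ball])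
       (rule m_0_left)
  from has_derivative_unique [OF this has_derivative_ident]
  have "(\<lambda>w. A 0 *v w) = (\<lambda>w. w)" unfolding A_def .
  then have "A 0 *v w = w" for w by (rule fun_cong)
  then show ?thesis by (simp add: matrix_eq)
qed

lemma det_A_near: "\<exists>r. 0 < r \<and> r \<le> R \<and> (\<forall>x\<in>ball 0 r. det (A x) \<noteq> 0)"
proof -
  have "continuous_on (ball 0 R) (\<lambda>x. det (A x))"
    using A_mholo by (intro holo_continuous_on [of "(*s)" "(*)"] holo_det) (auto simp: mholo_def)
  then have "open (ball 0 R \<inter> (\<lambda>x. det (A x)) -` (- {0}))" by (rule continuous_open_preimage) auto
  moreover have "0 \<in> ball 0 R \<inter> (\<lambda>x. det (A x)) -` (- {0})" using R by (simp add: A_0 det_I)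
  ultimately obtain e where e: "0 < e" "ball 0 e \<subseteq> ball 0 R \<inter> (\<lambda>x. det (A x)) -` (- {0})" by (rule openE)
  have "det (A x) \<noteq> 0" if "x \<in> ball 0 (min e R)" for x using subsetD [OF e(2), of x] that by simp
  then show ?thesis using e(1) R by (intro exI [of _ "min e R"]) simp
qed

lemma m_near:
  assumes "x \<in> ball 0 R" "open S" "x \<in> S"
  obtains e where "0 < e" "e \<le> R" "\<And>y. y \<in> ball 0 e \<Longrightarrow> m x y \<in> S"
proof -
  have "continuous (at 0) (m x)"
    using has_derivative_continuous [OF m_deriv_right [OF assms(1) zero_ball]] .
  moreover have "m x 0 \<in> S" using m_0_right assms by simp
  ultimately obtain S' where S': "open S'" "0 \<in> S'" "\<And>y. y \<in> S' \<Longrightarrow> m x y \<in> S"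
    using assms(2) continuous_at_open [of 0 "m x"] by auto
  then obtain e where "0 < e" "ball 0 e \<subseteq> S'" using open_contains_ball by blast
  with S'(3) have "0 < e" "\<And>y. y \<in> ball 0 e \<Longrightarrow> m x y \<in> S" by auto
  then show thesis using that [of "min e R"] R by simp
qed

text \<open>Differentiating \<open>m a (m x y) = m (m a x) y\<close> in y at 0: left translation by
  a carries the left invariant fields to themselves.\<close>

lemma J_A:
  assumes a: "a \<in> ball 0 R" and x: "x \<in> ball 0 R" and ax: "m a x \<in> ball 0 R"
  shows "J (a, x) ** A x = A (m a x)"
  unfolding matrix_eq
proof
  fix v
  obtain e where e: "0 < e" "e \<le> R" "\<And>y. y \<in> ball 0 e \<Longrightarrow> m x y \<in> ball 0 R"
    using m_near [OF x open_ball x] by blast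
  have "(m a has_derivative (\<lambda>w. J (a, x) *v w)) (at (m x 0))"
    using m_deriv_right [OF a x] m_0_right [OF x] by simp
  from has_derivative_compose [OF m_deriv_right [OF x zero_ball] this]
  have "((\<lambda>y. m a (m x y)) has_derivative (\<lambda>w. J (a, x) *v (J (x, 0) *v w))) (at 0)" .
  then have "(m (m a x) has_derivative (\<lambda>w. J (a, x) *v (J (x, 0) *v w))) (at 0)"
  proof (rule has_derivative_transform_within_open [where s="ball 0 e"])
    fix y :: "complex^'m" assume "y \<in> ball 0 e"
    then have "y \<in> ball 0 R" "m x y \<in> ball 0 R" using e by auto
    then show "m a (m x y) = m (m a x) y" using m_assoc [OF a x _ ax] by metis
  qed (use e in auto)
  from has_derivative_unique [OF this m_deriv_right [OF ax zero_ball]]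
  have "J (a, x) *v (J (x, 0) *v v) = J (m a x, 0) *v v" by (rule fun_cong)
  then show "J (a, x) ** A x *v v = A (m a x) *v v"
    unfolding A_def by (simp add: matrix_vector_mul_assoc)
qed

text \<open>The commutation relations of the left invariant vector fields \<open>x \<mapsto> A x *v u\<close>, obtained by
  differentiating their invariance \<open>J_A\<close>; the remaining second derivative of \<open>m\<close> is symmetric.\<close>

lemma A_bracket:
  assumes a: "a \<in> ball 0 R"
  shows "dd A a (A a *v u) *v v - dd A a (A a *v v) *v u = A a *v bracket u v"
proof -
  let ?M = "\<lambda>p. m (fst p) (snd p)"
  have p: "(a, 0) \<in> ball 0 R \<times> ball 0 R" using a zero_ball by simp
  obtain e where e: "0 < e" "e \<le> R" "\<And>y. y \<in> ball 0 e \<Longrightarrow> m a y \<in> ball 0 R"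
    using m_near [OF a open_ball a] by blast
  have dJ: "((\<lambda>x. J (a, x)) has_derivative (\<lambda>u. dd J (a, 0) (0, u))) (at 0)"
    by (rule has_derivative_compose [where f="\<lambda>x. (a, x)" and f'="\<lambda>u. (0, u)", OF _ mholo_dd(1) [OF cscale_pair J_mholo open_BB p]])
       (intro has_derivative_Pair has_derivative_ident has_derivative_const)
  have dA: "(A has_derivative dd A x) (at x)" if "x \<in> ball 0 R" for x
    by (rule mholo_dd(1) [OF cscale_vec A_mholo open_ball that])
  have L: "((\<lambda>x. J (a, x) ** A x) has_derivative (\<lambda>u. J (a, 0) ** dd A 0 u + dd J (a, 0) (0, u) ** A 0)) (at 0)"
    by (rule bounded_bilinear.FDERIV [OF bounded_bilinear_matrix_mult dJ dA [OF zero_ball]])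
  have "(A has_derivative dd A a) (at (m a 0))"
    using dA [OF a] m_0_right [OF a] by simp
  from has_derivative_compose [OF m_deriv_right [OF a zero_ball] this]
  have "((\<lambda>x. A (m a x)) has_derivative (\<lambda>u. dd A a (A a *v u))) (at 0)" unfolding A_def .
  then have "((\<lambda>x. J (a, x) ** A x) has_derivative (\<lambda>u. dd A a (A a *v u))) (at 0)"
  proof (rule has_derivative_transform_within_open [where s="ball 0 e"])
    fix x :: "complex^'m" assume "x \<in> ball 0 e"
    then have "x \<in> ball 0 R" "m a x \<in> ball 0 R" using e by auto
    then show "A (m a x) = J (a, x) ** A x" using J_A [OF a] by metis
  qed (use e in auto)
  from has_derivative_unique [OF this L]
  have "dd A a (A a *v u) = J (a, 0) ** dd A 0 u + dd J (a, 0) (0, u) ** A 0" for u by (rule fun_cong)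
  then have eq: "dd A a (A a *v u) = A a ** dd A 0 u + dd J (a, 0) (0, u)" for u
    unfolding A_def [symmetric] by (simp add: A_0)
  have sym: "dd J (a, 0) (0, u) *v v = dd (\<lambda>p. dd ?M p (0, v)) (a, 0) (0, u)" for u v
  proof -
    have "((\<lambda>p. J p *v v) has_derivative (\<lambda>u. dd J (a, 0) u *v v)) (at (a, 0))"
      by (rule bounded_linear.has_derivative [OF bounded_bilinear.bounded_linear_left [OF bounded_bilinear_matrix_vector_mult]
            mholo_dd(1) [OF cscale_pair J_mholo open_BB p]])
    then have "((\<lambda>p. dd ?M p (0, v)) has_derivative (\<lambda>u. dd J (a, 0) u *v v)) (at (a, 0))"
      by (rule has_derivative_transform_within_open [OF _ open_BB p]) (rule J_apply)
    then show ?thesis by (rule dd_eq [symmetric])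
  qed
  have "dd J (a, 0) (0, u) *v v = dd J (a, 0) (0, v) *v u"
    unfolding sym by (rule holo_vec_dd(3) [OF cscale_pair holo_m open_BB p])
  then show ?thesis
    unfolding eq bracket_def by (simp add: matrix_vector_bilinear_simps matrix_vector_mul_assoc)
qed

text \<open>\<Omega> is f applied to the left Maurer-Cartan form, whose matrix is the inverse of
  \<open>A x\<close>; \<open>A_bracket\<close> and \<open>f_bracket\<close> make it flat. Once dH =
  H \<Omega> holds in all directions, multiplicativity is a matter of uniqueness:
  \<open>H (m x y)\<close> and \<open>H x ** H y\<close> solve the same equation in y, since
  \<Omega> is left invariant.\<close>

theorem integrate:
  fixes f :: "complex^'m \<Rightarrow> complex^'n::finite^'n"
  assumes f_add: "\<And>x y. f (x + y) = f x + f y"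
    and f_scale: "\<And>c x i j. f (c *s x) $ i $ j = c * f x $ i $ j"
    and f_bracket: "\<And>u v. f (bracket u v) = f u ** f v - f v ** f u"
  obtains \<delta> \<epsilon> H where "0 < \<delta>" "\<delta> \<le> R" "mholo (*s) H (ball 0 \<delta>)" "H 0 = mat 1" "\<And>v. dd H 0 v = f v"
    "0 < \<epsilon>" "\<epsilon> \<le> \<delta>" "\<And>x y. x \<in> ball 0 \<epsilon> \<Longrightarrow> y \<in> ball 0 \<epsilon> \<Longrightarrow> m x y \<in> ball 0 \<delta> \<and> H (m x y) = H x ** H y"
proof -
  have f_0: "f 0 = 0" using f_add [of 0 0] by simp
  have f_minus: "f (- x) = - f x" for x using f_add [of x "- x"] f_0 by (simp add: eq_neg_iff_add_eq_0 add.commute)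
  have f_diff: "f (x - y) = f x - f y" for x y using f_add [of x "- y"] f_minus by simp
  have f_sum: "f (\<Sum>i\<in>I. g i) = (\<Sum>i\<in>I. f (g i))" if "finite I" for I :: "'m set" and g
    using that by (induct I) (auto simp: f_0 f_add)
  have f_real: "f (r *\<^sub>R x) = r *\<^sub>R f x" for r x
  proof -
    have "of_real r *s x = r *\<^sub>R x" using cscale_vec unfolding cscale_def by blast
    then have "f (r *\<^sub>R x) $ i $ j = of_real r * f x $ i $ j" for i j using f_scale [of "of_real r" x] by metis
    then show ?thesis by (simp only: vec_eq_iff vector_scaleR_component) (simp add: scaleR_conv_of_real)
  qed
  have f_expand: "f w $ i $ j = (\<Sum>l\<in>UNIV. w $ l * f (axis l 1) $ i $ j)" for w i j
  proof -
    have "f w = f (\<Sum>l\<in>UNIV. w $ l *s axis l 1)" by (simp add: basis_expansion)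
    then show ?thesis by (simp add: f_sum f_scale)
  qed
  have f_lin: "bounded_linear f"
    by (rule linear_conv_bounded_linear [THEN iffD1]) (simp add: linear_iff f_add f_real)
  obtain r1 where r1: "0 < r1" "r1 \<le> R" "\<And>x. x \<in> ball 0 r1 \<Longrightarrow> det (A x) \<noteq> 0"
    using det_A_near by blast
  have sub: "x \<in> ball 0 r1 \<Longrightarrow> x \<in> ball 0 R" for x :: "complex^'m" using r1 by simp
  define Ai where "Ai x = matrix_inv (A x)" for x
  have Ai: "A x ** Ai x = mat 1" "Ai x ** A x = mat 1" if "x \<in> ball 0 r1" for x
    unfolding Ai_def using matrix_inv r1(3) [OF that] by (auto simp: invertible_det_nz)
  have A_r1: "mholo (*s) A (ball 0 r1)" using A_mholo r1(2) by (meson mholo_subset subset_ball)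
  have Ai_mholo: "mholo (*s) Ai (ball 0 r1)"
    unfolding Ai_def by (rule mholo_matrix_inv [OF A_r1 r1(3)])
  define \<Omega> where "\<Omega> x w = f (Ai x *v w)" for x w
  have \<Omega>_lin: "linear (\<Omega> x)" for x
    unfolding \<Omega>_def
    by (intro linearI) (simp_all add: f_add matrix_vector_bilinear_simps f_real
        bounded_bilinear.scaleR_right [OF bounded_bilinear_matrix_vector_mult])
  have \<Omega>_mholo: "mholo (*s) (\<lambda>x. \<Omega> x w) (ball 0 r1)" for w
    unfolding mholo_def
  proof (intro allI)
    fix i j
    have "holo (*s) (*s) (\<lambda>x. Ai x *v w) (ball 0 r1)"
      by (rule mholo_mult_vec [OF Ai_mholo]) (simp add: holo_vec_iff holo_const)
    then have "holo (*s) (*) (\<lambda>x. \<Sum>l\<in>UNIV. (Ai x *v w) $ l * f (axis l 1) $ i $ j) (ball 0 r1)"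
      by (intro holo_sum holo_mult holo_const) (simp add: holo_vec_iff)
    then show "holo (*s) (*) (\<lambda>x. \<Omega> x w $ i $ j) (ball 0 r1)"
      by (rule holo_cong) (simp add: \<Omega>_def f_expand [of "Ai x *v w" for x])
  qed
  have \<Omega>_expand: "\<Omega> x w $ i $ j = (\<Sum>l\<in>UNIV. w $ l * \<Omega> x (axis l 1) $ i $ j)" for x w i j
  proof -
    have "Ai x *v w = (\<Sum>l\<in>UNIV. w $ l *s (Ai x *v axis l 1))"
      by (simp add: vec_eq_iff matrix_vector_mult_def axis_def if_distrib mult.commute cong: if_cong)
    then show ?thesis unfolding \<Omega>_def by (simp add: f_sum f_scale)
  qed
  \<comment> \<open>The Maurer-Cartan equation, with the exterior derivative of \<Omega> on the
    left.\<close>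
  have flat: "dd (\<lambda>x. \<Omega> x v) x w - dd (\<lambda>x. \<Omega> x w) x v = - (\<Omega> x w ** \<Omega> x v - \<Omega> x v ** \<Omega> x w)"
    if x: "x \<in> ball 0 r1" for x v w
  proof -
    have dA: "(A has_derivative dd A x) (at x)"
      by (rule mholo_dd(1) [OF cscale_vec A_mholo open_ball sub [OF x]])
    have dAi: "(Ai has_derivative dd Ai x) (at x)"
      by (rule mholo_dd(1) [OF cscale_vec Ai_mholo open_ball x])
    have "((\<lambda>x. Ai x ** A x) has_derivative (\<lambda>w. Ai x ** dd A x w + dd Ai x w ** A x)) (at x)"
      by (rule bounded_bilinear.FDERIV [OF bounded_bilinear_matrix_mult dAi dA])
    moreover have "((\<lambda>x. Ai x ** A x) has_derivative (\<lambda>w. 0)) (at x)"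
      by (rule has_derivative_transform_within_open [OF has_derivative_const [of "mat 1"] open_ball x]) (simp add: Ai)
    ultimately have "(\<lambda>w. Ai x ** dd A x w + dd Ai x w ** A x) = (\<lambda>w. 0)"
      by (rule has_derivative_unique)
    then have "Ai x ** dd A x w + dd Ai x w ** A x = 0" for w by (rule fun_cong)
    then have "dd Ai x w ** A x = - (Ai x ** dd A x w)" for w
      by (simp add: eq_neg_iff_add_eq_0 add.commute)
    then have "dd Ai x w ** A x ** Ai x = - (Ai x ** dd A x w) ** Ai x" for w by simp
    then have dAi_eq: "dd Ai x w = - (Ai x ** dd A x w ** Ai x)" for w
      by (simp add: matrix_mul_assoc [symmetric] Ai [OF x] matrix_bilinear_simps)
    have d\<Omega>: "dd (\<lambda>x. \<Omega> x v) x w = - f (Ai x *v (dd A x w *v (Ai x *v v)))" for v w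
    proof -
      have "((\<lambda>x. f (Ai x *v v)) has_derivative (\<lambda>w. f (dd Ai x w *v v))) (at x)"
        by (intro bounded_linear.has_derivative [OF f_lin]
            bounded_linear.has_derivative [OF bounded_bilinear.bounded_linear_left [OF bounded_bilinear_matrix_vector_mult]] dAi)
      then show ?thesis unfolding \<Omega>_def
        by (simp add: dd_eq dAi_eq matrix_vector_bilinear_simps f_minus matrix_vector_mul_assoc matrix_mul_assoc)
    qed
    \<comment> \<open>The constant vectors v and w agree at x with the left invariant fields of v'
      and w', to which \<open>A_bracket\<close> applies.\<close>
    define v' w' where "v' = Ai x *v v" and "w' = Ai x *v w"
    have vw: "v = A x *v v'" "w = A x *v w'"
      unfolding v'_def w'_def by (simp_all add: matrix_vector_mul_assoc Ai [OF x])
    have "dd (\<lambda>x. \<Omega> x v) x w - dd (\<lambda>x. \<Omega> x w) x v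
        = - f (Ai x *v (dd A x (A x *v w') *v v' - dd A x (A x *v v') *v w'))"
      unfolding d\<Omega> v'_def [symmetric] w'_def [symmetric] vw [symmetric]
      by (simp add: matrix_vector_bilinear_simps f_diff)
    also have "\<dots> = - f (bracket w' v')"
      unfolding A_bracket [OF sub [OF x]] by (simp add: matrix_vector_mul_assoc Ai [OF x])
    also have "\<dots> = - (\<Omega> x w ** \<Omega> x v - \<Omega> x v ** \<Omega> x w)"
      unfolding f_bracket \<Omega>_def v'_def w'_def ..
    finally show ?thesis .
  qed
  obtain K where K: "0 < K" "\<And>(P :: complex^'n^'n) (Q :: complex^'n^'n). norm (P ** Q) \<le> norm P * norm Q * K"
    using bounded_bilinear.pos_bounded [OF bounded_bilinear_matrix_mult [where 'n='n and 'k='n and 'p='n]] by blast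
  have "0 \<in> ball (0::complex^'m) r1" using r1(1) by simp
  then obtain r2 C where r2: "0 < r2" "ball 0 r2 \<subseteq> ball (0::complex^'m) r1" "0 < C"
    and C': "\<And>l x i j. l \<in> UNIV \<Longrightarrow> x \<in> ball 0 r2 \<Longrightarrow> cmod (\<Omega> x (axis l 1) $ i $ j) \<le> C"
    by (rule mholo_locally_bounded [where I=UNIV and F="\<lambda>l x. \<Omega> x (axis l 1)", OF \<Omega>_mholo finite_class.finite_UNIV open_ball]) blast
  note C = C' [OF UNIV_I]
  define c where "c = real CARD('n) * (real CARD('n) * (real CARD('m) * C))"
  have c: "0 < c" unfolding c_def using r2(3) by simp
  have \<Omega>_norm: "norm (\<Omega> y w) \<le> c * norm w" if y: "y \<in> ball 0 r2" for y w
  proof -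
    have "cmod (\<Omega> y w $ i $ j) \<le> real CARD('m) * C * norm w" for i j
    proof -
      have "cmod (\<Omega> y w $ i $ j) \<le> (\<Sum>l\<in>UNIV. cmod (w $ l * \<Omega> y (axis l 1) $ i $ j))"
        unfolding \<Omega>_expand [of y w] by (rule norm_sum)
      also have "\<dots> \<le> (\<Sum>l\<in>(UNIV::'m set). norm w * C)"
        unfolding norm_mult
        by (intro sum_mono mult_mono C y Finite_Cartesian_Product.norm_nth_le) auto
      finally show ?thesis by (simp add: mult_ac)
    qed
    from norm_matrix_le [OF this] show ?thesis by (simp add: c_def mult_ac)
  qed
  \<comment> \<open>For y and w in this ball \<Omega> meets the smallness condition of
    \<open>linear_ode_zero\<close>, where w is the direction of a ray.\<close>
  define r3 where "r3 = min r2 (1 / (2 * (c * K)))"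
  have r3: "0 < r3" "r3 \<le> r2" unfolding r3_def using r2(1) c K(1) by auto
  have \<Omega>_small: "norm (\<Omega> y w) * K \<le> 1/2" if "y \<in> ball 0 r3" "w \<in> ball 0 r3" for y w
  proof -
    have "norm (\<Omega> y w) * K \<le> (c * norm w) * K"
      using \<Omega>_norm [of y w] that r3(2) K(1) by (intro mult_right_mono) auto
    also have "\<dots> = (c * K) * norm w" by simp
    also have "\<dots> \<le> (c * K) * (1 / (2 * (c * K)))"
      using that(2) c K(1) unfolding r3_def by (intro mult_left_mono) auto
    finally show ?thesis using c K(1) by simp
  qed
  have \<Omega>_r3: "mholo (*s) (\<lambda>x. \<Omega> x (axis l 1)) (ball 0 r3)" for l
    using \<Omega>_mholo r3(2) r2(2) by (meson mholo_subset subset_ball subset_trans)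
  obtain \<delta> H where \<delta>: "0 < \<delta>" "\<delta> \<le> r3" and H: "mholo (*s) H (ball 0 \<delta>)" "H 0 = mat 1"
    and Hr: "\<And>x i j. x \<in> ball 0 \<delta> \<Longrightarrow> dd H x x $ i $ j = (\<Sum>l\<in>UNIV. x $ l * (H x ** \<Omega> x (axis l 1)) $ i $ j)"
    by (rule radial_solution [where \<Omega>="\<lambda>l x. \<Omega> x (axis l 1)", OF \<Omega>_r3 r3(1)]) blast
  have \<delta>R: "\<delta> \<le> R" "\<delta> \<le> r1"
    using ball_subset_ball_iff [of "0::complex^'m" r2 0 r1] r2(1,2) \<delta> r3(2) r1(2) by auto
  have sub2: "x \<in> ball 0 r1" "x \<in> ball 0 r3" "x \<in> ball 0 R" if "x \<in> ball 0 \<delta>" for x :: "complex^'m"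
    using that \<delta> \<delta>R by auto
  have radial: "dd H x x = H x ** \<Omega> x x" if x: "x \<in> ball 0 \<delta>" for x
  proof -
    have "(H x ** \<Omega> x x) $ i $ j = (\<Sum>l\<in>UNIV. x $ l * (H x ** \<Omega> x (axis l 1)) $ i $ j)" for i j
      unfolding matrix_matrix_mult_def
      by (simp add: \<Omega>_expand [of x x] sum_distrib_left mult_ac) (rule sum.swap)
    then show ?thesis using Hr [OF x] by (simp add: vec_eq_iff)
  qed
  have hH: "(H has_derivative dd H x) (at x)" if "x \<in> ball 0 \<delta>" for x
    by (rule mholo_dd(1) [OF cscale_vec H(1) open_ball that])
  have h\<Omega>: "((\<lambda>x. \<Omega> x v) has_derivative dd (\<lambda>x. \<Omega> x v) x) (at x)" if "x \<in> ball 0 \<delta>" for x v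
    by (rule mholo_dd(1) [OF cscale_vec \<Omega>_mholo open_ball sub2(1) [OF that]])
  have hdH: "((\<lambda>x. dd H x v) has_derivative dd (\<lambda>x. dd H x v) x) (at x)" if "x \<in> ball 0 \<delta>" for x v
    by (rule mholo_dd(1) [OF cscale_vec mholo_dd(3) [OF cscale_vec H(1) open_ball] open_ball that])
  note tB = scaleR_ball_0 [of _ \<delta>]
  \<comment> \<open>Flatness propagates the radial equation to all directions: the defect \<open>W v\<close> satisfies a linear
     homogeneous equation along rays.\<close>
  have dH: "dd H x v = H x ** \<Omega> x v" if x: "x \<in> ball 0 \<delta>" for x v
  proof -
    define W where "W x = dd H x v - H x ** \<Omega> x v" for x
    define W' where "W' x u = dd (\<lambda>x. dd H x v) x u - (H x ** dd (\<lambda>x. \<Omega> x v) x u + dd H x u ** \<Omega> x v)" for x u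
    have hW: "(W has_derivative W' x) (at x)" if "x \<in> ball 0 \<delta>" for x
      unfolding W_def W'_def
      by (intro has_derivative_diff hdH that bounded_bilinear.FDERIV [OF bounded_bilinear_matrix_mult] hH h\<Omega>)
    \<comment> \<open>Differentiating the radial equation at x in direction v and exchanging second
      derivatives determines the derivative of W in direction x; flatness collects the remaining
      terms into the product of W and \<Omega>.\<close>
    have W'x: "W' x x + W x = W x ** \<Omega> x x" if x: "x \<in> ball 0 \<delta>" for x
    proof -
      have lH: "linear (\<lambda>v. dd H y v)" if "y \<in> ball 0 \<delta>" for y
        using hH [OF that] has_derivative_linear by blast
      have 1: "((\<lambda>y. dd H y y) has_derivative (\<lambda>v. dd (\<lambda>y. dd H y x) x v + dd H x v)) (at x)"
        by (rule has_derivative_bilinear_eval [OF hdH [OF x] lH open_ball x has_derivative_ident])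
      have 2: "((\<lambda>y. \<Omega> y y) has_derivative (\<lambda>v. dd (\<lambda>y. \<Omega> y x) x v + \<Omega> x v)) (at x)"
        by (rule has_derivative_bilinear_eval [OF h\<Omega> [OF x] \<Omega>_lin open_ball x has_derivative_ident])
      have 3: "((\<lambda>y. H y ** \<Omega> y y) has_derivative
          (\<lambda>v. H x ** (dd (\<lambda>y. \<Omega> y x) x v + \<Omega> x v) + dd H x v ** \<Omega> x x)) (at x)"
        by (rule bounded_bilinear.FDERIV [OF bounded_bilinear_matrix_mult hH [OF x] 2])
      have "((\<lambda>y. H y ** \<Omega> y y) has_derivative (\<lambda>v. dd (\<lambda>y. dd H y x) x v + dd H x v)) (at x)"
        by (rule has_derivative_transform_within_open [OF 1 open_ball x]) (rule radial)
      from has_derivative_unique [OF this 3]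
      have "dd (\<lambda>y. dd H y x) x v + dd H x v = H x ** (dd (\<lambda>y. \<Omega> y x) x v + \<Omega> x v) + dd H x v ** \<Omega> x x"
        by (rule fun_cong)
      moreover have "dd (\<lambda>y. dd H y v) x x = dd (\<lambda>y. dd H y x) x v"
        by (rule mholo_dd(4) [OF cscale_vec H(1) open_ball x])
      ultimately have s: "dd (\<lambda>y. dd H y v) x x = H x ** dd (\<lambda>y. \<Omega> y x) x v + H x ** \<Omega> x v + dd H x v ** \<Omega> x x - dd H x v"
        by (simp add: matrix_bilinear_simps algebra_simps)
      have "dd (\<lambda>y. \<Omega> y x) x v = dd (\<lambda>y. \<Omega> y v) x x - (\<Omega> x v ** \<Omega> x x - \<Omega> x x ** \<Omega> x v)"
        using flat [OF sub2(1) [OF x], of x v] by (simp add: algebra_simps)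
      then show ?thesis
        unfolding W'_def W_def s radial [OF x] by (simp add: matrix_bilinear_simps matrix_mul_assoc)
    qed
    \<comment> \<open>The factor t absorbs the summand \<open>W x\<close> of the equation above and
      provides the initial value 0.\<close>
    have "t *\<^sub>R W (t *\<^sub>R x) = 0" if "t \<in> {0..1}" for t
    proof (rule linear_ode_zero [where z="\<lambda>t. t *\<^sub>R W (t *\<^sub>R x)" and B="\<lambda>t. \<Omega> (t *\<^sub>R x) x" and K=K])
      fix t :: real assume t: "t \<in> {0..1}"
      have lW: "linear (W' (t *\<^sub>R x))" using hW [OF tB [OF x t]] has_derivative_linear by blast
      have "((\<lambda>t. W (t *\<^sub>R x)) has_derivative (\<lambda>a. W' (t *\<^sub>R x) (a *\<^sub>R x))) (at t within {0..1})"
        by (rule has_derivative_ray [OF hW [OF tB [OF x t]]])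
      then have "((\<lambda>t. W (t *\<^sub>R x)) has_vector_derivative W' (t *\<^sub>R x) x) (at t within {0..1})"
        unfolding has_vector_derivative_def linear_cmul [OF lW] .
      then have "((\<lambda>t. t *\<^sub>R W (t *\<^sub>R x)) has_vector_derivative t *\<^sub>R W' (t *\<^sub>R x) x + 1 *\<^sub>R W (t *\<^sub>R x)) (at t within {0..1})"
        by (rule has_vector_derivative_scaleR [OF DERIV_ident])
      moreover have "t *\<^sub>R W' (t *\<^sub>R x) x + 1 *\<^sub>R W (t *\<^sub>R x) = (t *\<^sub>R W (t *\<^sub>R x)) ** \<Omega> (t *\<^sub>R x) x"
        using W'x [OF tB [OF x t]] linear_cmul [OF lW, of t x] linear_cmul [OF \<Omega>_lin, of "t *\<^sub>R x" t x]
        by (simp add: bounded_bilinear.scaleR_left [OF bounded_bilinear_matrix_mult]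
            bounded_bilinear.scaleR_right [OF bounded_bilinear_matrix_mult])
      ultimately show "((\<lambda>t. t *\<^sub>R W (t *\<^sub>R x)) has_vector_derivative (t *\<^sub>R W (t *\<^sub>R x)) ** \<Omega> (t *\<^sub>R x) x) (at t within {0..1})"
        by simp
      show "norm (\<Omega> (t *\<^sub>R x) x) * K \<le> 1/2"
        by (rule \<Omega>_small [OF sub2(2) [OF tB [OF x t]] sub2(2) [OF x]])
    qed (use K that in auto)
    from this [of 1] show ?thesis by (simp add: W_def)
  qed
  obtain \<epsilon> where \<epsilon>: "0 < \<epsilon>" "\<epsilon> \<le> \<delta>" "\<And>x y. x \<in> ball 0 \<epsilon> \<Longrightarrow> y \<in> ball 0 \<epsilon> \<Longrightarrow> m x y \<in> ball 0 \<delta>"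
  proof -
    have "continuous_on (ball 0 R \<times> ball 0 R) (\<lambda>p. m (fst p) (snd p))"
      by (rule holo_continuous_on [OF holo_m])
    then have "open ((ball 0 R \<times> ball 0 R) \<inter> (\<lambda>p. m (fst p) (snd p)) -` ball 0 \<delta>)"
      by (rule continuous_open_preimage [OF _ open_BB open_ball])
    moreover have "(0, 0) \<in> ((ball 0 R \<times> ball 0 R) \<inter> (\<lambda>p. m (fst p) (snd p)) -` ball 0 \<delta>)"
      using R \<delta>(1) m_0_right [OF zero_ball] by simp
    ultimately obtain X Y where XY: "open X" "open Y" "(0::complex^'m) \<in> X" "(0::complex^'m) \<in> Y"
      "X \<times> Y \<subseteq> ((ball 0 R \<times> ball 0 R) \<inter> (\<lambda>p. m (fst p) (snd p)) -` ball 0 \<delta>)"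
      by (elim open_prod_elim) auto
    then have "open (X \<inter> Y)" "0 \<in> X \<inter> Y" by auto
    then obtain e where "0 < e" "ball 0 e \<subseteq> X \<inter> Y" by (rule openE)
    then show thesis
    proof (intro that [of "min e \<delta>"])
      fix x y :: "complex^'m" assume "x \<in> ball 0 (min e \<delta>)" "y \<in> ball 0 (min e \<delta>)"
      then have "(x, y) \<in> X \<times> Y" using \<open>ball 0 e \<subseteq> X \<inter> Y\<close> by auto
      then show "m x y \<in> ball 0 \<delta>" using subsetD [OF XY(5)] by force
    qed (use \<delta>(1) in auto)
  qed
  show thesis
  proof (rule that [OF \<delta>(1) _ H _ \<epsilon>(1,2)])
    show "\<delta> \<le> R" using \<delta>R(1) .
    show "dd H 0 v = f v" for v
    proof -
      have "Ai 0 = mat 1" using Ai(1) [of 0] r1(1) by (simp add: A_0)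
      then show ?thesis using dH [of 0 v] \<delta>(1) H(2) by (simp add: \<Omega>_def)
    qed
    fix x y :: "complex^'m" assume x: "x \<in> ball 0 \<epsilon>" and y: "y \<in> ball 0 \<epsilon>"
    have in\<delta>: "y \<in> ball 0 \<delta>" if "y \<in> ball 0 \<epsilon>" for y :: "complex^'m" using that \<epsilon>(2) by simp
    \<comment> \<open>D measures the failure of multiplicativity and vanishes at y = 0. Left
      invariance of \<Omega>, in the form \<open>Ai (m x y) ** J (x, y) = Ai y\<close>, gives it the
      linear equation D' = D \<Omega> in y.\<close>
    define D where "D y = H (m x y) - H x ** H y" for y
    have hD: "(D has_derivative (\<lambda>w. D y ** \<Omega> y w)) (at y)" if y: "y \<in> ball 0 \<epsilon>" for y
    proof -
      note xy = \<epsilon>(3) [OF x y]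
      have xR: "x \<in> ball 0 R" and yR: "y \<in> ball 0 R" using sub2(3) in\<delta> x y by blast+
      have "((\<lambda>y. H (m x y)) has_derivative (\<lambda>w. dd H (m x y) (J (x, y) *v w))) (at y)"
        by (rule has_derivative_compose [OF m_deriv_right [OF xR yR] hH [OF xy]])
      moreover have "dd H (m x y) (J (x, y) *v w) = H (m x y) ** \<Omega> y w" for w
      proof -
        have "J (x, y) ** A y ** Ai y = A (m x y) ** Ai y"
          using J_A [OF xR yR sub2(3) [OF xy]] by simp
        then have "J (x, y) = A (m x y) ** Ai y"
          by (simp add: matrix_mul_assoc [symmetric] Ai [OF sub2(1) [OF in\<delta> [OF y]]])
        then have "Ai (m x y) ** J (x, y) = Ai y"
          by (simp add: matrix_mul_assoc Ai [OF sub2(1) [OF xy]])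
        then show ?thesis unfolding dH [OF xy] \<Omega>_def by (simp add: matrix_vector_mul_assoc)
      qed
      ultimately have 1: "((\<lambda>y. H (m x y)) has_derivative (\<lambda>w. H (m x y) ** \<Omega> y w)) (at y)" by simp
      have "((\<lambda>y. H x ** H y) has_derivative (\<lambda>w. H x ** dd H y w)) (at y)"
        by (rule bounded_linear.has_derivative [OF bounded_bilinear.bounded_linear_right [OF bounded_bilinear_matrix_mult] hH [OF in\<delta> [OF y]]])
      from has_derivative_diff [OF 1 this] show ?thesis
        unfolding D_def by (simp add: dH [OF in\<delta> [OF y]] matrix_bilinear_simps matrix_mul_assoc)
    qed
    note tE = scaleR_ball_0 [OF y]
    have "D (1 *\<^sub>R y) = 0"
    proof (rule linear_ode_zero [where z="\<lambda>t. D (t *\<^sub>R y)" and B="\<lambda>t. \<Omega> (t *\<^sub>R y) y" and K=K])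
      fix t :: real assume t: "t \<in> {0..1}"
      have "((\<lambda>t. D (t *\<^sub>R y)) has_derivative (\<lambda>a. D (t *\<^sub>R y) ** \<Omega> (t *\<^sub>R y) (a *\<^sub>R y))) (at t within {0..1})"
        by (rule has_derivative_ray [OF hD [OF tE [OF t]]])
      then show "((\<lambda>t. D (t *\<^sub>R y)) has_vector_derivative D (t *\<^sub>R y) ** \<Omega> (t *\<^sub>R y) y) (at t within {0..1})"
        unfolding has_vector_derivative_def linear_cmul [OF \<Omega>_lin] bounded_bilinear.scaleR_right [OF bounded_bilinear_matrix_mult] .
      show "norm (\<Omega> (t *\<^sub>R y) y) * K \<le> 1/2"
        by (rule \<Omega>_small [OF sub2(2) [OF in\<delta> [OF tE [OF t]]] sub2(2) [OF in\<delta> [OF y]]])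
    next
      have "x \<in> ball 0 R" using sub2(3) in\<delta> x by blast
      then show "D (0 *\<^sub>R y) = 0" by (simp add: D_def m_0_right H(2))
    qed (use K in auto)
    then show "m x y \<in> ball 0 \<delta> \<and> H (m x y) = H x ** H y"
      using \<epsilon>(3) [OF x y] by (simp add: D_def)
  qed
qed

end

section \<open>Holomorphic maps between manifolds\<close>

text \<open>The local content of \<open>complex_manifold\<close>, with relative openness spelled out
  by ambient open sets. In this form it is verified for projective space as well as for the group,
  and composition of holomorphic maps is proved once for both.\<close>

definition cmfd :: "'a topology \<Rightarrow> ('a, complex^'m::finite) chart set \<Rightarrow> bool" where
  "cmfd T \<Phi> \<longleftrightarrow> (\<Union>(U, \<phi>)\<in>\<Phi>. U) = topspace T \<and>
     (\<forall>(U, \<phi>)\<in>\<Phi>. openin T U \<and> inj_on \<phi> U \<and>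
        (\<forall>W. openin T W \<longrightarrow> (\<exists>Q. open Q \<and> \<phi> ` (W \<inter> U) = \<phi> ` U \<inter> Q)) \<and>
        (\<forall>Q. open Q \<longrightarrow> openin T {p \<in> U. \<phi> p \<in> Q})) \<and>
     (\<forall>(U, \<phi>)\<in>\<Phi>. \<forall>(W, \<psi>)\<in>\<Phi>. holo (*s) (*s) (\<lambda>x. \<psi> (inv_into U \<phi> x)) (\<phi> ` (U \<inter> W)))"

lemma cmfdD:
  assumes "cmfd T \<Phi>" "(U, \<phi>) \<in> \<Phi>"
  shows "openin T U" "inj_on \<phi> U" "openin T W \<Longrightarrow> \<exists>Q. open Q \<and> \<phi> ` (W \<inter> U) = \<phi> ` U \<inter> Q"
    "open Q \<Longrightarrow> openin T {p \<in> U. \<phi> p \<in> Q}"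
    "(Z, \<psi>) \<in> \<Phi> \<Longrightarrow> holo (*s) (*s) (\<lambda>x. \<psi> (inv_into U \<phi> x)) (\<phi> ` (U \<inter> Z))"
proof -
  have "openin T U \<and> inj_on \<phi> U \<and> (\<forall>W. openin T W \<longrightarrow> (\<exists>Q. open Q \<and> \<phi> ` (W \<inter> U) = \<phi> ` U \<inter> Q)) \<and>
      (\<forall>Q. open Q \<longrightarrow> openin T {p \<in> U. \<phi> p \<in> Q})"
    using bspec [OF conjunct1 [OF conjunct2 [OF assms(1) [unfolded cmfd_def]]] assms(2)] by simp
  then show "openin T U" "inj_on \<phi> U" "openin T W \<Longrightarrow> \<exists>Q. open Q \<and> \<phi> ` (W \<inter> U) = \<phi> ` U \<inter> Q"
    "open Q \<Longrightarrow> openin T {p \<in> U. \<phi> p \<in> Q}" by simp_all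
  show "holo (*s) (*s) (\<lambda>x. \<psi> (inv_into U \<phi> x)) (\<phi> ` (U \<inter> Z))" if "(Z, \<psi>) \<in> \<Phi>"
    using bspec [OF conjunct2 [OF conjunct2 [OF assms(1) [unfolded cmfd_def]]] assms(2)] that by auto
qed

lemma cmfd_cover:
  assumes "cmfd T \<Phi>" "p \<in> topspace T"
  obtains U \<phi> where "(U, \<phi>) \<in> \<Phi>" "p \<in> U"
  using assms unfolding cmfd_def by (metis (no_types, lifting) UN_E case_prod_unfold prod.collapse)

lemma complex_manifold_cmfd:
  assumes "complex_manifold k T \<Phi>"
  shows "cmfd T \<Phi>"
  unfolding cmfd_def
proof (intro conjI ballI)
  show "(\<Union>(U, \<phi>)\<in>\<Phi>. U) = topspace T" using assms unfolding complex_manifold_def by blast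
  fix c assume c: "c \<in> \<Phi>"
  obtain U \<phi> where c_eq: "c = (U, \<phi>)" by fastforce
  have U: "openin T U" and h: "homeomorphic_map (subtopology T U) (top_of_set (\<phi> ` U)) \<phi>"
    using assms c unfolding complex_manifold_def c_eq by fast+
  have tU: "topspace (subtopology T U) = U" using openin_subset [OF U] by auto
  have "inj_on \<phi> U" using homeomorphic_imp_injective_map [OF h] unfolding tU .
  moreover have "\<exists>Q. open Q \<and> \<phi> ` (W \<inter> U) = \<phi> ` U \<inter> Q" if "openin T W" for W
  proof -
    have "openin (subtopology T U) (W \<inter> U)" using that by (auto simp: openin_subtopology)
    then have "openin (top_of_set (\<phi> ` U)) (\<phi> ` (W \<inter> U))"
      using homeomorphic_imp_open_map [OF h] unfolding open_map_def by blast
    then show ?thesis by (auto simp: openin_open)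
  qed
  moreover have "openin T {p \<in> U. \<phi> p \<in> Q}" if "open Q" for Q
  proof -
    have "openin (top_of_set (\<phi> ` U)) (\<phi> ` U \<inter> Q)" using that by (auto simp: openin_open)
    then have "openin (subtopology T U) {p \<in> U. \<phi> p \<in> \<phi> ` U \<inter> Q}"
      using homeomorphic_imp_continuous_map [OF h] unfolding continuous_map_def tU by blast
    moreover have "{p \<in> U. \<phi> p \<in> \<phi> ` U \<inter> Q} = {p \<in> U. \<phi> p \<in> Q}" by auto
    ultimately show ?thesis using openin_trans_full [OF _ U] by metis
  qed
  ultimately show "case c of (U, \<phi>) \<Rightarrow> openin T U \<and> inj_on \<phi> U \<and>
      (\<forall>W. openin T W \<longrightarrow> (\<exists>Q. open Q \<and> \<phi> ` (W \<inter> U) = \<phi> ` U \<inter> Q)) \<and>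
      (\<forall>Q. open Q \<longrightarrow> openin T {p \<in> U. \<phi> p \<in> Q})"
    unfolding c_eq using U by blast
next
  fix c assume "c \<in> \<Phi>"
  then show "case c of (U, \<phi>) \<Rightarrow> \<forall>(W, \<psi>)\<in>\<Phi>. holo (*s) (*s) (\<lambda>x. \<psi> (inv_into U \<phi> x)) (\<phi> ` (U \<inter> W))"
    using assms unfolding complex_manifold_def by blast
qed

lemma holo_mapD:
  assumes "holo_map T \<Phi> T' \<Psi> S F"
  shows "openin T S" "continuous_map (subtopology T S) T' F"
    "(U, \<phi>) \<in> \<Phi> \<Longrightarrow> (W, \<psi>) \<in> \<Psi> \<Longrightarrow>
      holo (*s) (*s) (\<lambda>x. \<psi> (F (inv_into U \<phi> x))) (\<phi> ` {p \<in> S \<inter> U. F p \<in> W})"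
proof -
  have *: "\<forall>(U, \<phi>)\<in>\<Phi>. \<forall>(W, \<psi>)\<in>\<Psi>.
      holo (*s) (*s) (\<lambda>x. \<psi> (F (inv_into U \<phi> x))) (\<phi> ` {p \<in> S \<inter> U. F p \<in> W})"
    using assms unfolding holo_map_def by (rule conjunct2 [OF conjunct2])
  show "(U, \<phi>) \<in> \<Phi> \<Longrightarrow> (W, \<psi>) \<in> \<Psi> \<Longrightarrow>
      holo (*s) (*s) (\<lambda>x. \<psi> (F (inv_into U \<phi> x))) (\<phi> ` {p \<in> S \<inter> U. F p \<in> W})"
    using bspec [OF *, of "(U, \<phi>)"] by auto
qed (use assms in \<open>simp_all add: holo_map_def\<close>)

lemma holo_mapI:
  assumes "openin T S" "continuous_map (subtopology T S) T' F"
    "\<And>U \<phi> W \<psi>. (U, \<phi>) \<in> \<Phi> \<Longrightarrow> (W, \<psi>) \<in> \<Psi> \<Longrightarrow>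
      holo (*s) (*s) (\<lambda>x. \<psi> (F (inv_into U \<phi> x))) (\<phi> ` {p \<in> S \<inter> U. F p \<in> W})"
  shows "holo_map T \<Phi> T' \<Psi> S F"
  unfolding holo_map_def
proof (intro conjI ballI assms(1,2))
  fix c assume c: "c \<in> \<Phi>"
  obtain U \<phi> where c_eq: "c = (U, \<phi>)" by fastforce
  have "case d of (W, \<psi>) \<Rightarrow>
      holo (*s) (*s) (\<lambda>x. \<psi> (F (inv_into U \<phi> x))) (\<phi> ` {p \<in> S \<inter> U. F p \<in> W})" if d: "d \<in> \<Psi>" for d
  proof -
    obtain W \<psi> where d_eq: "d = (W, \<psi>)" by fastforce
    show ?thesis using assms(3) [OF c [unfolded c_eq] d [unfolded d_eq]] unfolding d_eq by simp
  qed
  then show "case c of (U, \<phi>) \<Rightarrow> \<forall>(W, \<psi>)\<in>\<Psi>.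
      holo (*s) (*s) (\<lambda>x. \<psi> (F (inv_into U \<phi> x))) (\<phi> ` {p \<in> S \<inter> U. F p \<in> W})"
    unfolding c_eq by blast
qed

lemma holo_funD:
  assumes "holo_fun T \<Phi> S g"
  shows "openin T S" "(U, \<phi>) \<in> \<Phi> \<Longrightarrow> holo (*s) (*) (\<lambda>x. g (inv_into U \<phi> x)) (\<phi> ` (S \<inter> U))"
proof -
  have *: "\<forall>(U, \<phi>)\<in>\<Phi>. holo (*s) (*) (\<lambda>x. g (inv_into U \<phi> x)) (\<phi> ` (S \<inter> U))"
    using assms unfolding holo_fun_def by (rule conjunct2)
  show "(U, \<phi>) \<in> \<Phi> \<Longrightarrow> holo (*s) (*) (\<lambda>x. g (inv_into U \<phi> x)) (\<phi> ` (S \<inter> U))"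
    using bspec [OF *, of "(U, \<phi>)"] by simp
qed (use assms in \<open>simp add: holo_fun_def\<close>)

lemma holo_funI:
  assumes "openin T S" "\<And>U \<phi>. (U, \<phi>) \<in> \<Phi> \<Longrightarrow> holo (*s) (*) (\<lambda>x. g (inv_into U \<phi> x)) (\<phi> ` (S \<inter> U))"
  shows "holo_fun T \<Phi> S g"
  unfolding holo_fun_def by (intro conjI ballI) (auto intro: assms)

text \<open>A chart of the middle manifold covers only a neighbourhood of a point, so holomorphy is
  checked locally. The parameters t and X let one proof serve maps, with X the preimage of a chart
  domain, and functions, with X everything.\<close>

lemma holo_compose_charts:
  assumes T: "cmfd T \<Phi>" and T': "cmfd T' \<Phi>'" and U: "(U, \<phi>) \<in> \<Phi>"
    and F: "holo_map T \<Phi> T' \<Phi>' S F" "F ` S \<subseteq> S'" "openin T' S'"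
    and G: "\<And>V \<psi>. (V, \<psi>) \<in> \<Phi>' \<Longrightarrow> holo (*s) t (\<lambda>x. g (inv_into V \<psi> x)) (\<psi> ` (V \<inter> S' \<inter> X))"
  shows "holo (*s) t (\<lambda>x. g (F (inv_into U \<phi> x))) (\<phi> ` {p \<in> S \<inter> U. F p \<in> X})"
proof (rule holo_local)
  fix x assume "x \<in> \<phi> ` {p \<in> S \<inter> U. F p \<in> X}"
  then obtain p where p: "p \<in> S" "p \<in> U" "F p \<in> X" "x = \<phi> p" by blast
  have inj: "inj_on \<phi> U" by (rule cmfdD [OF T U])
  have "F p \<in> topspace T'" using F(2,3) p(1) openin_subset by blast
  then obtain V \<psi> where V: "(V, \<psi>) \<in> \<Phi>'" "F p \<in> V" using cmfd_cover [OF T'] by blast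
  have oV: "openin T' V" and injV: "inj_on \<psi> V" by (rule cmfdD [OF T' V(1)])+
  have S: "openin T S" and cF: "continuous_map (subtopology T S) T' F"
    and hF: "holo (*s) (*s) (\<lambda>x. \<psi> (F (inv_into U \<phi> x))) (\<phi> ` {p \<in> S \<inter> U. F p \<in> V})"
    by (rule holo_mapD [OF F(1)])+ (use U V(1) in auto)
  have tS: "topspace (subtopology T S) = S" using openin_subset [OF S] by auto
  have "openin (subtopology T S) {q \<in> S. F q \<in> V}"
    using cF oV unfolding continuous_map_def tS by blast
  then have "openin T {q \<in> S. F q \<in> V}" using S by (rule openin_trans_full)
  then obtain Q where Q: "open Q" "\<phi> ` ({q \<in> S. F q \<in> V} \<inter> U) = \<phi> ` U \<inter> Q"
    using cmfdD(3) [OF T U] by blast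
  let ?Z = "\<phi> ` {p \<in> S \<inter> U. F p \<in> X}"
  have "p \<in> {q \<in> S. F q \<in> V} \<inter> U" using p V(2) by simp
  then have x: "x \<in> Q" using Q(2) p(4) imageI [of p _ \<phi>] by blast
  have ZQ: "?Z \<inter> Q \<subseteq> \<phi> ` {p \<in> S \<inter> U. F p \<in> V \<and> F p \<in> X}"
  proof
    fix z assume z: "z \<in> ?Z \<inter> Q"
    then obtain q where q: "q \<in> S" "q \<in> U" "F q \<in> X" "z = \<phi> q" by blast
    then have "\<phi> q \<in> \<phi> ` ({q \<in> S. F q \<in> V} \<inter> U)" using Q(2) z by blast
    then have "q \<in> {q \<in> S. F q \<in> V} \<inter> U" using inj_on_image_mem_iff [OF inj q(2)] by blast
    then show "z \<in> \<phi> ` {p \<in> S \<inter> U. F p \<in> V \<and> F p \<in> X}" using q by blast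
  qed
  have "holo (*s) t (\<lambda>x. g (inv_into V \<psi> (\<psi> (F (inv_into U \<phi> x))))) (?Z \<inter> Q)"
  proof (rule holo_compose [OF _ G [OF V(1)]])
    show "holo (*s) (*s) (\<lambda>x. \<psi> (F (inv_into U \<phi> x))) (?Z \<inter> Q)"
      by (rule holo_subset [OF hF]) (use ZQ in blast)
    show "(\<lambda>x. \<psi> (F (inv_into U \<phi> x))) ` (?Z \<inter> Q) \<subseteq> \<psi> ` (V \<inter> S' \<inter> X)"
    proof
      fix y assume "y \<in> (\<lambda>x. \<psi> (F (inv_into U \<phi> x))) ` (?Z \<inter> Q)"
      then obtain z where z: "y = \<psi> (F (inv_into U \<phi> z))" "z \<in> ?Z \<inter> Q" by (rule imageE)
      from subsetD [OF ZQ z(2)]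
      obtain q where q: "q \<in> S" "q \<in> U" "F q \<in> V" "F q \<in> X" "y = \<psi> (F (inv_into U \<phi> (\<phi> q)))"
        using z(1) by auto
      then show "y \<in> \<psi> ` (V \<inter> S' \<inter> X)" using F(2) inj by auto
    qed
  qed
  moreover have "g (inv_into V \<psi> (\<psi> (F (inv_into U \<phi> z)))) = g (F (inv_into U \<phi> z))" if "z \<in> ?Z \<inter> Q" for z
  proof -
    obtain q where q: "q \<in> S" "q \<in> U" "F q \<in> V" "z = \<phi> q" using subsetD [OF ZQ \<open>z \<in> ?Z \<inter> Q\<close>] by auto
    then show ?thesis using inj injV by simp
  qed
  ultimately have "holo (*s) t (\<lambda>x. g (F (inv_into U \<phi> x))) (?Z \<inter> Q)" by (rule holo_cong)
  then show "\<exists>O'. open O' \<and> x \<in> O' \<and> holo (*s) t (\<lambda>x. g (F (inv_into U \<phi> x))) (?Z \<inter> O')"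
    using Q(1) x by blast
qed

lemma holo_map_compose:
  assumes T: "cmfd T \<Phi>" and T': "cmfd T' \<Phi>'"
    and F: "holo_map T \<Phi> T' \<Phi>' S F" and G: "holo_map T' \<Phi>' T'' \<Phi>'' S' G" and FS: "F ` S \<subseteq> S'"
  shows "holo_map T \<Phi> T'' \<Phi>'' S (\<lambda>x. G (F x))"
proof (rule holo_mapI)
  show "openin T S" by (rule holo_mapD [OF F])
  have S': "openin T' S'" by (rule holo_mapD [OF G])
  have "continuous_map (subtopology T S) (subtopology T' S') F"
    using holo_mapD(2) [OF F] FS by (auto simp: continuous_map_in_subtopology)
  then have "continuous_map (subtopology T S) T'' (G \<circ> F)"
    by (rule continuous_map_compose [OF _ holo_mapD(2) [OF G]])
  then show "continuous_map (subtopology T S) T'' (\<lambda>x. G (F x))" by (simp add: o_def)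
  fix U \<phi> W \<zeta> assume c: "(U, \<phi>) \<in> \<Phi>" "(W, \<zeta>) \<in> \<Phi>''"
  have "holo (*s) (*s) (\<lambda>x. \<zeta> (G (F (inv_into U \<phi> x)))) (\<phi> ` {p \<in> S \<inter> U. F p \<in> {y. G y \<in> W}})"
  proof (rule holo_compose_charts [OF T T' c(1) F FS S', where g="\<lambda>y. \<zeta> (G y)"])
    fix V \<psi> assume "(V, \<psi>) \<in> \<Phi>'"
    from holo_mapD(3) [OF G this c(2)]
    show "holo (*s) (*s) (\<lambda>x. \<zeta> (G (inv_into V \<psi> x))) (\<psi> ` (V \<inter> S' \<inter> {y. G y \<in> W}))"
      by (rule holo_subset) auto
  qed
  then show "holo (*s) (*s) (\<lambda>x. \<zeta> (G (F (inv_into U \<phi> x)))) (\<phi> ` {p \<in> S \<inter> U. G (F p) \<in> W})"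
    by simp
qed

lemma holo_fun_compose:
  assumes T: "cmfd T \<Phi>" and T': "cmfd T' \<Phi>'"
    and F: "holo_map T \<Phi> T' \<Phi>' S F" and g: "holo_fun T' \<Phi>' S' g" and FS: "F ` S \<subseteq> S'"
  shows "holo_fun T \<Phi> S (\<lambda>x. g (F x))"
proof (rule holo_funI)
  show "openin T S" by (rule holo_mapD [OF F])
  have S': "openin T' S'" by (rule holo_funD [OF g])
  fix U \<phi> assume c: "(U, \<phi>) \<in> \<Phi>"
  have "holo (*s) (*) (\<lambda>x. g (F (inv_into U \<phi> x))) (\<phi> ` {p \<in> S \<inter> U. F p \<in> UNIV})"
  proof (rule holo_compose_charts [OF T T' c F FS S', where g=g])
    fix V \<psi> assume "(V, \<psi>) \<in> \<Phi>'"
    from holo_funD(2) [OF g this]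
    show "holo (*s) (*) (\<lambda>x. g (inv_into V \<psi> x)) (\<psi> ` (V \<inter> S' \<inter> UNIV))"
      by (simp add: Int_commute)
  qed
  moreover have "{p \<in> S \<inter> U. F p \<in> UNIV} = S \<inter> U" by auto
  ultimately show "holo (*s) (*) (\<lambda>x. g (F (inv_into U \<phi> x))) (\<phi> ` (S \<inter> U))" by (simp only:)
qed

lemma holo_map_subset:
  assumes "holo_map T \<Phi> T' \<Phi>' S F" "openin T S'" "S' \<subseteq> S"
  shows "holo_map T \<Phi> T' \<Phi>' S' F"
proof (rule holo_mapI)
  show "continuous_map (subtopology T S') T' F"
    using holo_mapD(2) [OF assms(1)] assms(3) by (rule continuous_map_from_subtopology_mono)
  fix U \<phi> W \<psi> assume "(U, \<phi>) \<in> \<Phi>" "(W, \<psi>) \<in> \<Phi>'"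
  from holo_mapD(3) [OF assms(1) this]
  show "holo (*s) (*s) (\<lambda>x. \<psi> (F (inv_into U \<phi> x))) (\<phi> ` {p \<in> S' \<inter> U. F p \<in> W})"
    by (rule holo_subset) (use assms(3) in auto)
qed (rule assms)

lemma holo_fun_subset:
  assumes "holo_fun T \<Phi> S g" "openin T S'" "S' \<subseteq> S"
  shows "holo_fun T \<Phi> S' g"
  by (rule holo_funI [OF assms(2)], rule holo_subset [OF holo_funD(2) [OF assms(1)]]) (use assms(3) in auto)

lemma holo_map_cong:
  assumes T: "cmfd T \<Phi>" and F: "holo_map T \<Phi> T' \<Phi>' S F" and eq: "\<And>x. x \<in> S \<Longrightarrow> F x = G x"
  shows "holo_map T \<Phi> T' \<Phi>' S G"
proof (rule holo_mapI)
  show "openin T S" by (rule holo_mapD [OF F])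
  show "continuous_map (subtopology T S) T' G"
    by (rule continuous_map_eq [OF holo_mapD(2) [OF F]]) (use eq in auto)
  fix U \<phi> W \<zeta> assume c: "(U, \<phi>) \<in> \<Phi>" "(W, \<zeta>) \<in> \<Phi>'"
  have inj: "inj_on \<phi> U" by (rule cmfdD [OF T c(1)])
  have "{p \<in> S \<inter> U. F p \<in> W} = {p \<in> S \<inter> U. G p \<in> W}" using eq by auto
  then have "holo (*s) (*s) (\<lambda>x. \<zeta> (F (inv_into U \<phi> x))) (\<phi> ` {p \<in> S \<inter> U. G p \<in> W})"
    using holo_mapD(3) [OF F c] by simp
  then show "holo (*s) (*s) (\<lambda>x. \<zeta> (G (inv_into U \<phi> x))) (\<phi> ` {p \<in> S \<inter> U. G p \<in> W})"
    by (rule holo_cong) (use inj eq in auto)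
qed

lemma holo_fun_cong:
  assumes T: "cmfd T \<Phi>" and g: "holo_fun T \<Phi> S g" and eq: "\<And>x. x \<in> S \<Longrightarrow> g x = h x"
  shows "holo_fun T \<Phi> S h"
proof (rule holo_funI)
  show "openin T S" by (rule holo_funD [OF g])
  fix U \<phi> assume c: "(U, \<phi>) \<in> \<Phi>"
  have inj: "inj_on \<phi> U" by (rule cmfdD [OF T c])
  from holo_funD(2) [OF g c]
  show "holo (*s) (*) (\<lambda>x. h (inv_into U \<phi> x)) (\<phi> ` (S \<inter> U))"
    by (rule holo_cong) (use inj eq in auto)
qed

lemma holo_fun_const: "openin T S \<Longrightarrow> holo_fun T \<Phi> S (\<lambda>x. c)"
  by (rule holo_funI) (auto intro: holo_const)

lemma holo_fun_add: "holo_fun T \<Phi> S g \<Longrightarrow> holo_fun T \<Phi> S h \<Longrightarrow> holo_fun T \<Phi> S (\<lambda>x. g x + h x)"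
  by (rule holo_funI, erule holo_funD) (intro holo_add holo_funD(2))

lemma holo_fun_diff: "holo_fun T \<Phi> S g \<Longrightarrow> holo_fun T \<Phi> S h \<Longrightarrow> holo_fun T \<Phi> S (\<lambda>x. g x - h x)"
  by (rule holo_funI, erule holo_funD) (intro holo_diff holo_funD(2))

lemma holo_fun_mult: "holo_fun T \<Phi> S g \<Longrightarrow> holo_fun T \<Phi> S h \<Longrightarrow> holo_fun T \<Phi> S (\<lambda>x. g x * h x)"
  by (rule holo_funI, erule holo_funD) (intro holo_mult holo_funD(2))

lemma holo_fun_sum:
  "(\<And>i. i \<in> I \<Longrightarrow> holo_fun T \<Phi> S (g i)) \<Longrightarrow> openin T S \<Longrightarrow> holo_fun T \<Phi> S (\<lambda>x. \<Sum>i\<in>I. g i x)"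
  by (induct I rule: infinite_finite_induct) (auto intro: holo_fun_add holo_fun_const)

lemma holo_fun_divide:
  assumes T: "cmfd T \<Phi>" and g: "holo_fun T \<Phi> S g" and h: "holo_fun T \<Phi> S h" "\<And>x. x \<in> S \<Longrightarrow> h x \<noteq> 0"
  shows "holo_fun T \<Phi> S (\<lambda>x. g x / h x)"
proof (rule holo_funI)
  show "openin T S" by (rule holo_funD [OF g])
  fix U \<phi> assume c: "(U, \<phi>) \<in> \<Phi>"
  have inj: "inj_on \<phi> U" by (rule cmfdD [OF T c])
  show "holo (*s) (*) (\<lambda>x. g (inv_into U \<phi> x) / h (inv_into U \<phi> x)) (\<phi> ` (S \<inter> U))"
    by (rule holo_divide [OF holo_funD(2) [OF g c] holo_funD(2) [OF h(1) c]]) (use inj h(2) in auto)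
qed

lemma holo_fun_open_vec:
  fixes w :: "'a \<Rightarrow> complex^'n::finite"
  assumes T: "cmfd T \<Phi>" and w: "\<And>j. holo_fun T \<Phi> S (\<lambda>a. w a $ j)" and Q: "open Q"
  shows "openin T {p \<in> S. w p \<in> Q}"
proof -
  have S: "openin T S" by (rule holo_funD [OF w])
  have "\<exists>O'. openin T O' \<and> p \<in> O' \<and> O' \<subseteq> {p \<in> S. w p \<in> Q}" if p: "p \<in> {p \<in> S. w p \<in> Q}" for p
  proof -
    have "p \<in> topspace T" using p openin_subset [OF S] by blast
    then obtain U \<phi> where U: "(U, \<phi>) \<in> \<Phi>" "p \<in> U" by (rule cmfd_cover [OF T])
    have inj: "inj_on \<phi> U" by (rule cmfdD [OF T U(1)])
    have "holo (*s) (*s) (\<lambda>x. w (inv_into U \<phi> x)) (\<phi> ` (S \<inter> U))"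
      unfolding holo_vec_iff using holo_funD(2) [OF w U(1)] by blast
    then have "continuous_on (\<phi> ` (S \<inter> U)) (\<lambda>x. w (inv_into U \<phi> x))" by (rule holo_continuous_on)
    then obtain Q' where Q': "open Q'" "Q' \<inter> \<phi> ` (S \<inter> U) = (\<lambda>x. w (inv_into U \<phi> x)) -` Q \<inter> \<phi> ` (S \<inter> U)"
      using Q unfolding continuous_on_open_invariant by blast
    let ?O = "{q \<in> U. \<phi> q \<in> Q'} \<inter> S"
    have "openin T ?O" by (intro openin_Int cmfdD(4) [OF T U(1) Q'(1)] S)
    moreover have "p \<in> ?O"
    proof -
      have "\<phi> p \<in> Q' \<inter> \<phi> ` (S \<inter> U)" unfolding Q'(2) using p U(2) inj by auto
      then show ?thesis using p U(2) by blast
    qed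
    moreover have "?O \<subseteq> {p \<in> S. w p \<in> Q}"
    proof
      fix q assume q: "q \<in> ?O"
      then have "\<phi> q \<in> Q' \<inter> \<phi> ` (S \<inter> U)" by blast
      then have "w (inv_into U \<phi> (\<phi> q)) \<in> Q" unfolding Q'(2) by blast
      then show "q \<in> {p \<in> S. w p \<in> Q}" using q inj by simp
    qed
    ultimately show ?thesis by blast
  qed
  then show ?thesis by (subst openin_subopen) blast
qed

lemma holo_fun_open:
  assumes T: "cmfd T \<Phi>" and g: "holo_fun T \<Phi> S g" and Q: "open Q"
  shows "openin T {p \<in> S. g p \<in> Q}"
proof -
  have "openin T {p \<in> S. (\<chi> j::1. g p) \<in> {v. v $ 1 \<in> Q}}"
  proof (rule holo_fun_open_vec [OF T])
    have "open ((\<lambda>v::complex^1. v $ 1) -` Q)"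
      by (intro open_vimage Q continuous_intros)
    then show "open {v::complex^1. v $ 1 \<in> Q}" by (simp add: vimage_def)
  qed (use g in simp)
  then show ?thesis by simp
qed

text \<open>Transition maps of the target carry holomorphy from one chart to all others, so the
  coordinates in a single chart suffice. In \<open>realize\<close> this handles the inverse of the
  constructed chart.\<close>

lemma holo_map_into_chart:
  assumes T: "cmfd T \<Phi>" and T': "cmfd T' \<Phi>'" and V: "(V, \<psi>) \<in> \<Phi>'" and S: "openin T S"
    and FV: "F ` S \<subseteq> V" and h: "\<And>j. holo_fun T \<Phi> S (\<lambda>a. \<psi> (F a) $ j)"
  shows "holo_map T \<Phi> T' \<Phi>' S F"
proof (rule holo_mapI [OF S])
  have injV: "inj_on \<psi> V" and oV: "openin T' V" by (rule cmfdD [OF T' V])+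
  have tS: "topspace (subtopology T S) = S" using openin_subset [OF S] by auto
  show "continuous_map (subtopology T S) T' F"
    unfolding continuous_map_def tS
  proof (intro conjI allI impI)
    show "F \<in> S \<rightarrow> topspace T'" using FV openin_subset [OF oV] by blast
    fix W assume W: "openin T' W"
    then obtain Q where Q: "open Q" "\<psi> ` (W \<inter> V) = \<psi> ` V \<inter> Q" using cmfdD(3) [OF T' V] by blast
    have "openin T {p \<in> S. \<psi> (F p) \<in> Q}" by (rule holo_fun_open_vec [OF T h Q(1)])
    moreover have "{p \<in> S. \<psi> (F p) \<in> Q} = {p \<in> S. F p \<in> W}"
    proof -
      have "\<psi> (F p) \<in> Q \<longleftrightarrow> F p \<in> W" if "p \<in> S" for p
      proof -
        have FpV: "F p \<in> V" using FV that by blast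
        then have "\<psi> (F p) \<in> Q \<longleftrightarrow> \<psi> (F p) \<in> \<psi> ` (W \<inter> V)" unfolding Q(2) by blast
        also have "\<dots> \<longleftrightarrow> F p \<in> W \<inter> V" by (rule inj_on_image_mem_iff [OF injV FpV]) blast
        finally show ?thesis using FpV by blast
      qed
      then show ?thesis by blast
    qed
    ultimately have "openin T {p \<in> S. F p \<in> W}" by simp
    then show "openin (subtopology T S) {p \<in> S. F p \<in> W}"
      using openin_subtopology_Int2 [of T "{p \<in> S. F p \<in> W}" S] by (simp add: Int_absorb1 Collect_conj_eq)
  qed
  fix U \<phi> W \<zeta> assume c: "(U, \<phi>) \<in> \<Phi>" "(W, \<zeta>) \<in> \<Phi>'"
  have inj: "inj_on \<phi> U" by (rule cmfdD [OF T c(1)])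
  have 1: "holo (*s) (*s) (\<lambda>x. \<psi> (F (inv_into U \<phi> x))) (\<phi> ` (S \<inter> U))"
    unfolding holo_vec_iff using holo_funD(2) [OF h c(1)] by blast
  have "holo (*s) (*s) (\<lambda>x. \<zeta> (inv_into V \<psi> (\<psi> (F (inv_into U \<phi> x))))) (\<phi> ` {p \<in> S \<inter> U. F p \<in> W})"
    by (rule holo_compose [OF holo_subset [OF 1] cmfdD(5) [OF T' V c(2)]]) (use FV inj in auto)
  then show "holo (*s) (*s) (\<lambda>x. \<zeta> (F (inv_into U \<phi> x))) (\<phi> ` {p \<in> S \<inter> U. F p \<in> W})"
    by (rule holo_cong) (use FV inj injV in auto)
qed

lemma holo_map_chart_coord:
  assumes F: "holo_map T \<Phi> T' \<Phi>' S F" and V: "(V, \<psi>) \<in> \<Phi>'" and FV: "F ` S \<subseteq> V"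
  shows "holo_fun T \<Phi> S (\<lambda>a. \<psi> (F a) $ j)"
proof (rule holo_funI)
  show "openin T S" by (rule holo_mapD [OF F])
  fix U \<phi> assume c: "(U, \<phi>) \<in> \<Phi>"
  have "{p \<in> S \<inter> U. F p \<in> V} = S \<inter> U" using FV by blast
  then show "holo (*s) (*) (\<lambda>x. \<psi> (F (inv_into U \<phi> x)) $ j) (\<phi> ` (S \<inter> U))"
    using holo_mapD(3) [OF F c V] by (simp add: holo_vec_iff)
qed

lemma holo_map_openin:
  assumes F: "holo_map T \<Phi> T' \<Phi>' S F" and W: "openin T' W"
  shows "openin T {p \<in> S. F p \<in> W}"
proof -
  have S: "openin T S" and c: "continuous_map (subtopology T S) T' F" by (rule holo_mapD [OF F])+
  have tS: "topspace (subtopology T S) = S" using openin_subset [OF S] by auto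
  have "openin (subtopology T S) {p \<in> S. F p \<in> W}" using c W unfolding continuous_map_def tS by blast
  then show ?thesis using S by (rule openin_trans_full)
qed

section \<open>Projective space\<close>

lemma proj_pt_eq: "proj_pt v = {c *s v | c. True}"
  unfolding proj_pt_def by (simp add: vec.span_singleton) (auto simp: image_def)

lemma proj_pt_mem: "v \<in> proj_pt v"
  unfolding proj_pt_eq by (auto intro: exI [of _ 1])

lemma proj_pt_scale: "c \<noteq> 0 \<Longrightarrow> proj_pt (c *s v) = proj_pt v"
  unfolding proj_pt_eq
proof (intro equalityI subsetI)
  fix x assume c: "c \<noteq> 0" and "x \<in> {d *s v | d. True}"
  then obtain d where "x = d *s v" by blast
  then have "x = (d / c) *s (c *s v)" using c by simp
  then show "x \<in> {d *s (c *s v) | d. True}" by blast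
qed auto

lemma proj_pt_eqD:
  assumes "proj_pt v = proj_pt w" "v \<noteq> 0"
  obtains c where "c \<noteq> 0" "v = c *s w"
proof -
  have "v \<in> proj_pt w" using assms(1) proj_pt_mem by blast
  then obtain c where "v = c *s w" unfolding proj_pt_eq by blast
  moreover have "c \<noteq> 0" using calculation assms(2) by auto
  ultimately show thesis using that by blast
qed

lemma proj_pt_in_space: "v \<noteq> 0 \<Longrightarrow> proj_pt v \<in> proj_space"
  unfolding proj_space_def by blast

lemma topspace_proj: "topspace (proj_topology :: (complex^'m::finite) set topology) = proj_space"
proof -
  have "openin proj_topology (proj_space :: (complex^'m) set set)"
    unfolding openin_proj_topology
  proof
    have "{v::complex^'m. v \<noteq> 0 \<and> proj_pt v \<in> proj_space} = - {0}"
      using proj_pt_in_space by auto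
    then show "open {v::complex^'m. v \<noteq> 0 \<and> proj_pt v \<in> proj_space}" by (simp add: open_Compl)
  qed simp
  moreover have "topspace (proj_topology :: (complex^'m) set topology) \<subseteq> proj_space"
    using openin_topspace openin_proj_topology by blast
  ultimately show ?thesis using openin_subset by blast
qed

definition aff_dom :: "'m::finite \<Rightarrow> (complex^'m) set set" where
  "aff_dom i = proj_pt ` {x. x $ i \<noteq> 0}"

definition aff_map :: "'m::finite \<Rightarrow> 'm \<Rightarrow> (complex^'m) set \<Rightarrow> complex^'m" where
  "aff_map k i p = (\<chi> j. if j = k then 0 else (THE x. x \<in> p \<and> x $ i = 1) $ Transposition.transpose i k j)"

text \<open>The representative, with coordinate i equal to 1, of the point with affine coordinates
  x. The swap undoes that of \<open>aff_map\<close>; entry i would read the constant 0 at k and is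
  overwritten.\<close>

definition aff_lift :: "'m::finite \<Rightarrow> 'm \<Rightarrow> complex^'m \<Rightarrow> complex^'m" where
  "aff_lift k i x = (\<chi> j. if j = i then 1 else x $ Transposition.transpose i k j)"

lemma affine_chart_eq: "affine_chart k i = (aff_dom i, aff_map k i)"
  unfolding affine_chart_def aff_dom_def aff_map_def by (auto simp: fun_eq_iff Let_def)

lemma aff_dom_iff: "v \<noteq> 0 \<Longrightarrow> proj_pt v \<in> aff_dom i \<longleftrightarrow> v $ i \<noteq> 0"
  unfolding aff_dom_def by (auto elim!: proj_pt_eqD)

lemma normalized_rep:
  assumes "v $ i \<noteq> (0::complex)"
  shows "(THE x. x \<in> proj_pt v \<and> x $ i = 1) = (1 / v $ i) *s v"
proof (rule the_equality)
  show "(1 / v $ i) *s v \<in> proj_pt v \<and> ((1 / v $ i) *s v) $ i = 1"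
    using assms unfolding proj_pt_eq by auto
  fix x assume "x \<in> proj_pt v \<and> x $ i = 1"
  then obtain c where c: "x = c *s v" and "x $ i = 1" unfolding proj_pt_eq by blast
  then have "c * v $ i = 1" by simp
  then have "c = 1 / v $ i" using assms by (simp add: field_simps)
  then show "x = (1 / v $ i) *s v" using c by simp
qed

lemma aff_map_proj_pt:
  "v $ i \<noteq> 0 \<Longrightarrow> aff_map k i (proj_pt v) $ j = (if j = k then 0 else v $ Transposition.transpose i k j / v $ i)"
  unfolding aff_map_def by (simp add: normalized_rep)

lemma aff_lift_nth: "aff_lift k i x $ i = 1"
  by (simp add: aff_lift_def)

lemma aff_lift_nonzero: "aff_lift k i x \<noteq> 0"
  using aff_lift_nth [of k i x] by auto

lemma aff_map_lift: "aff_map k i (proj_pt (aff_lift k i x)) = x" if "x \<in> Cn k"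
proof -
  have "aff_map k i (proj_pt (aff_lift k i x)) $ j = x $ j" for j
    using that by (subst aff_map_proj_pt) (auto simp: aff_lift_nth aff_lift_def Cn_def Transposition.transpose_def)
  then show ?thesis by (simp add: vec_eq_iff)
qed

lemma proj_pt_lift_map:
  assumes "p \<in> aff_dom i"
  shows "proj_pt (aff_lift k i (aff_map k i p)) = p"
proof -
  obtain v where v: "p = proj_pt v" "v $ i \<noteq> 0" using assms unfolding aff_dom_def by blast
  have "aff_lift k i (aff_map k i p) $ j = ((1 / v $ i) *s v) $ j" for j
    using v unfolding aff_lift_def v(1)
    by (auto simp: aff_map_proj_pt Transposition.transpose_def)
  then have "aff_lift k i (aff_map k i p) = (1 / v $ i) *s v" by (simp add: vec_eq_iff)
  then show ?thesis using v by (simp add: proj_pt_scale)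
qed

lemma aff_map_Cn: "aff_map k i p \<in> Cn k"
  by (simp add: aff_map_def Cn_def)

lemma inj_aff_map: "inj_on (aff_map k i) (aff_dom i)"
  by (rule inj_on_inverseI) (rule proj_pt_lift_map)

lemma aff_lift_in_dom: "proj_pt (aff_lift k i x) \<in> aff_dom i"
  by (simp add: aff_dom_iff aff_lift_nonzero aff_lift_nth)

lemma aff_map_image: "aff_map k i ` aff_dom i = Cn k"
proof
  show "Cn k \<subseteq> aff_map k i ` aff_dom i"
  proof
    fix x :: "complex^'a" assume "x \<in> Cn k"
    then show "x \<in> aff_map k i ` aff_dom i"
      using aff_map_lift [of x k i] aff_lift_in_dom [of k i x] by (metis image_eqI)
  qed
qed (auto simp: aff_map_Cn)

lemma inv_aff_map: "x \<in> Cn k \<Longrightarrow> inv_into (aff_dom i) (aff_map k i) x = proj_pt (aff_lift k i x)"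
  by (rule inv_into_f_eq [OF inj_aff_map aff_lift_in_dom aff_map_lift])

lemma holo_aff_lift: "holo (*s) (*s) (aff_lift k i :: complex^'m::finite \<Rightarrow> _) S" if "S \<subseteq> Cn k"
proof -
  have "holo (*s) (*) (\<lambda>x. aff_lift k i x $ j) S" for j
  proof (cases "j = i")
    case False
    then show ?thesis using holo_nth by (simp add: aff_lift_def)
  qed (simp add: aff_lift_def holo_const)
  then show ?thesis by (simp add: holo_vec_iff)
qed

lemma continuous_aff_lift: "continuous_on UNIV (aff_lift k i)"
  unfolding aff_lift_def
  by (rule continuous_on_vec_lambda, case_tac "j = i") (auto intro!: continuous_intros)

lemma holo_aff_of_lift:
  fixes w :: "'b::real_normed_vector \<Rightarrow> complex^'m::finite"
  assumes w: "holo s (*s) w S" and i: "\<And>x. x \<in> S \<Longrightarrow> w x $ i \<noteq> 0"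
  shows "holo s (*s) (\<lambda>x. aff_map k i (proj_pt (w x))) S"
  unfolding holo_vec_iff
proof
  fix j
  have wj: "holo s (*) (\<lambda>x. w x $ j) S" for j using w by (simp add: holo_vec_iff)
  have "holo s (*) (\<lambda>x. if j = k then 0 else w x $ Transposition.transpose i k j / w x $ i) S"
    by (cases "j = k") (auto intro!: holo_const holo_divide wj i)
  then show "holo s (*) (\<lambda>x. aff_map k i (proj_pt (w x)) $ j) S"
    by (rule holo_cong) (simp add: aff_map_proj_pt i)
qed

lemma openin_proj_cone: "openin proj_topology W \<Longrightarrow> open {v. v \<noteq> 0 \<and> proj_pt v \<in> W}"
  unfolding openin_proj_topology by blast

lemma aff_dom_space: "aff_dom i \<subseteq> proj_space"
  unfolding aff_dom_def proj_space_def by auto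

lemma open_aff_dom: "openin proj_topology (aff_dom i)"
  unfolding openin_proj_topology
proof
  show "aff_dom i \<subseteq> proj_space" by (rule aff_dom_space)
  have "{v. v \<noteq> 0 \<and> proj_pt v \<in> aff_dom i} = {v::complex^'a. v $ i \<noteq> 0}"
    using aff_dom_iff [of _ i] by (auto; metis zero_index)
  moreover have "open {v::complex^'a. v $ i \<noteq> 0}"
    by (intro open_Collect_neq continuous_intros)
  ultimately show "open {v. v \<noteq> 0 \<and> proj_pt v \<in> aff_dom i}" by simp
qed

lemma cmfd_proj: "cmfd proj_topology (proj_atlas (k::'m::finite))"
  unfolding cmfd_def
proof (intro conjI ballI)
  show "(\<Union>(U, \<phi>)\<in>proj_atlas k. U) = topspace proj_topology"
  proof (intro equalityI subsetI)
    fix p :: "(complex^'m) set" assume "p \<in> topspace proj_topology"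
    then obtain v where v: "p = proj_pt v" "v \<noteq> 0" unfolding topspace_proj proj_space_def by blast
    then obtain i where "v $ i \<noteq> 0" by (auto simp: vec_eq_iff)
    then have "p \<in> aff_dom i" using v by (simp add: aff_dom_iff)
    then show "p \<in> (\<Union>(U, \<phi>)\<in>proj_atlas k. U)"
      unfolding proj_atlas_def by (auto simp: affine_chart_eq)
  next
    fix p :: "(complex^'m) set" assume "p \<in> (\<Union>(U, \<phi>)\<in>proj_atlas k. U)"
    then obtain i where "p \<in> aff_dom i" unfolding proj_atlas_def by (auto simp: affine_chart_eq)
    then show "p \<in> topspace proj_topology" unfolding topspace_proj using aff_dom_space by blast
  qed
next
  fix c assume "c \<in> proj_atlas k"
  then obtain i where c: "c = (aff_dom i, aff_map k i)" unfolding proj_atlas_def by (auto simp: affine_chart_eq)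
  have "\<exists>Q. open Q \<and> aff_map k i ` (W \<inter> aff_dom i) = aff_map k i ` aff_dom i \<inter> Q"
    if W: "openin proj_topology W" for W :: "(complex^'m) set set"
  proof (intro exI conjI)
    \<comment> \<open>\<open>aff_lift\<close> is defined and continuous on all of V, so the preimage
      of the open cone over W is an ambient open set cutting out the chart image.\<close>
    let ?Q = "aff_lift k i -` {v. v \<noteq> 0 \<and> proj_pt v \<in> W}"
    show "open ?Q" by (rule open_vimage [OF openin_proj_cone [OF W] continuous_aff_lift])
    show "aff_map k i ` (W \<inter> aff_dom i) = aff_map k i ` aff_dom i \<inter> ?Q"
    proof (intro equalityI subsetI)
      fix x assume "x \<in> aff_map k i ` (W \<inter> aff_dom i)"
      then obtain p where "p \<in> W" "p \<in> aff_dom i" "x = aff_map k i p" by blast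
      then show "x \<in> aff_map k i ` aff_dom i \<inter> ?Q"
        using proj_pt_lift_map [of p i k] aff_lift_nonzero by auto
    next
      fix x assume x: "x \<in> aff_map k i ` aff_dom i \<inter> ?Q"
      then have "x \<in> Cn k" unfolding aff_map_image by blast
      then have "x = aff_map k i (proj_pt (aff_lift k i x))" by (simp add: aff_map_lift)
      then show "x \<in> aff_map k i ` (W \<inter> aff_dom i)" using x aff_lift_in_dom [of k i x] by blast
    qed
  qed
  moreover have "openin proj_topology {p \<in> aff_dom i. aff_map k i p \<in> Q}" if Q: "open Q" for Q
    unfolding openin_proj_topology
  proof
    show "{p \<in> aff_dom i. aff_map k i p \<in> Q} \<subseteq> proj_space"
      using aff_dom_space by blast
    let ?D = "{v::complex^'m. v $ i \<noteq> 0}"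
    have D: "open ?D" by (intro open_Collect_neq continuous_intros)
    have "holo (*s) (*s) (\<lambda>v. aff_map k i (proj_pt v)) ?D"
      by (rule holo_aff_of_lift [of _ "\<lambda>v. v"]) (auto intro: holo_linear)
    then have "open (?D \<inter> (\<lambda>v. aff_map k i (proj_pt v)) -` Q)"
      by (intro continuous_open_preimage [OF holo_continuous_on D Q])
    moreover have "?D \<inter> (\<lambda>v. aff_map k i (proj_pt v)) -` Q = {v. v \<noteq> 0 \<and> proj_pt v \<in> {p \<in> aff_dom i. aff_map k i p \<in> Q}}"
      using aff_dom_iff [of _ i] by (auto; metis zero_index)
    ultimately show "open {v. v \<noteq> 0 \<and> proj_pt v \<in> {p \<in> aff_dom i. aff_map k i p \<in> Q}}" by simp
  qed
  ultimately show "case c of (U, \<phi>) \<Rightarrow> openin proj_topology U \<and> inj_on \<phi> U \<and>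
      (\<forall>W. openin proj_topology W \<longrightarrow> (\<exists>Q. open Q \<and> \<phi> ` (W \<inter> U) = \<phi> ` U \<inter> Q)) \<and>
      (\<forall>Q. open Q \<longrightarrow> openin proj_topology {p \<in> U. \<phi> p \<in> Q})"
    unfolding c prod.case by (intro conjI allI impI open_aff_dom inj_aff_map)
next
  fix c assume "c \<in> proj_atlas k"
  then obtain i where c: "c = (aff_dom i, aff_map k i)" unfolding proj_atlas_def by (auto simp: affine_chart_eq)
  have "holo (*s) (*s) (\<lambda>x. aff_map k j (inv_into (aff_dom i) (aff_map k i) x)) (aff_map k i ` (aff_dom i \<inter> aff_dom j))" for j
  proof -
    let ?S = "aff_map k i ` (aff_dom i \<inter> aff_dom j)"
    have SC: "?S \<subseteq> Cn k" using aff_map_Cn by blast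
    have "holo (*s) (*s) (\<lambda>x. aff_map k j (proj_pt (aff_lift k i x))) ?S"
    proof (rule holo_aff_of_lift [OF holo_aff_lift [OF SC]])
      fix x assume "x \<in> ?S"
      then obtain p where p: "p \<in> aff_dom i" "p \<in> aff_dom j" "x = aff_map k i p" by blast
      then show "aff_lift k i x $ j \<noteq> 0"
        using proj_pt_lift_map [OF p(1), of k] aff_dom_iff [OF aff_lift_nonzero, of k i x j] by simp
    qed
    then show ?thesis by (rule holo_cong) (use SC in \<open>auto simp: inv_aff_map\<close>)
  qed
  then show "case c of (U, \<phi>) \<Rightarrow> \<forall>(W, \<psi>)\<in>proj_atlas k. holo (*s) (*s) (\<lambda>x. \<psi> (inv_into U \<phi> x)) (\<phi> ` (U \<inter> W))"
    unfolding c proj_atlas_def by (auto simp: affine_chart_eq)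
qed

lemma aff_chart_mem: "(aff_dom i, aff_map k i) \<in> proj_atlas k"
  unfolding proj_atlas_def by (metis affine_chart_eq rangeI)

lemma proj_atlas_cases:
  assumes "(W, \<psi>) \<in> proj_atlas k" obtains i where "W = aff_dom i" "\<psi> = aff_map k i"
  using assms unfolding proj_atlas_def by (auto simp: affine_chart_eq)

lemma holo_map_proj_pt:
  fixes w :: "'a \<Rightarrow> complex^'m::finite"
  assumes T: "cmfd T \<Phi>" and S: "openin T S" and w: "\<And>j. holo_fun T \<Phi> S (\<lambda>a. w a $ j)"
    and nz: "\<And>a. a \<in> S \<Longrightarrow> w a \<noteq> 0"
  shows "holo_map T \<Phi> proj_topology (proj_atlas k) S (\<lambda>a. proj_pt (w a))"
proof (rule holo_mapI [OF S])
  have tS: "topspace (subtopology T S) = S" using openin_subset [OF S] by auto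
  show "continuous_map (subtopology T S) proj_topology (\<lambda>a. proj_pt (w a))"
    unfolding continuous_map_def tS
  proof (intro conjI allI impI)
    show "(\<lambda>a. proj_pt (w a)) \<in> S \<rightarrow> topspace proj_topology"
      unfolding topspace_proj using nz proj_pt_in_space by blast
    fix W :: "(complex^'m) set set" assume "openin proj_topology W"
    then have "openin T {a \<in> S. w a \<in> {v. v \<noteq> 0 \<and> proj_pt v \<in> W}}"
      by (intro holo_fun_open_vec [OF T w] openin_proj_cone)
    moreover have "{a \<in> S. w a \<in> {v. v \<noteq> 0 \<and> proj_pt v \<in> W}} = {a \<in> S. proj_pt (w a) \<in> W}" using nz by auto
    ultimately have "openin T (S \<inter> {a \<in> S. proj_pt (w a) \<in> W})" by (simp add: Int_def)
    then have "openin (subtopology T S) (S \<inter> {a \<in> S. proj_pt (w a) \<in> W})"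
      by (metis Int_left_absorb openin_subtopology_Int2 inf_commute)
    then show "openin (subtopology T S) {a \<in> S. proj_pt (w a) \<in> W}" by (simp add: Int_def)
  qed
  fix U \<phi> W \<psi> assume c: "(U, \<phi>) \<in> \<Phi>" "(W, \<psi>) \<in> proj_atlas k"
  obtain i where i: "W = aff_dom i" "\<psi> = aff_map k i" using c(2) by (rule proj_atlas_cases)
  have inj: "inj_on \<phi> U" by (rule cmfdD [OF T c(1)])
  let ?Z = "\<phi> ` {p \<in> S \<inter> U. proj_pt (w p) \<in> W}"
  have "holo (*s) (*s) (\<lambda>x. w (inv_into U \<phi> x)) (\<phi> ` (S \<inter> U))"
    unfolding holo_vec_iff using holo_funD(2) [OF w c(1)] by blast
  then have h: "holo (*s) (*s) (\<lambda>x. w (inv_into U \<phi> x)) ?Z" by (rule holo_subset) auto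
  show "holo (*s) (*s) (\<lambda>x. \<psi> (proj_pt (w (inv_into U \<phi> x)))) ?Z"
    unfolding i(2)
  proof (rule holo_aff_of_lift [OF h])
    fix x assume "x \<in> ?Z"
    then show "w (inv_into U \<phi> x) $ i \<noteq> 0" using inj nz i(1) by (auto simp: aff_dom_iff)
  qed
qed

lemma holo_map_proj_lift:
  fixes F :: "'a \<Rightarrow> (complex^'m::finite) set"
  assumes T: "cmfd T \<Phi>" and F: "holo_map T \<Phi> proj_topology (proj_atlas k) S F" and i: "F ` S \<subseteq> aff_dom i"
  shows "holo_fun T \<Phi> S (\<lambda>a. aff_lift k i (aff_map k i (F a)) $ j)"
proof -
  have S: "openin T S" by (rule holo_mapD [OF F])
  show ?thesis
    by (cases "j = i") (simp_all add: aff_lift_def holo_fun_const [OF S] holo_map_chart_coord [OF F aff_chart_mem i])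
qed

section \<open>Action of the projective linear group\<close>

lemma pgl_of_proj_pt: "v \<noteq> 0 \<Longrightarrow> pgl_of A (proj_pt v) = proj_pt (A *v v)"
proof -
  assume "v \<noteq> 0"
  then have "pgl_of A (proj_pt v) = (*v) A ` proj_pt v" unfolding pgl_of_def by (simp add: proj_pt_in_space)
  also have "\<dots> = proj_pt (A *v v)"
    unfolding proj_pt_eq by (auto simp: image_def vector_scalar_commute [symmetric])
  finally show ?thesis .
qed

lemma matrix_vector_nonzero:
  fixes A :: "complex^'m::finite^'m"
  assumes "invertible A" "v \<noteq> 0" shows "A *v v \<noteq> 0"
  using assms by (metis matrix_inv(2) matrix_vector_mul_assoc matrix_vector_mul_lid matrix_vector_mult_0_right)

lemma holo_map_pgl:
  fixes A :: "complex^'m::finite^'m"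
  assumes A: "invertible A"
  shows "holo_map proj_topology (proj_atlas k) proj_topology (proj_atlas k) proj_space (pgl_of A)"
proof (rule holo_mapI)
  show "openin proj_topology (proj_space :: (complex^'m) set set)"
    using openin_topspace unfolding topspace_proj [symmetric] .
  have lin: "bounded_linear ((*v) A)" by (rule bounded_bilinear.bounded_linear_right [OF bounded_bilinear_matrix_vector_mult])
  show "continuous_map (subtopology proj_topology proj_space) proj_topology (pgl_of A)"
    unfolding topspace_proj [symmetric] subtopology_topspace continuous_map_def
  proof (intro conjI allI impI)
    show "pgl_of A \<in> topspace proj_topology \<rightarrow> topspace proj_topology"
      unfolding topspace_proj proj_space_def by (auto simp: pgl_of_proj_pt matrix_vector_nonzero [OF A])
    fix W :: "(complex^'m) set set" assume W: "openin proj_topology W"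
    show "openin proj_topology {p \<in> topspace proj_topology. pgl_of A p \<in> W}"
      unfolding openin_proj_topology topspace_proj
    proof
      have "{v. v \<noteq> 0 \<and> proj_pt v \<in> {p \<in> proj_space. pgl_of A p \<in> W}}
          = (*v) A -` {v. v \<noteq> 0 \<and> proj_pt v \<in> W}"
      proof -
        have "v \<noteq> 0 \<and> proj_pt v \<in> {p \<in> proj_space. pgl_of A p \<in> W} \<longleftrightarrow> A *v v \<noteq> 0 \<and> proj_pt (A *v v) \<in> W" for v
        proof (cases "v = 0")
          case False
          then show ?thesis
            using matrix_vector_nonzero [OF A False] by (simp add: pgl_of_proj_pt proj_pt_in_space)
        qed simp
        then show ?thesis unfolding vimage_def by simp
      qed
      moreover have "open ((*v) A -` {v. v \<noteq> 0 \<and> proj_pt v \<in> W})"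
        by (rule open_vimage [OF openin_proj_cone [OF W] linear_continuous_on [OF lin]])
      ultimately show "open {v. v \<noteq> 0 \<and> proj_pt v \<in> {p \<in> proj_space. pgl_of A p \<in> W}}" by simp
    qed blast
  qed
  fix U \<phi> W \<psi> assume c: "(U, \<phi>) \<in> proj_atlas k" "(W, \<psi>) \<in> proj_atlas k"
  obtain i j where i: "U = aff_dom i" "\<phi> = aff_map k i" "W = aff_dom j" "\<psi> = aff_map k j"
    using c by (metis proj_atlas_cases)
  let ?Z = "\<phi> ` {p \<in> proj_space \<inter> U. pgl_of A p \<in> W}"
  have ZC: "?Z \<subseteq> Cn k" using aff_map_Cn unfolding i by blast
  have "holo (*s) (*s) (\<lambda>x. aff_map k j (proj_pt (A *v aff_lift k i x))) ?Z"
  proof (rule holo_aff_of_lift)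
    have "holo (*s) (*s) ((*v) A) UNIV"
      by (rule holo_linear [OF lin]) (simp add: vector_scalar_commute)
    then show "holo (*s) (*s) (\<lambda>x. A *v aff_lift k i x) ?Z"
      using holo_compose [OF holo_aff_lift [OF ZC]] by blast
    fix x assume "x \<in> ?Z"
    then obtain p where p: "p \<in> aff_dom i" "x = aff_map k i p" "pgl_of A p \<in> aff_dom j" unfolding i by blast
    then have "pgl_of A (proj_pt (aff_lift k i x)) \<in> aff_dom j" by (simp add: proj_pt_lift_map)
    then show "(A *v aff_lift k i x) $ j \<noteq> 0"
      by (simp add: pgl_of_proj_pt aff_lift_nonzero aff_dom_iff matrix_vector_nonzero [OF A])
  qed
  then show "holo (*s) (*s) (\<lambda>x. \<psi> (pgl_of A (inv_into U \<phi> x))) ?Z"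
    by (rule holo_cong) (use ZC i in \<open>auto simp: inv_aff_map pgl_of_proj_pt aff_lift_nonzero\<close>)
qed

lemma invertible_mult: "invertible A \<Longrightarrow> invertible B \<Longrightarrow> invertible (A ** B)"
  for A B :: "complex^'m::finite^'m"
  unfolding invertible_det_nz by (simp add: det_mul)

lemma invertible_matrix_inv': "invertible A \<Longrightarrow> invertible (matrix_inv A)"
  for A :: "complex^'m::finite^'m"
  using matrix_inv unfolding invertible_def by blast

lemma pgl_of_mult:
  assumes "invertible B" "p \<in> proj_space"
  shows "pgl_of (A ** B) p = pgl_of A (pgl_of B p)"
proof -
  obtain v where "p = proj_pt v" "v \<noteq> 0" using assms(2) unfolding proj_space_def by blast
  then show ?thesis
    using matrix_vector_nonzero [OF assms(1)] by (simp add: pgl_of_proj_pt matrix_vector_mul_assoc)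
qed

lemma pgl_of_one: "p \<in> proj_space \<Longrightarrow> pgl_of (mat 1) p = p"
  unfolding proj_space_def by (auto simp: pgl_of_proj_pt)

lemma pgl_of_space: "invertible A \<Longrightarrow> p \<in> proj_space \<Longrightarrow> pgl_of A p \<in> proj_space"
  unfolding proj_space_def by (auto simp: pgl_of_proj_pt matrix_vector_nonzero)

lemma pgl_of_inv:
  assumes "invertible A" "p \<in> proj_space"
  shows "pgl_of (matrix_inv A) (pgl_of A p) = p" "pgl_of A (pgl_of (matrix_inv A) p) = p"
  using pgl_of_mult [OF assms, of "matrix_inv A"] pgl_of_mult [OF invertible_matrix_inv' [OF assms(1)] assms(2), of A]
  by (simp_all add: matrix_inv [OF assms(1)] pgl_of_one [OF assms(2)])

lemma mat_mult_nth: "(mat c ** B) $ i $ j = c * B $ i $ j" for B :: "complex^'m::finite^'m"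
  by (simp add: matrix_matrix_mult_def mat_def if_distrib if_distribR cong: if_cong)

lemma mat_mult_vec: "(mat c ** B) *v v = c *s (B *v v)" for B :: "complex^'m::finite^'m"
  by (simp add: vec_eq_iff matrix_vector_mult_def mat_mult_nth sum_distrib_left mult.assoc)

lemma pgl_of_scale:
  fixes A :: "complex^'m::finite^'m"
  assumes "c \<noteq> 0" shows "pgl_of (mat c ** A) = pgl_of A"
proof
  fix p
  show "pgl_of (mat c ** A) p = pgl_of A p"
  proof (cases "p \<in> proj_space")
    case True
    then obtain v where "p = proj_pt v" "v \<noteq> 0" unfolding proj_space_def by blast
    then show ?thesis using assms by (simp add: pgl_of_proj_pt mat_mult_vec proj_pt_scale)
  qed (simp add: pgl_of_def)
qed

text \<open>The \<open>2 \<times> 2\<close> minors of \<open>(A x, B x)\<close> are quadratic in \<open>x\<close>, so they vanish identically if they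
  vanish on a nonempty open set.\<close>

lemma pgl_of_agree:
  fixes A B :: "complex^'m::finite^'m"
  assumes A: "invertible A" and B: "invertible B" and W: "openin proj_topology W" "W \<noteq> {}"
    and eq: "\<And>p. p \<in> W \<Longrightarrow> pgl_of A p = pgl_of B p"
  obtains c where "c \<noteq> 0" "A = mat c ** B"
proof -
  let ?S = "{v. v \<noteq> 0 \<and> proj_pt v \<in> W}"
  have S: "open ?S" by (rule openin_proj_cone [OF W(1)])
  obtain x where x: "x \<in> ?S"
    using W openin_proj_topology [of W] unfolding proj_space_def by blast
  define q where "q i j y = (A *v y) $ i * (B *v y) $ j - (A *v y) $ j * (B *v y) $ i" for i j y
  have qS: "q i j v = 0" if "v \<in> ?S" for i j v
  proof -
    have "proj_pt (A *v v) = proj_pt (B *v v)"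
      using eq [of "proj_pt v"] that by (simp add: pgl_of_proj_pt)
    moreover have "A *v v \<noteq> 0" using matrix_vector_nonzero [OF A] that by simp
    ultimately obtain c where "A *v v = c *s (B *v v)" by (rule proj_pt_eqD)
    then show ?thesis by (simp add: q_def)
  qed
  have q0: "q i j y = 0" for i j y
  proof -
    have "continuous_on UNIV (\<lambda>t::real. x + t *\<^sub>R y)" "continuous_on UNIV (\<lambda>t::real. x - t *\<^sub>R y)"
      by (intro continuous_intros)+
    then have "open ((\<lambda>t::real. x + t *\<^sub>R y) -` ?S \<inter> (\<lambda>t::real. x - t *\<^sub>R y) -` ?S)"
      by (intro open_Int open_vimage S)
    moreover have "0 \<in> (\<lambda>t::real. x + t *\<^sub>R y) -` ?S \<inter> (\<lambda>t::real. x - t *\<^sub>R y) -` ?S" using x by simp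
    ultimately obtain e where e: "0 < e" "ball 0 e \<subseteq> (\<lambda>t::real. x + t *\<^sub>R y) -` ?S \<inter> (\<lambda>t::real. x - t *\<^sub>R y) -` ?S"
      by (rule openE)
    define t where "t = e / 2"
    have t: "t \<noteq> 0" "t \<in> ball 0 e" using e(1) by (auto simp: t_def)
    have "x + t *\<^sub>R y \<in> ?S" "x - t *\<^sub>R y \<in> ?S" using subsetD [OF e(2) t(2)] by auto
    then have "q i j (x + t *\<^sub>R y) + q i j (x - t *\<^sub>R y) - 2 * q i j x = 0" using qS x by simp
    \<comment> \<open>The second difference isolates the quadratic form: q vanishes at x and at the
      two shifted points, hence at y.\<close>
    moreover have "q i j (x + t *\<^sub>R y) + q i j (x - t *\<^sub>R y) - 2 * q i j x = 2 * (of_real t)\<^sup>2 * q i j y"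
    proof -
      have l: "(M *v (x + t *\<^sub>R y)) $ l = (M *v x) $ l + of_real t * (M *v y) $ l"
        "(M *v (x - t *\<^sub>R y)) $ l = (M *v x) $ l - of_real t * (M *v y) $ l" for M :: "complex^'m^'m" and l
        by (simp_all add: matrix_vector_bilinear_simps bounded_bilinear.scaleR_right [OF bounded_bilinear_matrix_vector_mult])
          (simp_all add: scaleR_conv_of_real)
      show ?thesis unfolding q_def l by (simp add: algebra_simps power2_eq_square)
    qed
    ultimately show ?thesis using t(1) by simp
  qed
  \<comment> \<open>Vanishing of all minors says that every vector is an eigenvector of M. Testing
    on an axis and on sums of two axes shows that M is scalar.\<close>
  define M where "M = A ** matrix_inv B"
  have AM: "A = M ** B" unfolding M_def by (simp add: matrix_mul_assoc [symmetric] matrix_inv [OF B])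
  have qM: "(M *v z) $ i * z $ j = (M *v z) $ j * z $ i" for z i j
    using q0 [of i j "matrix_inv B *v z"] unfolding q_def M_def
    by (simp add: matrix_vector_mul_assoc matrix_inv [OF B])
  have Mv: "(M *v axis j 1) $ i = M $ i $ j" for i j
    by (simp add: matrix_vector_mult_def axis_def if_distrib cong: if_cong)
  have off: "M $ i $ j = 0" if "i \<noteq> j" for i j
    using qM [of "axis j 1" i j] that unfolding Mv by (simp add: axis_def)
  have diag: "M $ i $ i = M $ j $ j" if "i \<noteq> j" for i j
    using qM [of "axis i 1 + axis j 1" i j] that off
    by (simp add: matrix_vector_bilinear_simps Mv) (simp add: axis_def)
  \<comment> \<open>All diagonal entries agree, so any index serves.\<close>
  define c where "c = M $ undefined $ undefined"
  have Mc: "M = mat c"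
    unfolding vec_eq_iff mat_def c_def
  proof (intro allI)
    fix i j
    show "M $ i $ j = (\<chi> i j. if i = j then M $ undefined $ undefined else 0) $ i $ j"
      using off [of i j] diag [of i undefined] by (cases "i = undefined") auto
  qed
  have "c \<noteq> 0"
  proof
    assume "c = 0"
    then have "A = 0" using AM Mc by (simp add: vec_eq_iff mat_mult_nth)
    moreover have "A *v axis undefined 1 \<noteq> 0" by (rule matrix_vector_nonzero [OF A]) (simp add: axis_eq_0_iff)
    ultimately show False by simp
  qed
  then show thesis using AM Mc that by blast
qed

lemma pgl_of_agree_eq:
  fixes A B :: "complex^'m::finite^'m"
  assumes "invertible A" "invertible B" "openin proj_topology W" "W \<noteq> {}" "\<And>p. p \<in> W \<Longrightarrow> pgl_of A p = pgl_of B p"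
  shows "pgl_of A = pgl_of B"
  using pgl_of_agree [OF assms] pgl_of_scale by metis

section \<open>Complex Lie groups in coordinates at the unit\<close>

locale clg =
  fixes k :: "'m::finite"
    and L :: "('a, 'b) monoid_scheme" (structure)
    and T :: "'a topology"
    and \<Phi> :: "('a, complex^'m) chart set"
  assumes clg: "complex_lie_group k L T \<Phi>"
begin

lemma L_group: "group L"
  using clg unfolding complex_lie_group_def by blast

sublocale group L by (rule L_group)

lemma carrier_top: "carrier L = topspace T"
  using clg unfolding complex_lie_group_def by blast

lemma mfd: "complex_manifold k T \<Phi>"
  using clg unfolding complex_lie_group_def by blast

lemma cT: "cmfd T \<Phi>"
  by (rule complex_manifold_cmfd [OF mfd])

abbreviation "hfun \<equiv> holo_fun T \<Phi>"
abbreviation "pchart \<equiv> proj_chart k T \<Phi>"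
abbreviation "IFPSs \<equiv> complex_IFPSs k L T \<Phi>"
abbreviation "induces \<equiv> induces_rep k L T \<Phi>"
abbreviation "LA \<equiv> lie_algebra_of L T \<Phi>"

lemma open_carrier: "openin T S \<Longrightarrow> S \<subseteq> carrier L"
  using openin_subset unfolding carrier_top by blast

lemma mult_cont: "continuous_map (prod_topology T T) T (\<lambda>(a, b). a \<otimes> b)"
  using clg unfolding complex_lie_group_def by blast

lemma mult_holo:
  assumes "(U, \<phi>) \<in> \<Phi>" "(W, \<psi>) \<in> \<Phi>" "(Z, \<zeta>) \<in> \<Phi>"
  shows "holo pair_scale (*s) (\<lambda>(x, y). \<zeta> (inv_into U \<phi> x \<otimes> inv_into W \<psi> y))
      {(\<phi> a, \<psi> b) | a b. a \<in> U \<and> b \<in> W \<and> a \<otimes> b \<in> Z}"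
proof -
  have "\<forall>(U, \<phi>)\<in>\<Phi>. \<forall>(W, \<psi>)\<in>\<Phi>. \<forall>(Z, \<zeta>)\<in>\<Phi>.
        holo pair_scale (*s)
          (\<lambda>(x, y). \<zeta> (inv_into U \<phi> x \<otimes> inv_into W \<psi> y))
          {(\<phi> a, \<psi> b) | a b. a \<in> U \<and> b \<in> W \<and> a \<otimes> b \<in> Z}"
    using clg unfolding complex_lie_group_def by (elim conjE)
  from bspec [OF this assms(1)]
  have "\<forall>(W, \<psi>)\<in>\<Phi>. \<forall>(Z, \<zeta>)\<in>\<Phi>.
        holo pair_scale (*s)
          (\<lambda>(x, y). \<zeta> (inv_into U \<phi> x \<otimes> inv_into W \<psi> y))
          {(\<phi> a, \<psi> b) | a b. a \<in> U \<and> b \<in> W \<and> a \<otimes> b \<in> Z}" unfolding prod.case .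
  from bspec [OF this assms(2)]
  have "\<forall>(Z, \<zeta>)\<in>\<Phi>.
        holo pair_scale (*s)
          (\<lambda>(x, y). \<zeta> (inv_into U \<phi> x \<otimes> inv_into W \<psi> y))
          {(\<phi> a, \<psi> b) | a b. a \<in> U \<and> b \<in> W \<and> a \<otimes> b \<in> Z}" unfolding prod.case .
  from bspec [OF this assms(3)] show ?thesis unfolding prod.case .
qed

lemma mult_near:
  assumes p: "p \<in> carrier L" "q \<in> carrier L" and W: "openin T W" "p \<otimes> q \<in> W"
  obtains N M where "openin T N" "p \<in> N" "openin T M" "q \<in> M" "\<And>a b. a \<in> N \<Longrightarrow> b \<in> M \<Longrightarrow> a \<otimes> b \<in> W"
proof -
  let ?S = "{x \<in> topspace (prod_topology T T). (case x of (a, b) \<Rightarrow> a \<otimes> b) \<in> W}"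
  have "openin (prod_topology T T) ?S"
    using mult_cont W(1) unfolding continuous_map_def by blast
  moreover have "(p, q) \<in> ?S" using p W(2) carrier_top by simp
  ultimately obtain N M where "openin T N" "openin T M" "p \<in> N" "q \<in> M" "N \<times> M \<subseteq> ?S"
    unfolding openin_prod_topology_alt by meson
  then show thesis by (intro that [of N M]) auto
qed

lemma holo_left:
  assumes a: "a \<in> carrier L"
  shows "holo_map T \<Phi> T \<Phi> (topspace T) (\<lambda>x. a \<otimes> x)"
proof (rule holo_mapI)
  show "openin T (topspace T)" by simp
  have "continuous_map T (prod_topology T T) (\<lambda>x. (a, x))"
    using a carrier_top by (intro continuous_map_pairedI) auto
  from continuous_map_compose [OF this mult_cont]
  show "continuous_map (subtopology T (topspace T)) T (\<lambda>x. a \<otimes> x)" by (simp add: o_def)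
  fix U \<phi> W \<psi> assume c: "(U, \<phi>) \<in> \<Phi>" "(W, \<psi>) \<in> \<Phi>"
  obtain V \<zeta> where V: "(V, \<zeta>) \<in> \<Phi>" "a \<in> V" using cmfd_cover [OF cT] a carrier_top by metis
  have inj: "inj_on \<phi> U" "inj_on \<zeta> V" by (rule cmfdD [OF cT c(1)], rule cmfdD [OF cT V(1)])
  let ?Z = "\<phi> ` {p \<in> topspace T \<inter> U. a \<otimes> p \<in> W}"
  have "holo (*s) pair_scale (\<lambda>x. (\<zeta> a, x)) ?Z"
    unfolding holo_def
    by (intro ballI exI [where x="\<lambda>v. (0, v)"] conjI allI has_derivative_Pair has_derivative_ident has_derivative_const)
       (simp add: pair_scale_def)
  from holo_compose [OF this mult_holo [OF V(1) c]]
  have "holo (*s) (*s) (\<lambda>x. \<psi> (inv_into V \<zeta> (\<zeta> a) \<otimes> inv_into U \<phi> x)) ?Z" using V(2) by auto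
  then show "holo (*s) (*s) (\<lambda>x. \<psi> (a \<otimes> inv_into U \<phi> x)) ?Z" using inj V(2) by simp
qed

lemma holo_right:
  assumes a: "a \<in> carrier L"
  shows "holo_map T \<Phi> T \<Phi> (topspace T) (\<lambda>x. x \<otimes> a)"
proof (rule holo_mapI)
  show "openin T (topspace T)" by simp
  have "continuous_map T (prod_topology T T) (\<lambda>x. (x, a))"
    using a carrier_top by (intro continuous_map_pairedI) auto
  from continuous_map_compose [OF this mult_cont]
  show "continuous_map (subtopology T (topspace T)) T (\<lambda>x. x \<otimes> a)" by (simp add: o_def)
  fix U \<phi> W \<psi> assume c: "(U, \<phi>) \<in> \<Phi>" "(W, \<psi>) \<in> \<Phi>"
  obtain V \<zeta> where V: "(V, \<zeta>) \<in> \<Phi>" "a \<in> V" using cmfd_cover [OF cT] a carrier_top by metis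
  have inj: "inj_on \<phi> U" "inj_on \<zeta> V" by (rule cmfdD [OF cT c(1)], rule cmfdD [OF cT V(1)])
  let ?Z = "\<phi> ` {p \<in> topspace T \<inter> U. p \<otimes> a \<in> W}"
  have "holo (*s) pair_scale (\<lambda>x. (x, \<zeta> a)) ?Z"
    unfolding holo_def
    by (intro ballI exI [where x="\<lambda>v. (v, 0)"] conjI allI has_derivative_Pair has_derivative_ident has_derivative_const)
       (simp add: pair_scale_def)
  from holo_compose [OF this mult_holo [OF c(1) V(1) c(2)]]
  have "holo (*s) (*s) (\<lambda>x. \<psi> (inv_into U \<phi> x \<otimes> inv_into V \<zeta> (\<zeta> a))) ?Z" using V(2) by auto
  then show "holo (*s) (*s) (\<lambda>x. \<psi> (inv_into U \<phi> x \<otimes> a)) ?Z" using inj V(2) by simp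
qed

lemma open_left:
  assumes a: "a \<in> carrier L" and S: "openin T S"
  shows "openin T {x \<in> carrier L. a \<otimes> x \<in> S}"
  using holo_map_openin [OF holo_left [OF a] S] by (simp add: carrier_top)

lemma open_translate:
  assumes a: "a \<in> carrier L" and S: "openin T S"
  shows "openin T ((\<lambda>x. a \<otimes> x) ` S)"
proof -
  have "(\<lambda>x. a \<otimes> x) ` S = {x \<in> carrier L. inv a \<otimes> x \<in> S}"
  proof (intro equalityI subsetI)
    fix y assume "y \<in> (\<lambda>x. a \<otimes> x) ` S"
    then obtain x where "x \<in> S" "y = a \<otimes> x" by blast
    then show "y \<in> {x \<in> carrier L. inv a \<otimes> x \<in> S}"
      using a open_carrier [OF S] by (auto simp: m_assoc [symmetric])
  next
    fix y assume y: "y \<in> {x \<in> carrier L. inv a \<otimes> x \<in> S}"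
    then have "y = a \<otimes> (inv a \<otimes> y)" using a by (simp add: m_assoc [symmetric])
    then show "y \<in> (\<lambda>x. a \<otimes> x) ` S" using y by blast
  qed
  then show ?thesis using open_left [OF inv_closed [OF a] S] by simp
qed

text \<open>Composition with \<open>pr\<close> extends a function on the hyperplane to one on an
  open subset of V that is constant in direction k, so that ordinary derivatives replace derivatives
  within the hyperplane.\<close>

definition pr :: "complex^'m \<Rightarrow> complex^'m" where
  "pr x = (\<chi> j. if j = k then 0 else x $ j)"

lemma pr_nth: "pr x $ j = (if j = k then 0 else x $ j)"
  by (simp add: pr_def)

lemma pr_Cn: "pr x \<in> Cn k"
  by (simp add: pr_def Cn_def)

lemma pr_id: "x \<in> Cn k \<Longrightarrow> pr x = x"
  by (auto simp: pr_def Cn_def vec_eq_iff)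

lemma pr_pr [simp]: "pr (pr x) = pr x"
  by (rule pr_id [OF pr_Cn])

lemma pr_0 [simp]: "pr 0 = 0"
  by (simp add: pr_def vec_eq_iff)

lemma pr_scale: "pr (c *s x) = c *s pr x"
  by (simp add: pr_def vec_eq_iff)

lemma pr_add: "pr (x + y) = pr x + pr y"
  by (simp add: pr_def vec_eq_iff)

lemma norm_pr: "norm (pr x) \<le> norm x"
  unfolding norm_vec_def by (rule L2_set_mono) (auto simp: pr_def)

lemma bounded_linear_pr: "bounded_linear pr"
  by (rule bounded_linear_intro [where K=1]) (simp_all add: norm_pr pr_add, simp add: pr_def vec_eq_iff)

lemma pr_ball: "x \<in> ball 0 r \<Longrightarrow> pr x \<in> ball 0 r"
  using norm_pr [of x] by simp

lemma Cn_diff: "x \<in> Cn k \<Longrightarrow> y \<in> Cn k \<Longrightarrow> x - y \<in> Cn k"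
  "x \<in> Cn k \<Longrightarrow> y \<in> Cn k \<Longrightarrow> x + y \<in> Cn k"
  by (auto simp: Cn_def)

lemma chart_Cn:
  assumes "(U, \<phi>) \<in> \<Phi>"
  shows "\<exists>Q. open Q \<and> \<phi> ` U = Cn k \<inter> Q"
proof -
  have "\<forall>(U, \<phi>)\<in>\<Phi>. openin T U \<and> openin (top_of_set (Cn k)) (\<phi> ` U) \<and>
        homeomorphic_map (subtopology T U) (top_of_set (\<phi> ` U)) \<phi>"
    using mfd unfolding complex_manifold_def by (elim conjE)
  from bspec [OF this assms] show ?thesis by (auto simp: openin_open)
qed

end

section \<open>Coordinates centred at the unit, thickened in direction k\<close>

locale clg_chart = clg k L T \<Phi>
  for k :: "'m::finite" and L :: "('a, 'b) monoid_scheme" (structure)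
    and T :: "'a topology" and \<Phi> :: "('a, complex^'m) chart set" +
  fixes U0 and \<phi>0 :: "'a \<Rightarrow> complex^'m"
  assumes U0: "(U0, \<phi>0) \<in> \<Phi>" and one_U0: "\<one> \<in> U0"
begin

text \<open>\<open>\<kappa>\<close> is the given chart shifted so that the unit has coordinate 0.
  \<open>\<sigma>\<close> is its inverse composed with \<open>pr\<close>, hence lives on an open
  subset of V and is constant in direction k; instead of being mutually inverse they satisfy
  \<open>\<kappa> (\<sigma> x) = pr x\<close>.\<close>

definition \<Omega>0 :: "(complex^'m) set" where
  "\<Omega>0 = {x. pr x + \<phi>0 \<one> \<in> \<phi>0 ` U0}"

definition \<sigma> :: "complex^'m \<Rightarrow> 'a" where
  "\<sigma> x = inv_into U0 \<phi>0 (pr x + \<phi>0 \<one>)"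

definition \<kappa> :: "'a \<Rightarrow> complex^'m" where
  "\<kappa> a = \<phi>0 a - \<phi>0 \<one>"

lemma open_U0: "openin T U0" and inj_\<phi>0: "inj_on \<phi>0 U0"
  by (rule cmfdD [OF cT U0])+

lemma \<phi>0_Cn: "a \<in> U0 \<Longrightarrow> \<phi>0 a \<in> Cn k"
  using chart_Cn [OF U0] by blast

lemma \<kappa>_Cn: "a \<in> U0 \<Longrightarrow> \<kappa> a \<in> Cn k"
  unfolding \<kappa>_def using \<phi>0_Cn one_U0 Cn_diff(1) by blast

lemma \<kappa>_one: "\<kappa> \<one> = 0"
  by (simp add: \<kappa>_def)

lemma \<kappa>_\<Omega>0: "a \<in> U0 \<Longrightarrow> \<kappa> a \<in> \<Omega>0"
  unfolding \<Omega>0_def using pr_id [OF \<kappa>_Cn] by (simp add: \<kappa>_def)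

lemma \<sigma>_\<kappa>: "a \<in> U0 \<Longrightarrow> \<sigma> (\<kappa> a) = a"
  unfolding \<sigma>_def using pr_id [OF \<kappa>_Cn] inj_\<phi>0 by (simp add: \<kappa>_def)

lemma \<sigma>_U0: "x \<in> \<Omega>0 \<Longrightarrow> \<sigma> x \<in> U0"
  unfolding \<sigma>_def \<Omega>0_def by (simp add: inv_into_into)

lemma \<kappa>_\<sigma>: "x \<in> \<Omega>0 \<Longrightarrow> \<kappa> (\<sigma> x) = pr x"
  unfolding \<sigma>_def \<Omega>0_def \<kappa>_def by (simp add: f_inv_into_f)

lemma zero_\<Omega>0: "0 \<in> \<Omega>0"
  using \<kappa>_\<Omega>0 [OF one_U0] by (simp add: \<kappa>_one)

lemma \<sigma>_0: "\<sigma> 0 = \<one>"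
  using \<sigma>_\<kappa> [OF one_U0] by (simp add: \<kappa>_one)

lemma \<sigma>_pr: "\<sigma> (pr x) = \<sigma> x"
  by (simp add: \<sigma>_def)

lemma \<sigma>_carrier: "x \<in> \<Omega>0 \<Longrightarrow> \<sigma> x \<in> carrier L"
  using \<sigma>_U0 open_carrier [OF open_U0] by blast

lemma continuous_shift: "continuous_on UNIV (\<lambda>x. pr x + \<phi>0 \<one>)"
  by (intro continuous_intros linear_continuous_on bounded_linear_pr)

lemma open_\<sigma>:
  assumes S: "openin T S"
  shows "open {x \<in> \<Omega>0. \<sigma> x \<in> S}"
proof -
  obtain Q where Q: "open Q" "\<phi>0 ` U0 = Cn k \<inter> Q" using chart_Cn [OF U0] by blast
  obtain Q' where Q': "open Q'" "\<phi>0 ` (S \<inter> U0) = \<phi>0 ` U0 \<inter> Q'" using cmfdD(3) [OF cT U0 S] by blast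
  have "{x \<in> \<Omega>0. \<sigma> x \<in> S} = (\<lambda>x. pr x + \<phi>0 \<one>) -` (Q \<inter> Q')"
  proof (intro equalityI subsetI)
    fix x assume x: "x \<in> {x \<in> \<Omega>0. \<sigma> x \<in> S}"
    then have "pr x + \<phi>0 \<one> = \<phi>0 (\<sigma> x)" "\<sigma> x \<in> S \<inter> U0"
      using \<sigma>_U0 unfolding \<sigma>_def \<Omega>0_def by (auto simp: f_inv_into_f)
    then have "pr x + \<phi>0 \<one> \<in> \<phi>0 ` (S \<inter> U0)" by auto
    then show "x \<in> (\<lambda>x. pr x + \<phi>0 \<one>) -` (Q \<inter> Q')" unfolding Q'(2) Q(2) by blast
  next
    fix x assume x: "x \<in> (\<lambda>x. pr x + \<phi>0 \<one>) -` (Q \<inter> Q')"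
    have "pr x + \<phi>0 \<one> \<in> Cn k" by (intro Cn_diff(2) pr_Cn \<phi>0_Cn one_U0)
    then have "pr x + \<phi>0 \<one> \<in> \<phi>0 ` (S \<inter> U0)" unfolding Q'(2) Q(2) using x by blast
    then obtain a where "a \<in> S" "a \<in> U0" "pr x + \<phi>0 \<one> = \<phi>0 a" by blast
    then show "x \<in> {x \<in> \<Omega>0. \<sigma> x \<in> S}" unfolding \<Omega>0_def \<sigma>_def using inj_\<phi>0 by simp
  qed
  moreover have "open ((\<lambda>x. pr x + \<phi>0 \<one>) -` (Q \<inter> Q'))"
    by (intro open_vimage open_Int Q(1) Q'(1) continuous_shift)
  ultimately show ?thesis by simp
qed

lemma open_\<Omega>0: "open \<Omega>0"
proof -
  have "{x \<in> \<Omega>0. \<sigma> x \<in> U0} = \<Omega>0" using \<sigma>_U0 by blast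
  then show ?thesis using open_\<sigma> [OF open_U0] by simp
qed

lemma nbhd_ball:
  assumes "openin T S" "\<one> \<in> S"
  obtains r where "0 < r" "ball 0 r \<subseteq> \<Omega>0" "\<sigma> ` ball 0 r \<subseteq> S"
proof -
  have "0 \<in> {x \<in> \<Omega>0. \<sigma> x \<in> S}" using zero_\<Omega>0 \<sigma>_0 assms(2) by simp
  then obtain r where "0 < r" "ball 0 r \<subseteq> {x \<in> \<Omega>0. \<sigma> x \<in> S}" by (rule openE [OF open_\<sigma> [OF assms(1)]])
  then show thesis using that by blast
qed

definition nb :: "real \<Rightarrow> 'a set" where
  "nb r = {a \<in> U0. \<kappa> a \<in> ball 0 r}"

lemma open_\<kappa>: "open Q \<Longrightarrow> openin T {a \<in> U0. \<kappa> a \<in> Q}"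
proof -
  assume Q: "open Q"
  have "open ((\<lambda>x. x - \<phi>0 \<one>) -` Q)" by (intro open_vimage Q continuous_intros)
  from cmfdD(4) [OF cT U0 this] show ?thesis by (simp add: \<kappa>_def)
qed

lemma open_nb: "openin T (nb r)"
  unfolding nb_def by (rule open_\<kappa>) simp

lemma one_nb: "0 < r \<Longrightarrow> \<one> \<in> nb r"
  unfolding nb_def using one_U0 by (simp add: \<kappa>_one)

lemma nb_image:
  assumes "ball 0 r \<subseteq> \<Omega>0"
  shows "nb r = \<sigma> ` ball 0 r"
proof (intro equalityI subsetI)
  fix a assume "a \<in> nb r"
  then show "a \<in> \<sigma> ` ball 0 r" unfolding nb_def using \<sigma>_\<kappa> [of a] by (metis (no_types, lifting) image_eqI mem_Collect_eq)
next
  fix a assume "a \<in> \<sigma> ` ball 0 r"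
  then obtain x where x: "x \<in> ball 0 r" "a = \<sigma> x" by blast
  then have "x \<in> \<Omega>0" using assms by blast
  then show "a \<in> nb r" unfolding nb_def using x \<sigma>_U0 \<kappa>_\<sigma> pr_ball by simp
qed

lemma continuous_\<sigma>: "continuous_map (top_of_set \<Omega>0) T \<sigma>"
  unfolding continuous_map_def
proof (intro conjI allI impI)
  show "\<sigma> \<in> topspace (top_of_set \<Omega>0) \<rightarrow> topspace T"
    using \<sigma>_carrier by (auto simp: carrier_top)
  fix S assume "openin T S"
  then have "open {x \<in> \<Omega>0. \<sigma> x \<in> S}" by (rule open_\<sigma>)
  then show "openin (top_of_set \<Omega>0) {x \<in> topspace (top_of_set \<Omega>0). \<sigma> x \<in> S}"
    by (simp add: openin_open_eq [OF open_\<Omega>0])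
qed

lemma connected_nb:
  assumes "ball 0 r \<subseteq> \<Omega>0"
  shows "connectedin T (nb r)"
  unfolding nb_image [OF assms]
proof (rule connectedin_continuous_map_image [OF continuous_\<sigma>])
  show "connectedin (top_of_set \<Omega>0) (ball 0 r)"
    using assms by (simp add: connectedin_subtopology)
qed

lemma nbhd_nb:
  assumes "openin T S" "\<one> \<in> S"
  obtains r where "0 < r" "ball 0 r \<subseteq> \<Omega>0" "nb r \<subseteq> S"
proof -
  obtain r where r: "0 < r" "ball 0 r \<subseteq> \<Omega>0" "\<sigma> ` ball 0 r \<subseteq> S"
    by (rule nbhd_ball [OF assms])
  then have "nb r \<subseteq> S" using nb_image [OF r(2)] by blast
  then show thesis using that r by blast
qed

text \<open>The coordinate balls \<open>nb r\<close> are connected as images of balls, and left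
  translation transports them from the unit to any point.\<close>

lemma connected_nbhd:
  assumes S: "openin T S" and p: "p \<in> S"
  obtains O' where "openin T O'" "connectedin T O'" "p \<in> O'" "O' \<subseteq> S"
proof -
  have pc: "p \<in> carrier L" using open_carrier [OF S] p by blast
  obtain r where r: "0 < r" "ball 0 r \<subseteq> \<Omega>0" "nb r \<subseteq> {x \<in> carrier L. p \<otimes> x \<in> S}"
    by (rule nbhd_nb [OF open_left [OF pc S]]) (use pc p in auto)
  have "continuous_map T T (\<lambda>x. p \<otimes> x)" using holo_mapD(2) [OF holo_left [OF pc]] by simp
  then have "connectedin T ((\<lambda>x. p \<otimes> x) ` nb r)"
    by (rule connectedin_continuous_map_image [OF _ connected_nb [OF r(2)]])
  moreover have "p \<in> (\<lambda>x. p \<otimes> x) ` nb r" using one_nb [OF r(1)] pc by (force intro: image_eqI [of _ _ \<one>])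
  ultimately show thesis
    using that [OF open_translate [OF pc open_nb]] r(3) by blast
qed

lemma holo_shift: "holo (*s) (*s) (\<lambda>x. pr x + \<phi>0 \<one>) S"
  unfolding holo_def
proof (intro ballI exI [where x=pr] conjI allI pr_scale)
  fix x
  show "((\<lambda>x. pr x + \<phi>0 \<one>) has_derivative pr) (at x within S)"
    using has_derivative_add_const [OF bounded_linear_imp_has_derivative [OF bounded_linear_pr]] .
qed

lemma holo_pull:
  assumes "hfun S g"
  shows "holo (*s) (*) (\<lambda>x. g (\<sigma> x)) {x \<in> \<Omega>0. \<sigma> x \<in> S}"
  unfolding \<sigma>_def
proof (rule holo_compose [OF holo_shift holo_funD(2) [OF assms U0]])
  show "(\<lambda>x. pr x + \<phi>0 \<one>) ` {x \<in> \<Omega>0. inv_into U0 \<phi>0 (pr x + \<phi>0 \<one>) \<in> S} \<subseteq> \<phi>0 ` (S \<inter> U0)"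
  proof
    fix y assume "y \<in> (\<lambda>x. pr x + \<phi>0 \<one>) ` {x \<in> \<Omega>0. inv_into U0 \<phi>0 (pr x + \<phi>0 \<one>) \<in> S}"
    then have "y \<in> \<phi>0 ` U0" "inv_into U0 \<phi>0 y \<in> S" unfolding \<Omega>0_def by auto
    then show "y \<in> \<phi>0 ` (S \<inter> U0)" by (intro image_eqI [of _ _ "inv_into U0 \<phi>0 y"]) (auto simp: f_inv_into_f inv_into_into)
  qed
qed

lemma holo_push:
  assumes G: "holo (*s) (*) G Q" and Q: "open Q"
  shows "hfun {a \<in> U0. \<kappa> a \<in> Q} (\<lambda>a. G (\<kappa> a))"
proof (rule holo_funI [OF open_\<kappa> [OF Q]])
  fix U \<phi> assume c: "(U, \<phi>) \<in> \<Phi>"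
  have inj: "inj_on \<phi> U" by (rule cmfdD [OF cT c])
  let ?S = "\<phi> ` ({a \<in> U0. \<kappa> a \<in> Q} \<inter> U)"
  have "holo (*s) (*s) (\<lambda>x. \<phi>0 (inv_into U \<phi> x)) ?S"
    by (rule holo_subset [OF cmfdD(5) [OF cT c U0]]) auto
  then have "holo (*s) (*s) (\<lambda>x. \<kappa> (inv_into U \<phi> x)) ?S"
    unfolding holo_vec_iff \<kappa>_def by (auto intro: holo_diff holo_const)
  then show "holo (*s) (*) (\<lambda>x. G (\<kappa> (inv_into U \<phi> x))) ?S"
    by (rule holo_compose [OF _ G]) (use inj in auto)
qed

lemma holo_fun_\<kappa>: "hfun U0 (\<lambda>a. \<kappa> a $ j)"
  using holo_push [OF holo_nth open_UNIV] by simp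

section \<open>Germs of holomorphic functions at the unit\<close>

abbreviation hn :: "('a \<Rightarrow> complex) set" where
  "hn \<equiv> holo_near T \<Phi> \<one>"

lemma hnI: "hfun S g \<Longrightarrow> \<one> \<in> S \<Longrightarrow> g \<in> hn"
  unfolding holo_near_def by blast

lemma hn_ball:
  assumes "g \<in> hn"
  obtains r where "0 < r" "ball 0 r \<subseteq> \<Omega>0" "holo (*s) (*) (\<lambda>x. g (\<sigma> x)) (ball 0 r)" "hfun (nb r) g"
proof -
  obtain S where S: "\<one> \<in> S" "hfun S g" using assms unfolding holo_near_def by blast
  obtain r where r: "0 < r" "ball 0 r \<subseteq> \<Omega>0" "\<sigma> ` ball 0 r \<subseteq> S"
    by (rule nbhd_ball [OF holo_funD(1) [OF S(2)] S(1)])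
  show thesis
  proof (rule that [OF r(1,2)])
    show "holo (*s) (*) (\<lambda>x. g (\<sigma> x)) (ball 0 r)"
      by (rule holo_subset [OF holo_pull [OF S(2)]]) (use r in blast)
    show "hfun (nb r) g"
      by (rule holo_fun_subset [OF S(2) open_nb]) (use r nb_image in auto)
  qed
qed

lemma hn_of_ball:
  assumes "0 < r" "holo (*s) (*) G (ball 0 r)" "\<And>a. a \<in> nb r \<Longrightarrow> g a = G (\<kappa> a)"
  shows "g \<in> hn"
proof (rule hnI [OF _ one_nb [OF assms(1)]])
  have "hfun (nb r) (\<lambda>a. G (\<kappa> a))" unfolding nb_def by (rule holo_push [OF assms(2)]) simp
  then show "hfun (nb r) g" by (rule holo_fun_cong [OF cT]) (simp add: assms(3))
qed

lemma hn_dd: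
  assumes "g \<in> hn"
  shows "((\<lambda>x. g (\<sigma> x)) has_derivative dd (\<lambda>x. g (\<sigma> x)) 0) (at 0)"
    "dd (\<lambda>x. g (\<sigma> x)) 0 (c *s v) = c * dd (\<lambda>x. g (\<sigma> x)) 0 v"
proof -
  obtain r where r: "0 < r" "holo (*s) (*) (\<lambda>x. g (\<sigma> x)) (ball 0 r)" by (rule hn_ball [OF assms])
  show "((\<lambda>x. g (\<sigma> x)) has_derivative dd (\<lambda>x. g (\<sigma> x)) 0) (at 0)"
    "dd (\<lambda>x. g (\<sigma> x)) 0 (c *s v) = c * dd (\<lambda>x. g (\<sigma> x)) 0 v"
    by (rule holo_dd [OF r(2) open_ball]; use r(1) in simp)+
qed

lemma hn_const: "(\<lambda>a. c) \<in> hn"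
  by (rule hnI [OF holo_fun_const [OF open_U0] one_U0])

lemma hn_add: "g \<in> hn \<Longrightarrow> h \<in> hn \<Longrightarrow> (\<lambda>a. g a + h a) \<in> hn"
  and hn_diff: "g \<in> hn \<Longrightarrow> h \<in> hn \<Longrightarrow> (\<lambda>a. g a - h a) \<in> hn"
  and hn_mult: "g \<in> hn \<Longrightarrow> h \<in> hn \<Longrightarrow> (\<lambda>a. g a * h a) \<in> hn"
proof -
  assume "g \<in> hn" "h \<in> hn"
  then obtain S S' where S: "\<one> \<in> S" "hfun S g" "\<one> \<in> S'" "hfun S' h"
    unfolding holo_near_def by blast
  have o: "openin T (S \<inter> S')" by (intro openin_Int holo_funD(1) [OF S(2)] holo_funD(1) [OF S(4)])
  have "hfun (S \<inter> S') g" "hfun (S \<inter> S') h"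
    by (rule holo_fun_subset [OF S(2) o], blast, rule holo_fun_subset [OF S(4) o], blast)
  then show "(\<lambda>a. g a + h a) \<in> hn" "(\<lambda>a. g a - h a) \<in> hn" "(\<lambda>a. g a * h a) \<in> hn"
    using S(1,3) by (blast intro: hnI holo_fun_add holo_fun_diff holo_fun_mult)+
qed

lemma hn_cmult: "g \<in> hn \<Longrightarrow> (\<lambda>a. c * g a) \<in> hn"
  by (rule hn_mult [OF hn_const])

lemma hn_sum: "(\<And>i. i \<in> I \<Longrightarrow> g i \<in> hn) \<Longrightarrow> (\<lambda>a. \<Sum>i\<in>I. g i a) \<in> hn"
  by (induct I rule: infinite_finite_induct) (auto intro: hn_add hn_const)

lemma hn_\<kappa>: "(\<lambda>a. \<kappa> a $ j) \<in> hn"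
  by (rule hnI [OF holo_fun_\<kappa> one_U0])

lemma hn_germ:
  assumes g: "g \<in> hn" and S: "openin T S" "\<one> \<in> S" and eq: "\<And>a. a \<in> S \<Longrightarrow> g a = h a"
  shows "h \<in> hn"
proof -
  obtain S' where S': "\<one> \<in> S'" "hfun S' g" using g unfolding holo_near_def by blast
  have "hfun (S' \<inter> S) g"
    by (rule holo_fun_subset [OF S'(2)]) (auto intro: openin_Int S holo_funD(1) [OF S'(2)])
  then have "hfun (S' \<inter> S) h" by (rule holo_fun_cong [OF cT]) (simp add: eq)
  then show ?thesis using S S' by (auto intro: hnI)
qed

section \<open>Tangent vectors\<close>

abbreviation TS :: "(('a \<Rightarrow> complex) \<Rightarrow> complex) set" where
  "TS \<equiv> tangent_space T \<Phi> \<one>"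

lemma TS_zero: "\<xi> \<in> TS \<Longrightarrow> g \<notin> hn \<Longrightarrow> \<xi> g = 0"
  unfolding tangent_space_def by blast

lemma TS_germ:
  assumes "\<xi> \<in> TS" "g \<in> hn" "openin T S" "\<one> \<in> S" "\<And>a. a \<in> S \<Longrightarrow> g a = h a"
  shows "\<xi> g = \<xi> h"
proof -
  have "h \<in> hn" by (rule hn_germ [OF assms(2-5)])
  then show ?thesis using assms unfolding tangent_space_def by blast
qed

lemma TS_add: "\<xi> \<in> TS \<Longrightarrow> g \<in> hn \<Longrightarrow> h \<in> hn \<Longrightarrow> \<xi> (\<lambda>a. g a + h a) = \<xi> g + \<xi> h"
  and TS_cmult: "\<xi> \<in> TS \<Longrightarrow> g \<in> hn \<Longrightarrow> \<xi> (\<lambda>a. c * g a) = c * \<xi> g"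
  and TS_mult: "\<xi> \<in> TS \<Longrightarrow> g \<in> hn \<Longrightarrow> h \<in> hn \<Longrightarrow> \<xi> (\<lambda>a. g a * h a) = g \<one> * \<xi> h + h \<one> * \<xi> g"
  unfolding tangent_space_def by blast+

lemma TS_diff: "\<xi> \<in> TS \<Longrightarrow> g \<in> hn \<Longrightarrow> h \<in> hn \<Longrightarrow> \<xi> (\<lambda>a. g a - h a) = \<xi> g - \<xi> h"
  using TS_add [of \<xi> g "\<lambda>a. -1 * h a"] TS_cmult [of \<xi> h "-1"] hn_cmult [of h "-1"] by simp

lemma TS_const: "\<xi> \<in> TS \<Longrightarrow> \<xi> (\<lambda>a. c) = 0"
proof -
  assume \<xi>: "\<xi> \<in> TS"
  have "\<xi> (\<lambda>a. 1) = 0" using TS_mult [OF \<xi> hn_const [of 1] hn_const [of 1]] by simp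
  then show ?thesis using TS_cmult [OF \<xi> hn_const [of 1], of c] by simp
qed

lemma TS_sum: "\<xi> \<in> TS \<Longrightarrow> (\<And>i. i \<in> I \<Longrightarrow> g i \<in> hn) \<Longrightarrow> \<xi> (\<lambda>a. \<Sum>i\<in>I. g i a) = (\<Sum>i\<in>I. \<xi> (g i))"
proof (induct I rule: infinite_finite_induct)
  case (insert i I)
  then show ?case using TS_add [OF insert(4), of "g i" "\<lambda>a. \<Sum>i\<in>I. g i a"] by (simp add: hn_sum)
qed (simp_all add: TS_const)

text \<open>\<open>tv\<close> and \<open>vc\<close> identify vectors of the hyperplane with
  derivations, see \<open>vc_tv\<close> and \<open>tv_vc\<close>. Coordinate k of u is ignored by
  \<open>tv\<close>, which leaves it free for gl(1).\<close>

definition tv :: "complex^'m \<Rightarrow> ('a \<Rightarrow> complex) \<Rightarrow> complex" where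
  "tv u g = (if g \<in> hn then dd (\<lambda>x. g (\<sigma> x)) 0 u else 0)"

definition vc :: "(('a \<Rightarrow> complex) \<Rightarrow> complex) \<Rightarrow> complex^'m" where
  "vc \<xi> = (\<chi> j. \<xi> (\<lambda>a. \<kappa> a $ j))"

lemma germ_ball:
  assumes "openin T S" "\<one> \<in> S" "\<And>a. a \<in> S \<Longrightarrow> g a = h a"
  obtains r where "0 < r" "\<And>x. x \<in> ball 0 r \<Longrightarrow> g (\<sigma> x) = h (\<sigma> x)"
  by (rule nbhd_ball [OF assms(1,2)]) (use assms(3) that in blast)

lemma tv_TS: "tv u \<in> TS"
  unfolding tangent_space_def
proof (intro CollectI conjI ballI allI impI)
  show "tv u g = 0" if "g \<notin> hn" for g using that by (simp add: tv_def)
  show "tv u g = tv u h" if g: "g \<in> hn" "h \<in> hn" and S: "\<exists>S. openin T S \<and> \<one> \<in> S \<and> (\<forall>x\<in>S. g x = h x)" for g h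
  proof -
    obtain r where r: "0 < r" "\<And>x. x \<in> ball 0 r \<Longrightarrow> g (\<sigma> x) = h (\<sigma> x)"
      using S by (elim exE conjE) (rule germ_ball [of _ g h], auto)
    have "((\<lambda>x. h (\<sigma> x)) has_derivative dd (\<lambda>x. g (\<sigma> x)) 0) (at 0)"
      by (rule has_derivative_transform_within_open [OF hn_dd(1) [OF g(1)] open_ball, of 0 r]) (use r in auto)
    from dd_eq [OF this, of u] show ?thesis using g by (simp add: tv_def)
  qed
  fix g assume g: "g \<in> hn"
  have gd: "((\<lambda>x. g (\<sigma> x)) has_derivative dd (\<lambda>x. g (\<sigma> x)) 0) (at 0)" by (rule hn_dd(1) [OF g])
  show "tv u (\<lambda>x. c * g x) = c * tv u g" for c
    using dd_eq [OF has_derivative_mult_right [OF gd, of c]] by (simp add: tv_def g hn_cmult)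
  fix h assume h: "h \<in> hn"
  have hd: "((\<lambda>x. h (\<sigma> x)) has_derivative dd (\<lambda>x. h (\<sigma> x)) 0) (at 0)" by (rule hn_dd(1) [OF h])
  show "tv u (\<lambda>x. g x + h x) = tv u g + tv u h"
    using dd_eq [OF has_derivative_add [OF gd hd]] by (simp add: tv_def g h hn_add)
  show "tv u (\<lambda>x. g x * h x) = g \<one> * tv u h + h \<one> * tv u g"
    using dd_eq [OF has_derivative_mult [OF gd hd]] by (simp add: tv_def g h hn_mult \<sigma>_0 mult.commute)
qed

lemma tv_pr: "tv (pr u) = tv u"
proof
  fix g
  show "tv (pr u) g = tv u g"
  proof (cases "g \<in> hn")
    case True
    have "((\<lambda>x. g (\<sigma> x)) has_derivative dd (\<lambda>x. g (\<sigma> x)) 0) (at (pr 0))"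
      using hn_dd(1) [OF True] by simp
    from has_derivative_compose [OF bounded_linear_imp_has_derivative [OF bounded_linear_pr] this]
    have "((\<lambda>x. g (\<sigma> x)) has_derivative (\<lambda>u. dd (\<lambda>x. g (\<sigma> x)) 0 (pr u))) (at 0)" by (simp add: \<sigma>_pr)
    from dd_eq [OF this, of u] show ?thesis using True by (simp add: tv_def)
  qed (simp add: tv_def)
qed

lemma vc_tv: "vc (tv u) = pr u"
proof -
  have "tv u (\<lambda>a. \<kappa> a $ j) = pr u $ j" for j
  proof -
    have "((\<lambda>x. pr x $ j) has_derivative (\<lambda>x. pr x $ j)) (at 0)"
      by (rule has_derivative_nth [OF bounded_linear_imp_has_derivative [OF bounded_linear_pr]])
    then have "((\<lambda>x. \<kappa> (\<sigma> x) $ j) has_derivative (\<lambda>x. pr x $ j)) (at 0)"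
      by (rule has_derivative_transform_within_open [OF _ open_\<Omega>0 zero_\<Omega>0]) (simp add: \<kappa>_\<sigma>)
    from dd_eq [OF this, of u] show ?thesis by (simp add: tv_def hn_\<kappa>)
  qed
  then show ?thesis by (simp add: vc_def vec_eq_iff)
qed

text \<open>With \<open>G l\<close> the radial primitive of the partial derivative along axis l, the
  sum of the \<open>x $ l * G l x\<close> has the same radial derivative as g, so the two differ by
  a constant.\<close>

lemma hadamard:
  fixes g :: "complex^'n::finite \<Rightarrow> complex"
  assumes g: "holo (*s) (*) g (ball 0 r)"
  obtains G where "\<forall>l. holo (*s) (*) (G l) (ball 0 r)" "\<forall>x\<in>ball 0 r. g x = g 0 + (\<Sum>l\<in>UNIV. x $ l * G l x)"
proof -
  have "\<forall>l. \<exists>G. holo (*s) (*) G (ball 0 r) \<and> (\<forall>x\<in>ball 0 r. G x + dd G x x = dd g x (axis l 1))"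
    using radial_primitive [OF cscale_vec holo_dd_holo(1) [OF cscale_vec g open_ball]] by metis
  then obtain G where G: "\<And>l. holo (*s) (*) (G l) (ball 0 r)"
    "\<And>l x. x \<in> ball 0 r \<Longrightarrow> G l x + dd (G l) x x = dd g x (axis l 1)" by metis
  define D where "D x v = (\<Sum>l\<in>UNIV. x $ l * dd (G l) x v + v $ l * G l x) - dd g x v" for x v
  have hd: "((\<lambda>x. (\<Sum>l\<in>UNIV. x $ l * G l x) - g x) has_derivative D x) (at x)" if x: "x \<in> ball 0 r" for x
    unfolding D_def
    by (intro has_derivative_diff has_derivative_sum has_derivative_mult holo_dd(1) [OF G(1) open_ball x]
        holo_dd(1) [OF g open_ball x] bounded_linear_imp_has_derivative bounded_linear_vec_nth)
  have "D x x = 0" if x: "x \<in> ball 0 r" for x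
  proof -
    have lin: "linear (dd g x)" using holo_dd(1) [OF g open_ball x] has_derivative_linear by blast
    have "dd g x x = dd g x (\<Sum>l\<in>UNIV. x $ l *s axis l 1)" by (simp add: basis_expansion)
    also have "\<dots> = (\<Sum>l\<in>UNIV. x $ l * dd g x (axis l 1))"
      by (simp add: linear_sum [OF lin] holo_dd(2) [OF g open_ball x])
    finally show ?thesis unfolding D_def by (simp add: G(2) [OF x, symmetric] algebra_simps)
  qed
  note radial_constant [OF hd this]
  then have "g x = g 0 + (\<Sum>l\<in>UNIV. x $ l * G l x)" if "x \<in> ball 0 r" for x
    using that by (fastforce simp: algebra_simps)
  then show thesis using that G(1) by blast
qed

text \<open>By \<open>hadamard\<close> a germ is its value at the unit plus coordinates times
  holomorphic germs. The Leibniz rule leaves only the first order, so a derivation is determined by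
  its values on the coordinates.\<close>

lemma tv_vc:
  assumes \<xi>: "\<xi> \<in> TS"
  shows "tv (vc \<xi>) = \<xi>"
proof
  fix g
  show "tv (vc \<xi>) g = \<xi> g"
  proof (cases "g \<in> hn")
    case True
    then obtain r where r: "0 < r" "ball 0 r \<subseteq> \<Omega>0" "holo (*s) (*) (\<lambda>x. g (\<sigma> x)) (ball 0 r)" by (rule hn_ball)
    obtain G where G': "\<forall>l. holo (*s) (*) (G l) (ball 0 r)"
      and gG': "\<forall>x\<in>ball 0 r. g (\<sigma> x) = g (\<sigma> 0) + (\<Sum>l\<in>UNIV. x $ l * G l x)"
      by (rule hadamard [OF r(3)])
    note G = spec [OF G'] and gG = bspec [OF gG']
    have Gh: "(\<lambda>a. G l (\<kappa> a)) \<in> hn" for l by (rule hn_of_ball [OF r(1) G]) simp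
    define h where "h a = g \<one> + (\<Sum>l\<in>UNIV. \<kappa> a $ l * G l (\<kappa> a))" for a
    have gh: "g a = h a" if "a \<in> nb r" for a
      using that gG [of "\<kappa> a"] by (simp add: nb_def \<sigma>_\<kappa> h_def \<sigma>_0)
    have eq: "\<zeta> g = (\<Sum>l\<in>UNIV. G l 0 * \<zeta> (\<lambda>a. \<kappa> a $ l))" if \<zeta>: "\<zeta> \<in> TS" for \<zeta>
    proof -
      have "\<zeta> g = \<zeta> h" by (rule TS_germ [OF \<zeta> True open_nb one_nb [OF r(1)] gh])
      also have "\<dots> = (\<Sum>l\<in>UNIV. \<zeta> (\<lambda>a. \<kappa> a $ l * G l (\<kappa> a)))"
      proof -
        have "(\<lambda>a. \<Sum>l\<in>UNIV. \<kappa> a $ l * G l (\<kappa> a)) \<in> hn" by (intro hn_sum hn_mult hn_\<kappa> Gh)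
        moreover have "\<zeta> (\<lambda>a. \<Sum>l\<in>UNIV. \<kappa> a $ l * G l (\<kappa> a)) = (\<Sum>l\<in>UNIV. \<zeta> (\<lambda>a. \<kappa> a $ l * G l (\<kappa> a)))"
          by (rule TS_sum [OF \<zeta>]) (intro hn_mult hn_\<kappa> Gh)
        ultimately show ?thesis
          unfolding h_def using TS_add [OF \<zeta> hn_const, of _ "g \<one>"] by (simp add: TS_const [OF \<zeta>])
      qed
      also have "\<dots> = (\<Sum>l\<in>UNIV. G l 0 * \<zeta> (\<lambda>a. \<kappa> a $ l))"
        by (simp add: TS_mult [OF \<zeta> hn_\<kappa> Gh] \<kappa>_one)
      finally show ?thesis .
    qed
    \<comment> \<open>\<open>vc_tv\<close> covers the coordinates other than k. Coordinate k is
      identically 0 on the chart domain, so there both derivations give 0.\<close>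
    have "\<xi> (\<lambda>a. \<kappa> a $ l) = tv (vc \<xi>) (\<lambda>a. \<kappa> a $ l)" for l
    proof (cases "l = k")
      case True
      have "\<xi> (\<lambda>a. \<kappa> a $ k) = \<xi> (\<lambda>a. 0)"
        by (rule TS_germ [OF \<xi> hn_\<kappa> open_U0 one_U0]) (use \<kappa>_Cn in \<open>auto simp: Cn_def\<close>)
      moreover have "tv (vc \<xi>) (\<lambda>a. \<kappa> a $ k) = tv (vc \<xi>) (\<lambda>a. 0)"
        by (rule TS_germ [OF tv_TS hn_\<kappa> open_U0 one_U0]) (use \<kappa>_Cn in \<open>auto simp: Cn_def\<close>)
      ultimately show ?thesis using True by (simp add: TS_const \<xi> tv_TS)
    next
      case False
      have "vc (tv (vc \<xi>)) $ l = vc \<xi> $ l" using False by (simp add: vc_tv pr_nth)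
      then show ?thesis by (simp add: vc_def)
    qed
    then show ?thesis using eq [OF \<xi>] eq [OF tv_TS, of "vc \<xi>"] by simp
  next
    case False
    then show ?thesis using TS_zero [OF \<xi>] by (simp add: tv_def)
  qed
qed

end

section \<open>The Lie algebra in coordinates\<close>

lemma sum_fun_apply: "(\<Sum>i\<in>I. F i) x = (\<Sum>i\<in>I. F i x)"
  for F :: "'i \<Rightarrow> 'x \<Rightarrow> 'y::comm_monoid_add"
  by (induct I rule: infinite_finite_induct) auto

context clg_chart
begin

lemma mult_ball:
  assumes S: "openin T S" "\<one> \<in> S"
  obtains r where "0 < r" "ball 0 r \<subseteq> \<Omega>0" "\<forall>x\<in>ball 0 r. \<forall>y\<in>ball 0 r. \<sigma> x \<otimes> \<sigma> y \<in> S"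
proof -
  obtain N M where N: "openin T N" "\<one> \<in> N" and M: "openin T M" "\<one> \<in> M"
    and NM: "\<And>a b. a \<in> N \<Longrightarrow> b \<in> M \<Longrightarrow> a \<otimes> b \<in> S"
    using mult_near [OF one_closed one_closed S(1)] S(2) by (metis one_closed r_one)
  obtain r where r: "0 < r" "ball 0 r \<subseteq> \<Omega>0" "\<sigma> ` ball 0 r \<subseteq> N \<inter> M"
    by (rule nbhd_ball [of "N \<inter> M"]) (use N M in auto)
  then show thesis using that [OF r(1,2)] NM by blast
qed

abbreviation mul :: "('a \<Rightarrow> complex) \<Rightarrow> (complex^'m) \<times> (complex^'m) \<Rightarrow> complex" where
  "mul g \<equiv> (\<lambda>p. g (\<sigma> (fst p) \<otimes> \<sigma> (snd p)))"

lemma holo_shift_pair: "holo pair_scale pair_scale (\<lambda>p. (pr (fst p) + \<phi>0 \<one>, pr (snd p) + \<phi>0 \<one>)) S"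
  unfolding holo_def
proof (intro ballI exI [where x="\<lambda>p. (pr (fst p), pr (snd p))"] conjI allI)
  fix p :: "(complex^'m) \<times> (complex^'m)"
  show "((\<lambda>p. (pr (fst p) + \<phi>0 \<one>, pr (snd p) + \<phi>0 \<one>)) has_derivative (\<lambda>p. (pr (fst p), pr (snd p)))) (at p within S)"
    by (intro has_derivative_Pair has_derivative_add_const bounded_linear.has_derivative [OF bounded_linear_pr]
        has_derivative_fst has_derivative_snd has_derivative_ident)
qed (simp add: pair_scale_def pr_scale)

lemma mult_hn:
  assumes g: "g \<in> hn"
  obtains r where "0 < r" "ball 0 r \<subseteq> \<Omega>0" "\<forall>x\<in>ball 0 r. \<forall>y\<in>ball 0 r. \<sigma> x \<otimes> \<sigma> y \<in> U0"
    "holo pair_scale (*) (mul g) (ball 0 r \<times> ball 0 r)"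
proof -
  obtain S where S: "\<one> \<in> S" "hfun S g" using g unfolding holo_near_def by blast
  obtain r where r: "0 < r" "ball 0 r \<subseteq> \<Omega>0" and rS: "\<forall>x\<in>ball 0 r. \<forall>y\<in>ball 0 r. \<sigma> x \<otimes> \<sigma> y \<in> S \<inter> U0"
    by (rule mult_ball [of "S \<inter> U0"]) (use S holo_funD(1) [OF S(2)] open_U0 one_U0 in auto)
  let ?B = "ball (0::complex^'m) r \<times> ball (0::complex^'m) r"
  let ?sh = "\<lambda>p. (pr (fst p) + \<phi>0 \<one>, pr (snd p) + \<phi>0 \<one>)"
  let ?D = "{(\<phi>0 a, \<phi>0 b) | a b. a \<in> U0 \<and> b \<in> U0 \<and> a \<otimes> b \<in> U0}"
  have sh: "?sh ` ?B \<subseteq> ?D"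
  proof
    fix q assume "q \<in> ?sh ` ?B"
    then obtain x y where xy: "x \<in> ball 0 r" "y \<in> ball 0 r" "q = (pr x + \<phi>0 \<one>, pr y + \<phi>0 \<one>)" by auto
    have "x \<in> \<Omega>0" "y \<in> \<Omega>0" using xy r(2) by auto
    then have "q = (\<phi>0 (\<sigma> x), \<phi>0 (\<sigma> y))" "\<sigma> x \<in> U0" "\<sigma> y \<in> U0"
      using \<sigma>_U0 unfolding xy(3) \<sigma>_def \<Omega>0_def by (auto simp: f_inv_into_f)
    then show "q \<in> ?D" using rS xy by blast
  qed
  have "holo pair_scale (*s) (\<lambda>p. \<phi>0 (\<sigma> (fst p) \<otimes> \<sigma> (snd p))) ?B"
    using holo_compose [OF holo_shift_pair mult_holo [OF U0 U0 U0] sh] by (simp add: \<sigma>_def)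
  then have "holo pair_scale (*) (\<lambda>p. g (inv_into U0 \<phi>0 (\<phi>0 (\<sigma> (fst p) \<otimes> \<sigma> (snd p))))) ?B"
    by (rule holo_compose [OF _ holo_funD(2) [OF S(2) U0]]) (use rS in auto)
  then have "holo pair_scale (*) (mul g) ?B"
    by (rule holo_cong) (use rS inj_\<phi>0 in auto)
  then show thesis using that r rS by blast
qed

text \<open>Turns the derivation in the second factor into a partial derivative of the
  multiplication in coordinates, whose holomorphy in x is an instance of
  \<open>holo_dd_holo\<close>.\<close>

lemma mul_formula:
  assumes r: "0 < r" "ball 0 r \<subseteq> \<Omega>0" and h: "holo pair_scale (*) (mul g) (ball 0 r \<times> ball 0 r)" and x: "x \<in> ball 0 r"
  shows "(\<lambda>b. g (\<sigma> x \<otimes> b)) \<in> hn" "tv u (\<lambda>b. g (\<sigma> x \<otimes> b)) = dd (mul g) (x, 0) (0, u)"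
    "holo (*s) (*) (\<lambda>x. dd (mul g) (x, 0) (0, u)) (ball 0 r)"
proof -
  have o: "open (ball (0::complex^'m) r \<times> ball (0::complex^'m) r)" by (intro open_Times open_ball)
  have "holo (*s) (*) (\<lambda>y. mul g (x, y)) (ball 0 r)"
    by (rule holo_compose [OF holo_embed(2) h]) (use x in auto)
  then show hn: "(\<lambda>b. g (\<sigma> x \<otimes> b)) \<in> hn"
    by (rule hn_of_ball [OF r(1)]) (simp add: nb_def \<sigma>_\<kappa>)
  have p: "(x, 0) \<in> ball (0::complex^'m) r \<times> ball (0::complex^'m) r" using x r(1) by simp
  have "((\<lambda>y. (x, y)) has_derivative (\<lambda>u. (0, u))) (at 0)"
    by (intro has_derivative_Pair has_derivative_ident has_derivative_const)
  from has_derivative_compose [OF this holo_dd(1) [OF h o p]]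
  have "((\<lambda>y. g (\<sigma> x \<otimes> \<sigma> y)) has_derivative (\<lambda>u. dd (mul g) (x, 0) (0, u))) (at 0)"
    unfolding fst_conv snd_conv .
  from dd_eq [OF this] show "tv u (\<lambda>b. g (\<sigma> x \<otimes> b)) = dd (mul g) (x, 0) (0, u)"
    using hn by (simp add: tv_def)
  show "holo (*s) (*) (\<lambda>x. dd (mul g) (x, 0) (0, u)) (ball 0 r)"
    by (rule holo_compose [OF holo_embed(1) holo_dd_holo(1) [OF cscale_pair h o]]) (use r(1) in auto)
qed

text \<open>The left invariant vector field extending \<eta>, applied to g.\<close>

definition conv :: "('a \<Rightarrow> complex) \<Rightarrow> (('a \<Rightarrow> complex) \<Rightarrow> complex) \<Rightarrow> 'a \<Rightarrow> complex" where
  "conv g \<eta> = (\<lambda>a. \<eta> (\<lambda>b. g (a \<otimes> b)))"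

lemma conv_hn:
  assumes g: "g \<in> hn" and \<eta>: "\<eta> \<in> TS"
  shows "conv g \<eta> \<in> hn"
proof -
  obtain r where r: "0 < r" "ball 0 r \<subseteq> \<Omega>0" and h: "holo pair_scale (*) (mul g) (ball 0 r \<times> ball 0 r)"
    by (rule mult_hn [OF g])
  have "0 \<in> ball (0::complex^'m) r" using r(1) by simp
  note h2 = mul_formula(3) [OF r h this, of "vc \<eta>"]
  show ?thesis
  proof (rule hn_of_ball [OF r(1) h2])
    fix a assume "a \<in> nb r"
    then have a: "a = \<sigma> (\<kappa> a)" "\<kappa> a \<in> ball 0 r" by (simp_all add: nb_def \<sigma>_\<kappa>)
    have "conv g \<eta> (\<sigma> (\<kappa> a)) = tv (vc \<eta>) (\<lambda>b. g (\<sigma> (\<kappa> a) \<otimes> b))" by (simp add: conv_def tv_vc [OF \<eta>])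
    also have "\<dots> = dd (mul g) (\<kappa> a, 0) (0, vc \<eta>)" by (rule mul_formula(2) [OF r h a(2)])
    finally show "conv g \<eta> a = dd (mul g) (\<kappa> a, 0) (0, vc \<eta>)" using a(1) by simp
  qed
qed

lemma left_hn:
  assumes g: "g \<in> hn"
  obtains r where "0 < r" "\<forall>a\<in>nb r. (\<lambda>b. g (a \<otimes> b)) \<in> hn"
proof -
  obtain r where r: "0 < r" "ball 0 r \<subseteq> \<Omega>0" and h: "holo pair_scale (*) (mul g) (ball 0 r \<times> ball 0 r)"
    by (rule mult_hn [OF g])
  have "(\<lambda>b. g (a \<otimes> b)) \<in> hn" if "a \<in> nb r" for a
    using mul_formula(1) [OF r h, of "\<kappa> a"] that by (simp add: nb_def \<sigma>_\<kappa>)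
  then show thesis using that r(1) by blast
qed

lemma open_carrier_L: "openin T (carrier L)"
  by (simp add: carrier_top)

text \<open>The group laws hold on the carrier only, while functions live on the whole type. A
  derivation does not see values off the carrier; if g is outside \<open>hn\<close> then so is h,
  and both sides are 0.\<close>

lemma TS_eq_carrier:
  assumes \<xi>: "\<xi> \<in> TS" and eq: "\<And>a. a \<in> carrier L \<Longrightarrow> g a = h a"
  shows "\<xi> g = \<xi> h"
proof (cases "g \<in> hn")
  case True
  show ?thesis by (rule TS_germ [OF \<xi> True open_carrier_L one_closed eq])
next
  case False
  have "h \<notin> hn"
    using False hn_germ [OF _ open_carrier_L one_closed, of h g] eq by metis
  with False show ?thesis by (simp add: TS_zero [OF \<xi>])
qed

lemma nb_carrier: "nb r \<subseteq> carrier L"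
  by (rule open_carrier [OF open_nb])

lemma conv_one: "\<eta> \<in> TS \<Longrightarrow> conv g \<eta> \<one> = \<eta> g"
  unfolding conv_def by (rule TS_eq_carrier) simp_all

text \<open>Continuity of the multiplication keeps \<open>a \<otimes> b\<close> in the set of
  agreement for a and b near the unit.\<close>

lemma conv_germ:
  assumes g: "g \<in> hn" and \<eta>: "\<eta> \<in> TS" and S: "openin T S" "\<one> \<in> S" and eq: "\<And>a. a \<in> S \<Longrightarrow> g a = h a"
  obtains r where "0 < r" "\<forall>a\<in>nb r. conv g \<eta> a = conv h \<eta> a"
proof -
  obtain r where r: "0 < r" "\<forall>a\<in>nb r. (\<lambda>b. g (a \<otimes> b)) \<in> hn" by (rule left_hn [OF g])
  obtain N M where N: "openin T N" "\<one> \<in> N" and M: "openin T M" "\<one> \<in> M"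
    and NM: "\<And>a b. a \<in> N \<Longrightarrow> b \<in> M \<Longrightarrow> a \<otimes> b \<in> S"
    using mult_near [OF one_closed one_closed S(1)] S(2) by (metis one_closed r_one)
  obtain r' where r': "0 < r'" "nb r' \<subseteq> N" using nbhd_nb [OF N] by metis
  have "conv g \<eta> a = conv h \<eta> a" if a: "a \<in> nb (min r r')" for a
  proof -
    have a': "a \<in> nb r" "a \<in> N" using a r'(2) by (auto simp: nb_def)
    show ?thesis unfolding conv_def
      by (rule TS_germ [OF \<eta> _ M]) (use r(2) a' NM eq in auto)
  qed
  then show thesis using that [of "min r r'"] r(1) r'(1) by simp
qed

lemma conv_add:
  assumes g: "g \<in> hn" and h: "h \<in> hn" and \<eta>: "\<eta> \<in> TS" and \<xi>: "\<xi> \<in> TS"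
  shows "\<xi> (conv (\<lambda>a. g a + h a) \<eta>) = \<xi> (conv g \<eta>) + \<xi> (conv h \<eta>)"
proof -
  obtain r where r: "0 < r" "\<forall>a\<in>nb r. (\<lambda>b. g (a \<otimes> b)) \<in> hn" by (rule left_hn [OF g])
  obtain r' where r': "0 < r'" "\<forall>a\<in>nb r'. (\<lambda>b. h (a \<otimes> b)) \<in> hn" by (rule left_hn [OF h])
  have "\<xi> (conv (\<lambda>a. g a + h a) \<eta>) = \<xi> (\<lambda>a. conv g \<eta> a + conv h \<eta> a)"
  proof (rule TS_germ [OF \<xi> conv_hn [OF hn_add [OF g h] \<eta>] open_nb one_nb [of "min r r'"]])
    fix a assume "a \<in> nb (min r r')"
    then have "a \<in> nb r" "a \<in> nb r'" by (auto simp: nb_def)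
    then show "conv (\<lambda>a. g a + h a) \<eta> a = conv g \<eta> a + conv h \<eta> a"
      unfolding conv_def using r(2) r'(2) by (intro TS_add [OF \<eta>]) auto
  qed (use r(1) r'(1) in simp)
  also have "\<dots> = \<xi> (conv g \<eta>) + \<xi> (conv h \<eta>)" by (intro TS_add [OF \<xi>] conv_hn g h \<eta>)
  finally show ?thesis .
qed

lemma conv_cmult:
  assumes g: "g \<in> hn" and \<eta>: "\<eta> \<in> TS" and \<xi>: "\<xi> \<in> TS"
  shows "\<xi> (conv (\<lambda>a. c * g a) \<eta>) = c * \<xi> (conv g \<eta>)"
proof -
  obtain r where r: "0 < r" "\<forall>a\<in>nb r. (\<lambda>b. g (a \<otimes> b)) \<in> hn" by (rule left_hn [OF g])
  have "\<xi> (conv (\<lambda>a. c * g a) \<eta>) = \<xi> (\<lambda>a. c * conv g \<eta> a)"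
  proof (rule TS_germ [OF \<xi> conv_hn [OF hn_cmult [OF g] \<eta>] open_nb one_nb [OF r(1)]])
    fix a assume "a \<in> nb r"
    then show "conv (\<lambda>a. c * g a) \<eta> a = c * conv g \<eta> a"
      unfolding conv_def using r(2) by (intro TS_cmult [OF \<eta>]) auto
  qed
  also have "\<dots> = c * \<xi> (conv g \<eta>)" by (intro TS_cmult [OF \<xi>] conv_hn g \<eta>)
  finally show ?thesis .
qed

text \<open>The mixed terms \<open>\<eta> h * \<xi> g\<close> and \<open>\<eta> g * \<xi> h\<close>
  are together symmetric in \<xi> and \<eta> and cancel in the commutator; this is why
  \<open>br\<close> is again a derivation.\<close>

lemma conv_mult:
  assumes g: "g \<in> hn" and h: "h \<in> hn" and \<eta>: "\<eta> \<in> TS" and \<xi>: "\<xi> \<in> TS"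
  shows "\<xi> (conv (\<lambda>a. g a * h a) \<eta>) = g \<one> * \<xi> (conv h \<eta>) + \<eta> h * \<xi> g + (h \<one> * \<xi> (conv g \<eta>) + \<eta> g * \<xi> h)"
proof -
  obtain r where r: "0 < r" "\<forall>a\<in>nb r. (\<lambda>b. g (a \<otimes> b)) \<in> hn" by (rule left_hn [OF g])
  obtain r' where r': "0 < r'" "\<forall>a\<in>nb r'. (\<lambda>b. h (a \<otimes> b)) \<in> hn" by (rule left_hn [OF h])
  have "\<xi> (conv (\<lambda>a. g a * h a) \<eta>) = \<xi> (\<lambda>a. g a * conv h \<eta> a + h a * conv g \<eta> a)"
  proof (rule TS_germ [OF \<xi> conv_hn [OF hn_mult [OF g h] \<eta>] open_nb one_nb [of "min r r'"]])
    fix a assume a: "a \<in> nb (min r r')"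
    then have a': "a \<in> nb r" "a \<in> nb r'" by (auto simp: nb_def)
    have "a \<otimes> \<one> = a" using a nb_carrier [of "min r r'"] by auto
    then show "conv (\<lambda>a. g a * h a) \<eta> a = g a * conv h \<eta> a + h a * conv g \<eta> a"
      unfolding conv_def using r(2) r'(2) a' TS_mult [OF \<eta>, of "\<lambda>b. g (a \<otimes> b)" "\<lambda>b. h (a \<otimes> b)"] by simp
  qed (use r(1) r'(1) in simp)
  also have "\<dots> = \<xi> (\<lambda>a. g a * conv h \<eta> a) + \<xi> (\<lambda>a. h a * conv g \<eta> a)"
    by (intro TS_add [OF \<xi>] hn_mult conv_hn g h \<eta>)
  also have "\<dots> = g \<one> * \<xi> (conv h \<eta>) + \<eta> h * \<xi> g + (h \<one> * \<xi> (conv g \<eta>) + \<eta> g * \<xi> h)"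
    by (simp add: TS_mult [OF \<xi>] conv_hn g h \<eta> conv_one [OF \<eta>])
  finally show ?thesis .
qed

definition br :: "(('a \<Rightarrow> complex) \<Rightarrow> complex) \<Rightarrow> (('a \<Rightarrow> complex) \<Rightarrow> complex) \<Rightarrow> ('a \<Rightarrow> complex) \<Rightarrow> complex" where
  "br \<xi> \<eta> g = (if g \<in> hn then \<xi> (conv g \<eta>) - \<eta> (conv g \<xi>) else 0)"

lemma br_TS:
  assumes \<xi>: "\<xi> \<in> TS" and \<eta>: "\<eta> \<in> TS"
  shows "br \<xi> \<eta> \<in> TS"
  unfolding tangent_space_def
proof (intro CollectI conjI ballI allI impI)
  show "br \<xi> \<eta> g = 0" if "g \<notin> hn" for g using that by (simp add: br_def)
  show "br \<xi> \<eta> g = br \<xi> \<eta> h" if g: "g \<in> hn" and h: "h \<in> hn" and S: "\<exists>S. openin T S \<and> \<one> \<in> S \<and> (\<forall>x\<in>S. g x = h x)" for g h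
  proof -
    obtain S where S: "openin T S" "\<one> \<in> S" "\<And>x. x \<in> S \<Longrightarrow> g x = h x" using S by blast
    have eq: "\<xi> (conv g \<eta>) = \<xi> (conv h \<eta>)" if \<xi>: "\<xi> \<in> TS" and \<eta>: "\<eta> \<in> TS" for \<xi> \<eta>
    proof -
      obtain r where r: "0 < r" "\<forall>a\<in>nb r. conv g \<eta> a = conv h \<eta> a" by (rule conv_germ [OF g \<eta> S])
      show ?thesis by (rule TS_germ [OF \<xi> conv_hn [OF g \<eta>] open_nb one_nb [OF r(1)]]) (use r(2) in blast)
    qed
    show ?thesis by (simp add: br_def g h eq [OF \<xi> \<eta>] eq [OF \<eta> \<xi>])
  qed
  fix g assume g: "g \<in> hn"
  show "br \<xi> \<eta> (\<lambda>x. c * g x) = c * br \<xi> \<eta> g" for c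
    by (simp add: br_def g hn_cmult conv_cmult \<xi> \<eta> right_diff_distrib)
  fix h assume h: "h \<in> hn"
  show "br \<xi> \<eta> (\<lambda>x. g x + h x) = br \<xi> \<eta> g + br \<xi> \<eta> h"
    by (simp add: br_def g h hn_add conv_add \<xi> \<eta>)
  show "br \<xi> \<eta> (\<lambda>x. g x * h x) = g \<one> * br \<xi> \<eta> h + h \<one> * br \<xi> \<eta> g"
    by (simp add: br_def g h hn_mult conv_mult \<xi> \<eta> algebra_simps)
qed

section \<open>The tangent space as a Lie algebra of dimension n\<close>

lemma lie_carrier_eq: "lie_carrier LA = TS"
  and lie_scale_eq: "lie_scale LA = (\<lambda>c \<xi> g. c * \<xi> g)"
  and lie_bracket_eq: "lie_bracket LA = br"
  unfolding lie_algebra_of_def by (simp_all add: br_def conv_def fun_eq_iff)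

lemma vector_space_fun: "vector_space (\<lambda>c (\<xi> :: ('a \<Rightarrow> complex) \<Rightarrow> complex) g. c * \<xi> g)"
  by unfold_locales (simp_all add: fun_eq_iff algebra_simps)

lemma TS_plus: "\<xi> \<in> TS \<Longrightarrow> \<eta> \<in> TS \<Longrightarrow> \<xi> + \<eta> \<in> TS"
  and TS_smult: "\<xi> \<in> TS \<Longrightarrow> (\<lambda>g. c * \<xi> g) \<in> TS"
  and TS_null: "0 \<in> TS"
proof -
  have lin: "tv (u + v) = tv u + tv v" "tv (c *s u) = (\<lambda>g. c * tv u g)" "tv 0 = 0" for u v c
  proof -
    have "tv (u + v) g = tv u g + tv v g \<and> tv (c *s u) g = c * tv u g \<and> tv 0 g = 0" for g
    proof (cases "g \<in> hn")
      case True
      have lin: "linear (dd (\<lambda>x. g (\<sigma> x)) 0)"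
        using hn_dd(1) [OF True] has_derivative_linear by blast
      show ?thesis using True linear_add [OF lin] hn_dd(2) [OF True] linear_0 [OF lin] by (simp add: tv_def)
    qed (simp add: tv_def)
    then show "tv (u + v) = tv u + tv v" "tv (c *s u) = (\<lambda>g. c * tv u g)" "tv 0 = 0"
      by (simp_all add: fun_eq_iff)
  qed
  show "\<xi> + \<eta> \<in> TS" if "\<xi> \<in> TS" "\<eta> \<in> TS"
    using lin(1) [of "vc \<xi>" "vc \<eta>"] tv_TS [of "vc \<xi> + vc \<eta>"] that by (simp add: tv_vc)
  show "(\<lambda>g. c * \<xi> g) \<in> TS" if "\<xi> \<in> TS"
    using lin(2) [of c "vc \<xi>"] tv_TS [of "c *s vc \<xi>"] that by (simp add: tv_vc)
  show "0 \<in> TS" using lin(3) tv_TS [of 0] by simp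
qed

lemma tv_add: "tv (u + v) = tv u + tv v" and tv_smult: "tv (c *s u) = (\<lambda>g. c * tv u g)"
proof -
  have "tv (u + v) g = tv u g + tv v g \<and> tv (c *s u) g = c * tv u g" for g
  proof (cases "g \<in> hn")
    case True
    have lin: "linear (dd (\<lambda>x. g (\<sigma> x)) 0)"
      using hn_dd(1) [OF True] has_derivative_linear by blast
    show ?thesis using True linear_add [OF lin] hn_dd(2) [OF True] by (simp add: tv_def)
  qed (simp add: tv_def)
  then show "tv (u + v) = tv u + tv v" "tv (c *s u) = (\<lambda>g. c * tv u g)"
    by (simp_all add: fun_eq_iff)
qed

definition TB :: "(('a \<Rightarrow> complex) \<Rightarrow> complex) set" where
  "TB = (\<lambda>j. tv (axis j 1)) ` (UNIV - {k})"

lemma tv_axis: "j \<noteq> k \<Longrightarrow> tv (axis j 1) (\<lambda>a. \<kappa> a $ l) = (if l = j then 1 else 0)"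
  using vc_tv [of "axis j 1"] by (simp add: vc_def vec_eq_iff pr_nth axis_def)

lemma TB_inj: "inj_on (\<lambda>j. tv (axis j 1)) (UNIV - {k})"
proof (rule inj_onI)
  fix i j assume "i \<in> UNIV - {k}" "j \<in> UNIV - {k}" and "tv (axis i 1) = tv (axis j 1)"
  then show "i = j" using tv_axis [of i i] tv_axis [of j i] by (auto split: if_splits)
qed

lemma TS_expand: "\<xi> \<in> TS \<Longrightarrow> \<xi> = (\<Sum>j\<in>UNIV - {k}. (\<lambda>g. vc \<xi> $ j * tv (axis j 1) g))"
proof -
  assume \<xi>: "\<xi> \<in> TS"
  have tv0: "tv 0 = 0" using tv_smult [of 0 0] by (simp add: fun_eq_iff)
  have tvs: "tv (\<Sum>j\<in>I. F j) = (\<Sum>j\<in>I. tv (F j))" for I :: "'m set" and F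
    by (induct I rule: infinite_finite_induct) (simp_all add: tv0 tv_add)
  have "\<xi> = tv (\<Sum>j\<in>UNIV. vc \<xi> $ j *s axis j 1)" by (simp add: basis_expansion tv_vc [OF \<xi>])
  also have "\<dots> = (\<Sum>j\<in>UNIV. tv (vc \<xi> $ j *s axis j 1))" by (rule tvs)
  also have "\<dots> = (\<Sum>j\<in>UNIV. (\<lambda>g. vc \<xi> $ j * tv (axis j 1) g))" by (simp add: tv_smult)
  also have "\<dots> = (\<Sum>j\<in>UNIV - {k}. (\<lambda>g. vc \<xi> $ j * tv (axis j 1) g))"
  proof (rule sum.mono_neutral_right)
    have "vc \<xi> $ k = pr (vc \<xi>) $ k" using vc_tv [of "vc \<xi>"] by (simp add: tv_vc [OF \<xi>])
    then have "vc \<xi> $ k = 0" by (simp add: pr_nth)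
    then show "\<forall>i\<in>UNIV - (UNIV - {k}). (\<lambda>g. vc \<xi> $ i * tv (axis i 1) g) = 0" by (simp add: fun_eq_iff)
  qed auto
  finally show ?thesis .
qed

lemma span_TB: "module.span (\<lambda>c (\<xi> :: ('a \<Rightarrow> complex) \<Rightarrow> complex) g. c * \<xi> g) TB = TS"
proof -
  interpret vs: vector_space "\<lambda>c (\<xi> :: ('a \<Rightarrow> complex) \<Rightarrow> complex) g. c * \<xi> g" by (rule vector_space_fun)
  have sub: "vs.subspace TS" unfolding vs.subspace_def by (simp add: TS_plus TS_smult TS_null)
  show ?thesis
  proof
    have "TB \<subseteq> TS" unfolding TB_def using tv_TS by blast
    then show "vs.span TB \<subseteq> TS" by (rule vs.span_minimal [OF _ sub])
    show "TS \<subseteq> vs.span TB"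
    proof
      fix \<xi> assume \<xi>: "\<xi> \<in> TS"
      show "\<xi> \<in> vs.span TB"
        by (subst TS_expand [OF \<xi>]) (intro vs.span_sum vs.span_scale vs.span_base, simp add: TB_def)
    qed
  qed
qed

lemma finite_TB: "finite TB"
  unfolding TB_def by simp

text \<open>The derivations along the axes other than k are dual to the coordinate functions, hence
  independent; they span by \<open>span_TB\<close>.\<close>

lemma lie_dim_eq: "lie_dim LA + 1 = CARD('m)"
proof -
  interpret vs: vector_space "\<lambda>c (\<xi> :: ('a \<Rightarrow> complex) \<Rightarrow> complex) g. c * \<xi> g" by (rule vector_space_fun)
  have key: "c x = 0" if s: "(\<Sum>x\<in>TB. (\<lambda>g. c x * x g)) = 0" and x: "x \<in> TB" for c x
  proof -
    obtain j where j: "j \<noteq> k" and xj: "x = tv (axis j 1)" using x unfolding TB_def by blast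
    have 1: "(\<Sum>x\<in>TB. (\<lambda>g. c x * x g)) (\<lambda>a. \<kappa> a $ j) = 0" by (simp only: s zero_fun_apply)
    have 2: "(\<Sum>x\<in>TB. (\<lambda>g. c x * x g)) (\<lambda>a. \<kappa> a $ j)
        = (\<Sum>i\<in>UNIV - {k}. c (tv (axis i 1)) * tv (axis i 1) (\<lambda>a. \<kappa> a $ j))"
      unfolding TB_def by (simp add: sum_fun_apply sum.reindex [OF TB_inj])
    have 3: "\<dots> = (\<Sum>i\<in>UNIV - {k}. if i = j then c (tv (axis j 1)) else 0)"
      by (rule sum.cong) (auto simp: tv_axis)
    have 4: "\<dots> = c (tv (axis j 1))" using j by simp
    have "c (tv (axis j 1)) = 0" by (rule trans [OF sym [OF trans [OF 2 trans [OF 3 4]]] 1])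
    then show ?thesis unfolding xj .
  qed
  have "vs.independent TB"
  proof
    assume "vs.dependent TB"
    then obtain u v where "v \<in> TB" "u v \<noteq> 0" "(\<Sum>v\<in>TB. (\<lambda>g. u v * v g)) = 0"
      unfolding vs.dependent_finite [OF finite_TB] by blast
    then show False using key [of u v] by simp
  qed
  then have "vs.dim (vs.span TB) = card TB" by (rule vs.dim_span_eq_card_independent)
  then have "vs.dim TS = card TB" unfolding span_TB .
  moreover have "card TB = CARD('m) - 1" unfolding TB_def by (simp add: card_image [OF TB_inj])
  moreover have "0 < CARD('m)" by simp
  ultimately show ?thesis unfolding lie_dim_def lie_carrier_eq lie_scale_eq by linarith
qed

text \<open>\<open>conv (conv g \<zeta>) \<eta>\<close> is a product of two left invariant fields
  applied to g, which rests on associativity of the group. In this form the twelve terms of the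
  Jacobi identity cancel in pairs.\<close>

lemma br_br:
  assumes \<xi>: "\<xi> \<in> TS" and \<eta>: "\<eta> \<in> TS" and \<zeta>: "\<zeta> \<in> TS" and g: "g \<in> hn"
  shows "br \<xi> (br \<eta> \<zeta>) g = \<xi> (conv (conv g \<zeta>) \<eta>) - \<xi> (conv (conv g \<eta>) \<zeta>)
      - \<eta> (conv (conv g \<xi>) \<zeta>) + \<zeta> (conv (conv g \<xi>) \<eta>)"
proof -
  have as: "conv (\<lambda>b. g (a \<otimes> b)) \<zeta> b = conv g \<zeta> (a \<otimes> b)" if "\<zeta> \<in> TS" "a \<in> carrier L" "b \<in> carrier L" for \<zeta> a b
    unfolding conv_def by (rule TS_eq_carrier [OF that(1)]) (use that(2,3) in \<open>simp add: m_assoc\<close>)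
  have as': "\<eta> (conv (\<lambda>b. g (a \<otimes> b)) \<zeta>) = conv (conv g \<zeta>) \<eta> a" if "\<eta> \<in> TS" "\<zeta> \<in> TS" "a \<in> carrier L" for \<eta> \<zeta> a
    unfolding conv_def [of "conv g \<zeta>"] by (rule TS_eq_carrier [OF that(1)]) (use as that in auto)
  obtain r where r: "0 < r" "\<forall>a\<in>nb r. (\<lambda>b. g (a \<otimes> b)) \<in> hn" by (rule left_hn [OF g])
  have "\<xi> (\<lambda>a. conv (conv g \<zeta>) \<eta> a - conv (conv g \<eta>) \<zeta> a) = \<xi> (conv g (br \<eta> \<zeta>))"
  proof (rule TS_germ [OF \<xi> _ open_nb one_nb [OF r(1)]])
    show "(\<lambda>a. conv (conv g \<zeta>) \<eta> a - conv (conv g \<eta>) \<zeta> a) \<in> hn" by (intro hn_diff conv_hn g \<eta> \<zeta>)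
    fix a assume a: "a \<in> nb r"
    then have ac: "a \<in> carrier L" using nb_carrier by blast
    show "conv (conv g \<zeta>) \<eta> a - conv (conv g \<eta>) \<zeta> a = conv g (br \<eta> \<zeta>) a"
      unfolding conv_def [of g "br \<eta> \<zeta>"] br_def using r(2) a as' ac \<eta> \<zeta> by simp
  qed
  moreover have "\<xi> (\<lambda>a. conv (conv g \<zeta>) \<eta> a - conv (conv g \<eta>) \<zeta> a) = \<xi> (conv (conv g \<zeta>) \<eta>) - \<xi> (conv (conv g \<eta>) \<zeta>)"
    by (intro TS_diff [OF \<xi>] conv_hn g \<eta> \<zeta>)
  moreover have "br \<eta> \<zeta> (conv g \<xi>) = \<eta> (conv (conv g \<xi>) \<zeta>) - \<zeta> (conv (conv g \<xi>) \<eta>)"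
    by (simp add: br_def conv_hn g \<xi>)
  ultimately show ?thesis using g by (simp add: br_def [of \<xi>])
qed

lemma conv_linear:
  shows "conv g (\<xi> + \<eta>) = (\<lambda>a. conv g \<xi> a + conv g \<eta> a)" "conv g (\<lambda>g. c * \<xi> g) = (\<lambda>a. c * conv g \<xi> a)"
  by (simp_all add: conv_def)

lemma lie_algebra_L: "lie_algebra LA"
proof -
  interpret vs: vector_space "\<lambda>c (\<xi> :: ('a \<Rightarrow> complex) \<Rightarrow> complex) g. c * \<xi> g" by (rule vector_space_fun)
  have 1: "vs.subspace TS" unfolding vs.subspace_def by (simp add: TS_plus TS_smult TS_null)
  have 2: "\<exists>B. finite B \<and> B \<subseteq> TS \<and> vs.span B = TS"
    using finite_TB span_TB vs.span_superset by metis
  have 3: "br \<xi> \<xi> = 0" for \<xi> by (simp add: br_def fun_eq_iff)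
  have 4: "br (\<lambda>g. c * \<xi> g) \<eta> = (\<lambda>g. c * br \<xi> \<eta> g)" "br \<xi> (\<lambda>g. c * \<eta> g) = (\<lambda>g. c * br \<xi> \<eta> g)"
    if \<xi>: "\<xi> \<in> TS" and \<eta>: "\<eta> \<in> TS" for c \<xi> \<eta>
    by (auto simp: br_def fun_eq_iff conv_linear TS_cmult conv_hn \<xi> \<eta> right_diff_distrib)
  have 5: "br (\<xi> + \<eta>) \<zeta> = br \<xi> \<zeta> + br \<eta> \<zeta>" "br \<zeta> (\<xi> + \<eta>) = br \<zeta> \<xi> + br \<zeta> \<eta>"
    if \<xi>: "\<xi> \<in> TS" and \<eta>: "\<eta> \<in> TS" and \<zeta>: "\<zeta> \<in> TS" for \<xi> \<eta> \<zeta>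
    by (auto simp: br_def fun_eq_iff conv_linear TS_add conv_hn \<xi> \<eta> \<zeta>)
  have 6: "br \<xi> (br \<eta> \<zeta>) + br \<eta> (br \<zeta> \<xi>) + br \<zeta> (br \<xi> \<eta>) = 0"
    if \<xi>: "\<xi> \<in> TS" and \<eta>: "\<eta> \<in> TS" and \<zeta>: "\<zeta> \<in> TS" for \<xi> \<eta> \<zeta>
  proof
    fix g
    show "(br \<xi> (br \<eta> \<zeta>) + br \<eta> (br \<zeta> \<xi>) + br \<zeta> (br \<xi> \<eta>)) g = 0 g"
    proof (cases "g \<in> hn")
      case True
      then show ?thesis by (simp add: br_br \<xi> \<eta> \<zeta>)
    qed (simp add: br_def)
  qed
  show ?thesis
    unfolding lie_algebra_def lie_carrier_eq lie_scale_eq lie_bracket_eq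
    using vector_space_fun 1 2 3 4 5 6 br_TS by simp
qed

text \<open>The group law in coordinates, times addition in coordinate k. This yields a local group
  on an open ball of V rather than of the hyperplane; the coordinates of group elements are the
  points with entry k equal to 0.\<close>

definition lm :: "complex^'m \<Rightarrow> complex^'m \<Rightarrow> complex^'m" where
  "lm x y = (\<chi> j. if j = k then x $ k + y $ k else \<kappa> (\<sigma> x \<otimes> \<sigma> y) $ j)"

lemma lm_local_group:
  obtains R where "ball 0 R \<subseteq> \<Omega>0" "\<forall>x\<in>ball 0 R. \<forall>y\<in>ball 0 R. \<sigma> x \<otimes> \<sigma> y \<in> U0" "local_group lm R"
    "\<forall>u v. local_group.bracket lm u v = vc (br (tv u) (tv v))"
proof -
  let ?P = "\<lambda>j r. 0 < r \<and> ball 0 r \<subseteq> \<Omega>0 \<and> (\<forall>x\<in>ball 0 r. \<forall>y\<in>ball 0 r. \<sigma> x \<otimes> \<sigma> y \<in> U0) \<and>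
      holo pair_scale (*) (mul (\<lambda>a. \<kappa> a $ j)) (ball 0 r \<times> ball 0 r)"
  have "\<forall>j. \<exists>r. ?P j r"
  proof
    fix j show "\<exists>r. ?P j r" by (rule mult_hn [OF hn_\<kappa> [of j]]) blast
  qed
  then have "\<exists>r. \<forall>j. ?P j (r j)" by (rule choice)
  then obtain r where rP: "\<forall>j. ?P j (r j)" by (rule exE)
  have r: "0 < r j" "ball 0 (r j) \<subseteq> \<Omega>0" "\<forall>x\<in>ball 0 (r j). \<forall>y\<in>ball 0 (r j). \<sigma> x \<otimes> \<sigma> y \<in> U0"
    "holo pair_scale (*) (mul (\<lambda>a. \<kappa> a $ j)) (ball 0 (r j) \<times> ball 0 (r j))" for j
    using conjunct1 [OF spec [OF rP, of j]] conjunct1 [OF conjunct2 [OF spec [OF rP, of j]]]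
      conjunct1 [OF conjunct2 [OF conjunct2 [OF spec [OF rP, of j]]]] conjunct2 [OF conjunct2 [OF conjunct2 [OF spec [OF rP, of j]]]]
    by - assumption+
  define R where "R = Min (range r)"
  have R: "0 < R" unfolding R_def using r(1) by simp
  have Rle: "R \<le> r j" for j unfolding R_def by simp
  have RB: "ball (0::complex^'m) R \<subseteq> ball 0 (r j)" for j using Rle [of j] by (rule subset_ball)
  let ?B = "ball (0::complex^'m) R"
  have R\<Omega>: "?B \<subseteq> \<Omega>0" using RB r(2) by blast
  have RU: "\<sigma> x \<otimes> \<sigma> y \<in> U0" if "x \<in> ?B" "y \<in> ?B" for x y using that RB r(3) by blast
  have hR: "holo pair_scale (*) (mul (\<lambda>a. \<kappa> a $ j)) (?B \<times> ?B)" for j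
    by (rule holo_subset [OF r(4)]) (use RB in blast)
  have \<sigma>lm: "\<sigma> (lm x y) = \<sigma> x \<otimes> \<sigma> y" if "x \<in> ?B" "y \<in> ?B" for x y
  proof -
    have "pr (lm x y) = \<kappa> (\<sigma> x \<otimes> \<sigma> y)"
      using \<kappa>_Cn [OF RU [OF that]] by (auto simp: vec_eq_iff pr_nth lm_def Cn_def)
    then show ?thesis using \<sigma>_pr [of "lm x y"] \<sigma>_\<kappa> [OF RU [OF that]] by simp
  qed
  have coordk: "holo pair_scale (*) (\<lambda>p. fst p $ k + snd p $ k) S" for S :: "((complex^'m) \<times> (complex^'m)) set"
    by (rule holo_linear) (auto intro!: bounded_linear_add bounded_linear_compose [OF bounded_linear_vec_nth]
        bounded_linear_fst bounded_linear_snd simp: pair_scale_def distrib_left)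
  have hm: "holo pair_scale (*s) (\<lambda>p. lm (fst p) (snd p)) (?B \<times> ?B)"
    unfolding holo_vec_iff
  proof
    fix j
    show "holo pair_scale (*) (\<lambda>p. lm (fst p) (snd p) $ j) (?B \<times> ?B)"
      by (cases "j = k") (simp_all add: lm_def coordk hR)
  qed
  have loc: "local_group lm R"
  proof
    show "0 < R" by (rule R)
    show "holo pair_scale (*s) (\<lambda>p. lm (fst p) (snd p)) (?B \<times> ?B)" by (rule hm)
    show "lm x 0 = x" "lm 0 x = x" if "x \<in> ?B" for x
    proof -
      have x: "x \<in> \<Omega>0" using that R\<Omega> by blast
      have "\<sigma> x \<otimes> \<one> = \<sigma> x" "\<one> \<otimes> \<sigma> x = \<sigma> x" using \<sigma>_carrier [OF x] by simp_all
      then show "lm x 0 = x" "lm 0 x = x"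
        using \<kappa>_\<sigma> [OF x] unfolding lm_def vec_eq_iff \<sigma>_0 by (simp_all add: pr_nth)
    qed
    fix x y z assume B: "x \<in> ?B" "y \<in> ?B" "z \<in> ?B" "lm x y \<in> ?B" "lm y z \<in> ?B"
    have "\<sigma> x \<in> carrier L" "\<sigma> y \<in> carrier L" "\<sigma> z \<in> carrier L" using B R\<Omega> \<sigma>_carrier by blast+
    then have "\<sigma> (lm x y) \<otimes> \<sigma> z = \<sigma> x \<otimes> \<sigma> (lm y z)" using B by (simp add: \<sigma>lm m_assoc)
    then show "lm (lm x y) z = lm x (lm y z)" by (simp add: lm_def [of "lm x y"] lm_def [of x "lm y z"] vec_eq_iff) (simp add: lm_def add.assoc)
  qed
  interpret lg: local_group lm R by (rule loc)
  have "lg.bracket u v = vc (br (tv u) (tv v))" for u v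
  proof -
    have o: "open (?B \<times> ?B)" by (intro open_Times open_ball)
    have zero: "0 \<in> ?B" using R by simp
    have dA: "(lg.A has_derivative dd lg.A 0) (at 0)"
      by (rule mholo_dd(1) [OF cscale_vec lg.A_mholo open_ball zero])
    have Av: "(lg.A x *v v) $ j = dd (\<lambda>p. lm (fst p) (snd p) $ j) (x, 0) (0, v)" if "x \<in> ?B" for x v j
    proof -
      have p: "(x, 0) \<in> ?B \<times> ?B" using that zero by simp
      show ?thesis unfolding lg.A_def lg.J_apply [OF p] by (rule holo_vec_dd(1) [OF cscale_pair hm o p])
    qed
    have dAv: "((\<lambda>x. (lg.A x *v v) $ j) has_derivative (\<lambda>u. (dd lg.A 0 u *v v) $ j)) (at 0)" for v j
      by (intro has_derivative_nth bounded_linear.has_derivative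
          [OF bounded_bilinear.bounded_linear_left [OF bounded_bilinear_matrix_vector_mult]] dA)
    have j: "(dd lg.A 0 u *v v) $ j = tv u (conv (\<lambda>a. \<kappa> a $ j) (tv v))" if "j \<noteq> k" for u v j
    proof -
      have "(\<lambda>p. lm (fst p) (snd p) $ j) = mul (\<lambda>a. \<kappa> a $ j)" using that by (simp add: lm_def)
      then have "(lg.A x *v v) $ j = conv (\<lambda>a. \<kappa> a $ j) (tv v) (\<sigma> x)" if "x \<in> ?B" for x
        using Av [OF that, of v j] mul_formula(2) [OF R R\<Omega> hR that, of v j] by (simp add: conv_def)
      then have "((\<lambda>x. conv (\<lambda>a. \<kappa> a $ j) (tv v) (\<sigma> x)) has_derivative (\<lambda>u. (dd lg.A 0 u *v v) $ j)) (at 0)"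
        by (rule has_derivative_transform_within_open [OF dAv open_ball zero])
      from dd_eq [OF this] show ?thesis by (simp add: tv_def [of u] conv_hn hn_\<kappa> tv_TS)
    qed
    \<comment> \<open>The left invariant fields of addition are constant, so coordinate k
      contributes nothing to the bracket.\<close>
    have jk: "(dd lg.A 0 u *v v) $ k = 0" for u v
    proof -
      have bl: "bounded_linear (\<lambda>p::(complex^'m) \<times> (complex^'m). fst p $ k + snd p $ k)"
        by (auto intro!: bounded_linear_add bounded_linear_compose [OF bounded_linear_vec_nth]
          bounded_linear_fst bounded_linear_snd)
      have "(lg.A x *v v) $ k = v $ k" if "x \<in> ?B" for x
        using Av [OF that, of v k] dd_eq [OF bounded_linear_imp_has_derivative [OF bl], of "(x, 0)" "(0, v)"] by (simp add: lm_def)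
      then have "((\<lambda>x. v $ k) has_derivative (\<lambda>u. (dd lg.A 0 u *v v) $ k)) (at 0)"
        by (rule has_derivative_transform_within_open [OF dAv open_ball zero])
      from fun_cong [OF has_derivative_unique [OF this has_derivative_const]] show ?thesis by simp
    qed
    have vck: "vc (br (tv u) (tv v)) $ k = 0"
    proof -
      have "pr (vc (br (tv u) (tv v))) = vc (br (tv u) (tv v))"
        using vc_tv [of "vc (br (tv u) (tv v))"] by (simp add: tv_vc br_TS tv_TS)
      then show ?thesis by (metis pr_nth)
    qed
    show ?thesis
      unfolding vec_eq_iff lg.bracket_def
    proof
      fix i
      show "(dd lg.A 0 u *v v - dd lg.A 0 v *v u) $ i = vc (br (tv u) (tv v)) $ i"
      proof (cases "i = k")
        case True
        then show ?thesis by (simp add: jk vck)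
      next
        case False
        then show ?thesis by (simp add: j vc_def br_def hn_\<kappa>)
      qed
    qed
  qed
  then show thesis using that [of R] R\<Omega> RU loc by blast
qed

text \<open>f composed with \<open>tv\<close> respects the bracket of \<open>lm\<close> and kills
  direction k. Products of group elements have coordinates with entry k equal to 0, so
  multiplicativity on the ball of V restricts to the group.\<close>

theorem integrate_group:
  fixes f :: "(('a \<Rightarrow> complex) \<Rightarrow> complex) \<Rightarrow> complex^'n::finite^'n"
  assumes f: "lie_hom LA gl_lie f"
  obtains r s H where "0 < r" "ball 0 r \<subseteq> \<Omega>0" "\<forall>i j. hfun (nb r) (\<lambda>a. H a $ i $ j)" "H \<one> = mat 1"
    "0 < s" "s \<le> r" "\<forall>a\<in>nb s. \<forall>b\<in>nb s. a \<otimes> b \<in> nb r \<and> H (a \<otimes> b) = H a ** H b"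
    "\<forall>\<xi>\<in>TS. \<forall>i j. \<xi> (\<lambda>a. H a $ i $ j) = f \<xi> $ i $ j"
proof -
  obtain R where R: "ball 0 R \<subseteq> \<Omega>0" "\<forall>x\<in>ball 0 R. \<forall>y\<in>ball 0 R. \<sigma> x \<otimes> \<sigma> y \<in> U0"
    and loc: "local_group lm R" and brk: "\<forall>u v. local_group.bracket lm u v = vc (br (tv u) (tv v))"
    by (rule lm_local_group)
  interpret lg: local_group lm R by (rule loc)
  have fadd: "f (\<xi> + \<eta>) = f \<xi> + f \<eta>" and fbr: "f (br \<xi> \<eta>) = f \<xi> ** f \<eta> - f \<eta> ** f \<xi>"
    and fsc: "f (\<lambda>g. c * \<xi> g) = map_matrix ((*) c) (f \<xi>)" if "\<xi> \<in> TS" "\<eta> \<in> TS" for \<xi> \<eta> c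
    using f that unfolding lie_hom_def lie_carrier_eq lie_scale_eq lie_bracket_eq by (auto simp: gl_lie_def)
  obtain \<delta> \<epsilon> H where \<delta>: "0 < \<delta>" "\<delta> \<le> R" and H: "mholo (*s) H (ball 0 \<delta>)" "H 0 = mat 1" "\<And>v. dd H 0 v = f (tv v)"
    and \<epsilon>: "0 < \<epsilon>" "\<epsilon> \<le> \<delta>" and Hm: "\<And>x y. x \<in> ball 0 \<epsilon> \<Longrightarrow> y \<in> ball 0 \<epsilon> \<Longrightarrow> lm x y \<in> ball 0 \<delta> \<and> H (lm x y) = H x ** H y"
  proof (rule lg.integrate [of "\<lambda>u. f (tv u)"])
    show "f (tv (x + y)) = f (tv x) + f (tv y)" for x y by (simp add: tv_add fadd tv_TS)
    show "f (tv (c *s x)) $ i $ j = c * f (tv x) $ i $ j" for c x i j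
      by (simp add: tv_smult fsc [OF tv_TS tv_TS] map_matrix_def)
    show "f (tv (lg.bracket u v)) = f (tv u) ** f (tv v) - f (tv v) ** f (tv u)" for u v
      using brk by (simp add: tv_vc br_TS tv_TS fbr)
  qed blast
  define H' where "H' a = H (\<kappa> a)" for a
  have Hh: "hfun (nb \<delta>) (\<lambda>a. H' a $ i $ j)" for i j
    unfolding nb_def H'_def using H(1) by (intro holo_push) (auto simp: mholo_def)
  have b\<delta>: "ball 0 \<delta> \<subseteq> \<Omega>0" using R(1) \<delta>(2) by (meson subset_ball subset_trans)
  show thesis
  proof (rule that [OF \<delta>(1) b\<delta> _ _ \<epsilon>(1,2)])
    show "\<forall>i j. hfun (nb \<delta>) (\<lambda>a. H' a $ i $ j)" using Hh by blast
    show "H' \<one> = mat 1" by (simp add: H'_def \<kappa>_one H(2))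
    show "\<forall>a\<in>nb \<epsilon>. \<forall>b\<in>nb \<epsilon>. a \<otimes> b \<in> nb \<delta> \<and> H' (a \<otimes> b) = H' a ** H' b"
    proof (intro ballI)
      fix a b assume ab: "a \<in> nb \<epsilon>" "b \<in> nb \<epsilon>"
      then have \<kappa>ab: "\<kappa> a \<in> ball 0 \<epsilon>" "\<kappa> b \<in> ball 0 \<epsilon>" "a \<in> U0" "b \<in> U0" by (auto simp: nb_def)
      then have "\<kappa> a \<in> ball 0 R" "\<kappa> b \<in> ball 0 R" using \<epsilon>(2) \<delta>(2) by auto
      then have U: "a \<otimes> b \<in> U0" using R(2) \<sigma>_\<kappa> \<kappa>ab(3,4) by metis
      have "\<kappa> a $ k = 0" "\<kappa> b $ k = 0" "\<kappa> (a \<otimes> b) $ k = 0" using \<kappa>_Cn \<kappa>ab(3,4) U by (auto simp: Cn_def)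
      then have "lm (\<kappa> a) (\<kappa> b) = \<kappa> (a \<otimes> b)" by (auto simp: lm_def vec_eq_iff \<sigma>_\<kappa> \<kappa>ab(3,4))
      then show "a \<otimes> b \<in> nb \<delta> \<and> H' (a \<otimes> b) = H' a ** H' b"
        using Hm [OF \<kappa>ab(1,2)] U by (simp add: nb_def H'_def)
    qed
    show "\<forall>\<xi>\<in>TS. \<forall>i j. \<xi> (\<lambda>a. H' a $ i $ j) = f \<xi> $ i $ j"
    proof (intro ballI allI)
      fix \<xi> i j assume \<xi>: "\<xi> \<in> TS"
      have hn: "(\<lambda>a. H' a $ i $ j) \<in> hn" by (rule hnI [OF Hh one_nb [OF \<delta>(1)]])
      have zero: "0 \<in> ball (0::complex^'m) \<delta>" using \<delta>(1) by simp
      have "((\<lambda>x. H x $ i $ j) has_derivative (\<lambda>v. f (tv v) $ i $ j)) (at 0)"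
        using has_derivative_nth [OF has_derivative_nth [OF mholo_dd(1) [OF cscale_vec H(1) open_ball zero]]]
        by (simp add: H(3))
      then have "((\<lambda>x. H x $ i $ j) has_derivative (\<lambda>v. f (tv v) $ i $ j)) (at (pr 0))" by simp
      from has_derivative_compose [OF bounded_linear_imp_has_derivative [OF bounded_linear_pr] this]
      have "((\<lambda>x. H (pr x) $ i $ j) has_derivative (\<lambda>v. f (tv v) $ i $ j)) (at 0)" by (simp add: tv_pr)
      then have "((\<lambda>x. H' (\<sigma> x) $ i $ j) has_derivative (\<lambda>v. f (tv v) $ i $ j)) (at 0)"
        by (rule has_derivative_transform_within_open [OF _ open_\<Omega>0 zero_\<Omega>0]) (simp add: H'_def \<kappa>_\<sigma>)
      from dd_eq [OF this, of "vc \<xi>"] have "tv (vc \<xi>) (\<lambda>a. H' a $ i $ j) = f (tv (vc \<xi>)) $ i $ j"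
        using hn by (simp add: tv_def [of _ "\<lambda>a. H' a $ i $ j"])
      then show "\<xi> (\<lambda>a. H' a $ i $ j) = f \<xi> $ i $ j" by (simp add: tv_vc [OF \<xi>])
    qed
  qed
qed

end

section \<open>Projective charts and their germs\<close>

lemma PGL_iff: "g \<in> PGL \<longleftrightarrow> (\<exists>A. invertible A \<and> g = pgl_of A)"
  unfolding PGL_def by blast

lemma proj_chartD:
  assumes "proj_chart k T \<Phi> (U, \<phi>)"
  shows "\<phi> \<in> extensional U" "inj_on \<phi> U" "holo_map T \<Phi> proj_topology (proj_atlas k) U \<phi>"
    "holo_map proj_topology (proj_atlas k) T \<Phi> (\<phi> ` U) (inv_into U \<phi>)" "openin T U"
    "\<And>x. x \<in> U \<Longrightarrow> \<phi> x \<in> proj_space"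
    "\<And>S. openin T S \<Longrightarrow> S \<subseteq> U \<Longrightarrow> openin proj_topology (\<phi> ` S)"
proof -
  show 1: "\<phi> \<in> extensional U" "inj_on \<phi> U" "holo_map T \<Phi> proj_topology (proj_atlas k) U \<phi>"
    "holo_map proj_topology (proj_atlas k) T \<Phi> (\<phi> ` U) (inv_into U \<phi>)"
    using assms unfolding proj_chart_def biholomorphic_onto_open_def by auto
  show "openin T U" by (rule holo_mapD [OF 1(3)])
  have "\<phi> ` U \<subseteq> proj_space"
    using openin_subset [OF holo_mapD(1) [OF 1(4)]] unfolding topspace_proj .
  then show "\<phi> x \<in> proj_space" if "x \<in> U" for x using that by blast
  show "openin proj_topology (\<phi> ` S)" if S: "openin T S" "S \<subseteq> U" for S
  proof -
    have "{y \<in> \<phi> ` U. inv_into U \<phi> y \<in> S} = \<phi> ` S" using S(2) 1(2) by auto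
    then show ?thesis using holo_map_openin [OF 1(4) S(1)] by simp
  qed
qed

text \<open>Equality of germs at p up to PGL. This replaces the conditions on connected components,
  which are awkward to compose and to restrict; \<open>comp_loc\<close> translates between the
  two.\<close>

definition locp :: "'a topology \<Rightarrow> 'a \<Rightarrow> ('a \<Rightarrow> (complex^'m::finite) set) \<Rightarrow> ('a \<Rightarrow> (complex^'m) set) \<Rightarrow> bool" where
  "locp T p \<psi> \<psi>' \<longleftrightarrow> (\<exists>S A. openin T S \<and> p \<in> S \<and> invertible A \<and> (\<forall>x\<in>S. \<psi>' x = pgl_of A (\<psi> x)))"

lemma locpI: "openin T S \<Longrightarrow> p \<in> S \<Longrightarrow> invertible A \<Longrightarrow> (\<And>x. x \<in> S \<Longrightarrow> \<psi>' x = pgl_of A (\<psi> x)) \<Longrightarrow> locp T p \<psi> \<psi>'"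
  unfolding locp_def by blast

lemma locp_sym:
  assumes "locp T p \<psi> \<psi>'" "openin T U" "p \<in> U" "\<And>x. x \<in> U \<Longrightarrow> \<psi> x \<in> proj_space"
  shows "locp T p \<psi>' \<psi>"
proof -
  obtain S A where S: "openin T S" "p \<in> S" "invertible A" "\<forall>x\<in>S. \<psi>' x = pgl_of A (\<psi> x)"
    using assms(1) unfolding locp_def by blast
  show ?thesis
    by (rule locpI [of T "S \<inter> U" p "matrix_inv A"])
       (use S assms in \<open>auto simp: pgl_of_inv intro: invertible_matrix_inv'\<close>)
qed

lemma locp_trans:
  assumes "locp T p \<psi> \<psi>'" "locp T p \<psi>' \<psi>''" "openin T U" "p \<in> U" "\<And>x. x \<in> U \<Longrightarrow> \<psi> x \<in> proj_space"
  shows "locp T p \<psi> \<psi>''"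
proof -
  obtain S A where S: "openin T S" "p \<in> S" "invertible A" "\<forall>x\<in>S. \<psi>' x = pgl_of A (\<psi> x)"
    using assms(1) unfolding locp_def by blast
  obtain S' B where S': "openin T S'" "p \<in> S'" "invertible B" "\<forall>x\<in>S'. \<psi>'' x = pgl_of B (\<psi>' x)"
    using assms(2) unfolding locp_def by blast
  show ?thesis
    by (rule locpI [of T "S \<inter> S' \<inter> U" p "B ** A"])
       (use S S' assms in \<open>auto simp: pgl_of_mult intro: invertible_mult\<close>)
qed

lemma invertible_one: "invertible (mat 1 :: complex^'m::finite^'m)"
  by (simp add: invertible_det_nz det_I)

lemma locp_refl: "openin T U \<Longrightarrow> p \<in> U \<Longrightarrow> (\<And>x. x \<in> U \<Longrightarrow> \<psi> x \<in> proj_space) \<Longrightarrow> locp T p \<psi> \<psi>"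
  by (rule locpI [of T U p "mat 1"]) (auto simp: pgl_of_one invertible_one)

text \<open>The element of PGL relating the two germs is unique by \<open>pgl_of_agree_eq\<close>,
  because the images of open sets are open. Hence it is locally constant, and constant on the
  connected set C.\<close>

lemma connected_single:
  fixes \<psi> :: "'a \<Rightarrow> (complex^'m::finite) set"
  assumes C: "connectedin T C" "C \<subseteq> W" and W: "openin T W"
    and op: "\<And>S. openin T S \<Longrightarrow> S \<subseteq> W \<Longrightarrow> openin proj_topology (\<psi> ` S)"
    and l: "\<And>p. p \<in> C \<Longrightarrow> locp T p \<psi> \<psi>'"
  shows "\<exists>A. invertible A \<and> (\<forall>x\<in>C. \<psi>' x = pgl_of A (\<psi> x))"
proof (cases "C = {}")
  case True
  then show ?thesis using invertible_one by blast
next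
  case False
  then obtain p where p: "p \<in> C" by blast
  then obtain S0 A where S0: "openin T S0" "p \<in> S0" "invertible A" "\<forall>x\<in>S0. \<psi>' x = pgl_of A (\<psi> x)"
    using l unfolding locp_def by blast
  \<comment> \<open>P1 collects the points where the transition is the chosen A, P2 those where it
    is another element: two open sets that cover C and are disjoint by uniqueness.\<close>
  define P1 where "P1 = \<Union>{S. openin T S \<and> S \<subseteq> W \<and> (\<forall>x\<in>S. \<psi>' x = pgl_of A (\<psi> x))}"
  define P2 where "P2 = \<Union>{S. openin T S \<and> S \<subseteq> W \<and> (\<exists>B. invertible B \<and> pgl_of B \<noteq> pgl_of A \<and> (\<forall>x\<in>S. \<psi>' x = pgl_of B (\<psi> x)))}"
  have o: "openin T P1" "openin T P2" unfolding P1_def P2_def by (auto intro: openin_Union)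
  have cov: "C \<subseteq> P1 \<union> P2"
  proof
    fix q assume q: "q \<in> C"
    then obtain S B where S: "openin T S" "q \<in> S" "invertible B" "\<forall>x\<in>S. \<psi>' x = pgl_of B (\<psi> x)"
      using l unfolding locp_def by blast
    have SW: "openin T (S \<inter> W)" "q \<in> S \<inter> W" using S(1,2) W q C(2) by auto
    show "q \<in> P1 \<union> P2"
    proof (cases "pgl_of B = pgl_of A")
      case True
      then have "S \<inter> W \<in> {S. openin T S \<and> S \<subseteq> W \<and> (\<forall>x\<in>S. \<psi>' x = pgl_of A (\<psi> x))}" using SW S by auto
      then show ?thesis unfolding P1_def using SW(2) by blast
    next
      case False
      then have "S \<inter> W \<in> {S. openin T S \<and> S \<subseteq> W \<and> (\<exists>B. invertible B \<and> pgl_of B \<noteq> pgl_of A \<and> (\<forall>x\<in>S. \<psi>' x = pgl_of B (\<psi> x)))}"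
        using SW S by blast
      then show ?thesis unfolding P2_def using SW(2) by blast
    qed
  qed
  have dis: "P1 \<inter> P2 = {}"
  proof (rule ccontr)
    assume "P1 \<inter> P2 \<noteq> {}"
    then obtain x S S' B where x: "x \<in> S" "x \<in> S'" and S: "openin T S" "S \<subseteq> W" "\<forall>x\<in>S. \<psi>' x = pgl_of A (\<psi> x)"
      and S': "openin T S'" "invertible B" "pgl_of B \<noteq> pgl_of A" "\<forall>x\<in>S'. \<psi>' x = pgl_of B (\<psi> x)"
      unfolding P1_def P2_def by blast
    have "openin proj_topology (\<psi> ` (S \<inter> S'))" by (rule op) (use S S' in auto)
    moreover have "\<psi> ` (S \<inter> S') \<noteq> {}" using x by blast
    moreover have "pgl_of B p = pgl_of A p" if "p \<in> \<psi> ` (S \<inter> S')" for p using that S(3) S'(4) by auto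
    ultimately have "pgl_of B = pgl_of A" using pgl_of_agree_eq [OF S'(2) S0(3)] by blast
    then show False using S'(3) by simp
  qed
  have "p \<in> P1"
  proof -
    have "S0 \<inter> W \<in> {S. openin T S \<and> S \<subseteq> W \<and> (\<forall>x\<in>S. \<psi>' x = pgl_of A (\<psi> x))}" using S0 W by auto
    then show ?thesis unfolding P1_def using S0(2) p C(2) by blast
  qed
  then have "P2 \<inter> C = {}"
    using connectedinD [OF C(1) o] cov dis p by blast
  then have "C \<subseteq> P1" using cov by blast
  then have "\<forall>x\<in>C. \<psi>' x = pgl_of A (\<psi> x)" unfolding P1_def by blast
  then show ?thesis using S0(3) by blast
qed

lemma ball_pairs:
  "(\<forall>(U, \<phi>)\<in>A. \<forall>(W, \<psi>)\<in>A. P U \<phi> W \<psi>) \<longleftrightarrow> (\<forall>U \<phi> W \<psi>. (U, \<phi>) \<in> A \<longrightarrow> (W, \<psi>) \<in> A \<longrightarrow> P U \<phi> W \<psi>)"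
  by fastforce

lemma all_pairs_cong:
  assumes "\<And>U \<phi> W \<psi>. (U, \<phi>) \<in> A \<Longrightarrow> (W, \<psi>) \<in> A \<Longrightarrow> P U \<phi> W \<psi> \<longleftrightarrow> Q U \<phi> W \<psi>"
  shows "(\<forall>U \<phi> W \<psi>. (U, \<phi>) \<in> A \<longrightarrow> (W, \<psi>) \<in> A \<longrightarrow> P U \<phi> W \<psi>) \<longleftrightarrow>
    (\<forall>U \<phi> W \<psi>. (U, \<phi>) \<in> A \<longrightarrow> (W, \<psi>) \<in> A \<longrightarrow> Q U \<phi> W \<psi>)"
  using assms by blast

section \<open>Atlases and left invariance in terms of germs\<close>

context clg_chart
begin

text \<open>The group is locally connected, so a component of an open set contains a neighbourhood
  of each of its points; conversely \<open>connected_single\<close> glues the germs along a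
  component.\<close>

lemma comp_loc:
  assumes c: "pchart (U, \<phi>)" and W: "openin T W" "W \<subseteq> U"
  shows "(\<forall>C\<in>connected_components_of (subtopology T W). \<exists>g\<in>PGL. \<forall>y\<in>\<phi> ` C. F (inv_into U \<phi> y) = g y) \<longleftrightarrow>
    (\<forall>p\<in>W. locp T p \<phi> F)"
proof
  note inj = proj_chartD(2) [OF c]
  have inv: "inv_into U \<phi> (\<phi> x) = x" if "x \<in> W" for x using that W(2) inj by auto
  have tW: "topspace (subtopology T W) = W" using openin_subset [OF W(1)] by auto
  show "\<forall>p\<in>W. locp T p \<phi> F"
    if h: "\<forall>C\<in>connected_components_of (subtopology T W). \<exists>g\<in>PGL. \<forall>y\<in>\<phi> ` C. F (inv_into U \<phi> y) = g y"
  proof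
    fix p assume p: "p \<in> W"
    obtain S where S: "openin T S" "connectedin T S" "p \<in> S" "S \<subseteq> W" by (rule connected_nbhd [OF W(1) p])
    let ?C = "connected_component_of_set (subtopology T W) p"
    have "?C \<in> connected_components_of (subtopology T W)"
      using p tW by (simp add: connected_component_in_connected_components_of)
    then obtain g where g: "g \<in> PGL" "\<forall>y\<in>\<phi> ` ?C. F (inv_into U \<phi> y) = g y" using h by blast
    obtain A where A: "invertible A" "g = pgl_of A" using g(1) PGL_iff by blast
    have "S \<subseteq> ?C"
      using S by (intro connected_component_of_maximal) (auto simp: connectedin_subtopology)
    then show "locp T p \<phi> F"
      using g(2) A inv S by (intro locpI [OF S(1,3) A(1)]) (metis image_eqI subsetD)
  qed
  show "\<forall>C\<in>connected_components_of (subtopology T W). \<exists>g\<in>PGL. \<forall>y\<in>\<phi> ` C. F (inv_into U \<phi> y) = g y"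
    if h: "\<forall>p\<in>W. locp T p \<phi> F"
  proof
    fix C assume C: "C \<in> connected_components_of (subtopology T W)"
    have "connectedin (subtopology T W) C" by (rule connectedin_connected_components_of [OF C])
    then have C': "connectedin T C" "C \<subseteq> W" by (auto simp: connectedin_subtopology)
    obtain A where "invertible A" "\<forall>x\<in>C. F x = pgl_of A (\<phi> x)"
      using connected_single [OF C' W(1), of \<phi> F] proj_chartD(7) [OF c] W(2) h C'(2) by blast
    then show "\<exists>g\<in>PGL. \<forall>y\<in>\<phi> ` C. F (inv_into U \<phi> y) = g y"
      using inv C'(2) by (intro bexI [of _ "pgl_of A"]) (auto simp: PGL_iff subset_eq)
  qed
qed

lemma proj_atlas_on_iff:
  "proj_atlas_on k T \<Phi> \<A> \<longleftrightarrow> (\<forall>U \<phi>. (U, \<phi>) \<in> \<A> \<longrightarrow> pchart (U, \<phi>)) \<and> (\<Union>(U, \<phi>)\<in>\<A>. U) = topspace T \<and>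
     (\<forall>U \<phi> W \<psi>. (U, \<phi>) \<in> \<A> \<longrightarrow> (W, \<psi>) \<in> \<A> \<longrightarrow> (\<forall>p\<in>U \<inter> W. locp T p \<phi> \<psi>))"
proof -
  have key: "(\<forall>(U, \<phi>)\<in>\<A>. \<forall>(W, \<psi>)\<in>\<A>. \<forall>C\<in>connected_components_of (subtopology T (U \<inter> W)).
        \<exists>g\<in>PGL. \<forall>y\<in>\<phi> ` C. \<psi> (inv_into U \<phi> y) = g y) \<longleftrightarrow>
      (\<forall>U \<phi> W \<psi>. (U, \<phi>) \<in> \<A> \<longrightarrow> (W, \<psi>) \<in> \<A> \<longrightarrow> (\<forall>p\<in>U \<inter> W. locp T p \<phi> \<psi>))"
    if c: "\<forall>U \<phi>. (U, \<phi>) \<in> \<A> \<longrightarrow> pchart (U, \<phi>)"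
    unfolding ball_pairs
  proof (rule all_pairs_cong)
    fix U \<phi> W \<psi> assume UW: "(U, \<phi>) \<in> \<A>" "(W, \<psi>) \<in> \<A>"
    have o: "openin T U" "openin T W" using UW c proj_chartD(5) by blast+
    show "(\<forall>C\<in>connected_components_of (subtopology T (U \<inter> W)).
        \<exists>g\<in>PGL. \<forall>y\<in>\<phi> ` C. \<psi> (inv_into U \<phi> y) = g y) \<longleftrightarrow> (\<forall>p\<in>U \<inter> W. locp T p \<phi> \<psi>)"
      by (rule comp_loc) (use UW c o in \<open>auto intro!: openin_Int\<close>)
  qed
  have e: "(\<forall>c\<in>\<A>. pchart c) \<longleftrightarrow> (\<forall>U \<phi>. (U, \<phi>) \<in> \<A> \<longrightarrow> pchart (U, \<phi>))" by auto
  show ?thesis unfolding proj_atlas_on_def e by (rule conj_cong [OF refl], rule conj_cong [OF refl], rule key)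
qed

lemma left_invariant_iff:
  assumes c: "\<forall>U \<phi>. (U, \<phi>) \<in> \<A> \<longrightarrow> pchart (U, \<phi>)"
  shows "left_invariant L T \<A> \<longleftrightarrow> (\<forall>a\<in>carrier L. \<forall>U \<phi> W \<psi>. (U, \<phi>) \<in> \<A> \<longrightarrow> (W, \<psi>) \<in> \<A> \<longrightarrow>
     (\<forall>p\<in>U. a \<otimes> p \<in> W \<longrightarrow> locp T p \<phi> (\<lambda>x. \<psi> (a \<otimes> x))))"
proof -
  have eq: "(\<forall>C\<in>connected_components_of (subtopology T (U \<inter> {x \<in> carrier L. a \<otimes> x \<in> W})).
          \<exists>g\<in>PGL. \<forall>y\<in>\<phi> ` C. \<psi> (a \<otimes> inv_into U \<phi> y) = g y) \<longleftrightarrow>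
      (\<forall>p\<in>U. a \<otimes> p \<in> W \<longrightarrow> locp T p \<phi> (\<lambda>x. \<psi> (a \<otimes> x)))"
    if a: "a \<in> carrier L" and UW: "(U, \<phi>) \<in> \<A>" "(W, \<psi>) \<in> \<A>" for a U \<phi> W \<psi>
  proof -
    have o: "openin T U" "openin T W" using UW c proj_chartD(5) by blast+
    have "(\<forall>C\<in>connected_components_of (subtopology T (U \<inter> {x \<in> carrier L. a \<otimes> x \<in> W})).
          \<exists>g\<in>PGL. \<forall>y\<in>\<phi> ` C. (\<lambda>x. \<psi> (a \<otimes> x)) (inv_into U \<phi> y) = g y) \<longleftrightarrow>
      (\<forall>p\<in>U \<inter> {x \<in> carrier L. a \<otimes> x \<in> W}. locp T p \<phi> (\<lambda>x. \<psi> (a \<otimes> x)))"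
    proof (rule comp_loc)
      show "pchart (U, \<phi>)" using UW c by blast
      show "openin T (U \<inter> {x \<in> carrier L. a \<otimes> x \<in> W})" by (intro openin_Int o open_left [OF a])
    qed blast
    then show ?thesis using open_carrier [OF o(1)] by auto
  qed
  show ?thesis unfolding left_invariant_def ball_pairs by (rule ball_cong [OF refl], rule all_pairs_cong, rule eq)
qed

lemma IFPS_D:
  assumes "\<A> \<in> IFPSs"
  shows "(U, \<phi>) \<in> \<A> \<Longrightarrow> pchart (U, \<phi>)"
    "p \<in> carrier L \<Longrightarrow> \<exists>U \<phi>. (U, \<phi>) \<in> \<A> \<and> p \<in> U"
    "(U, \<phi>) \<in> \<A> \<Longrightarrow> (W, \<psi>) \<in> \<A> \<Longrightarrow> p \<in> U \<Longrightarrow> p \<in> W \<Longrightarrow> locp T p \<phi> \<psi>"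
    "(U, \<phi>) \<in> \<A> \<Longrightarrow> (W, \<psi>) \<in> \<A> \<Longrightarrow> a \<in> carrier L \<Longrightarrow> p \<in> U \<Longrightarrow> a \<otimes> p \<in> W \<Longrightarrow> locp T p \<phi> (\<lambda>x. \<psi> (a \<otimes> x))"
    "proj_atlas_on k T \<Phi> \<B> \<Longrightarrow> \<A> \<subseteq> \<B> \<Longrightarrow> \<B> = \<A>"
proof -
  have f: "proj_atlas_on k T \<Phi> \<A>" "\<And>\<B>. proj_atlas_on k T \<Phi> \<B> \<Longrightarrow> \<A> \<subseteq> \<B> \<Longrightarrow> \<B> = \<A>" "left_invariant L T \<A>"
    using assms unfolding complex_IFPSs_def flat_proj_structure_def by auto
  have a: "\<forall>U \<phi>. (U, \<phi>) \<in> \<A> \<longrightarrow> pchart (U, \<phi>)" "(\<Union>(U, \<phi>)\<in>\<A>. U) = topspace T"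
     "\<forall>U \<phi> W \<psi>. (U, \<phi>) \<in> \<A> \<longrightarrow> (W, \<psi>) \<in> \<A> \<longrightarrow> (\<forall>p\<in>U \<inter> W. locp T p \<phi> \<psi>)"
    using conjunct1 [OF f(1) [unfolded proj_atlas_on_iff]]
      conjunct1 [OF conjunct2 [OF f(1) [unfolded proj_atlas_on_iff]]]
      conjunct2 [OF conjunct2 [OF f(1) [unfolded proj_atlas_on_iff]]] by - assumption+
  show "(U, \<phi>) \<in> \<A> \<Longrightarrow> pchart (U, \<phi>)" using a(1) by blast
  show "\<exists>U \<phi>. (U, \<phi>) \<in> \<A> \<and> p \<in> U" if "p \<in> carrier L"
  proof -
    have "p \<in> (\<Union>(U, \<phi>)\<in>\<A>. U)" using that unfolding a(2) carrier_top .
    then show ?thesis by auto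
  qed
  show "(U, \<phi>) \<in> \<A> \<Longrightarrow> (W, \<psi>) \<in> \<A> \<Longrightarrow> p \<in> U \<Longrightarrow> p \<in> W \<Longrightarrow> locp T p \<phi> \<psi>" using a(3) by blast
  show "(U, \<phi>) \<in> \<A> \<Longrightarrow> (W, \<psi>) \<in> \<A> \<Longrightarrow> a \<in> carrier L \<Longrightarrow> p \<in> U \<Longrightarrow> a \<otimes> p \<in> W \<Longrightarrow> locp T p \<phi> (\<lambda>x. \<psi> (a \<otimes> x))"
    using f(3) unfolding left_invariant_iff [OF a(1)] by blast
  show "proj_atlas_on k T \<Phi> \<B> \<Longrightarrow> \<A> \<subseteq> \<B> \<Longrightarrow> \<B> = \<A>" by (rule f(2))
qed

text \<open>A chart compatible with the structure at all common points can be added to the atlas, so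
  maximality shows that it was already there.\<close>

lemma IFPS_mem:
  assumes \<A>: "\<A> \<in> IFPSs" and c: "pchart (W, \<psi>)"
    and l: "\<And>U \<phi> p. (U, \<phi>) \<in> \<A> \<Longrightarrow> p \<in> U \<Longrightarrow> p \<in> W \<Longrightarrow> locp T p \<phi> \<psi>"
  shows "(W, \<psi>) \<in> \<A>"
proof -
  have "proj_atlas_on k T \<Phi> (insert (W, \<psi>) \<A>)"
    unfolding proj_atlas_on_iff
  proof (intro conjI allI impI ballI)
    fix U \<phi> assume "(U, \<phi>) \<in> insert (W, \<psi>) \<A>"
    then show "pchart (U, \<phi>)" using c IFPS_D(1) [OF \<A>] by auto
  next
    have "W \<subseteq> topspace T" using proj_chartD(5) [OF c] openin_subset by blast
    moreover have "(\<Union>(U, \<phi>)\<in>\<A>. U) = topspace T"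
      using \<A> unfolding complex_IFPSs_def flat_proj_structure_def proj_atlas_on_def by blast
    ultimately show "(\<Union>(U, \<phi>)\<in>insert (W, \<psi>) \<A>. U) = topspace T" by auto
  next
    fix U \<phi> U' \<phi>' p assume U: "(U, \<phi>) \<in> insert (W, \<psi>) \<A>" "(U', \<phi>') \<in> insert (W, \<psi>) \<A>" "p \<in> U \<inter> U'"
    have s: "locp T p \<psi> \<phi>" if "(U, \<phi>) \<in> \<A>" "p \<in> U" "p \<in> W" for U \<phi>
      by (rule locp_sym [OF l [OF that] proj_chartD(5) [OF IFPS_D(1) [OF \<A> that(1)]] that(2)])
         (rule proj_chartD(6) [OF IFPS_D(1) [OF \<A> that(1)]])
    have r: "locp T p \<psi> \<psi>" if "p \<in> W"
      by (rule locp_refl [OF proj_chartD(5) [OF c] that proj_chartD(6) [OF c]])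
    show "locp T p \<phi> \<phi>'"
      using U s r l IFPS_D(3) [OF \<A>] by auto
  qed
  from IFPS_D(5) [OF \<A> this] show ?thesis by blast
qed

lemma IFPS_eqI:
  assumes \<A>: "\<A> \<in> IFPSs" and \<B>: "\<B> \<in> IFPSs"
    and l: "\<And>U \<phi> W \<psi> p. (U, \<phi>) \<in> \<A> \<Longrightarrow> (W, \<psi>) \<in> \<B> \<Longrightarrow> p \<in> U \<Longrightarrow> p \<in> W \<Longrightarrow> locp T p \<phi> \<psi>"
  shows "\<A> = \<B>"
proof
  show "\<B> \<subseteq> \<A>"
  proof
    fix c assume c: "c \<in> \<B>"
    obtain W \<psi> where ceq: "c = (W, \<psi>)" by fastforce
    show "c \<in> \<A>" unfolding ceq
      by (rule IFPS_mem [OF \<A> IFPS_D(1) [OF \<B>]]) (use c ceq l in auto)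
  qed
  show "\<A> \<subseteq> \<B>"
  proof
    fix c assume c: "c \<in> \<A>"
    obtain U \<phi> where ceq: "c = (U, \<phi>)" by fastforce
    have pc: "pchart (U, \<phi>)" by (rule IFPS_D(1) [OF \<A>]) (use c ceq in simp)
    show "c \<in> \<B>" unfolding ceq
    proof (rule IFPS_mem [OF \<B> pc])
      fix W \<psi> p assume "(W, \<psi>) \<in> \<B>" "p \<in> W" "p \<in> U"
      then have "locp T p \<phi> \<psi>" by (intro l [of U \<phi> W \<psi> p]) (use c ceq in auto)
      then show "locp T p \<psi> \<phi>"
        by (rule locp_sym [OF _ proj_chartD(5) [OF pc] \<open>p \<in> U\<close> proj_chartD(6) [OF pc]])
    qed
  qed
qed

lemma locp_translate:
  assumes a: "a \<in> carrier L" "p \<in> carrier L" and l: "locp T p (\<lambda>x. \<psi> (a \<otimes> x)) (\<lambda>x. \<psi>' (a \<otimes> x))"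
  shows "locp T (a \<otimes> p) \<psi> \<psi>'"
proof -
  obtain S A where S: "openin T S" "p \<in> S" "invertible A" "\<forall>x\<in>S. \<psi>' (a \<otimes> x) = pgl_of A (\<psi> (a \<otimes> x))"
    using l unfolding locp_def by blast
  show ?thesis
    by (rule locpI [OF open_translate [OF a(1) S(1)] _ S(3)]) (use S in auto)
qed

lemma locp_cong:
  assumes "locp T p \<psi> \<psi>'" "openin T S" "p \<in> S" "\<And>x. x \<in> S \<Longrightarrow> \<psi> x = \<phi> x" "\<And>x. x \<in> S \<Longrightarrow> \<psi>' x = \<phi>' x"
  shows "locp T p \<phi> \<phi>'"
proof -
  obtain S' A where S': "openin T S'" "p \<in> S'" "invertible A" "\<forall>x\<in>S'. \<psi>' x = pgl_of A (\<psi> x)"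
    using assms(1) unfolding locp_def by blast
  show ?thesis by (rule locpI [of T "S \<inter> S'" p A]) (use S' assms in auto)
qed

lemma proj_chart_pgl:
  assumes c: "pchart (U, \<phi>)" and A: "invertible A"
  shows "pchart (U, restrict (\<lambda>x. pgl_of A (\<phi> x)) U)"
proof -
  note cD = proj_chartD [OF c]
  let ?\<psi> = "restrict (\<lambda>x. pgl_of A (\<phi> x)) U"
  have inj: "inj_on ?\<psi> U"
  proof (rule inj_onI)
    fix x y assume xy: "x \<in> U" "y \<in> U" "?\<psi> x = ?\<psi> y"
    then have "\<phi> x = \<phi> y" using pgl_of_inv(1) [OF A] cD(6) by (metis restrict_apply')
    then show "x = y" using inj_onD [OF cD(2)] xy by blast
  qed
  have "holo_map T \<Phi> proj_topology (proj_atlas k) U (\<lambda>x. pgl_of A (\<phi> x))"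
    by (rule holo_map_compose [OF cT cmfd_proj cD(3) holo_map_pgl [OF A]]) (use cD(6) in blast)
  then have h: "holo_map T \<Phi> proj_topology (proj_atlas k) U ?\<psi>"
    by (rule holo_map_cong [OF cT]) simp
  let ?Ai = "matrix_inv A"
  have Ai: "invertible ?Ai" by (rule invertible_matrix_inv' [OF A])
  have im: "?\<psi> ` U = {y \<in> proj_space. pgl_of ?Ai y \<in> \<phi> ` U}"
  proof (intro equalityI subsetI)
    fix y assume "y \<in> ?\<psi> ` U"
    then obtain x where "x \<in> U" "y = pgl_of A (\<phi> x)" by auto
    then show "y \<in> {y \<in> proj_space. pgl_of ?Ai y \<in> \<phi> ` U}"
      using cD(6) pgl_of_space [OF A] pgl_of_inv(1) [OF A] by auto
  next
    fix y assume "y \<in> {y \<in> proj_space. pgl_of ?Ai y \<in> \<phi> ` U}"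
    then obtain x where x: "y \<in> proj_space" "x \<in> U" "pgl_of ?Ai y = \<phi> x" by blast
    then have "y = pgl_of A (\<phi> x)" using pgl_of_inv(2) [OF A x(1)] by simp
    then show "y \<in> ?\<psi> ` U" using x(2) by auto
  qed
  have o: "openin proj_topology (?\<psi> ` U)"
    unfolding im by (rule holo_map_openin [OF holo_map_pgl [OF Ai]]) (rule holo_mapD(1) [OF cD(4)])
  have "holo_map proj_topology (proj_atlas k) T \<Phi> (?\<psi> ` U) (\<lambda>y. inv_into U \<phi> (pgl_of ?Ai y))"
    by (rule holo_map_compose [OF cmfd_proj cmfd_proj holo_map_subset [OF holo_map_pgl [OF Ai] o] cD(4)])
       (use im in auto)
  then have "holo_map proj_topology (proj_atlas k) T \<Phi> (?\<psi> ` U) (inv_into U ?\<psi>)"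
  proof (rule holo_map_cong [OF cmfd_proj])
    fix y assume "y \<in> ?\<psi> ` U"
    then obtain x where x: "x \<in> U" "y = ?\<psi> x" by blast
    have "inv_into U ?\<psi> y = x" unfolding x(2) by (rule inv_into_f_f [OF inj x(1)])
    moreover have "pgl_of ?Ai y = \<phi> x" using x pgl_of_inv(1) [OF A cD(6) [OF x(1)]] by simp
    ultimately show "inv_into U \<phi> (pgl_of ?Ai y) = inv_into U ?\<psi> y" using x(1) cD(2) by simp
  qed
  then show ?thesis unfolding proj_chart_def biholomorphic_onto_open_def using inj h by auto
qed

lemma proj_chart_translate:
  assumes c: "pchart (U, \<phi>)" and a: "a \<in> carrier L"
  shows "pchart ((\<lambda>x. a \<otimes> x) ` U, restrict (\<lambda>x. \<phi> (inv a \<otimes> x)) ((\<lambda>x. a \<otimes> x) ` U))"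
proof -
  note cD = proj_chartD [OF c]
  let ?W = "(\<lambda>x. a \<otimes> x) ` U"
  let ?\<psi> = "restrict (\<lambda>x. \<phi> (inv a \<otimes> x)) ?W"
  have Uc: "U \<subseteq> carrier L" by (rule open_carrier [OF cD(5)])
  have ia: "inv a \<in> carrier L" using a by simp
  have W: "openin T ?W" by (rule open_translate [OF a cD(5)])
  have ax: "inv a \<otimes> (a \<otimes> x) = x" if "x \<in> U" for x using that Uc a by (auto simp: m_assoc [symmetric])
  have \<psi>: "?\<psi> (a \<otimes> x) = \<phi> x" if "x \<in> U" for x using that ax by simp
  have inj: "inj_on ?\<psi> ?W"
  proof (rule inj_onI)
    fix x y assume "x \<in> ?W" "y \<in> ?W" and e: "?\<psi> x = ?\<psi> y"
    then obtain x' y' where "x' \<in> U" "x = a \<otimes> x'" "y' \<in> U" "y = a \<otimes> y'" by blast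
    then show "x = y" using e \<psi> inj_onD [OF cD(2)] by metis
  qed
  have im: "?\<psi> ` ?W = \<phi> ` U" using \<psi> by (force simp: image_image)
  have "holo_map T \<Phi> proj_topology (proj_atlas k) ?W (\<lambda>x. \<phi> (inv a \<otimes> x))"
    by (rule holo_map_compose [OF cT cT holo_map_subset [OF holo_left [OF ia] W] cD(3)])
       (use ax openin_subset [OF W] in auto)
  then have h: "holo_map T \<Phi> proj_topology (proj_atlas k) ?W ?\<psi>"
    by (rule holo_map_cong [OF cT]) simp
  have "holo_map proj_topology (proj_atlas k) T \<Phi> (\<phi> ` U) (\<lambda>y. a \<otimes> inv_into U \<phi> y)"
    by (rule holo_map_compose [OF cmfd_proj cT cD(4) holo_left [OF a]])
       (use openin_subset [OF cD(5)] in \<open>auto simp: cD(2)\<close>)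
  then have "holo_map proj_topology (proj_atlas k) T \<Phi> (\<phi> ` U) (inv_into ?W ?\<psi>)"
  proof (rule holo_map_cong [OF cmfd_proj])
    fix y assume "y \<in> \<phi> ` U"
    then obtain x where x: "x \<in> U" "y = \<phi> x" by blast
    have "inv_into ?W ?\<psi> (?\<psi> (a \<otimes> x)) = a \<otimes> x" by (rule inv_into_f_f [OF inj]) (use x in blast)
    then show "a \<otimes> inv_into U \<phi> y = inv_into ?W ?\<psi> y" using \<psi> [OF x(1)] x cD(2) by simp
  qed
  then show ?thesis unfolding proj_chart_def biholomorphic_onto_open_def using inj h im by auto
qed

end

section \<open>Projective homomorphisms\<close>

lemma mat_nth: "mat c $ i $ j = (if i = j then c else 0)"
  by (simp add: mat_def)

lemma matrix_mult_nth: "(A ** B) $ i $ j = (\<Sum>l\<in>UNIV. A $ i $ l * B $ l $ j)"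
  by (simp add: matrix_matrix_mult_def)

lemma mat_mult_comm: "A ** mat c = mat c ** A" for A :: "complex^'m::finite^'m"
  by (simp add: vec_eq_iff matrix_mult_nth mat_nth if_distrib if_distribR mult.commute cong: if_cong)

lemma mat_vec: "mat c *v v = c *s v" for v :: "complex^'m::finite"
  using mat_mult_vec [of c "mat 1" v] by simp

text \<open>Scalar matrices are central, so the bracket descends to gl(V) modulo scalars.\<close>

lemma commutator_add_mat:
  fixes A B :: "complex^'m::finite^'m"
  shows "(A + mat c) ** (B + mat d) - (B + mat d) ** (A + mat c) = A ** B - B ** A"
  unfolding matrix_bilinear_simps mat_mult_comm [of A] mat_mult_comm [of B] mat_mult_comm [of "mat d"] by simp

lemma map_matrix_mult: "map_matrix ((*) c) A = mat c ** A" for A :: "complex^'m::finite^'m"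
  by (simp add: vec_eq_iff mat_mult_nth map_matrix_def)

context clg_chart
begin

lemma \<sigma>_lm:
  assumes "\<sigma> x \<otimes> \<sigma> y \<in> U0"
  shows "\<sigma> (lm x y) = \<sigma> x \<otimes> \<sigma> y"
proof -
  have "pr (lm x y) = \<kappa> (\<sigma> x \<otimes> \<sigma> y)"
    using \<kappa>_Cn [OF assms] by (auto simp: vec_eq_iff pr_nth lm_def Cn_def)
  then show ?thesis using \<sigma>_pr [of "lm x y"] \<sigma>_\<kappa> [OF assms] by simp
qed

lemma nb_mono: "r \<le> s \<Longrightarrow> nb r \<subseteq> nb s"
  unfolding nb_def by auto

text \<open>The left invariant fields are the columns of an invertible matrix near the unit. If all
  left invariant derivatives vanish, so does the full derivative.\<close>

lemma left_const:
  assumes g: "g \<in> hn" and t: "0 < t" "\<And>a \<eta>. a \<in> nb t \<Longrightarrow> \<eta> \<in> TS \<Longrightarrow> conv g \<eta> a = 0"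
  obtains \<rho> where "0 < \<rho>" "\<forall>a\<in>nb \<rho>. g a = g \<one>"
proof -
  obtain R where R: "ball 0 R \<subseteq> \<Omega>0" "\<forall>x\<in>ball 0 R. \<forall>y\<in>ball 0 R. \<sigma> x \<otimes> \<sigma> y \<in> U0"
    and loc: "local_group lm R" and brk: "\<forall>u v. local_group.bracket lm u v = vc (br (tv u) (tv v))"
    by (rule lm_local_group)
  interpret lg: local_group lm R by (rule loc)
  obtain r where r: "0 < r" "ball 0 r \<subseteq> \<Omega>0" and hr: "holo (*s) (*) (\<lambda>x. g (\<sigma> x)) (ball 0 r)"
    by (rule hn_ball [OF g])
  obtain r2 where r2: "0 < r2" "ball 0 r2 \<subseteq> \<Omega>0" and h2: "holo pair_scale (*) (mul g) (ball 0 r2 \<times> ball 0 r2)"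
    by (rule mult_hn [OF g])
  obtain e where e: "0 < e" "e \<le> R" "\<forall>x\<in>ball 0 e. det (lg.A x) \<noteq> 0" using lg.det_A_near by blast
  define \<rho> where "\<rho> = min (min r r2) (min e t)"
  have \<rho>: "0 < \<rho>" "\<rho> \<le> r" "\<rho> \<le> r2" "\<rho> \<le> e" "\<rho> \<le> t" unfolding \<rho>_def using r r2 e t by auto
  have d0: "dd (\<lambda>x. g (\<sigma> x)) x w = 0" if x: "x \<in> ball 0 \<rho>" for x w
  proof -
    have xe: "x \<in> ball 0 e" "x \<in> ball 0 r" "x \<in> ball 0 r2" "x \<in> ball 0 t" using x \<rho> by auto
    have xR: "x \<in> ball 0 R" and dt: "det (lg.A x) \<noteq> 0" using xe(1) e(2,3) by auto
    have x\<Omega>: "x \<in> \<Omega>0" using xR R(1) by blast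
    define u where "u = matrix_inv (lg.A x) *v w"
    have w: "w = lg.A x *v u"
      unfolding u_def using dt by (simp add: matrix_vector_mul_assoc matrix_inv invertible_det_nz)
    have 1: "((\<lambda>x. g (\<sigma> x)) has_derivative dd (\<lambda>x. g (\<sigma> x)) x) (at (lm x 0))"
      using holo_dd(1) [OF hr open_ball xe(2)] lg.m_0_right [OF xR] by simp
    from has_derivative_compose [OF lg.m_deriv_right [OF xR lg.zero_ball] this]
    have "((\<lambda>y. g (\<sigma> (lm x y))) has_derivative (\<lambda>u. dd (\<lambda>x. g (\<sigma> x)) x (lg.J (x, 0) *v u))) (at 0)" .
    then have "((\<lambda>y. g (\<sigma> x \<otimes> \<sigma> y)) has_derivative (\<lambda>u. dd (\<lambda>x. g (\<sigma> x)) x (lg.J (x, 0) *v u))) (at 0)"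
      by (rule has_derivative_transform_within_open [OF _ open_ball lg.zero_ball]) (use R(2) xR \<sigma>_lm in auto)
    then have "dd (\<lambda>y. g (\<sigma> x \<otimes> \<sigma> y)) 0 u = dd (\<lambda>x. g (\<sigma> x)) x (lg.A x *v u)"
      unfolding lg.A_def by (rule dd_eq)
    moreover have "(\<lambda>b. g (\<sigma> x \<otimes> b)) \<in> hn" by (rule mul_formula(1) [OF r2 h2 xe(3)])
    ultimately have "conv g (tv u) (\<sigma> x) = dd (\<lambda>x. g (\<sigma> x)) x w"
      unfolding conv_def by (simp add: tv_def w)
    moreover have "\<sigma> x \<in> nb t"
      unfolding nb_def using \<sigma>_U0 [OF x\<Omega>] \<kappa>_\<sigma> [OF x\<Omega>] pr_ball [OF xe(4)] by simp
    ultimately show ?thesis using t(2) [OF _ tv_TS] by metis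
  qed
  have "g (\<sigma> x) = g (\<sigma> 0)" if x: "x \<in> ball 0 \<rho>" for x
  proof (rule radial_constant [where r=\<rho> and h="\<lambda>x. g (\<sigma> x)" and h'="\<lambda>x w. 0"])
    show "((\<lambda>x. g (\<sigma> x)) has_derivative (\<lambda>w. 0)) (at x)" if "x \<in> ball 0 \<rho>" for x
    proof -
      have "x \<in> ball 0 r" using that \<rho>(2) by simp
      moreover have "dd (\<lambda>x. g (\<sigma> x)) x = (\<lambda>w. 0)" using d0 [OF that] by (rule ext)
      ultimately show ?thesis using holo_dd(1) [OF hr open_ball, of x] by simp
    qed
  qed (use x in auto)
  then have "\<forall>a\<in>nb \<rho>. g a = g \<one>"
    using \<sigma>_\<kappa> \<sigma>_0 unfolding nb_def by (metis (no_types, lifting) mem_Collect_eq)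
  then show thesis using that \<rho>(1) by blast
qed

section \<open>Matrix-valued functions near the unit and their differentials\<close>

definition mfun :: "('a \<Rightarrow> complex^'m^'m) \<Rightarrow> real \<Rightarrow> bool" where
  "mfun H r \<longleftrightarrow> (\<forall>i j. hfun (nb r) (\<lambda>a. H a $ i $ j))"

definition dH :: "('a \<Rightarrow> complex^'m^'m) \<Rightarrow> (('a \<Rightarrow> complex) \<Rightarrow> complex) \<Rightarrow> complex^'m^'m" where
  "dH H \<xi> = (\<chi> i j. \<xi> (\<lambda>a. H a $ i $ j))"

lemma dH_nth: "dH H \<xi> $ i $ j = \<xi> (\<lambda>a. H a $ i $ j)"
  by (simp add: dH_def)

lemma mfun_hn: "mfun H r \<Longrightarrow> 0 < r \<Longrightarrow> (\<lambda>a. H a $ i $ j) \<in> hn"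
  unfolding mfun_def by (blast intro: hnI one_nb)

lemma mfun_mono: "mfun H r \<Longrightarrow> s \<le> r \<Longrightarrow> mfun H s"
  unfolding mfun_def using holo_fun_subset [OF _ open_nb nb_mono] by blast

lemma mfun_mult: "mfun H r \<Longrightarrow> mfun K r \<Longrightarrow> mfun (\<lambda>a. H a ** K a) r"
  unfolding mfun_def matrix_mult_nth by (auto intro!: holo_fun_sum holo_fun_mult open_nb)

lemma mfun_const: "mfun (\<lambda>a. P) r"
  unfolding mfun_def by (simp add: holo_fun_const open_nb)

lemma holo_fun_prod:
  "(\<And>i. i \<in> I \<Longrightarrow> hfun S (g i)) \<Longrightarrow> openin T S \<Longrightarrow> hfun S (\<lambda>x. \<Prod>i\<in>I. g i x)"
  by (induct I rule: infinite_finite_induct) (auto intro: holo_fun_mult holo_fun_const)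

lemma mfun_det: "mfun H r \<Longrightarrow> hfun (nb r) (\<lambda>a. det (H a))"
  unfolding det_def mfun_def
  by (intro holo_fun_sum holo_fun_mult holo_fun_const holo_fun_prod open_nb) auto

lemma mfun_inv:
  assumes H: "mfun H r" and inv: "\<And>a. a \<in> nb r \<Longrightarrow> invertible (H a)"
  shows "mfun (\<lambda>a. matrix_inv (H a)) r"
  unfolding mfun_def
proof (intro allI)
  fix i j
  have d: "det (H a) \<noteq> 0" if "a \<in> nb r" for a using inv [OF that] by (simp add: invertible_det_nz)
  have "mfun (\<lambda>a. \<chi> p q. if q = i then axis j 1 $ p else H a $ p $ q) r"
    unfolding mfun_def
  proof (intro allI)
    fix p q show "hfun (nb r) (\<lambda>a. (\<chi> p q. if q = i then axis j 1 $ p else H a $ p $ q) $ p $ q)"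
      using H by (cases "q = i") (auto simp: mfun_def intro: holo_fun_const open_nb)
  qed
  from holo_fun_divide [OF cT mfun_det [OF this] mfun_det [OF H] d]
  have "hfun (nb r) (\<lambda>a. det (\<chi> p q. if q = i then axis j 1 $ p else H a $ p $ q) / det (H a))" .
  then show "hfun (nb r) (\<lambda>a. matrix_inv (H a) $ i $ j)"
    by (rule holo_fun_cong [OF cT]) (simp add: matrix_inv_cramer d)
qed

lemma dH_mult:
  assumes "mfun H r" "mfun K r" "0 < r" "\<xi> \<in> TS"
  shows "dH (\<lambda>a. H a ** K a) \<xi> = H \<one> ** dH K \<xi> + dH H \<xi> ** K \<one>"
proof -
  note hn = mfun_hn [OF assms(1,3)] mfun_hn [OF assms(2,3)]
  have "dH (\<lambda>a. H a ** K a) \<xi> $ i $ j = (H \<one> ** dH K \<xi> + dH H \<xi> ** K \<one>) $ i $ j" for i j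
  proof -
    have "dH (\<lambda>a. H a ** K a) \<xi> $ i $ j = (\<Sum>l\<in>UNIV. \<xi> (\<lambda>a. H a $ i $ l * K a $ l $ j))"
      unfolding dH_nth matrix_mult_nth by (rule TS_sum [OF assms(4)]) (intro hn_mult hn)
    also have "\<dots> = (\<Sum>l\<in>UNIV. H \<one> $ i $ l * dH K \<xi> $ l $ j + dH H \<xi> $ i $ l * K \<one> $ l $ j)"
      by (simp add: TS_mult [OF assms(4) hn] dH_nth mult.commute)
    finally show ?thesis by (simp add: matrix_mult_nth sum.distrib)
  qed
  then show ?thesis by (simp add: vec_eq_iff)
qed

lemma dH_const: "\<xi> \<in> TS \<Longrightarrow> dH (\<lambda>a. P) \<xi> = 0"
  by (simp add: dH_def vec_eq_iff TS_const)

lemma dH_left: "mfun K r \<Longrightarrow> 0 < r \<Longrightarrow> \<xi> \<in> TS \<Longrightarrow> dH (\<lambda>a. P ** K a) \<xi> = P ** dH K \<xi>"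
  using dH_mult [OF mfun_const, of K r \<xi> P] by (simp add: dH_const)

lemma dH_right: "mfun K r \<Longrightarrow> 0 < r \<Longrightarrow> \<xi> \<in> TS \<Longrightarrow> dH (\<lambda>a. K a ** P) \<xi> = dH K \<xi> ** P"
  using dH_mult [OF _ mfun_const, of K r \<xi> P] by (simp add: dH_const)

text \<open>Proportionality with the factor eliminated, in a form that can be
  differentiated.\<close>

lemma minors:
  fixes H K :: "complex^'m^'m"
  assumes "H = mat c ** K"
  shows "H $ i $ j * K $ l $ l = H $ l $ l * K $ i $ j"
  unfolding assms mat_mult_nth by simp

text \<open>The minors against entry (k, k) are differentiated at the unit, where both matrices are
  the identity. The scalar comes out as the difference of the (k, k) entries of the two
  differentials.\<close>

lemma dH_projective:
  assumes H: "mfun H r" "H \<one> = mat 1" and K: "mfun K r" "K \<one> = mat 1" and r: "0 < r" and \<xi>: "\<xi> \<in> TS"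
    and p: "\<And>a. a \<in> nb r \<Longrightarrow> \<exists>c. H a = mat c ** K a"
  shows "\<exists>c. dH H \<xi> = dH K \<xi> + mat c"
proof -
  note hn = mfun_hn [OF H(1) r] mfun_hn [OF K(1) r]
  have "dH H \<xi> $ i $ j = (dH K \<xi> + mat (dH H \<xi> $ k $ k - dH K \<xi> $ k $ k)) $ i $ j" for i j
  proof -
    have "\<xi> (\<lambda>a. H a $ i $ j * K a $ k $ k) = \<xi> (\<lambda>a. H a $ k $ k * K a $ i $ j)"
    proof (rule TS_germ [OF \<xi> _ open_nb one_nb [OF r]])
      show "(\<lambda>a. H a $ i $ j * K a $ k $ k) \<in> hn" by (intro hn_mult hn)
      fix a assume "a \<in> nb r"
      then obtain c where "H a = mat c ** K a" using p by blast
      then show "H a $ i $ j * K a $ k $ k = H a $ k $ k * K a $ i $ j" by (rule minors)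
    qed
    then show ?thesis
      by (simp add: TS_mult [OF \<xi>] hn H(2) K(2) mat_nth dH_nth algebra_simps split: if_splits)
  qed
  then have "dH H \<xi> = dH K \<xi> + mat (dH H \<xi> $ k $ k - dH K \<xi> $ k $ k)" unfolding vec_eq_iff by (intro allI)
  then show ?thesis by blast
qed

text \<open>Germ of a projective homomorphism: r is the radius on which H is holomorphic, s one for
  which products of two elements stay inside. The dependence of the factor c on a and b is
  unrestricted.\<close>

definition phom :: "('a \<Rightarrow> complex^'m^'m) \<Rightarrow> real \<Rightarrow> real \<Rightarrow> bool" where
  "phom H r s \<longleftrightarrow> 0 < s \<and> s \<le> r \<and> mfun H r \<and> H \<one> = mat 1 \<and>
     (\<forall>a\<in>nb s. \<forall>b\<in>nb s. a \<otimes> b \<in> nb r \<and> (\<exists>c. H (a \<otimes> b) = mat c ** (H a ** H b)))"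

lemma left_translate_hn:
  assumes g: "hfun (nb r) g" and s: "0 < s" and a: "a \<in> carrier L" and ab: "\<And>b. b \<in> nb s \<Longrightarrow> a \<otimes> b \<in> nb r"
  shows "(\<lambda>b. g (a \<otimes> b)) \<in> hn"
proof (rule hnI [OF _ one_nb [OF s]])
  have "holo_map T \<Phi> T \<Phi> (nb s) (\<lambda>b. a \<otimes> b)"
    by (rule holo_map_subset [OF holo_left [OF a] open_nb]) (use nb_carrier carrier_top in auto)
  then show "hfun (nb s) (\<lambda>b. g (a \<otimes> b))"
    by (rule holo_fun_compose [OF cT cT _ g]) (use ab in auto)
qed

text \<open>If \<open>H (a b)\<close> and \<open>H a H b\<close> are proportional, all \<open>2 \<times> 2\<close> minors of the pair vanish. Differentiating
  these identities in \<open>b\<close> and then in \<open>a\<close> needs no information on the factor of proportionality.\<close>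

lemma phom_second_derivative:
  assumes H: "phom H r s" and \<xi>: "\<xi> \<in> TS" and \<eta>: "\<eta> \<in> TS"
  shows "\<exists>c. \<forall>i j. \<xi> (conv (\<lambda>a. H a $ i $ j) \<eta>) = (dH H \<xi> ** dH H \<eta> + mat c) $ i $ j"
proof -
  have s: "0 < s" "s \<le> r" and Hr: "mfun H r" and H1: "H \<one> = mat 1"
    and Hm: "\<And>a b. a \<in> nb s \<Longrightarrow> b \<in> nb s \<Longrightarrow> a \<otimes> b \<in> nb r \<and> (\<exists>c. H (a \<otimes> b) = mat c ** (H a ** H b))"
    using H unfolding phom_def by auto
  have r: "0 < r" using s by simp
  define M N where "M = dH H \<xi>" and "N = dH H \<eta>"
  define C where "C i j = conv (\<lambda>a. H a $ i $ j) \<eta>" for i j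
  note hn = mfun_hn [OF Hr r]
  have Chn: "C i j \<in> hn" for i j unfolding C_def by (rule conv_hn [OF hn \<eta>])
  have C1: "C i j \<one> = N $ i $ j" for i j unfolding C_def N_def dH_nth by (rule conv_one [OF \<eta>])
  have HNhn: "(\<lambda>a. (H a ** N) $ i $ j) \<in> hn" for i j
    by (rule mfun_hn [OF mfun_mult [OF Hr mfun_const] r])
  have \<xi>HN: "\<xi> (\<lambda>a. (H a ** N) $ i $ j) = (M ** N) $ i $ j" for i j
    using dH_right [OF Hr r \<xi>, of N] unfolding M_def dH_nth [of "\<lambda>a. H a ** N" \<xi>, symmetric] by simp
  have \<xi>H: "\<xi> (\<lambda>a. H a $ i $ j) = M $ i $ j" for i j unfolding M_def dH_nth ..
  \<comment> \<open>The minors of \<open>H (a \<otimes> b)\<close> and \<open>H a ** H b\<close>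
    against entry (k, k), differentiated in b at the unit.\<close>
  have eq1: "C i j a * H a $ k $ k + H a $ i $ j * (H a ** N) $ k $ k = C k k a * H a $ i $ j + H a $ k $ k * (H a ** N) $ i $ j"
    if a: "a \<in> nb s" for a i j
  proof -
    have ac: "a \<in> carrier L" using a nb_carrier by blast
    have hn1: "(\<lambda>b. H (a \<otimes> b) $ i $ j) \<in> hn" for i j
      by (rule left_translate_hn [OF _ s(1) ac]) (use Hr Hm [OF a] in \<open>auto simp: mfun_def\<close>)
    have hn2: "(\<lambda>b. (H a ** H b) $ i $ j) \<in> hn" for i j
      by (rule mfun_hn [OF mfun_mult [OF mfun_const Hr] r])
    have \<eta>2: "\<eta> (\<lambda>b. (H a ** H b) $ i $ j) = (H a ** N) $ i $ j" for i j
      using dH_left [OF Hr r \<eta>, of "H a"] unfolding N_def dH_nth [of "\<lambda>b. H a ** H b" \<eta>, symmetric] by simp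
    have "\<eta> (\<lambda>b. H (a \<otimes> b) $ i $ j * (H a ** H b) $ k $ k) = \<eta> (\<lambda>b. H (a \<otimes> b) $ k $ k * (H a ** H b) $ i $ j)"
    proof (rule TS_germ [OF \<eta> _ open_nb one_nb [OF s(1)]])
      show "(\<lambda>b. H (a \<otimes> b) $ i $ j * (H a ** H b) $ k $ k) \<in> hn" by (intro hn_mult hn1 hn2)
      fix b assume "b \<in> nb s"
      then obtain c where "H (a \<otimes> b) = mat c ** (H a ** H b)" using Hm [OF a] by blast
      then show "H (a \<otimes> b) $ i $ j * (H a ** H b) $ k $ k = H (a \<otimes> b) $ k $ k * (H a ** H b) $ i $ j" by (rule minors)
    qed
    then show ?thesis
      unfolding TS_mult [OF \<eta> hn1 hn2] \<eta>2 C_def conv_def by (simp add: H1 ac algebra_simps)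
  qed
  \<comment> \<open>The identity \<open>eq1\<close> differentiated in a at the unit; the unknown
    scalar is expressed by the entry (k, k).\<close>
  have eq2: "\<xi> (C i j) = (M ** N) $ i $ j + (if i = j then \<xi> (C k k) - (M ** N) $ k $ k else 0)" for i j
  proof -
    have "\<xi> (\<lambda>a. C i j a * H a $ k $ k + H a $ i $ j * (H a ** N) $ k $ k) = \<xi> (\<lambda>a. C k k a * H a $ i $ j + H a $ k $ k * (H a ** N) $ i $ j)"
      by (rule TS_germ [OF \<xi> _ open_nb one_nb [OF s(1)] eq1]) (intro hn_add hn_mult Chn hn HNhn)
    moreover have "\<xi> (\<lambda>a. C i j a * H a $ k $ k + H a $ i $ j * (H a ** N) $ k $ k)
        = \<xi> (\<lambda>a. C i j a * H a $ k $ k) + \<xi> (\<lambda>a. H a $ i $ j * (H a ** N) $ k $ k)"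
      by (intro TS_add [OF \<xi>] hn_mult Chn hn HNhn)
    moreover have "\<xi> (\<lambda>a. C k k a * H a $ i $ j + H a $ k $ k * (H a ** N) $ i $ j)
        = \<xi> (\<lambda>a. C k k a * H a $ i $ j) + \<xi> (\<lambda>a. H a $ k $ k * (H a ** N) $ i $ j)"
      by (intro TS_add [OF \<xi>] hn_mult Chn hn HNhn)
    ultimately show ?thesis
      by (simp add: TS_mult [OF \<xi>] Chn hn HNhn C1 \<xi>HN \<xi>H H1 mat_nth algebra_simps split: if_splits)
  qed
  show ?thesis
    unfolding C_def [symmetric] M_def [symmetric] N_def [symmetric] vector_add_component mat_nth
    by (intro exI [of _ "\<xi> (C k k) - (M ** N) $ k $ k"] allI) (rule eq2)
qed

text \<open>\<open>br\<close> antisymmetrises the second derivative just computed, and the two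
  unknown scalars contribute only their difference.\<close>

lemma phom_bracket:
  assumes H: "phom H r s" and \<xi>: "\<xi> \<in> TS" and \<eta>: "\<eta> \<in> TS"
  shows "\<exists>c. dH H (br \<xi> \<eta>) = dH H \<xi> ** dH H \<eta> - dH H \<eta> ** dH H \<xi> + mat c"
proof -
  have hn: "(\<lambda>a. H a $ i $ j) \<in> hn" for i j
    using H unfolding phom_def by (intro mfun_hn [of H r]) auto
  obtain c where c: "\<forall>i j. \<xi> (conv (\<lambda>a. H a $ i $ j) \<eta>) = (dH H \<xi> ** dH H \<eta> + mat c) $ i $ j"
    using phom_second_derivative [OF H \<xi> \<eta>] by blast
  obtain d where d: "\<forall>i j. \<eta> (conv (\<lambda>a. H a $ i $ j) \<xi>) = (dH H \<eta> ** dH H \<xi> + mat d) $ i $ j"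
    using phom_second_derivative [OF H \<eta> \<xi>] by blast
  have "dH H (br \<xi> \<eta>) $ i $ j = (dH H \<xi> ** dH H \<eta> - dH H \<eta> ** dH H \<xi> + mat (c - d)) $ i $ j" for i j
    using c d by (simp add: dH_nth br_def hn mat_nth)
  then have "dH H (br \<xi> \<eta>) = dH H \<xi> ** dH H \<eta> - dH H \<eta> ** dH H \<xi> + mat (c - d)"
    by (simp add: vec_eq_iff)
  then show ?thesis by blast
qed

text \<open>With M the quotient of K by H, \<open>M (a \<otimes> b)\<close> is proportional to
  \<open>K a ** M b ** Hi a\<close>, and dM at the unit is scalar. Hence the left invariant
  derivatives of M at a are proportional to \<open>M a\<close>, the ratios of the entries of M to
  entry (k, k) have vanishing left invariant derivatives, and \<open>left_const\<close> makes M
  scalar.\<close>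

lemma phom_unique:
  assumes H: "phom H r s" "\<And>a. a \<in> nb r \<Longrightarrow> invertible (H a)" and K: "phom K r' s'"
    and d: "\<And>\<xi>. \<xi> \<in> TS \<Longrightarrow> \<exists>c. dH K \<xi> = dH H \<xi> + mat c"
  obtains \<rho> where "0 < \<rho>" "\<forall>a\<in>nb \<rho>. \<exists>c. c \<noteq> 0 \<and> K a = mat c ** H a"
proof -
  have s: "0 < s" "s \<le> r" and Hr: "mfun H r" and H1: "H \<one> = mat 1"
    and Hm: "\<And>a b. a \<in> nb s \<Longrightarrow> b \<in> nb s \<Longrightarrow> a \<otimes> b \<in> nb r \<and> (\<exists>c. H (a \<otimes> b) = mat c ** (H a ** H b))"
    using H(1) unfolding phom_def by auto
  have s': "0 < s'" "s' \<le> r'" and Kr: "mfun K r'" and K1: "K \<one> = mat 1"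
    and Km: "\<And>a b. a \<in> nb s' \<Longrightarrow> b \<in> nb s' \<Longrightarrow> a \<otimes> b \<in> nb r' \<and> (\<exists>c. K (a \<otimes> b) = mat c ** (K a ** K b))"
    using K unfolding phom_def by auto
  define q where "q = min r r'"
  have q: "0 < q" "q \<le> r" "q \<le> r'" unfolding q_def using s s' by auto
  have Hq: "mfun H q" and Kq: "mfun K q" using mfun_mono Hr Kr q by blast+
  have Hinv: "invertible (H a)" if "a \<in> nb q" for a using H(2) nb_mono [OF q(2)] that by blast
  define Hi where "Hi a = matrix_inv (H a)" for a
  have Hi: "mfun Hi q" unfolding Hi_def by (rule mfun_inv [OF Hq Hinv])
  have HiH: "Hi a ** H a = mat 1" "H a ** Hi a = mat 1" if "a \<in> nb q" for a
    unfolding Hi_def using matrix_inv [OF Hinv [OF that]] by auto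
  define M where "M a = K a ** Hi a" for a
  have Mq: "mfun M q" unfolding M_def by (rule mfun_mult [OF Kq Hi])
  have MH: "M a ** H a = K a" if "a \<in> nb q" for a
    unfolding M_def by (simp add: matrix_mul_assoc [symmetric] HiH [OF that])
  have one_q: "\<one> \<in> nb q" by (rule one_nb [OF q(1)])
  have M1: "M \<one> = mat 1" using MH [OF one_q] by (simp add: H1 K1)
  have dM: "\<exists>c. dH M \<xi> = mat c" if \<xi>: "\<xi> \<in> TS" for \<xi>
  proof -
    have "dH K \<xi> = dH (\<lambda>a. M a ** H a) \<xi>"
      unfolding vec_eq_iff dH_nth
    proof (intro allI)
      fix i j
      show "\<xi> (\<lambda>a. K a $ i $ j) = \<xi> (\<lambda>a. (M a ** H a) $ i $ j)"
        by (rule TS_germ [OF \<xi> mfun_hn [OF Kq q(1)] open_nb one_q]) (simp add: MH)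
    qed
    also have "\<dots> = dH H \<xi> + dH M \<xi>" using dH_mult [OF Mq Hq q(1) \<xi>] by (simp add: M1 H1)
    finally show ?thesis using d [OF \<xi>] by (metis add_left_cancel)
  qed
  obtain t where t: "0 < t" "\<forall>a\<in>nb t. \<forall>b\<in>nb t. a \<otimes> b \<in> nb q" "t \<le> s" "t \<le> s'" "t \<le> q"
  proof -
    obtain t0 where t0: "0 < t0" "ball 0 t0 \<subseteq> \<Omega>0" "\<forall>x\<in>ball 0 t0. \<forall>y\<in>ball 0 t0. \<sigma> x \<otimes> \<sigma> y \<in> nb q"
      by (rule mult_ball [OF open_nb one_q])
    have "\<forall>a\<in>nb t0. \<forall>b\<in>nb t0. a \<otimes> b \<in> nb q" using t0(3) unfolding nb_image [OF t0(2)] by blast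
    moreover define t where "t = Min {t0, s, s', q}"
    moreover have "t \<le> t0" "t \<le> s" "t \<le> s'" "t \<le> q" "0 < t" unfolding t_def using t0(1) s(1) s'(1) q(1) by auto
    ultimately show thesis using that [of t] nb_mono [of t t0] by blast
  qed
  define Q where "Q a b = K a ** M b ** Hi a" for a b
  have prp: "M (a \<otimes> b) $ i $ j * Q a b $ l $ l = M (a \<otimes> b) $ l $ l * Q a b $ i $ j"
    if a: "a \<in> nb t" and b: "b \<in> nb t" for a b i j l
  proof -
    have aq: "a \<in> nb q" "b \<in> nb q" and as: "a \<in> nb s" "b \<in> nb s" and as': "a \<in> nb s'" "b \<in> nb s'"
      using a b nb_mono t(3-5) by blast+
    have abq: "a \<otimes> b \<in> nb q" using t(2) a b by blast
    obtain c where c: "H (a \<otimes> b) = mat c ** (H a ** H b)" using Hm [OF as] by blast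
    obtain c' where c': "K (a \<otimes> b) = mat c' ** (K a ** K b)" using Km [OF as'] by blast
    \<comment> \<open>\<open>H (a \<otimes> b)\<close> is invertible on this ball, so its factor
      cannot vanish and may be divided by.\<close>
    have "c \<noteq> 0"
    proof
      assume "c = 0"
      then have "H (a \<otimes> b) = 0" using c by (simp add: vec_eq_iff mat_mult_nth)
      then have "H (a \<otimes> b) ** Hi (a \<otimes> b) = 0" by (simp add: vec_eq_iff matrix_mult_nth)
      then have "(mat 1 :: complex^'m^'m) = 0" using HiH(2) [OF abq] by simp
      then have "(mat 1 :: complex^'m^'m) $ k $ k = 0 $ k $ k" by (rule arg_cong)
      then show False by (simp add: mat_nth)
    qed
    have QH: "Q a b ** (H a ** H b) = K a ** K b"
    proof -
      have "Q a b ** (H a ** H b) = K a ** M b ** (Hi a ** H a) ** H b" unfolding Q_def by (simp only: matrix_mul_assoc)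
      also have "\<dots> = K a ** (M b ** H b)" by (simp add: HiH [OF aq(1)] matrix_mul_assoc)
      finally show ?thesis by (simp add: MH [OF aq(2)])
    qed
    have "mat c ** M (a \<otimes> b) ** (H a ** H b) = M (a \<otimes> b) ** H (a \<otimes> b)"
      unfolding c by (simp add: matrix_mul_assoc mat_mult_comm)
    also have "\<dots> = mat c' ** Q a b ** (H a ** H b)"
      unfolding MH [OF abq] c' QH [symmetric] by (simp add: matrix_mul_assoc)
    finally have "mat c ** M (a \<otimes> b) ** (H a ** H b) ** (Hi b ** Hi a) = mat c' ** Q a b ** (H a ** H b) ** (Hi b ** Hi a)"
      by simp
    moreover have "X ** (H a ** H b) ** (Hi b ** Hi a) = X" for X :: "complex^'m^'m"
    proof -
      have "X ** (H a ** H b) ** (Hi b ** Hi a) = X ** (H a ** (H b ** Hi b) ** Hi a)" by (simp only: matrix_mul_assoc)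
      then show ?thesis by (simp add: HiH [OF aq(1)] HiH [OF aq(2)])
    qed
    ultimately have "mat c ** M (a \<otimes> b) = mat c' ** Q a b" by simp
    then have "c * M (a \<otimes> b) $ i $ j = c' * Q a b $ i $ j" for i j
      by (metis mat_mult_nth)
    then have "M (a \<otimes> b) $ i $ j = c' / c * Q a b $ i $ j" for i j
      using \<open>c \<noteq> 0\<close> by (simp add: field_simps)
    then show ?thesis by simp
  qed
  note Mhn = mfun_hn [OF Mq q(1)]
  have eq: "conv (\<lambda>a. M a $ i $ j) \<eta> a * M a $ k $ k = conv (\<lambda>a. M a $ k $ k) \<eta> a * M a $ i $ j"
    if a: "a \<in> nb t" and \<eta>: "\<eta> \<in> TS" for a \<eta> i j
  proof -
    have ac: "a \<in> carrier L" using a nb_carrier by blast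
    have aq: "a \<in> nb q" using a nb_mono t(5) by blast
    have hn1: "(\<lambda>b. M (a \<otimes> b) $ i $ j) \<in> hn" for i j
      by (rule left_translate_hn [OF _ t(1) ac]) (use Mq t(2) a in \<open>auto simp: mfun_def\<close>)
    have KM: "mfun (\<lambda>b. K a ** M b) q" by (rule mfun_mult [OF mfun_const Mq])
    have hn2: "(\<lambda>b. Q a b $ i $ j) \<in> hn" for i j
      unfolding Q_def by (rule mfun_hn [OF mfun_mult [OF KM mfun_const] q(1)])
    obtain c where c: "dH M \<eta> = mat c" using dM [OF \<eta>] by blast
    \<comment> \<open>Since dM is scalar, the derivative of \<open>Q a\<close> at the unit is a
      multiple of its value \<open>M a\<close> there; the multiple cancels in the minors.\<close>
    have "dH (Q a) \<eta> = K a ** mat c ** Hi a"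
      unfolding Q_def using dH_right [OF KM q(1) \<eta>, of "Hi a"] dH_left [OF Mq q(1) \<eta>, of "K a"] c by simp
    also have "\<dots> = mat c ** M a" by (simp add: mat_mult_comm M_def matrix_mul_assoc)
    finally have \<eta>2: "\<eta> (\<lambda>b. Q a b $ i $ j) = c * M a $ i $ j" for i j
      by (metis dH_nth mat_mult_nth)
    have Q1: "Q a \<one> = M a" by (simp add: Q_def M1) (simp add: M_def)
    have "\<eta> (\<lambda>b. M (a \<otimes> b) $ i $ j * Q a b $ k $ k) = \<eta> (\<lambda>b. M (a \<otimes> b) $ k $ k * Q a b $ i $ j)"
      by (rule TS_germ [OF \<eta> _ open_nb one_nb [OF t(1)]]) (intro hn_mult hn1 hn2, rule prp [OF a])
    then show ?thesis
      unfolding TS_mult [OF \<eta> hn1 hn2] \<eta>2 Q1 conv_def by (simp add: ac algebra_simps)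
  qed
  have "openin T {a \<in> nb t. M a $ k $ k \<in> - {0}}"
    by (rule holo_fun_open [OF cT]) (use mfun_mono [OF Mq t(5)] in \<open>auto simp: mfun_def\<close>)
  moreover have "\<one> \<in> {a \<in> nb t. M a $ k $ k \<in> - {0}}" using one_nb [OF t(1)] by (simp add: M1 mat_nth)
  ultimately obtain u where u: "0 < u" "ball 0 u \<subseteq> \<Omega>0" "nb u \<subseteq> {a \<in> nb t. M a $ k $ k \<in> - {0}}"
    by (rule nbhd_nb)
  have ut: "nb u \<subseteq> nb t" and Mk: "\<And>a. a \<in> nb u \<Longrightarrow> M a $ k $ k \<noteq> 0" using u(3) by auto
  have Mu: "hfun (nb u) (\<lambda>a. M a $ i $ j)" for i j
    by (rule holo_fun_subset [OF Mq [unfolded mfun_def, rule_format] open_nb]) (use ut nb_mono [OF t(5)] in blast)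
  have "\<exists>\<rho>. 0 < \<rho> \<and> (\<forall>a\<in>nb \<rho>. M a $ i $ j / M a $ k $ k = mat 1 $ i $ j)" for i j
  proof -
    define g where "g a = M a $ i $ j / M a $ k $ k" for a
    have gu: "hfun (nb u) g" unfolding g_def by (rule holo_fun_divide [OF cT Mu Mu Mk])
    have ghn: "g \<in> hn" by (rule hnI [OF gu one_nb [OF u(1)]])
    obtain v where v: "0 < v" "ball 0 v \<subseteq> \<Omega>0" and vv: "\<forall>x\<in>ball 0 v. \<forall>y\<in>ball 0 v. \<sigma> x \<otimes> \<sigma> y \<in> nb u"
      by (rule mult_ball [OF open_nb one_nb [OF u(1)]])
    have vu: "a \<otimes> b \<in> nb u" if "a \<in> nb v" "b \<in> nb v" for a b using vv that unfolding nb_image [OF v(2)] by blast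
    have c0: "conv g \<eta> a = 0" if a: "a \<in> nb v" and \<eta>: "\<eta> \<in> TS" for a \<eta>
    proof -
      have ac: "a \<in> carrier L" using a nb_carrier by blast
      have au: "a \<in> nb u" using vu [OF a one_nb [OF v(1)]] ac by simp
      have hn1: "(\<lambda>b. M (a \<otimes> b) $ i $ j) \<in> hn" for i j by (rule left_translate_hn [OF Mu v(1) ac vu [OF a]])
      have hn2: "(\<lambda>b. g (a \<otimes> b)) \<in> hn" by (rule left_translate_hn [OF gu v(1) ac vu [OF a]])
      have "\<eta> (\<lambda>b. g (a \<otimes> b) * M (a \<otimes> b) $ k $ k) = \<eta> (\<lambda>b. M (a \<otimes> b) $ i $ j)"
        by (rule TS_germ [OF \<eta> hn_mult [OF hn2 hn1] open_nb one_nb [OF v(1)]]) (use vu [OF a] Mk in \<open>simp add: g_def\<close>)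
      then have "g a * conv (\<lambda>a. M a $ k $ k) \<eta> a + M a $ k $ k * conv g \<eta> a = conv (\<lambda>a. M a $ i $ j) \<eta> a"
        unfolding TS_mult [OF \<eta> hn2 hn1] conv_def by (simp add: ac)
      moreover have "conv (\<lambda>a. M a $ i $ j) \<eta> a = g a * conv (\<lambda>a. M a $ k $ k) \<eta> a"
        using eq [OF subsetD [OF ut au] \<eta>, of i j] Mk [OF au] by (simp add: g_def field_simps)
      ultimately show ?thesis using Mk [OF au] by simp
    qed
    obtain \<rho> where \<rho>: "0 < \<rho>" "\<forall>a\<in>nb \<rho>. g a = g \<one>" by (rule left_const [OF ghn v(1) c0])
    then show ?thesis unfolding g_def by (auto simp: M1 mat_nth)
  qed
  then obtain \<rho> where \<rho>: "\<And>i j. 0 < \<rho> i j" "\<And>i j a. a \<in> nb (\<rho> i j) \<Longrightarrow> M a $ i $ j / M a $ k $ k = mat 1 $ i $ j" by metis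
  define w where "w = min u (Min (range (\<lambda>p. \<rho> (fst p) (snd p))))"
  have w: "0 < w" "w \<le> u" unfolding w_def using \<rho>(1) u(1) by auto
  have w\<rho>: "w \<le> \<rho> i j" for i j
  proof -
    have "Min (range (\<lambda>p. \<rho> (fst p) (snd p))) \<le> \<rho> (fst (i, j)) (snd (i, j))"
      by (rule Min_le [OF _ rangeI [where f="\<lambda>p. \<rho> (fst p) (snd p)" and x="(i, j)"]]) simp
    then show ?thesis unfolding w_def by simp
  qed
  have "\<exists>c. c \<noteq> 0 \<and> K a = mat c ** H a" if a: "a \<in> nb w" for a
  proof -
    have au: "a \<in> nb u" using a nb_mono [OF w(2)] by blast
    have aq: "a \<in> nb q" using au ut nb_mono [OF t(5)] by blast
    have "M a $ i $ j = mat (M a $ k $ k) $ i $ j" for i j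
    proof -
      have "M a $ i $ j / M a $ k $ k = mat 1 $ i $ j" by (rule \<rho>(2)) (use a nb_mono [OF w\<rho>, of i j] in blast)
      then show ?thesis using Mk [OF au] by (simp add: mat_nth split: if_splits)
    qed
    then have "M a = mat (M a $ k $ k)" unfolding vec_eq_iff by (intro allI)
    then show ?thesis using MH [OF aq] Mk [OF au] by metis
  qed
  then show thesis using that w(1) by blast
qed

end

section \<open>Structures and their developing maps\<close>

text \<open>A sends x to x + l(x) (w - v) for a linear form l with l(v) = 1 and l(w) nonzero. Then
  l(A x) = l(x) l(w), so the kernel is trivial. A combination of two coordinates suffices for
  l.\<close>

lemma ex_matrix_map:
  fixes v w :: "complex^'m::finite"
  assumes v: "v \<noteq> 0" and w: "w \<noteq> 0"
  obtains A where "invertible A" "A *v v = w"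
proof -
  obtain i where i: "v $ i \<noteq> 0" using v by (auto simp: vec_eq_iff)
  obtain j where j: "w $ j \<noteq> 0" using w by (auto simp: vec_eq_iff)
  obtain \<alpha> \<beta> where \<alpha>\<beta>: "\<alpha> * v $ i + \<beta> * v $ j = 1" "\<alpha> * w $ i + \<beta> * w $ j \<noteq> 0"
  proof (cases "w $ i = 0")
    case False
    then show thesis using that [of "1 / v $ i" 0] i by simp
  next
    case wi: True
    show thesis
    proof (cases "v $ j = 0")
      case True
      then show thesis using that [of "1 / v $ i" 1] i j wi by simp
    next
      case False
      then show thesis using that [of 0 "1 / v $ j"] j by simp
    qed
  qed
  define \<l> where "\<l> x = \<alpha> * x $ i + \<beta> * x $ j" for x :: "complex^'m"
  define A :: "complex^'m^'m" where
    "A = (\<chi> p q. (if p = q then 1 else 0) + (w $ p - v $ p) * ((if q = i then \<alpha> else 0) + (if q = j then \<beta> else 0)))"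
  have Ax: "A *v x = x + \<l> x *s (w - v)" for x
  proof -
    have "(A *v x) $ p = (x + \<l> x *s (w - v)) $ p" for p
    proof -
      have "(A *v x) $ p = (\<Sum>q\<in>UNIV. (if p = q then x $ q else 0) +
          (w $ p - v $ p) * ((if q = i then \<alpha> * x $ q else 0) + (if q = j then \<beta> * x $ q else 0)))"
        unfolding A_def matrix_vector_mult_def by (auto intro!: sum.cong simp: algebra_simps)
      also have "\<dots> = x $ p + (w $ p - v $ p) * (\<alpha> * x $ i + \<beta> * x $ j)"
        by (simp add: sum.distrib sum_distrib_left [symmetric])
      finally show ?thesis by (simp add: \<l>_def algebra_simps)
    qed
    then show ?thesis by (simp add: vec_eq_iff)
  qed
  have "x = 0" if "A *v x = 0" for x
  proof -
    have x: "x + \<l> x *s (w - v) = 0" using that unfolding Ax .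
    have "\<l> (x + \<l> x *s (w - v)) = \<l> x + \<l> x * (\<l> w - \<l> v)" by (simp add: \<l>_def algebra_simps)
    moreover have "\<l> (x + \<l> x *s (w - v)) = 0" unfolding x by (simp add: \<l>_def)
    moreover have "\<l> v = 1" using \<alpha>\<beta>(1) by (simp add: \<l>_def)
    ultimately have "\<l> x * \<l> w = 0" by (simp add: algebra_simps)
    then show ?thesis using x \<alpha>\<beta>(2) by (simp add: \<l>_def)
  qed
  then have "\<exists>B. B ** A = mat 1" unfolding matrix_left_invertible_ker by blast
  then have "invertible A" unfolding invertible_left_inverse .
  moreover have "A *v v = w" using \<alpha>\<beta>(1) by (simp add: Ax \<l>_def)
  ultimately show thesis by (rule that)
qed

section \<open>Matrices modulo scalars\<close>

lemma trace_mat: "trace (mat c :: complex^'m::finite^'m) = of_nat CARD('m) * c"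
  by (simp add: trace_def mat_nth)

lemma gl_class_eq_iff: "gl_class A = gl_class B \<longleftrightarrow> (\<exists>c. A = B + mat c)"
proof
  assume "gl_class A = gl_class B"
  moreover have "A \<in> gl_class A" unfolding gl_class_def by (auto intro!: exI [of _ 0] simp: vec_eq_iff mat_nth)
  ultimately show "\<exists>c. A = B + mat c" unfolding gl_class_def by blast
next
  assume "\<exists>c. A = B + mat c"
  then obtain c where c: "A = B + mat c" by blast
  have m: "mat x + mat y = mat (x + y)" for x y :: complex by (simp add: vec_eq_iff mat_nth)
  show "gl_class A = gl_class B"
  proof
    show "gl_class A \<subseteq> gl_class B" unfolding gl_class_def c by (auto simp: add.assoc m)
    show "gl_class B \<subseteq> gl_class A"
    proof
      fix X assume "X \<in> gl_class B"
      then obtain d where "X = B + mat d" unfolding gl_class_def by blast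
      then have "X = A + mat (d - c)" unfolding c by (simp add: add.assoc m)
      then show "X \<in> gl_class A" unfolding gl_class_def by blast
    qed
  qed
qed

lemma traceless_eq:
  fixes A B :: "complex^'m::finite^'m"
  assumes "trace A = 0" "trace B = 0" "A = B + mat c"
  shows "A = B"
proof -
  have "of_nat CARD('m) * c = 0" using assms by (simp add: trace_add trace_mat)
  then have "c = 0" by simp
  then show ?thesis using assms(3) by (simp add: vec_eq_iff mat_nth)
qed

text \<open>The element that \<open>differential_at_unit\<close> selects from the class of A modulo
  scalars.\<close>

definition traceless :: "complex^'m::finite^'m \<Rightarrow> complex^'m^'m" where
  "traceless A = A + mat (- trace A / of_nat CARD('m))"

lemma trace_traceless: "trace (traceless A) = 0"
  by (simp add: traceless_def trace_add trace_mat)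

lemma gl_class_traceless: "gl_class (traceless A) = gl_class A"
  unfolding gl_class_eq_iff traceless_def by blast

lemma conj_add_mat:
  fixes P :: "complex^'m::finite^'m"
  assumes "invertible P"
  shows "P ** (A + mat c) ** matrix_inv P = P ** A ** matrix_inv P + mat c"
proof -
  have "P ** mat c ** matrix_inv P = mat c ** (P ** matrix_inv P)" unfolding mat_mult_comm [of P] matrix_mul_assoc ..
  then show ?thesis by (simp add: matrix_bilinear_simps matrix_inv [OF assms])
qed

lemma Ad_class_gl_class:
  fixes P :: "complex^'m::finite^'m"
  assumes "invertible P"
  shows "Ad_class P (gl_class A) = gl_class (P ** A ** matrix_inv P)"
proof -
  have "{X + mat c | c. True} = range (\<lambda>c. X + mat c)" for X :: "complex^'m^'m" by blast
  then show ?thesis unfolding Ad_class_def gl_class_def by (simp only: image_image conj_add_mat [OF assms])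
qed

context clg_chart
begin

text \<open>H is a holomorphic lift of the local map h of the correspondence. One ball serves for
  the translation a and for the point x, whereas in \<open>induces_rep\<close> the neighbourhood
  depends on a.\<close>

definition dev :: "'a set \<Rightarrow> ('a \<Rightarrow> (complex^'m) set) \<Rightarrow> ('a \<Rightarrow> complex^'m^'m) \<Rightarrow> real \<Rightarrow> bool" where
  "dev U \<phi> H r \<longleftrightarrow> 0 < r \<and> ball 0 r \<subseteq> \<Omega>0 \<and> nb r \<subseteq> U \<and> mfun H r \<and> H \<one> = mat 1 \<and>
     (\<forall>a\<in>nb r. invertible (H a)) \<and>
     (\<forall>a\<in>nb r. \<forall>x\<in>nb r. a \<otimes> x \<in> U \<and> \<phi> (a \<otimes> x) = pgl_of (H a) (\<phi> x))"

lemma devD: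
  assumes "dev U \<phi> H r"
  shows "0 < r" "ball 0 r \<subseteq> \<Omega>0" "nb r \<subseteq> U" "mfun H r" "H \<one> = mat 1"
    "\<And>a. a \<in> nb r \<Longrightarrow> invertible (H a)"
    "\<And>a x. a \<in> nb r \<Longrightarrow> x \<in> nb r \<Longrightarrow> a \<otimes> x \<in> U"
    "\<And>a x. a \<in> nb r \<Longrightarrow> x \<in> nb r \<Longrightarrow> \<phi> (a \<otimes> x) = pgl_of (H a) (\<phi> x)"
  using assms unfolding dev_def by auto

lemma mult_nb:
  assumes "openin T S" "\<one> \<in> S"
  obtains r where "0 < r" "ball 0 r \<subseteq> \<Omega>0" "nb r \<subseteq> S" "\<forall>a\<in>nb r. \<forall>x\<in>nb r. a \<otimes> x \<in> S"
proof -
  obtain r where r: "0 < r" "ball 0 r \<subseteq> \<Omega>0" and m: "\<forall>x\<in>ball 0 r. \<forall>y\<in>ball 0 r. \<sigma> x \<otimes> \<sigma> y \<in> S"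
    by (rule mult_ball [OF assms])
  have m': "a \<otimes> x \<in> S" if "a \<in> nb r" "x \<in> nb r" for a x using m that unfolding nb_image [OF r(2)] by blast
  have "a \<in> S" if "a \<in> nb r" for a
  proof -
    have "a \<in> carrier L" using that nb_carrier by blast
    then show ?thesis using m' [OF that one_nb [OF r(1)]] by simp
  qed
  then show thesis using that r m' by blast
qed

text \<open>By associativity \<open>H (a \<otimes> b)\<close> and \<open>H a ** H b\<close> act
  alike on an open set of chart values, so \<open>pgl_of_agree\<close> makes them
  proportional.\<close>

lemma dev_phom:
  assumes c: "pchart (U, \<phi>)" and d: "dev U \<phi> H r"
  shows "\<exists>s. phom H r s"
proof -
  note cD = proj_chartD [OF c] and dD = devD [OF d]
  obtain s0 where s0: "0 < s0" "ball 0 s0 \<subseteq> \<Omega>0" "nb s0 \<subseteq> nb r" "\<forall>a\<in>nb s0. \<forall>x\<in>nb s0. a \<otimes> x \<in> nb r"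
    by (rule mult_nb [OF open_nb one_nb [OF dD(1)]])
  define s where "s = min s0 r"
  have s: "0 < s" "s \<le> s0" "s \<le> r" unfolding s_def using s0 dD(1) by auto
  have m: "a \<otimes> x \<in> nb r" if "a \<in> nb s" "x \<in> nb s" for a x using s0(4) that nb_mono [OF s(2)] by blast
  have "\<exists>c. H (a \<otimes> b) = mat c ** (H a ** H b)" if a: "a \<in> nb s" and b: "b \<in> nb s" for a b
  proof -
    have ar: "a \<in> nb r" "b \<in> nb r" using a b nb_mono [OF s(3)] by blast+
    have ac: "a \<in> carrier L" "b \<in> carrier L" using a b nb_carrier by blast+
    have e: "pgl_of (H (a \<otimes> b)) p = pgl_of (H a ** H b) p" if p: "p \<in> \<phi> ` nb s" for p
    proof -
      obtain x where x: "x \<in> nb s" "p = \<phi> x" using p by blast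
      have xr: "x \<in> nb r" using x nb_mono [OF s(3)] by blast
      have xc: "x \<in> carrier L" using x nb_carrier by blast
      have xU: "x \<in> U" using xr dD(3) by blast
      have "pgl_of (H (a \<otimes> b)) p = \<phi> (a \<otimes> (b \<otimes> x))"
        unfolding x(2) using dD(8) [OF m [OF a b] xr] ac xc by (simp add: m_assoc)
      also have "\<dots> = pgl_of (H a) (pgl_of (H b) p)"
        unfolding x(2) by (simp add: dD(8) [OF ar(1) m [OF b x(1)]] dD(8) [OF ar(2) xr])
      also have "\<dots> = pgl_of (H a ** H b) p"
        unfolding x(2) by (rule pgl_of_mult [OF dD(6) [OF ar(2)] cD(6) [OF xU], symmetric])
      finally show ?thesis .
    qed
    have o: "openin proj_topology (\<phi> ` nb s)" by (rule cD(7) [OF open_nb]) (use nb_mono [OF s(3)] dD(3) in blast)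
    have ne: "\<phi> ` nb s \<noteq> {}" using one_nb [OF s(1)] by blast
    obtain c where "c \<noteq> 0" "H (a \<otimes> b) = mat c ** (H a ** H b)"
      by (rule pgl_of_agree [OF dD(6) [OF m [OF a b]] invertible_mult [OF dD(6) [OF ar(1)] dD(6) [OF ar(2)]] o ne e])
    then show ?thesis by blast
  qed
  then have "phom H r s" unfolding phom_def using s dD m by blast
  then show ?thesis ..
qed

text \<open>Left invariance gives germs only. Connectedness of the coordinate ball makes one matrix
  serve all its points, with a radius independent of a.\<close>

lemma IFPS_transition:
  assumes \<A>: "\<A> \<in> IFPSs" and U: "(U, \<phi>) \<in> \<A>" and S: "openin T S" "\<one> \<in> S" "S \<subseteq> U"
  obtains r where "0 < r" "ball 0 r \<subseteq> \<Omega>0" "nb r \<subseteq> S" "\<forall>a\<in>nb r. \<forall>x\<in>nb r. a \<otimes> x \<in> S"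
    "\<forall>a\<in>nb r. \<exists>A. invertible A \<and> (\<forall>x\<in>nb r. \<phi> (a \<otimes> x) = pgl_of A (\<phi> x))"
proof -
  note cD = proj_chartD [OF IFPS_D(1) [OF \<A> U]]
  obtain r where r: "0 < r" "ball 0 r \<subseteq> \<Omega>0" "nb r \<subseteq> S" "\<forall>a\<in>nb r. \<forall>x\<in>nb r. a \<otimes> x \<in> S"
    by (rule mult_nb [OF S(1,2)])
  have "\<exists>A. invertible A \<and> (\<forall>x\<in>nb r. \<phi> (a \<otimes> x) = pgl_of A (\<phi> x))" if a: "a \<in> nb r" for a
  proof (rule connected_single [OF connected_nb [OF r(2)] order_refl open_nb])
    show "openin proj_topology (\<phi> ` S')" if "openin T S'" "S' \<subseteq> nb r" for S'
      by (rule cD(7) [OF that(1)]) (use that r(3) S(3) in blast)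
    show "locp T p \<phi> (\<lambda>x. \<phi> (a \<otimes> x))" if p: "p \<in> nb r" for p
      by (rule IFPS_D(4) [OF \<A> U U]) (use a p r(3,4) S(3) nb_carrier in blast)+
  qed
  then show thesis using that r by blast
qed

text \<open>PGL is transitive on points, and a maximal atlas is stable under composition of its
  charts with PGL.\<close>

lemma IFPS_base_chart:
  assumes \<A>: "\<A> \<in> IFPSs"
  obtains U \<phi> where "(U, \<phi>) \<in> \<A>" "\<one> \<in> U" "\<phi> \<one> = proj_pt (axis k 1)"
proof -
  obtain U \<phi> where U: "(U, \<phi>) \<in> \<A>" "\<one> \<in> U" using IFPS_D(2) [OF \<A> one_closed] by blast
  note c = IFPS_D(1) [OF \<A> U(1)]
  note cD = proj_chartD [OF c]
  obtain v where v: "v \<noteq> 0" "\<phi> \<one> = proj_pt v" using cD(6) [OF U(2)] unfolding proj_space_def by blast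
  obtain A :: "complex^'m^'m" where A: "invertible A" "A *v v = axis k 1"
    by (rule ex_matrix_map [OF v(1), of "axis k 1"]) (simp add: axis_eq_0_iff)
  let ?\<psi> = "restrict (\<lambda>x. pgl_of A (\<phi> x)) U"
  have "(U, ?\<psi>) \<in> \<A>"
  proof (rule IFPS_mem [OF \<A> proj_chart_pgl [OF c A(1)]])
    fix U' \<phi>' p assume U': "(U', \<phi>') \<in> \<A>" "p \<in> U'" "p \<in> U"
    note c'D = proj_chartD [OF IFPS_D(1) [OF \<A> U'(1)]]
    have "locp T p \<phi> ?\<psi>" by (rule locpI [OF cD(5) U'(3) A(1)]) simp
    then show "locp T p \<phi>' ?\<psi>"
      by (rule locp_trans [OF IFPS_D(3) [OF \<A> U'(1) U(1) U'(2,3)] _ c'D(5) U'(2) c'D(6)])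
  qed
  moreover have "?\<psi> \<one> = proj_pt (axis k 1)" using U(2) v A by (simp add: pgl_of_proj_pt)
  ultimately show thesis using that U(2) by blast
qed

end

lemma matrix_axis_nth: "(A *v axis j 1) $ i = A $ i $ j" for A :: "complex^'m::finite^'n::finite"
  by (simp add: matrix_vector_mult_def axis_def if_distrib cong: if_cong)

context clg_chart
begin

text \<open>The matrices \<open>A a\<close> are merely chosen pointwise. Their values on vectors are
  known, up to factors, through lifts w that are holomorphic in a; linearity of \<open>A a\<close>
  relates the factors at E, \<open>vp j\<close> and \<open>vm j\<close>, so \<open>A a\<close>
  divided by its factor at E has holomorphic entries.\<close>

lemma dev_exists:
  assumes \<A>: "\<A> \<in> IFPSs" and U: "(U, \<phi>) \<in> \<A>" "\<one> \<in> U" and base: "\<phi> \<one> = proj_pt (axis k 1)"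
  obtains H r where "dev U \<phi> H r"
proof -
  note cD = proj_chartD [OF IFPS_D(1) [OF \<A> U(1)]]
  \<comment> \<open>On S the chart values have nonzero coordinate k, so they have lifts normalised
    at k.\<close>
  define S where "S = {x \<in> U. \<phi> x \<in> aff_dom k}"
  have oS: "openin T S" unfolding S_def by (rule holo_map_openin [OF cD(3) open_aff_dom])
  have "\<one> \<in> S" unfolding S_def using U(2) by (simp add: base aff_dom_iff axis_eq_0_iff)
  then obtain r where r: "0 < r" "ball 0 r \<subseteq> \<Omega>0" "nb r \<subseteq> S" and rr: "\<forall>a\<in>nb r. \<forall>x\<in>nb r. a \<otimes> x \<in> S"
    and tr: "\<forall>a\<in>nb r. \<exists>A. invertible A \<and> (\<forall>x\<in>nb r. \<phi> (a \<otimes> x) = pgl_of A (\<phi> x))"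
    by (rule IFPS_transition [OF \<A> U(1) oS _]) (auto simp: S_def)
  obtain A where A: "\<And>a. a \<in> nb r \<Longrightarrow> invertible (A a)"
    and A\<phi>: "\<And>a x. a \<in> nb r \<Longrightarrow> x \<in> nb r \<Longrightarrow> \<phi> (a \<otimes> x) = pgl_of (A a) (\<phi> x)"
    using tr by metis
  have rU: "nb r \<subseteq> U" using r(3) unfolding S_def by blast
  have one_r: "\<one> \<in> nb r" by (rule one_nb [OF r(1)])
  have "open {v. v \<noteq> 0 \<and> proj_pt v \<in> \<phi> ` nb r}" by (rule openin_proj_cone [OF cD(7) [OF open_nb rU]])
  moreover have "axis k 1 \<in> {v. v \<noteq> 0 \<and> proj_pt v \<in> \<phi> ` nb r}"
    using base one_r by (auto simp: axis_eq_0_iff intro!: image_eqI [of _ _ \<one>])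
  ultimately obtain e where e: "0 < e" "ball (axis k 1) e \<subseteq> {v. v \<noteq> 0 \<and> proj_pt v \<in> \<phi> ` nb r}" by (rule openE)
  define B where "B = ball (axis k (1::complex)) e"
  define pt where "pt v = inv_into (nb r) \<phi> (proj_pt v)" for v
  have Bnz: "v \<noteq> 0" if "v \<in> B" for v using e(2) that unfolding B_def by blast
  have pt: "pt v \<in> nb r" "\<phi> (pt v) = proj_pt v" if "v \<in> B" for v
  proof -
    have "proj_pt v \<in> \<phi> ` nb r" using e(2) that unfolding B_def by blast
    then show "pt v \<in> nb r" "\<phi> (pt v) = proj_pt v" unfolding pt_def by (rule inv_into_into, rule f_inv_into_f)
  qed
  define w where "w v a = aff_lift k k (aff_map k k (\<phi> (a \<otimes> pt v)))" for v a
  have w_holo: "hfun (nb r) (\<lambda>a. w v a $ j)" if v: "v \<in> B" for v j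
    unfolding w_def
  proof (rule holo_map_proj_lift [OF cT])
    have "pt v \<in> carrier L" using pt(1) [OF v] nb_carrier by blast
    then have "holo_map T \<Phi> T \<Phi> (nb r) (\<lambda>a. a \<otimes> pt v)"
      by (intro holo_map_subset [OF holo_right open_nb]) (use nb_carrier carrier_top in auto)
    then show "holo_map T \<Phi> proj_topology (proj_atlas k) (nb r) (\<lambda>a. \<phi> (a \<otimes> pt v))"
      by (rule holo_map_compose [OF cT cT _ cD(3)]) (use rr pt(1) [OF v] in \<open>auto simp: S_def\<close>)
    show "(\<lambda>a. \<phi> (a \<otimes> pt v)) ` nb r \<subseteq> aff_dom k" using rr pt(1) [OF v] by (auto simp: S_def)
  qed
  have wk: "w v a $ k = 1" for v a unfolding w_def by (rule aff_lift_nth)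
  have Aw: "A a *v v = (A a *v v) $ k *s w v a" "(A a *v v) $ k \<noteq> 0" if a: "a \<in> nb r" and v: "v \<in> B" for a v
  proof -
    have d: "\<phi> (a \<otimes> pt v) \<in> aff_dom k" using rr a pt(1) [OF v] unfolding S_def by blast
    have "proj_pt (A a *v v) = \<phi> (a \<otimes> pt v)"
      unfolding A\<phi> [OF a pt(1) [OF v]] pt(2) [OF v] by (rule pgl_of_proj_pt [OF Bnz [OF v], symmetric])
    also have "\<dots> = proj_pt (w v a)" unfolding w_def by (rule proj_pt_lift_map [OF d, symmetric])
    finally obtain c where c: "c \<noteq> 0" "A a *v v = c *s w v a"
      by (rule proj_pt_eqD) (rule matrix_vector_nonzero [OF A [OF a] Bnz [OF v]])
    have "(A a *v v) $ k = c" unfolding c(2) using wk by simp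
    then show "A a *v v = (A a *v v) $ k *s w v a" "(A a *v v) $ k \<noteq> 0" using c by auto
  qed
  have w1: "w v \<one> = (1 / v $ k) *s v" if v: "v \<in> B" "v $ k \<noteq> 0" for v
  proof -
    have p: "pt v \<in> carrier L" using pt(1) [OF v(1)] nb_carrier by blast
    have "w v \<one> $ j = ((1 / v $ k) *s v) $ j" for j
      unfolding w_def using p v(2) by (simp add: pt(2) [OF v(1)] aff_lift_def aff_map_proj_pt)
    then show ?thesis unfolding vec_eq_iff by (intro allI)
  qed
  \<comment> \<open>Half of the radius e, so that \<open>vp j\<close> and \<open>vm j\<close> stay
    in B.\<close>
  define s :: real where "s = e / 2"
  define c :: complex where "c = of_real s"
  have c0: "c \<noteq> 0" unfolding c_def s_def using e(1) by simp
  define E :: "complex^'m" where "E = axis k 1"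
  define vp vm where "vp j = E + c *s axis j 1" and "vm j = E - c *s axis j 1" for j
  have nc: "norm (c *s axis j (1::complex)) < e" for j :: 'm
  proof -
    have "c *s axis j (1::complex) = axis j c" by (simp add: vec_eq_iff axis_def)
    moreover have "norm (axis j c) = norm c"
      by (simp add: norm_vec_def L2_set_def axis_def if_distrib [of norm] if_distrib [of "\<lambda>x. x\<^sup>2"] cong: if_cong)
    ultimately show ?thesis using e(1) by (simp add: c_def s_def)
  qed
  have EB: "E \<in> B" unfolding B_def E_def using e(1) by simp
  have pB: "vp j \<in> B" and mB: "vm j \<in> B" for j
    unfolding B_def vp_def vm_def E_def using nc [of j] by (simp_all add: dist_norm)
  \<comment> \<open>The denominators of \<open>l\<close> below. For j other than k the value at the
    unit is 2 c, so their product is nonzero near the unit.\<close>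
  define dn where "dn j a = w (vp j) a $ j - w (vm j) a $ j" for j a
  define D where "D a = (\<Prod>j\<in>UNIV - {k}. dn j a)" for a
  have dnh: "hfun (nb r) (dn j)" for j unfolding dn_def by (intro holo_fun_diff w_holo pB mB)
  have "openin T {a \<in> nb r. D a \<in> - {0}}"
    unfolding D_def by (intro holo_fun_open [OF cT] holo_fun_prod dnh open_nb) auto
  moreover have "\<one> \<in> {a \<in> nb r. D a \<in> - {0}}"
  proof -
    have "dn j \<one> \<noteq> 0" if "j \<noteq> k" for j
      unfolding dn_def using that c0 w1 [OF pB, of j] w1 [OF mB, of j] by (simp add: vp_def vm_def E_def axis_def)
    then show ?thesis using one_r by (simp add: D_def)
  qed
  ultimately obtain q where q: "0 < q" "ball 0 q \<subseteq> \<Omega>0" "nb q \<subseteq> {a \<in> nb r. D a \<in> - {0}}" by (rule nbhd_nb)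
  have qr: "nb q \<subseteq> nb r" using q(3) by blast
  have dn0: "dn j a \<noteq> 0" if "a \<in> nb q" "j \<noteq> k" for a j
  proof -
    have "D a \<noteq> 0" using q(3) that(1) by blast
    then show ?thesis using that(2) unfolding D_def by simp
  qed
  \<comment> \<open>Let \<alpha>, \<beta>, \<gamma> be the factors at E, \<open>vp j\<close> and
    \<open>vm j\<close>. Linearity gives \<beta> + \<gamma> = 2 \<alpha> in coordinate k and a
    second equation in coordinate j; eliminating \<gamma> leaves \<beta> = \<alpha> l. Column j of
    \<open>A a\<close> is then \<alpha> times column j of the matrix defined next.\<close>
  define l where "l j a = 2 * (w E a $ j - w (vm j) a $ j) / dn j a" for j a
  define H :: "'a \<Rightarrow> complex^'m^'m" where
    "H a = (\<chi> i j. if j = k then w E a $ i else (l j a * w (vp j) a $ i - w E a $ i) / c)" for a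
  have wq: "hfun (nb q) (\<lambda>a. w v a $ j)" if "v \<in> B" for v j
    by (rule holo_fun_subset [OF w_holo [OF that] open_nb qr])
  have Hh: "mfun H q"
    unfolding mfun_def
  proof (intro allI)
    fix i j
    show "hfun (nb q) (\<lambda>a. H a $ i $ j)"
    proof (cases "j = k")
      case True
      then show ?thesis unfolding H_def using wq [OF EB] by simp
    next
      case False
      have "hfun (nb q) (l j)" unfolding l_def
        by (intro holo_fun_divide [OF cT] holo_fun_mult holo_fun_const holo_fun_diff wq EB mB open_nb
            holo_fun_subset [OF dnh open_nb qr] dn0 False)
      then have "hfun (nb q) (\<lambda>a. (l j a * w (vp j) a $ i - w E a $ i) / c)"
        by (intro holo_fun_divide [OF cT] holo_fun_mult holo_fun_const holo_fun_diff wq EB pB open_nb c0)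
      then show ?thesis unfolding H_def using False by simp
    qed
  qed
  have AH: "A a = mat ((A a *v E) $ k) ** H a" "(A a *v E) $ k \<noteq> 0" if a: "a \<in> nb q" for a
  proof -
    have ar: "a \<in> nb r" using a qr by blast
    define \<alpha> where "\<alpha> = (A a *v E) $ k"
    have \<alpha>: "A a *v E = \<alpha> *s w E a" "\<alpha> \<noteq> 0" unfolding \<alpha>_def by (rule Aw [OF ar EB])+
    then show "(A a *v E) $ k \<noteq> 0" by (simp add: \<alpha>_def)
    have "A a $ i $ j = \<alpha> * H a $ i $ j" for i j
    proof (cases "j = k")
      case True
      have "A a $ i $ k = (A a *v E) $ i" unfolding E_def by (rule matrix_axis_nth [symmetric])
      then show ?thesis using True \<alpha>(1) by (simp add: H_def)
    next
      case False
      define \<beta> \<gamma> where "\<beta> = (A a *v vp j) $ k" and "\<gamma> = (A a *v vm j) $ k"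
      have \<beta>: "A a *v vp j = \<beta> *s w (vp j) a" unfolding \<beta>_def by (rule Aw [OF ar pB])
      have \<gamma>: "A a *v vm j = \<gamma> *s w (vm j) a" unfolding \<gamma>_def by (rule Aw [OF ar mB])
      have sum: "2 * (A a *v E) $ i = (A a *v vp j) $ i + (A a *v vm j) $ i" for i
        unfolding vp_def vm_def by (simp add: matrix_vector_right_distrib matrix_vector_mult_diff_distrib)
      have k2: "\<gamma> = 2 * \<alpha> - \<beta>" using sum [of k] by (simp add: \<alpha>_def \<beta>_def \<gamma>_def)
      have "2 * (\<alpha> * w E a $ j) = \<beta> * w (vp j) a $ j + \<gamma> * w (vm j) a $ j"
        using sum [of j] unfolding \<alpha>(1) \<beta> \<gamma> by simp
      then have "\<beta> * dn j a = \<alpha> * (2 * (w E a $ j - w (vm j) a $ j))"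
        unfolding k2 dn_def by (simp add: algebra_simps)
      then have \<beta>l: "\<beta> = \<alpha> * l j a" using dn0 [OF a False] by (simp add: l_def field_simps)
      have "c * A a $ i $ j = (A a *v (c *s axis j 1)) $ i"
        by (simp add: vector_scalar_commute matrix_axis_nth)
      also have "c *s axis j 1 = vp j - E" unfolding vp_def by simp
      also have "(A a *v (vp j - E)) $ i = \<beta> * w (vp j) a $ i - \<alpha> * w E a $ i"
        unfolding matrix_vector_mult_diff_distrib \<beta> \<alpha>(1) by simp
      finally show ?thesis using False c0 by (simp add: H_def \<beta>l field_simps)
    qed
    then have "A a $ i $ j = (mat \<alpha> ** H a) $ i $ j" for i j unfolding mat_mult_nth .
    then show "A a = mat ((A a *v E) $ k) ** H a" unfolding \<alpha>_def [symmetric] vec_eq_iff by (intro allI)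
  qed
  have H1: "H \<one> = mat 1"
  proof -
    have wE: "w E \<one> = E" using w1 [OF EB] by (simp add: E_def)
    have "H \<one> $ i $ j = mat 1 $ i $ j" for i j
    proof (cases "j = k")
      case True
      then have "H \<one> $ i $ j = E $ i" by (simp add: H_def wE)
      then show ?thesis using True by (simp add: E_def mat_nth axis_def)
    next
      case False
      have wp: "w (vp j) \<one> = vp j" and wm: "w (vm j) \<one> = vm j"
        using w1 [OF pB, of j] w1 [OF mB, of j] False by (simp_all add: vp_def vm_def E_def axis_def)
      have "l j \<one> = 1" unfolding l_def dn_def wE wp wm using False c0 by (simp add: vp_def vm_def E_def axis_def)
      then have "H \<one> $ i $ j = (vp j $ i - E $ i) / c" using False by (simp add: H_def wE wp)
      then show ?thesis using c0 by (simp add: vp_def mat_nth axis_def)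
    qed
    then show ?thesis unfolding vec_eq_iff by (intro allI)
  qed
  have "dev U \<phi> H q"
    unfolding dev_def
  proof (intro conjI ballI)
    show "nb q \<subseteq> U" using qr rU by blast
    fix a assume a: "a \<in> nb q"
    have ar: "a \<in> nb r" using a qr by blast
    have "det (A a) \<noteq> 0" using A [OF ar] by (simp add: invertible_det_nz)
    then have "det (H a) \<noteq> 0" by (metis AH(1) [OF a] det_mul mult_zero_right)
    then show "invertible (H a)" by (simp add: invertible_det_nz)
    fix x assume x: "x \<in> nb q"
    then have xr: "x \<in> nb r" using qr by blast
    show "a \<otimes> x \<in> U" using rr ar xr unfolding S_def by blast
    have "pgl_of (A a) = pgl_of (H a)" by (metis AH [OF a] pgl_of_scale)
    then show "\<phi> (a \<otimes> x) = pgl_of (H a) (\<phi> x)" using A\<phi> [OF ar xr] by simp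
  qed (fact q Hh H1)+
  then show thesis by (rule that)
qed

text \<open>In \<open>induces_rep\<close> the neighbourhood W depends on a.
  \<open>IFPS_transition\<close> supplies matrices on a common ball, and agreement near the base
  point identifies their action with that of the lift H.\<close>

lemma induces_dev:
  assumes \<A>: "\<A> \<in> IFPSs" and f: "induces \<A> f"
  obtains U \<phi> H r where "(U, \<phi>) \<in> \<A>" "\<phi> \<one> = proj_pt (axis k 1)" "dev U \<phi> H r" "f \<in> extensional TS"
    "\<forall>\<xi>\<in>TS. trace (f \<xi>) = 0" "\<forall>\<xi>\<in>TS. gl_class (f \<xi>) = gl_class (dH H \<xi>)"
proof -
  obtain U \<phi> N h where U: "(U, \<phi>) \<in> \<A>" "\<one> \<in> U" "\<phi> \<one> = proj_pt (axis k 1)" and N: "openin T N" "\<one> \<in> N"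
    and h: "\<forall>a\<in>N. h a \<in> PGL \<and>
           (\<exists>W. openin proj_topology W \<and> proj_pt (axis k 1) \<in> W \<and> W \<subseteq> \<phi> ` U \<and>
              (\<forall>y\<in>W. a \<otimes> inv_into U \<phi> y \<in> U \<and> \<phi> (a \<otimes> inv_into U \<phi> y) = h a y))"
    and d: "differential_at_unit L T \<Phi> h f"
    using f unfolding induces_rep_def by - (elim exE conjE, rule that; assumption)
  obtain N' H where N': "openin T N'" "\<one> \<in> N'" and H: "\<forall>a\<in>N'. invertible (H a) \<and> pgl_of (H a) = h a"
    "H \<one> = mat 1" "\<forall>i j. hfun N' (\<lambda>a. H a $ i $ j)" and fx: "f \<in> extensional TS"
    and ft: "\<forall>\<xi>\<in>TS. trace (f \<xi>) = 0 \<and> gl_class (f \<xi>) = gl_class (\<chi> i j. \<xi> (\<lambda>a. H a $ i $ j))"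
    using d unfolding differential_at_unit_def lie_carrier_eq by - (elim exE conjE, rule that; assumption)
  note cD = proj_chartD [OF IFPS_D(1) [OF \<A> U(1)]]
  have oS: "openin T (N \<inter> N' \<inter> U)" by (intro openin_Int N N' cD)
  obtain r where r: "0 < r" "ball 0 r \<subseteq> \<Omega>0" "nb r \<subseteq> N \<inter> N' \<inter> U" "\<forall>a\<in>nb r. \<forall>x\<in>nb r. a \<otimes> x \<in> N \<inter> N' \<inter> U"
    and tr: "\<forall>a\<in>nb r. \<exists>A. invertible A \<and> (\<forall>x\<in>nb r. \<phi> (a \<otimes> x) = pgl_of A (\<phi> x))"
    by (rule IFPS_transition [OF \<A> U(1) oS]) (use N N' U in auto)
  have e: "\<phi> (a \<otimes> x) = pgl_of (H a) (\<phi> x)" if a: "a \<in> nb r" and x: "x \<in> nb r" for a x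
  proof -
    obtain A where A: "invertible A" "\<forall>x\<in>nb r. \<phi> (a \<otimes> x) = pgl_of A (\<phi> x)" using tr a by blast
    have aN: "a \<in> N" "a \<in> N'" using a r(3) by blast+
    obtain W where W: "openin proj_topology W" "proj_pt (axis k 1) \<in> W"
       and Wh: "\<forall>y\<in>W. a \<otimes> inv_into U \<phi> y \<in> U \<and> \<phi> (a \<otimes> inv_into U \<phi> y) = h a y"
      using conjunct2 [OF bspec [OF h aN(1)]] by - (elim exE conjE, rule that; assumption)
    have Ha: "invertible (H a)" "pgl_of (H a) = h a" using bspec [OF H(1) aN(2)] by simp_all
    have "pgl_of A = pgl_of (H a)"
    proof (rule pgl_of_agree_eq [OF A(1) Ha(1)])
      show "openin proj_topology (W \<inter> \<phi> ` nb r)" by (intro openin_Int W cD(7) open_nb) (use r(3) in blast)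
      show "W \<inter> \<phi> ` nb r \<noteq> {}" using W(2) U(3) one_nb [OF r(1)] by (metis IntI empty_iff imageI)
      fix y assume y: "y \<in> W \<inter> \<phi> ` nb r"
      then obtain z where z: "z \<in> nb r" "y = \<phi> z" by blast
      have "inv_into U \<phi> y = z" unfolding z(2) by (rule inv_into_f_f [OF cD(2)]) (use z(1) r(3) in blast)
      then have "\<phi> (a \<otimes> z) = h a y" using bspec [OF Wh, of y] y by simp
      then show "pgl_of A y = pgl_of (H a) y" using bspec [OF A(2) z(1)] unfolding z(2) Ha(2) by simp
    qed
    then show ?thesis using A(2) x by metis
  qed
  have "dev U \<phi> H r"
    unfolding dev_def mfun_def
  proof (intro conjI ballI allI)
    show "hfun (nb r) (\<lambda>a. H a $ i $ j)" for i j
      by (rule holo_fun_subset [OF H(3) [rule_format] open_nb]) (use r(3) in blast)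
  qed (use r H e in auto)
  then show thesis
    by (rule that [OF U(1,3) _ fx]) (use ft in \<open>simp_all add: dH_def\<close>)
qed

lemma dev_induces:
  assumes \<A>: "\<A> \<in> IFPSs" and U: "(U, \<phi>) \<in> \<A>" "\<phi> \<one> = proj_pt (axis k 1)" and d: "dev U \<phi> H r"
    and f: "f \<in> extensional TS" "\<And>\<xi>. \<xi> \<in> TS \<Longrightarrow> trace (f \<xi>) = 0" "\<And>\<xi>. \<xi> \<in> TS \<Longrightarrow> gl_class (f \<xi>) = gl_class (dH H \<xi>)"
  shows "induces \<A> f"
proof -
  note cD = proj_chartD [OF IFPS_D(1) [OF \<A> U(1)]] and dD = devD [OF d]
  have one_r: "\<one> \<in> nb r" by (rule one_nb [OF dD(1)])
  have diff: "differential_at_unit L T \<Phi> (\<lambda>a. pgl_of (H a)) f"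
    unfolding differential_at_unit_def lie_carrier_eq
    using f dD(4) open_nb one_r dD(5,6) unfolding dH_def mfun_def by (intro conjI exI [of _ "nb r"] exI [of _ H]) auto
  show ?thesis
    unfolding induces_rep_def
  proof (intro exI conjI ballI)
    show "(U, \<phi>) \<in> \<A>" "\<phi> \<one> = proj_pt (axis k 1)" by fact+
    show "\<one> \<in> U" using dD(3) one_r by blast
    show "openin T (nb r)" "\<one> \<in> nb r" by (fact open_nb one_r)+
    show "differential_at_unit L T \<Phi> (\<lambda>a. pgl_of (H a)) f" by (rule diff)
    fix a assume a: "a \<in> nb r"
    show "pgl_of (H a) \<in> PGL" using dD(6) [OF a] PGL_iff by blast
    show "openin proj_topology (\<phi> ` nb r)" by (rule cD(7) [OF open_nb dD(3)])
    show "proj_pt (axis k 1) \<in> \<phi> ` nb r" using U(2) one_r by (metis imageI)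
    show "\<phi> ` nb r \<subseteq> \<phi> ` U" using dD(3) by blast
    fix y assume "y \<in> \<phi> ` nb r"
    then obtain z where z: "z \<in> nb r" "y = \<phi> z" by blast
    have "inv_into U \<phi> y = z" unfolding z(2) by (rule inv_into_f_f [OF cD(2)]) (use z(1) dD(3) in blast)
    then show "a \<otimes> inv_into U \<phi> y \<in> U" "\<phi> (a \<otimes> inv_into U \<phi> y) = pgl_of (H a) y"
      using dD(7,8) [OF a z(1)] z(2) by simp_all
  qed
qed

lemma induces_exists:
  assumes \<A>: "\<A> \<in> IFPSs"
  shows "\<exists>f. induces \<A> f"
proof -
  obtain U \<phi> where U: "(U, \<phi>) \<in> \<A>" "\<one> \<in> U" "\<phi> \<one> = proj_pt (axis k 1)" by (rule IFPS_base_chart [OF \<A>])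
  obtain H r where d: "dev U \<phi> H r" by (rule dev_exists [OF \<A> U])
  have "induces \<A> (restrict (\<lambda>\<xi>. traceless (dH H \<xi>)) TS)"
    by (rule dev_induces [OF \<A> U(1,3) d]) (simp_all add: trace_traceless gl_class_traceless)
  then show ?thesis by blast
qed

end

section \<open>Structures and equivalence classes of representations\<close>

context clg_chart
begin

lemma mfun_conj: "mfun H r \<Longrightarrow> mfun (\<lambda>a. P ** H a ** Q) r"
  by (intro mfun_mult mfun_const)

lemma dH_conj:
  assumes "mfun H r" "0 < r" "\<xi> \<in> TS"
  shows "dH (\<lambda>a. P ** H a ** Q) \<xi> = P ** dH H \<xi> ** Q"
  using dH_right [OF mfun_mult [OF mfun_const assms(1)] assms(2,3), of P Q] dH_left [OF assms, of P] by simp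

lemma dev_base:
  assumes "dev U \<phi> H r" "a \<in> nb r"
  shows "\<phi> a = pgl_of (H a) (\<phi> \<one>)"
proof -
  have "a \<in> carrier L" using assms(2) nb_carrier by blast
  then show ?thesis using devD(8) [OF assms(1,2) one_nb [OF devD(1) [OF assms(1)]]] by simp
qed

text \<open>Two charts at the unit differ by the action of some P, so \<open>H' a\<close> is
  proportional to \<open>P ** H a ** matrix_inv P\<close>; \<open>dH_projective\<close>
  differentiates this.\<close>

lemma induces_rep_equiv:
  assumes \<A>: "\<A> \<in> IFPSs" and f: "induces \<A> f" and f': "induces \<A> f'"
  shows "rep_equiv LA f (axis k 1) f' (axis k 1)"
proof -
  obtain U \<phi> H r where U: "(U, \<phi>) \<in> \<A>" "\<phi> \<one> = proj_pt (axis k 1)" and d: "dev U \<phi> H r"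
    and fH: "\<forall>\<xi>\<in>TS. gl_class (f \<xi>) = gl_class (dH H \<xi>)"
    by (rule induces_dev [OF \<A> f])
  obtain U' \<phi>' H' r' where U': "(U', \<phi>') \<in> \<A>" "\<phi>' \<one> = proj_pt (axis k 1)" and d': "dev U' \<phi>' H' r'"
    and fH': "\<forall>\<xi>\<in>TS. gl_class (f' \<xi>) = gl_class (dH H' \<xi>)"
    by (rule induces_dev [OF \<A> f'])
  note cD = proj_chartD [OF IFPS_D(1) [OF \<A> U(1)]] and dD = devD [OF d] and d'D = devD [OF d']
  have one: "\<one> \<in> nb r" "\<one> \<in> nb r'" using one_nb dD(1) d'D(1) by auto
  have "locp T \<one> \<phi> \<phi>'" by (rule IFPS_D(3) [OF \<A> U(1) U'(1)]) (use dD(3) d'D(3) one in blast)+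
  then obtain S P where S: "openin T S" "\<one> \<in> S" and P: "invertible P" and SP: "\<forall>x\<in>S. \<phi>' x = pgl_of P (\<phi> x)"
    unfolding locp_def by blast
  obtain t where t: "0 < t" "ball 0 t \<subseteq> \<Omega>0" "nb t \<subseteq> S \<inter> nb r \<inter> nb r'" "\<forall>a\<in>nb t. \<forall>x\<in>nb t. a \<otimes> x \<in> S \<inter> nb r \<inter> nb r'"
    by (rule mult_nb [of "S \<inter> nb r \<inter> nb r'"]) (use S one open_nb in auto)
  have "\<exists>c. H' a = mat c ** (P ** H a ** matrix_inv P)" if a: "a \<in> nb t" for a
  proof -
    have ar: "a \<in> nb r" "a \<in> nb r'" using a t(3) by blast+
    have Pa: "invertible (H' a ** P)" "invertible (P ** H a)"
      by (intro invertible_mult P dD(6) [OF ar(1)] d'D(6) [OF ar(2)])+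
    have tU: "nb t \<subseteq> U" using t(3) dD(3) by blast
    have e: "pgl_of (H' a ** P) p = pgl_of (P ** H a) p" if p: "p \<in> \<phi> ` nb t" for p
    proof -
      obtain x where x: "x \<in> nb t" "p = \<phi> x" using p by blast
      have xr: "x \<in> nb r" "x \<in> nb r'" "x \<in> S" using x t(3) by blast+
      have axS: "a \<otimes> x \<in> S" using t(4) a x(1) by blast
      have px: "\<phi> x \<in> proj_space" using cD(6) tU x(1) by blast
      have "pgl_of (H' a ** P) p = pgl_of (H' a) (\<phi>' x)"
        unfolding x(2) pgl_of_mult [OF P px] using SP xr(3) by simp
      also have "\<dots> = \<phi>' (a \<otimes> x)" by (rule d'D(8) [OF ar(2) xr(2), symmetric])
      also have "\<dots> = pgl_of P (\<phi> (a \<otimes> x))" using SP axS by simp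
      also have "\<dots> = pgl_of (P ** H a) p"
        unfolding x(2) dD(8) [OF ar(1) xr(1)] by (rule pgl_of_mult [OF dD(6) [OF ar(1)] px, symmetric])
      finally show ?thesis .
    qed
    have ne: "\<phi> ` nb t \<noteq> {}" using one_nb [OF t(1)] by blast
    obtain c where c: "c \<noteq> 0" "H' a ** P = mat c ** (P ** H a)"
      by (rule pgl_of_agree [OF Pa cD(7) [OF open_nb tU] ne e])
    have "H' a ** P ** matrix_inv P = mat c ** (P ** H a ** matrix_inv P)" unfolding c(2) by (simp only: matrix_mul_assoc)
    then have "H' a = mat c ** (P ** H a ** matrix_inv P)"
      by (simp add: matrix_mul_assoc [symmetric] matrix_inv [OF P])
    then show ?thesis ..
  qed
  note prp = this
  define tt where "tt = min t (min r r')"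
  have tt: "0 < tt" "tt \<le> t" "tt \<le> r" "tt \<le> r'" unfolding tt_def using t(1) dD(1) d'D(1) by auto
  have "gl_class (f' \<xi>) = Ad_class P (gl_class (f \<xi>))" if \<xi>: "\<xi> \<in> TS" for \<xi>
  proof -
    have "\<exists>c. dH H' \<xi> = dH (\<lambda>a. P ** H a ** matrix_inv P) \<xi> + mat c"
    proof (rule dH_projective [OF mfun_mono [OF d'D(4) tt(4)] d'D(5) mfun_conj [OF mfun_mono [OF dD(4) tt(3)]] _ tt(1) \<xi>])
      show "P ** H \<one> ** matrix_inv P = mat 1" by (simp add: dD(5) matrix_inv [OF P])
      show "\<exists>c. H' a = mat c ** (P ** H a ** matrix_inv P)" if "a \<in> nb tt" for a
        by (rule prp) (use that nb_mono [OF tt(2)] in blast)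
    qed
    then have "gl_class (dH H' \<xi>) = gl_class (P ** dH H \<xi> ** matrix_inv P)"
      unfolding gl_class_eq_iff dH_conj [OF dD(4,1) \<xi>] .
    then show ?thesis using fH fH' \<xi> Ad_class_gl_class [OF P, of "dH H \<xi>"] by simp
  qed
  moreover have "proj_pt (axis k 1) = pgl_of P (proj_pt (axis k 1))" using SP S(2) U(2) U'(2) by metis
  ultimately show ?thesis unfolding rep_equiv_def lie_carrier_eq using P by blast
qed

text \<open>\<open>phom_unique\<close> compares H' with the conjugate of H by P. As
  \<open>\<phi> a\<close> is the image of the base point under \<open>H a\<close> and P fixes that
  point, the two charts differ by P near the unit, and left invariance of both structures carries
  this to every point.\<close>

lemma rep_equiv_eq:
  assumes \<A>: "\<A> \<in> IFPSs" and \<B>: "\<B> \<in> IFPSs"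
    and f: "induces \<A> f" and f': "induces \<B> f'"
    and eq: "rep_equiv LA f (axis k 1) f' (axis k 1)"
  shows "\<A> = \<B>"
proof -
  obtain U \<phi> H r where U: "(U, \<phi>) \<in> \<A>" "\<phi> \<one> = proj_pt (axis k 1)" and d: "dev U \<phi> H r"
    and fH: "\<forall>\<xi>\<in>TS. gl_class (f \<xi>) = gl_class (dH H \<xi>)"
    by (rule induces_dev [OF \<A> f])
  obtain U' \<phi>' H' r' where U': "(U', \<phi>') \<in> \<B>" "\<phi>' \<one> = proj_pt (axis k 1)" and d': "dev U' \<phi>' H' r'"
    and fH': "\<forall>\<xi>\<in>TS. gl_class (f' \<xi>) = gl_class (dH H' \<xi>)"
    by (rule induces_dev [OF \<B> f'])
  note c = IFPS_D(1) [OF \<A> U(1)] and c' = IFPS_D(1) [OF \<B> U'(1)]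
  note cD = proj_chartD [OF c] and c'D = proj_chartD [OF c'] and dD = devD [OF d] and d'D = devD [OF d']
  have one: "\<one> \<in> nb r" "\<one> \<in> nb r'" using one_nb dD(1) d'D(1) by auto
  have oneU: "\<one> \<in> U" "\<one> \<in> U'" using one dD(3) d'D(3) by blast+
  obtain P where P: "invertible P" and Ad: "\<forall>\<xi>\<in>TS. gl_class (f' \<xi>) = Ad_class P (gl_class (f \<xi>))"
    and Po: "proj_pt (axis k 1) = pgl_of P (proj_pt (axis k 1))"
    using eq unfolding rep_equiv_def lie_carrier_eq by blast
  define o' :: "(complex^'m) set" where "o' = proj_pt (axis k 1)"
  have o': "o' \<in> proj_space" unfolding o'_def by (rule proj_pt_in_space) (simp add: axis_eq_0_iff)
  let ?C = "\<lambda>a. P ** H a ** matrix_inv P"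
  obtain s where s: "phom H r s" using dev_phom [OF c d] by blast
  obtain s' where s': "phom H' r' s'" using dev_phom [OF c' d'] by blast
  have C: "phom ?C r s"
    unfolding phom_def
  proof (intro conjI ballI)
    show "0 < s" "s \<le> r" using s unfolding phom_def by auto
    show "mfun ?C r" by (rule mfun_conj [OF dD(4)])
    show "?C \<one> = mat 1" by (simp add: dD(5) matrix_inv [OF P])
    fix a b assume ab: "a \<in> nb s" "b \<in> nb s"
    have h: "a \<otimes> b \<in> nb r \<and> (\<exists>c. H (a \<otimes> b) = mat c ** (H a ** H b))" using s ab unfolding phom_def by blast
    then show "a \<otimes> b \<in> nb r" ..
    obtain c where c: "H (a \<otimes> b) = mat c ** (H a ** H b)" using h by blast
    have "?C a ** ?C b = P ** H a ** (matrix_inv P ** P) ** H b ** matrix_inv P" by (simp only: matrix_mul_assoc)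
    then have "?C a ** ?C b = P ** (H a ** H b) ** matrix_inv P" by (simp add: matrix_inv [OF P] matrix_mul_assoc)
    moreover have "?C (a \<otimes> b) = (P ** mat c) ** (H a ** H b) ** matrix_inv P" unfolding c by (simp only: matrix_mul_assoc)
    ultimately have "?C (a \<otimes> b) = mat c ** (?C a ** ?C b)" unfolding mat_mult_comm [of P] by (simp only: matrix_mul_assoc)
    then show "\<exists>c. ?C (a \<otimes> b) = mat c ** (?C a ** ?C b)" ..
  qed
  have Cinv: "invertible (?C a)" if "a \<in> nb r" for a
    by (intro invertible_mult P dD(6) [OF that] invertible_matrix_inv' [OF P])
  have dC: "\<exists>c. dH H' \<xi> = dH ?C \<xi> + mat c" if \<xi>: "\<xi> \<in> TS" for \<xi>
    unfolding gl_class_eq_iff [symmetric] dH_conj [OF dD(4,1) \<xi>]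
    using Ad fH fH' \<xi> Ad_class_gl_class [OF P, of "dH H \<xi>"] by simp
  obtain \<rho> where \<rho>: "0 < \<rho>" "\<forall>a\<in>nb \<rho>. \<exists>c. c \<noteq> 0 \<and> H' a = mat c ** ?C a"
    by (rule phom_unique [OF C Cinv s' dC])
  have \<phi>\<phi>': "locp T \<one> \<phi> \<phi>'"
  proof (rule locpI [OF _ _ P])
    show "openin T (nb \<rho> \<inter> nb r \<inter> nb r')" by (intro openin_Int open_nb)
    show "\<one> \<in> nb \<rho> \<inter> nb r \<inter> nb r'" using one one_nb [OF \<rho>(1)] by blast
    fix a assume a: "a \<in> nb \<rho> \<inter> nb r \<inter> nb r'"
    then have ar: "a \<in> nb r" "a \<in> nb r'" by auto
    obtain c where c: "c \<noteq> 0" "H' a = mat c ** ?C a" using \<rho>(2) a by blast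
    have "\<phi>' a = pgl_of (H' a) o'" using dev_base [OF d' ar(2)] U'(2) by (simp add: o'_def)
    also have "\<dots> = pgl_of (P ** H a ** matrix_inv P) o'" unfolding c(2) pgl_of_scale [OF c(1)] ..
    also have "\<dots> = pgl_of (P ** H a) (pgl_of (matrix_inv P) o')" by (rule pgl_of_mult [OF invertible_matrix_inv' [OF P] o'])
    also have "pgl_of (matrix_inv P) o' = o'" using pgl_of_inv(1) [OF P o'] Po by (simp add: o'_def)
    also have "pgl_of (P ** H a) o' = pgl_of P (pgl_of (H a) o')" by (rule pgl_of_mult [OF dD(6) [OF ar(1)] o'])
    also have "pgl_of (H a) o' = \<phi> a" using dev_base [OF d ar(1)] U(2) by (simp add: o'_def)
    finally show "\<phi>' a = pgl_of P (\<phi> a)" .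
  qed
  show ?thesis
  proof (rule IFPS_eqI [OF \<A> \<B>])
    fix V \<psi> V' \<psi>' p assume V: "(V, \<psi>) \<in> \<A>" "(V', \<psi>') \<in> \<B>" and p: "p \<in> V" "p \<in> V'"
    have pc: "p \<in> carrier L" using p(1) open_carrier [OF proj_chartD(5) [OF IFPS_D(1) [OF \<A> V(1)]]] by blast
    have p1: "p \<otimes> \<one> \<in> V" "p \<otimes> \<one> \<in> V'" using p pc by auto
    have 1: "locp T \<one> \<phi> (\<lambda>x. \<psi> (p \<otimes> x))" by (rule IFPS_D(4) [OF \<A> U(1) V(1) pc oneU(1) p1(1)])
    have 2: "locp T \<one> \<phi>' (\<lambda>x. \<psi>' (p \<otimes> x))" by (rule IFPS_D(4) [OF \<B> U'(1) V(2) pc oneU(2) p1(2)])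
    have 3: "locp T \<one> \<phi> (\<lambda>x. \<psi>' (p \<otimes> x))" by (rule locp_trans [OF \<phi>\<phi>' 2 cD(5) oneU(1) cD(6)])
    have 4: "locp T \<one> (\<lambda>x. \<psi> (p \<otimes> x)) \<phi>" by (rule locp_sym [OF 1 cD(5) oneU(1) cD(6)])
    have "locp T \<one> (\<lambda>x. \<psi> (p \<otimes> x)) (\<lambda>x. \<psi>' (p \<otimes> x))"
    proof (rule locp_trans [OF 4 3])
      show "openin T {x \<in> carrier L. p \<otimes> x \<in> V}" by (rule open_left [OF pc proj_chartD(5) [OF IFPS_D(1) [OF \<A> V(1)]]])
      show "\<one> \<in> {x \<in> carrier L. p \<otimes> x \<in> V}" using p1(1) by simp
      show "\<psi> (p \<otimes> x) \<in> proj_space" if "x \<in> {x \<in> carrier L. p \<otimes> x \<in> V}" for x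
        using that proj_chartD(6) [OF IFPS_D(1) [OF \<A> V(1)]] by blast
    qed
    from locp_translate [OF pc one_closed this] show "locp T p \<psi> \<psi>'" using pc by simp
  qed
qed

text \<open>The inverse of the chart is holomorphic, so every germ is a holomorphic function of the
  affine coordinates, and the chain rule carries their vanishing derivatives over to it.\<close>

lemma chart_kernel:
  assumes c: "pchart (U, \<phi>)" and U: "\<one> \<in> U" "\<phi> \<one> \<in> aff_dom k" and \<xi>: "\<xi> \<in> TS"
    and z: "\<And>j. \<xi> (\<lambda>a. aff_map k k (\<phi> a) $ j) = 0"
  shows "\<xi> = 0"
proof
  fix g
  note cD = proj_chartD [OF c]
  show "\<xi> g = 0 g"
  proof (cases "g \<in> hn")
    case False
    then show ?thesis by (simp add: TS_zero [OF \<xi>])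
  next
    case True
    then obtain S where S: "\<one> \<in> S" "hfun S g" unfolding holo_near_def by blast
    define V where "V = S \<inter> {x \<in> U. \<phi> x \<in> aff_dom k}"
    have V: "openin T V" unfolding V_def
      by (intro openin_Int holo_funD(1) [OF S(2)] holo_map_openin [OF cD(3) open_aff_dom])
    have VU: "V \<subseteq> U" "V \<subseteq> S" "\<phi> ` V \<subseteq> aff_dom k" and oneV: "\<one> \<in> V" unfolding V_def using S(1) U by auto
    have \<phi>V: "holo_map T \<Phi> proj_topology (proj_atlas k) V \<phi>" by (rule holo_map_subset [OF cD(3) V VU(1)])
    have "holo_fun proj_topology (proj_atlas k) (\<phi> ` V) (\<lambda>y. g (inv_into U \<phi> y))"
      by (rule holo_fun_compose [OF cmfd_proj cT holo_map_subset [OF cD(4) cD(7) [OF V VU(1)] image_mono [OF VU(1)]] S(2)])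
         (use VU cD(2) in auto)
    from holo_funD(2) [OF this aff_chart_mem]
    have h: "holo (*s) (*) (\<lambda>x. g (inv_into U \<phi> (inv_into (aff_dom k) (aff_map k k) x))) (aff_map k k ` (\<phi> ` V \<inter> aff_dom k))"
      (is "holo _ _ ?\<Gamma> ?I") .
    obtain e where e: "0 < e" "ball 0 e \<subseteq> \<Omega>0" "\<sigma> ` ball 0 e \<subseteq> V" by (rule nbhd_ball [OF V oneV])
    define \<Psi> where "\<Psi> x = aff_map k k (\<phi> (\<sigma> x))" for x
    have \<Psi>hn: "(\<lambda>a. aff_map k k (\<phi> a) $ j) \<in> hn" for j
      by (rule hnI [OF holo_map_chart_coord [OF \<phi>V aff_chart_mem VU(3)] oneV])
    define D where "D v = (\<chi> j. dd (\<lambda>x. aff_map k k (\<phi> (\<sigma> x)) $ j) 0 v)" for v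
    have "(\<Psi> has_derivative D) (at 0)"
      unfolding \<Psi>_def D_def by (subst has_derivative_vec_iff) (simp add: hn_dd(1) [OF \<Psi>hn])
    then have \<Psi>D: "(\<Psi> has_derivative D) (at 0 within ball 0 e)" by (rule has_derivative_at_withinI)
    have D0: "D (vc \<xi>) = 0"
    proof -
      have "tv (vc \<xi>) (\<lambda>a. aff_map k k (\<phi> a) $ j) = 0" for j unfolding tv_vc [OF \<xi>] by (rule z)
      then show ?thesis unfolding tv_def D_def by (simp add: \<Psi>hn vec_eq_iff)
    qed
    have \<Psi>I: "\<Psi> ` ball 0 e \<subseteq> ?I"
    proof
      fix y assume "y \<in> \<Psi> ` ball 0 e"
      then obtain x where x: "x \<in> ball 0 e" "y = aff_map k k (\<phi> (\<sigma> x))" unfolding \<Psi>_def by blast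
      then have "\<sigma> x \<in> V" using e(3) by blast
      then show "y \<in> ?I" unfolding x(2) using VU(3) by blast
    qed
    have z0: "0 \<in> ball (0::complex^'m) e" using e(1) by simp
    have "\<Psi> 0 \<in> ?I" using \<Psi>I z0 by blast
    \<comment> \<open>This derivative is taken within a piece of the hyperplane and is determined
      only along it. \<Psi> maps into that piece, so the chain rule within sets applies.\<close>
    then obtain G where G: "(?\<Gamma> has_derivative G) (at (\<Psi> 0) within ?I)" using h unfolding holo_def by blast
    have "((\<lambda>x. ?\<Gamma> (\<Psi> x)) has_derivative (\<lambda>v. G (D v))) (at 0 within ball 0 e)"
      by (rule has_derivative_in_compose [OF \<Psi>D has_derivative_subset [OF G \<Psi>I]])
    then have "((\<lambda>x. ?\<Gamma> (\<Psi> x)) has_derivative (\<lambda>v. G (D v))) (at 0)"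
      using at_within_open [OF z0 open_ball] by simp
    then have "((\<lambda>x. g (\<sigma> x)) has_derivative (\<lambda>v. G (D v))) (at 0)"
    proof (rule has_derivative_transform_within_open [OF _ open_ball z0])
      fix x :: "complex^'m" assume "x \<in> ball 0 e"
      then have "\<sigma> x \<in> V" using e(3) by blast
      then have "\<sigma> x \<in> U" "\<phi> (\<sigma> x) \<in> aff_dom k" using VU by blast+
      then show "?\<Gamma> (\<Psi> x) = g (\<sigma> x)"
        unfolding \<Psi>_def by (simp add: inv_into_f_f [OF inj_aff_map] inv_into_f_f [OF cD(2)])
    qed
    then have "dd (\<lambda>x. g (\<sigma> x)) 0 (vc \<xi>) = G (D (vc \<xi>))" by (rule dd_eq)
    also have "\<dots> = 0" unfolding D0 by (rule linear_0 [OF has_derivative_linear [OF G]])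
    finally have "tv (vc \<xi>) g = 0" by (simp add: tv_def)
    then show ?thesis by (simp add: tv_vc [OF \<xi>])
  qed
qed

end

section \<open>Prehomogeneous vector spaces\<close>

lemma lie_algebra_sum:
  assumes \<gg>: "lie_algebra \<gg>" and \<hh>: "lie_algebra \<hh>"
  shows "lie_algebra (lie_sum \<gg> \<hh>)"
proof -
  interpret v: vector_space "lie_scale \<gg>" using \<gg> unfolding lie_algebra_def by blast
  interpret w: vector_space "lie_scale \<hh>" using \<hh> unfolding lie_algebra_def by blast
  let ?s = "\<lambda>c p. (lie_scale \<gg> c (fst p), lie_scale \<hh> c (snd p))"
  have vs: "vector_space ?s"
    by unfold_locales (simp_all add: v.scale_right_distrib v.scale_left_distrib w.scale_right_distrib w.scale_left_distrib)
  interpret p: vector_space ?s by (rule vs)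
  have sub: "v.subspace (lie_carrier \<gg>)" "w.subspace (lie_carrier \<hh>)"
    using \<gg> \<hh> unfolding lie_algebra_def by blast+
  have psub: "p.subspace (lie_carrier \<gg> \<times> lie_carrier \<hh>)"
    using sub unfolding v.subspace_def w.subspace_def p.subspace_def by (auto simp: zero_prod_def)
  obtain B where B: "finite B" "B \<subseteq> lie_carrier \<gg>" "v.span B = lie_carrier \<gg>"
    using \<gg> unfolding lie_algebra_def by blast
  obtain C where C: "finite C" "C \<subseteq> lie_carrier \<hh>" "w.span C = lie_carrier \<hh>"
    using \<hh> unfolding lie_algebra_def by blast
  let ?B = "(\<lambda>x. (x, 0)) ` B \<union> (\<lambda>y. (0, y)) ` C"
  have Bs: "?B \<subseteq> lie_carrier \<gg> \<times> lie_carrier \<hh>"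
    using B(2) C(2) v.subspace_0 [OF sub(1)] w.subspace_0 [OF sub(2)] by auto
  have "p.span ?B = lie_carrier \<gg> \<times> lie_carrier \<hh>"
  proof
    show "p.span ?B \<subseteq> lie_carrier \<gg> \<times> lie_carrier \<hh>" by (rule p.span_minimal [OF Bs psub])
    have "v.subspace {x. (x, 0) \<in> p.span ?B}"
      unfolding v.subspace_def
    proof (intro conjI ballI allI)
      show "0 \<in> {x. (x, 0) \<in> p.span ?B}" using p.span_zero [of ?B] by (simp add: zero_prod_def)
      fix x y c assume x: "x \<in> {x. (x, 0) \<in> p.span ?B}"
      show "lie_scale \<gg> c x \<in> {x. (x, 0) \<in> p.span ?B}" using p.span_scale [of "(x, 0)" ?B c] x by simp
      assume y: "y \<in> {x. (x, 0) \<in> p.span ?B}"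
      show "x + y \<in> {x. (x, 0) \<in> p.span ?B}" using p.span_add [of "(x, 0)" ?B "(y, 0)"] x y by simp
    qed
    then have 1: "v.span B \<subseteq> {x. (x, 0) \<in> p.span ?B}"
      by (rule v.span_minimal [rotated]) (auto intro: p.span_base)
    have "w.subspace {y. (0, y) \<in> p.span ?B}"
      unfolding w.subspace_def
    proof (intro conjI ballI allI)
      show "0 \<in> {y. (0, y) \<in> p.span ?B}" using p.span_zero [of ?B] by (simp add: zero_prod_def)
      fix x y c assume x: "x \<in> {y. (0, y) \<in> p.span ?B}"
      show "lie_scale \<hh> c x \<in> {y. (0, y) \<in> p.span ?B}" using p.span_scale [of "(0, x)" ?B c] x by simp
      assume y: "y \<in> {y. (0, y) \<in> p.span ?B}"
      show "x + y \<in> {y. (0, y) \<in> p.span ?B}" using p.span_add [of "(0, x)" ?B "(0, y)"] x y by simp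
    qed
    then have 2: "w.span C \<subseteq> {y. (0, y) \<in> p.span ?B}"
      by (rule w.span_minimal [rotated]) (auto intro: p.span_base)
    show "lie_carrier \<gg> \<times> lie_carrier \<hh> \<subseteq> p.span ?B"
    proof
      fix z assume z: "z \<in> lie_carrier \<gg> \<times> lie_carrier \<hh>"
      then have "(fst z, 0) \<in> p.span ?B" "(0, snd z) \<in> p.span ?B" using 1 2 B(3) C(3) by auto
      from p.span_add [OF this] show "z \<in> p.span ?B" by simp
    qed
  qed
  then have span: "\<exists>B. finite B \<and> B \<subseteq> lie_carrier \<gg> \<times> lie_carrier \<hh> \<and> p.span B = lie_carrier \<gg> \<times> lie_carrier \<hh>"
    using Bs B(1) C(1) by (intro exI [of _ ?B]) auto
  show ?thesis
    unfolding lie_algebra_def lie_sum_def lie_data.simps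
    by (intro conjI vs psub span) (use \<gg> \<hh> in \<open>auto simp: lie_algebra_def zero_prod_def\<close>)
qed

lemma lie_algebra_gl1: "lie_algebra gl1_lie"
proof -
  have "x \<in> vector_space_over_itself.span {1}" for x :: complex
    using vector_space_over_itself.span_scale [OF vector_space_over_itself.span_base [of 1 "{1}"], of x] by simp
  then have "\<exists>B. finite B \<and> B \<subseteq> UNIV \<and> vector_space_over_itself.span B = (UNIV :: complex set)"
    by (intro exI [of _ "{1}"]) blast
  then show ?thesis
    unfolding lie_algebra_def gl1_lie_def lie_data.simps
    using vector_space_over_itself.vector_space_axioms by (simp add: algebra_simps)
qed

lemma lie_rep_tensor:
  assumes \<ll>: "lie_algebra \<ll>" and f: "lie_rep \<ll> f"
  shows "lie_rep (lie_sum \<ll> gl1_lie) (tensor_Lambda1 \<ll> f)"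
proof -
  interpret v: vector_space "lie_scale \<ll>" using \<ll> unfolding lie_algebra_def by blast
  have sub: "v.subspace (lie_carrier \<ll>)" using \<ll> unfolding lie_algebra_def by blast
  have br: "\<And>x y. x \<in> lie_carrier \<ll> \<Longrightarrow> y \<in> lie_carrier \<ll> \<Longrightarrow> lie_bracket \<ll> x y \<in> lie_carrier \<ll>"
    using \<ll> unfolding lie_algebra_def by blast
  have h: "\<And>x y. x \<in> lie_carrier \<ll> \<Longrightarrow> y \<in> lie_carrier \<ll> \<Longrightarrow> f (x + y) = f x + f y"
    "\<And>c x. x \<in> lie_carrier \<ll> \<Longrightarrow> f (lie_scale \<ll> c x) = map_matrix ((*) c) (f x)"
    "\<And>x y. x \<in> lie_carrier \<ll> \<Longrightarrow> y \<in> lie_carrier \<ll> \<Longrightarrow> f (lie_bracket \<ll> x y) = f x ** f y - f y ** f x"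
    using f unfolding lie_rep_def lie_hom_def gl_lie_def by auto
  have t: "tensor_Lambda1 \<ll> f (x, c) = f x + mat c" if "x \<in> lie_carrier \<ll>" for x c
    using that by (simp add: tensor_Lambda1_def lie_sum_def gl1_lie_def)
  show ?thesis
    unfolding lie_rep_def lie_hom_def
  proof (intro conjI ballI allI)
    show "tensor_Lambda1 \<ll> f \<in> extensional (lie_carrier (lie_sum \<ll> gl1_lie))"
      unfolding tensor_Lambda1_def by (rule restrict_extensional)
    fix p assume "p \<in> lie_carrier (lie_sum \<ll> gl1_lie)"
    then obtain x c where p: "p = (x, c)" and x: "x \<in> lie_carrier \<ll>" by (cases p) (auto simp: lie_sum_def)
    show "tensor_Lambda1 \<ll> f p \<in> lie_carrier gl_lie" by (simp add: gl_lie_def)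
    show "tensor_Lambda1 \<ll> f (lie_scale (lie_sum \<ll> gl1_lie) b p) = lie_scale gl_lie b (tensor_Lambda1 \<ll> f p)" for b
      using x by (simp add: p lie_sum_def gl1_lie_def gl_lie_def t v.subspace_scale [OF sub] h vec_eq_iff
          map_matrix_def mat_nth algebra_simps)
    fix q assume "q \<in> lie_carrier (lie_sum \<ll> gl1_lie)"
    then obtain y d where q: "q = (y, d)" and y: "y \<in> lie_carrier \<ll>" by (cases q) (auto simp: lie_sum_def)
    show "tensor_Lambda1 \<ll> f (p + q) = tensor_Lambda1 \<ll> f p + tensor_Lambda1 \<ll> f q"
      using x y by (simp add: p q t v.subspace_add [OF sub] h vec_eq_iff mat_nth algebra_simps)
    have "(mat 0 :: complex^'b^'b) = 0" by (simp add: vec_eq_iff mat_nth)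
    then show "tensor_Lambda1 \<ll> f (lie_bracket (lie_sum \<ll> gl1_lie) p q) = lie_bracket gl_lie (tensor_Lambda1 \<ll> f p) (tensor_Lambda1 \<ll> f q)"
      using x y by (simp add: gl_lie_def p q t commutator_add_mat lie_sum_def gl1_lie_def br h)
  qed
qed

lemma tensor_generic_iff:
  "generic_point (lie_sum \<ll> gl1_lie) (tensor_Lambda1 \<ll> f) v \<longleftrightarrow> (\<forall>y. \<exists>X\<in>lie_carrier \<ll>. \<exists>c. f X *v v + c *s v = y)"
proof -
  have m: "(A + mat c) *v v = A *v v + c *s v" for A c by (simp add: matrix_vector_mult_add_rdistrib mat_vec)
  have "(\<lambda>X. tensor_Lambda1 \<ll> f X *v v) ` lie_carrier (lie_sum \<ll> gl1_lie) = {f X *v v + c *s v | X c. X \<in> lie_carrier \<ll>}"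
    by (auto simp: tensor_Lambda1_def lie_sum_def gl1_lie_def m image_iff intro!: exI)
  then show ?thesis unfolding generic_point_def by (auto simp: set_eq_iff; metis)
qed

context clg_chart
begin

lemma PV_typeI:
  fixes f :: "(('a \<Rightarrow> complex) \<Rightarrow> complex) \<Rightarrow> complex^'m^'m"
  assumes "lie_rep LA f"
    and "generic_point (lie_sum LA gl1_lie) (tensor_Lambda1 LA f) v"
  shows "PV_type_IFPS LA f"
  unfolding PV_type_IFPS_def is_PV_def vec_dim_card
  using assms lie_algebra_L lie_algebra_sum [OF lie_algebra_L lie_algebra_gl1] lie_rep_tensor [OF lie_algebra_L assms(1)]
    lie_dim_eq by blast

text \<open>\<open>dH H\<close> is linear and, by \<open>phom_bracket\<close>, respects brackets
  modulo scalars. Both sides of each law for f are traceless, and traceless matrices that agree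
  modulo scalars are equal.\<close>

lemma induces_lie_rep:
  assumes \<A>: "\<A> \<in> IFPSs" and f: "induces \<A> f"
  shows "lie_rep LA f"
proof -
  obtain U \<phi> H r where U: "(U, \<phi>) \<in> \<A>" and d: "dev U \<phi> H r" and fe: "f \<in> extensional TS"
    and tr: "\<forall>\<xi>\<in>TS. trace (f \<xi>) = 0" and fH: "\<forall>\<xi>\<in>TS. gl_class (f \<xi>) = gl_class (dH H \<xi>)"
    by (rule induces_dev [OF \<A> f])
  obtain s where s: "phom H r s" using dev_phom [OF IFPS_D(1) [OF \<A> U] d] by blast
  have cl: "\<exists>c. f \<xi> = dH H \<xi> + mat c" if "\<xi> \<in> TS" for \<xi> using fH that unfolding gl_class_eq_iff by blast
  have m: "mat x + mat y = mat (x + y)" "mat x - mat y = mat (x - y)" for x y :: complex by (simp_all add: vec_eq_iff mat_nth)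
  show ?thesis
    unfolding lie_rep_def lie_hom_def lie_carrier_eq lie_scale_eq lie_bracket_eq
  proof (intro conjI ballI allI)
    show "f \<in> extensional TS" by (rule fe)
    fix \<xi> assume \<xi>: "\<xi> \<in> TS"
    obtain c where c: "f \<xi> = dH H \<xi> + mat c" using cl [OF \<xi>] by blast
    show "f \<xi> \<in> lie_carrier gl_lie" by (simp add: gl_lie_def)
    show "f (\<lambda>g. b * \<xi> g) = lie_scale gl_lie b (f \<xi>)" for b
    proof -
      obtain e where e: "f (\<lambda>g. b * \<xi> g) = dH H (\<lambda>g. b * \<xi> g) + mat e" using cl [OF TS_smult [OF \<xi>]] by blast
      have tb: "trace (lie_scale gl_lie b (f \<xi>)) = 0"
        using bspec [OF tr \<xi>] by (simp add: gl_lie_def map_matrix_def trace_def sum_distrib_left [symmetric])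
      have "f (\<lambda>g. b * \<xi> g) = lie_scale gl_lie b (f \<xi>) + mat (e - b * c)"
        unfolding e c by (simp add: gl_lie_def map_matrix_def vec_eq_iff mat_nth dH_nth algebra_simps)
      from traceless_eq [OF bspec [OF tr TS_smult [OF \<xi>]] tb this] show ?thesis .
    qed
    fix \<eta> assume \<eta>: "\<eta> \<in> TS"
    obtain c' where c': "f \<eta> = dH H \<eta> + mat c'" using cl [OF \<eta>] by blast
    show "f (\<xi> + \<eta>) = f \<xi> + f \<eta>"
    proof -
      obtain e where e: "f (\<xi> + \<eta>) = dH H (\<xi> + \<eta>) + mat e" using cl [OF TS_plus [OF \<xi> \<eta>]] by blast
      have tb: "trace (f \<xi> + f \<eta>) = 0" using bspec [OF tr \<xi>] bspec [OF tr \<eta>] by (simp add: trace_add)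
      have "f (\<xi> + \<eta>) = f \<xi> + f \<eta> + mat (e - c - c')"
        unfolding e c c' by (simp add: vec_eq_iff mat_nth dH_nth)
      from traceless_eq [OF bspec [OF tr TS_plus [OF \<xi> \<eta>]] tb this] show ?thesis .
    qed
    show "f (br \<xi> \<eta>) = lie_bracket gl_lie (f \<xi>) (f \<eta>)"
    proof -
      obtain e where e: "f (br \<xi> \<eta>) = dH H (br \<xi> \<eta>) + mat e" using cl [OF br_TS [OF \<xi> \<eta>]] by blast
      obtain e' where e': "dH H (br \<xi> \<eta>) = dH H \<xi> ** dH H \<eta> - dH H \<eta> ** dH H \<xi> + mat e'"
        using phom_bracket [OF s \<xi> \<eta>] by blast
      have tb: "trace (lie_bracket gl_lie (f \<xi>) (f \<eta>)) = 0"
        by (simp add: gl_lie_def trace_sub trace_mul_sym [of "f \<eta>"])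
      have "f (br \<xi> \<eta>) = lie_bracket gl_lie (f \<xi>) (f \<eta>) + mat (e' + e)"
        unfolding e e' c c' gl_lie_def lie_data.simps commutator_add_mat by (simp add: m add.assoc)
      from traceless_eq [OF bspec [OF tr br_TS [OF \<xi> \<eta>]] tb this] show ?thesis .
    qed
  qed
qed

text \<open>The infinitesimal orbit of \<open>axis k 1\<close> under the sum with gl(1), with
  coordinate k of u as the parameter of gl(1). Being an endomorphism of V, it is surjective, which
  is genericity, exactly when it is injective.\<close>

definition orbit_map :: "((('a \<Rightarrow> complex) \<Rightarrow> complex) \<Rightarrow> complex^'m^'m) \<Rightarrow> complex^'m \<Rightarrow> complex^'m" where
  "orbit_map f u = f (tv u) *v axis k 1 + u $ k *s axis k 1"

lemma orbit_map_linear: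
  assumes rep: "lie_hom LA gl_lie f"
  shows "Vector_Spaces.linear (*s) (*s) (orbit_map f)"
proof unfold_locales
  have f_add: "f (\<xi> + \<eta>) = f \<xi> + f \<eta>" if "\<xi> \<in> TS" "\<eta> \<in> TS" for \<xi> \<eta>
    using rep that unfolding lie_hom_def lie_carrier_eq by blast
  show "orbit_map f (u + v) = orbit_map f u + orbit_map f v" for u v
    unfolding orbit_map_def tv_add f_add [OF tv_TS tv_TS]
    by (simp add: matrix_vector_mult_add_rdistrib vector_add_component vec_eq_iff algebra_simps)
  have f_scale: "f (\<lambda>g. b * \<xi> g) = mat b ** f \<xi>" if "\<xi> \<in> TS" for b \<xi>
    using rep that unfolding lie_hom_def lie_carrier_eq lie_scale_eq gl_lie_def by (simp add: map_matrix_mult)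
  show "orbit_map f (b *s u) = b *s orbit_map f u" for b u
    unfolding orbit_map_def tv_smult f_scale [OF tv_TS] mat_mult_vec by (simp add: vec_eq_iff algebra_simps)
qed

text \<open>If u is in the kernel of the orbit map, its tangent vector kills the affine coordinates
  of the line through \<open>H a *v axis k 1\<close>, that is, of the chart;
  \<open>chart_kernel\<close> makes this vector zero. An injective endomorphism of V is
  surjective.\<close>

lemma induces_generic:
  assumes \<A>: "\<A> \<in> IFPSs" and f: "induces \<A> f"
  shows "generic_point (lie_sum LA gl1_lie) (tensor_Lambda1 LA f) (axis k 1)"
proof -
  obtain U \<phi> H r where U: "(U, \<phi>) \<in> \<A>" "\<phi> \<one> = proj_pt (axis k 1)" and d: "dev U \<phi> H r" and fe: "f \<in> extensional TS"
    and tr: "\<forall>\<xi>\<in>TS. trace (f \<xi>) = 0" and fH: "\<forall>\<xi>\<in>TS. gl_class (f \<xi>) = gl_class (dH H \<xi>)"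
    by (rule induces_dev [OF \<A> f])
  note c = IFPS_D(1) [OF \<A> U(1)]
  note cD = proj_chartD [OF c] and dD = devD [OF d]
  have rep: "lie_hom LA gl_lie f" using induces_lie_rep [OF \<A> f] unfolding lie_rep_def by blast
  define E :: "complex^'m" where "E = axis k 1"
  have E0: "E \<noteq> 0" unfolding E_def by (simp add: axis_eq_0_iff)
  define G where "G = orbit_map f"
  have G_def': "G u = f (tv u) *v E + u $ k *s E" for u unfolding G_def orbit_map_def E_def ..
  have "Vector_Spaces.linear (*s) (*s) G" unfolding G_def by (rule orbit_map_linear [OF rep])
  moreover have "u = 0" if G0: "G u = 0" for u
  proof -
    define \<xi> where "\<xi> = tv u"
    have \<xi>: "\<xi> \<in> TS" unfolding \<xi>_def by (rule tv_TS)
    obtain b where b: "f \<xi> = dH H \<xi> + mat b" using fH \<xi> unfolding gl_class_eq_iff by blast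
    have H0: "\<xi> (\<lambda>a. H a $ j $ k) = 0" if "j \<noteq> k" for j
    proof -
      have "G u $ j = f \<xi> $ j $ k" using that unfolding G_def' \<xi>_def E_def vector_add_component matrix_axis_nth
        by (simp add: axis_def)
      then show ?thesis using G0 that by (simp add: b mat_nth dH_nth)
    qed
    define V where "V = nb r \<inter> {x \<in> U. \<phi> x \<in> aff_dom k}"
    have V: "openin T V" unfolding V_def by (intro openin_Int open_nb holo_map_openin [OF cD(3) open_aff_dom])
    have oneU: "\<one> \<in> U" "\<phi> \<one> \<in> aff_dom k"
      using dD(3) one_nb [OF dD(1)] E0 by (auto simp: U(2) E_def aff_dom_iff)
    have oneV: "\<one> \<in> V" unfolding V_def using one_nb [OF dD(1)] oneU by blast
    have VU: "V \<subseteq> U" "V \<subseteq> nb r" "\<phi> ` V \<subseteq> aff_dom k" unfolding V_def by auto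
    have \<phi>V: "holo_map T \<Phi> proj_topology (proj_atlas k) V \<phi>" by (rule holo_map_subset [OF cD(3) V VU(1)])
    define q where "q j a = aff_map k k (\<phi> a) $ j" for j a
    have qhn: "q j \<in> hn" for j
      unfolding q_def by (rule hnI [OF holo_map_chart_coord [OF \<phi>V aff_chart_mem VU(3)] oneV])
    \<comment> \<open>Affine coordinate j of the chart is a quotient of entries in column k of H;
      the product form is ready for the Leibniz rule.\<close>
    have qH: "q j a * H a $ k $ k = H a $ j $ k" if a: "a \<in> V" and j: "j \<noteq> k" for j a
    proof -
      have ar: "a \<in> nb r" using a VU(2) by blast
      have nz: "H a *v E \<noteq> 0" by (rule matrix_vector_nonzero [OF dD(6) [OF ar] E0])
      have p: "\<phi> a = proj_pt (H a *v E)"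
        unfolding dev_base [OF d ar] U(2) E_def [symmetric] by (rule pgl_of_proj_pt [OF E0])
      have "\<phi> a \<in> aff_dom k" using a unfolding V_def by blast
      then have kk: "H a $ k $ k \<noteq> 0" unfolding p aff_dom_iff [OF nz] by (simp add: E_def matrix_axis_nth)
      then have "q j a = H a $ j $ k / H a $ k $ k"
        unfolding q_def p using j by (simp add: aff_map_proj_pt E_def matrix_axis_nth)
      then show ?thesis using kk by simp
    qed
    have Hhn: "(\<lambda>a. H a $ j $ k) \<in> hn" for j by (rule mfun_hn [OF dD(4,1)])
    have "\<xi> (q j) = 0" for j
    proof (cases "j = k")
      case True
      have "q j = (\<lambda>a. 0)" unfolding q_def using True aff_map_Cn [of k k] by (auto simp: Cn_def)
      then show ?thesis using TS_const [OF \<xi>] by simp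
    next
      case False
      have "\<xi> (\<lambda>a. q j a * H a $ k $ k) = \<xi> (\<lambda>a. H a $ j $ k)"
        by (rule TS_germ [OF \<xi> hn_mult [OF qhn Hhn] V oneV]) (rule qH [OF _ False])
      moreover have "q j \<one> = 0" using False by (simp add: q_def U(2) aff_map_proj_pt)  (simp add: axis_def)
      ultimately show ?thesis
        using H0 [OF False] dD(5) by (simp add: TS_mult [OF \<xi> qhn Hhn] mat_nth)
    qed
    then have \<xi>0: "\<xi> = 0" unfolding q_def by (intro chart_kernel [OF c oneU \<xi>])
    have "f (0 + 0) = f 0 + f 0" using rep TS_null unfolding lie_hom_def lie_carrier_eq by blast
    then have f0: "f 0 = 0" by simp
    have "u $ k = 0"
    proof -
      have "G u = u $ k *s E" unfolding G_def' \<xi>_def [symmetric] \<xi>0 f0 by simp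
      then show ?thesis using G0 E0 by simp
    qed
    moreover have "u $ j = 0" if "j \<noteq> k" for j
    proof -
      have "pr u = 0" using vc_tv [of u] unfolding \<xi>_def [symmetric] \<xi>0 by (simp add: vc_def vec_eq_iff)
      then have "pr u $ j = 0" by simp
      then show ?thesis using that by (simp add: pr_nth)
    qed
    ultimately have "u $ j = 0" for j by (cases "j = k") auto
    then show ?thesis by (simp add: vec_eq_iff)
  qed
  ultimately have "surj G" by (intro vec.linear_inj_imp_surj) (auto simp: vec.linear_inj_iff_eq_0)
  then have "\<forall>y. \<exists>X\<in>TS. \<exists>c. f X *v E + c *s E = y" unfolding G_def' surj_def using tv_TS by metis
  then show ?thesis unfolding tensor_generic_iff lie_carrier_eq E_def .
qed

end

section \<open>Structures from representations\<close>

text \<open>The real inverse function theorem requires a continuous derivative, which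
  \<open>holo_dd_holo\<close> supplies. The inverse of a complex-linear bijection is complex-linear,
  so the inverse map is holomorphic.\<close>

lemma holo_inverse_function:
  fixes F :: "complex^'m::finite \<Rightarrow> complex^'m"
  assumes F: "holo (*s) (*s) F S" and S: "open S" "p \<in> S" and inj: "\<And>v. dd F p v = 0 \<Longrightarrow> v = 0"
  obtains U V g where "open U" "U \<subseteq> S" "p \<in> U" "open V" "F p \<in> V" "homeomorphism U V F g" "holo (*s) (*s) g V"
proof -
  define F' where "F' x = Blinfun (dd F x)" for x
  have dF: "(F has_derivative dd F x) (at x)" if "x \<in> S" for x by (rule holo_dd [OF F S(1) that])
  have F'a: "blinfun_apply (F' x) = dd F x" if "x \<in> S" for x
    unfolding F'_def by (rule bounded_linear_Blinfun_apply [OF has_derivative_bounded_linear [OF dF [OF that]]])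
  have d: "(F has_derivative blinfun_apply (F' x)) (at x)" if "x \<in> S" for x unfolding F'a [OF that] by (rule dF [OF that])
  have "continuous_on S (\<lambda>x. blinfun_apply (F' x) v)" for v
  proof -
    have "continuous_on S (\<lambda>x. dd F x v)"
    proof (rule holo_continuous_on)
      show "holo (*s) (*s) (\<lambda>x. dd F x v) S"
        unfolding holo_vec_iff
      proof
        fix j
        have Fj: "holo (*s) (*) (\<lambda>x. F x $ j) S" using F unfolding holo_vec_iff by blast
        show "holo (*s) (*) (\<lambda>x. dd F x v $ j) S"
          by (rule holo_cong [OF holo_dd_holo(1) [OF cscale_vec Fj S(1)]])
             (rule dd_eq [OF has_derivative_nth [OF dF]])
      qed
    qed
    then show ?thesis by (rule continuous_on_eq) (simp add: F'a)
  qed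
  then have cont: "continuous_on S F'" by (intro continuous_on_blinfun_componentwise)
  have lin: "linear (dd F p)" by (rule has_derivative_linear [OF dF [OF S(2)]])
  have "inj (dd F p)" unfolding linear_injective_0 [OF lin] using inj by blast
  then obtain h where h: "linear h" "h \<circ> dd F p = id"
    using linear_injective_left_inverse [OF lin] by blast
  have "blinfun_apply (Blinfun h) = h"
    by (rule bounded_linear_Blinfun_apply) (use h(1) in \<open>simp add: linear_conv_bounded_linear\<close>)
  then have inv: "Blinfun h o\<^sub>L F' p = id_blinfun"
    by (intro blinfun_eqI) (use h(2) in \<open>simp add: F'a [OF S(2)] fun_eq_iff\<close>)
  obtain U V g g' where U: "open U" "U \<subseteq> S" "p \<in> U" "open V" "F p \<in> V" "homeomorphism U V F g"
    and g: "\<And>y. y \<in> V \<Longrightarrow> (g has_derivative (g' y)) (at y)" "\<And>y. y \<in> V \<Longrightarrow> g' y = inv_into UNIV (blinfun_apply (F' (g y)))"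
      "\<And>y. y \<in> V \<Longrightarrow> bij (blinfun_apply (F' (g y)))"
    by (rule inverse_function_theorem [OF S(1) d cont S(2) inv]) blast+
  have "holo (*s) (*s) g V"
    unfolding holo_def
  proof (intro ballI exI conjI allI)
    fix y c v assume y: "y \<in> V"
    show "(g has_derivative (g' y)) (at y within V)" by (rule has_derivative_at_withinI [OF g(1) [OF y]])
    have gS: "g y \<in> S" using U(2,6) y unfolding homeomorphism_def by blast
    let ?D = "blinfun_apply (F' (g y))"
    have sc: "?D (c *s w) = c *s ?D w" for w unfolding F'a [OF gS] by (rule holo_dd(2) [OF F S(1) gS])
    have "?D (c *s inv_into UNIV ?D v) = c *s v" unfolding sc using g(3) [OF y] by (simp add: bij_is_surj surj_f_inv_f)
    then show "g' y (c *s v) = c *s g' y v" unfolding g(2) [OF y] using g(3) [OF y] by (metis bij_inv_eq_iff)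
  qed
  then show thesis by (rule that [OF U])
qed

lemma holo_fun_chart:
  assumes T: "cmfd T \<Phi>" and V: "(V, \<psi>) \<in> \<Phi>" and G: "holo (*s) (*) G Q" and Q: "open Q"
  shows "holo_fun T \<Phi> {a \<in> V. \<psi> a \<in> Q} (\<lambda>a. G (\<psi> a))"
proof (rule holo_funI [OF cmfdD(4) [OF T V Q]])
  fix U \<phi> assume c: "(U, \<phi>) \<in> \<Phi>"
  have inj: "inj_on \<phi> U" by (rule cmfdD [OF T c])
  show "holo (*s) (*) (\<lambda>x. G (\<psi> (inv_into U \<phi> x))) (\<phi> ` ({a \<in> V. \<psi> a \<in> Q} \<inter> U))"
    by (rule holo_compose [OF holo_subset [OF cmfdD(5) [OF T c V]] G]) (use inj in auto)
qed

context clg_chart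
begin

lemma locp_pull:
  assumes "p \<in> carrier L" "q \<in> carrier L" and "locp T (p \<otimes> q) \<psi> \<psi>'"
  shows "locp T q (\<lambda>x. \<psi> (p \<otimes> x)) (\<lambda>x. \<psi>' (p \<otimes> x))"
proof -
  obtain S A where S: "openin T S" "p \<otimes> q \<in> S" "invertible A" "\<forall>x\<in>S. \<psi>' x = pgl_of A (\<psi> x)"
    using assms(3) unfolding locp_def by blast
  show ?thesis by (rule locpI [OF open_left [OF assms(1) S(1)] _ S(3)]) (use S assms in auto)
qed

text \<open>Every chart is tested at the unit, by comparing its translates with the reference germ
  \<phi>. Compatibility and left invariance then follow from transitivity of the comparison. The
  translates of \<phi> pass the test by \<open>eq\<close>, and they cover the group.\<close>

lemma atlas_of_local_hom:
  assumes c: "pchart (U, \<phi>)" and one: "\<one> \<in> U" and inv: "\<And>a. a \<in> U \<Longrightarrow> invertible (H a)"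
    and eq: "\<And>a x. a \<in> U \<Longrightarrow> x \<in> U \<Longrightarrow> a \<otimes> x \<in> U \<Longrightarrow> \<phi> (a \<otimes> x) = pgl_of (H a) (\<phi> x)"
  obtains \<A> where "\<A> \<in> IFPSs" "(U, \<phi>) \<in> \<A>"
proof -
  note cD = proj_chartD [OF c]
  define \<A> where "\<A> = {(W, \<psi>). pchart (W, \<psi>) \<and> (\<forall>p\<in>W. locp T \<one> \<phi> (\<lambda>x. \<psi> (p \<otimes> x)))}"
  have \<A>I: "(W, \<psi>) \<in> \<A>" if "pchart (W, \<psi>)" "\<And>p. p \<in> W \<Longrightarrow> locp T \<one> \<phi> (\<lambda>x. \<psi> (p \<otimes> x))" for W \<psi>
    using that unfolding \<A>_def by blast
  have \<A>D: "pchart (W, \<psi>)" "p \<in> W \<Longrightarrow> locp T \<one> \<phi> (\<lambda>x. \<psi> (p \<otimes> x))" if "(W, \<psi>) \<in> \<A>" for W \<psi> p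
    using that unfolding \<A>_def by blast+
  have Uc: "x \<in> carrier L" if "x \<in> U" for x using that open_carrier [OF cD(5)] by blast
  have Wc: "x \<in> carrier L" if "(W, \<psi>) \<in> \<A>" "x \<in> W" for W \<psi> x
    using that open_carrier [OF proj_chartD(5) [OF \<A>D(1)]] by blast
  have loc: "locp T \<one> \<phi> (\<lambda>x. \<phi> (b \<otimes> x))" if b: "b \<in> U" for b
  proof (rule locpI [OF _ _ inv [OF b]])
    show "openin T (U \<inter> {x \<in> carrier L. b \<otimes> x \<in> U})" by (intro openin_Int cD(5) open_left Uc [OF b])
    show "\<one> \<in> U \<inter> {x \<in> carrier L. b \<otimes> x \<in> U}" using one b Uc [OF b] by simp
    show "\<phi> (b \<otimes> x) = pgl_of (H b) (\<phi> x)" if "x \<in> U \<inter> {x \<in> carrier L. b \<otimes> x \<in> U}" for x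
      by (rule eq [OF b]) (use that in auto)
  qed
  have U\<A>: "(U, \<phi>) \<in> \<A>" by (rule \<A>I [OF c loc])
  have tr\<A>: "((\<lambda>x. p \<otimes> x) ` U, restrict (\<lambda>x. \<phi> (inv p \<otimes> x)) ((\<lambda>x. p \<otimes> x) ` U)) \<in> \<A>" (is "(?W, ?\<psi>) \<in> \<A>")
    if p: "p \<in> carrier L" for p
  proof (rule \<A>I [OF proj_chart_translate [OF c p]])
    fix q assume "q \<in> ?W"
    then obtain b where b: "b \<in> U" "q = p \<otimes> b" by blast
    have bc: "b \<in> carrier L" by (rule Uc [OF b(1)])
    have o: "openin T (U \<inter> {x \<in> carrier L. b \<otimes> x \<in> U})" by (intro openin_Int cD(5) open_left bc)
    show "locp T \<one> \<phi> (\<lambda>x. ?\<psi> (q \<otimes> x))"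
    proof (rule locp_cong [OF loc [OF b(1)] o])
      show "\<one> \<in> U \<inter> {x \<in> carrier L. b \<otimes> x \<in> U}" using one b bc by simp
      fix x assume x: "x \<in> U \<inter> {x \<in> carrier L. b \<otimes> x \<in> U}"
      then have "q \<otimes> x = p \<otimes> (b \<otimes> x)" unfolding b(2) using p bc by (simp add: m_assoc)
      moreover have "inv p \<otimes> (p \<otimes> (b \<otimes> x)) = b \<otimes> x" using p bc x by (simp add: m_assoc [symmetric])
      ultimately show "\<phi> (b \<otimes> x) = ?\<psi> (q \<otimes> x)" using x by simp
    qed simp
  qed
  \<comment> \<open>Germs are compared through their common reference \<phi> at the unit.\<close>
  have cmp: "locp T \<one> (\<lambda>x. \<psi> (p \<otimes> x)) h" if W: "(W, \<psi>) \<in> \<A>" "p \<in> W" and h: "locp T \<one> \<phi> h" for W \<psi> p h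
  proof -
    have pc: "p \<in> carrier L" by (rule Wc [OF W])
    note wD = proj_chartD [OF \<A>D(1) [OF W(1)]]
    have "locp T \<one> (\<lambda>x. \<psi> (p \<otimes> x)) \<phi>" by (rule locp_sym [OF \<A>D(2) [OF W] cD(5) one cD(6)])
    then show ?thesis
      by (rule locp_trans [OF _ h open_left [OF pc wD(5)]]) (use W(2) pc wD(6) in auto)
  qed
  have at: "proj_atlas_on k T \<Phi> \<A>"
    unfolding proj_atlas_on_iff
  proof (intro conjI allI impI ballI)
    show "pchart (W, \<psi>)" if "(W, \<psi>) \<in> \<A>" for W \<psi> by (rule \<A>D [OF that])
    show "(\<Union>(W, \<psi>)\<in>\<A>. W) = topspace T"
    proof
      show "(\<Union>(W, \<psi>)\<in>\<A>. W) \<subseteq> topspace T" using Wc unfolding carrier_top by blast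
      show "topspace T \<subseteq> (\<Union>(W, \<psi>)\<in>\<A>. W)"
      proof
        fix p assume "p \<in> topspace T"
        then have p: "p \<in> carrier L" unfolding carrier_top .
        have "p \<in> (\<lambda>x. p \<otimes> x) ` U" using one p by (intro image_eqI [of _ _ \<one>]) auto
        then show "p \<in> (\<Union>(W, \<psi>)\<in>\<A>. W)" by (intro UN_I [OF tr\<A> [OF p]]) simp
      qed
    qed
    fix W \<psi> W' \<psi>' p assume W: "(W, \<psi>) \<in> \<A>" "(W', \<psi>') \<in> \<A>" "p \<in> W \<inter> W'"
    then have pW: "p \<in> W" "p \<in> W'" by auto
    have pc: "p \<in> carrier L" by (rule Wc [OF W(1) pW(1)])
    show "locp T p \<psi> \<psi>'"
      using locp_translate [OF pc one_closed cmp [OF W(1) pW(1) \<A>D(2) [OF W(2) pW(2)]]] pc by simp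
  qed
  have max: "\<B> = \<A>" if \<B>: "proj_atlas_on k T \<Phi> \<B>" "\<A> \<subseteq> \<B>" for \<B>
  proof (intro equalityI that(2) subsetI)
    fix ch assume ch: "ch \<in> \<B>"
    obtain W \<psi> where W: "ch = (W, \<psi>)" by fastforce
    have \<B>c: "\<forall>U \<phi>. (U, \<phi>) \<in> \<B> \<longrightarrow> pchart (U, \<phi>)"
      and \<B>l: "\<forall>U \<phi> W \<psi>. (U, \<phi>) \<in> \<B> \<longrightarrow> (W, \<psi>) \<in> \<B> \<longrightarrow> (\<forall>p\<in>U \<inter> W. locp T p \<phi> \<psi>)"
      using conjunct1 [OF \<B>(1) [unfolded proj_atlas_on_iff]]
        conjunct2 [OF conjunct2 [OF \<B>(1) [unfolded proj_atlas_on_iff]]] by - assumption+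
    have wc: "pchart (W, \<psi>)" using \<B>c ch W by blast
    show "ch \<in> \<A>" unfolding W
    proof (rule \<A>I [OF wc])
      \<comment> \<open>A chart of a larger atlas is compatible at p with the translate of \<phi> to
        p, which belongs to \<A>; so it passes the test as well.\<close>
      fix p assume p: "p \<in> W"
      have pc: "p \<in> carrier L" using p open_carrier [OF proj_chartD(5) [OF wc]] by blast
      let ?V = "(\<lambda>x. p \<otimes> x) ` U"
      let ?\<chi> = "restrict (\<lambda>x. \<phi> (inv p \<otimes> x)) ?V"
      have pV: "p \<in> ?V" using one pc by (intro image_eqI [of _ _ \<one>]) auto
      have V\<A>: "(?V, ?\<chi>) \<in> \<A>" by (rule tr\<A> [OF pc])
      have "locp T (p \<otimes> \<one>) ?\<chi> \<psi>" unfolding r_one [OF pc] using \<B>l V\<A> \<B>(2) ch W p pV by blast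
      then have "locp T \<one> (\<lambda>x. ?\<chi> (p \<otimes> x)) (\<lambda>x. \<psi> (p \<otimes> x))" by (rule locp_pull [OF pc one_closed])
      then show "locp T \<one> \<phi> (\<lambda>x. \<psi> (p \<otimes> x))"
        by (rule locp_trans [OF \<A>D(2) [OF V\<A> pV] _ cD(5) one cD(6)])
    qed
  qed
  have ch: "\<forall>U \<phi>. (U, \<phi>) \<in> \<A> \<longrightarrow> pchart (U, \<phi>)" using \<A>D(1) by blast
  have "left_invariant L T \<A>"
    unfolding left_invariant_iff [OF ch]
  proof (intro ballI allI impI)
    fix a W \<psi> W' \<psi>' p
    assume a: "a \<in> carrier L" and W: "(W, \<psi>) \<in> \<A>" "(W', \<psi>') \<in> \<A>" and p: "p \<in> W" "a \<otimes> p \<in> W'"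
    have pc: "p \<in> carrier L" by (rule Wc [OF W(1) p(1)])
    have "locp T \<one> (\<lambda>x. \<psi> (p \<otimes> x)) (\<lambda>x. \<psi>' (a \<otimes> p \<otimes> x))" by (rule cmp [OF W(1) p(1) \<A>D(2) [OF W(2) p(2)]])
    then have "locp T \<one> (\<lambda>x. \<psi> (p \<otimes> x)) (\<lambda>x. \<psi>' (a \<otimes> (p \<otimes> x)))"
      by (rule locp_cong [OF _ open_carrier_L one_closed]) (use a pc in \<open>simp_all add: m_assoc\<close>)
    from locp_translate [OF pc one_closed, of \<psi> "\<lambda>y. \<psi>' (a \<otimes> y)", OF this]
    show "locp T p \<psi> (\<lambda>x. \<psi>' (a \<otimes> x))" using pc by simp
  qed
  then have "\<A> \<in> IFPSs"
    unfolding complex_IFPSs_def flat_proj_structure_def using at max by blast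
  then show thesis by (rule that [OF _ U\<A>])
qed

text \<open>Genericity makes the orbit map surjective, hence injective in finite dimension.\<close>

lemma orbit_map_inj:
  assumes rep: "lie_hom LA gl_lie f"
    and gen: "\<forall>y. \<exists>X\<in>TS. \<exists>c. f X *v axis k 1 + c *s axis k 1 = y"
  shows "orbit_map f u = 0 \<Longrightarrow> u = 0"
proof -
  have "\<exists>u. orbit_map f u = y" for y
  proof -
    obtain X c where X: "X \<in> TS" "f X *v axis k 1 + c *s axis k 1 = y" using gen by blast
    \<comment> \<open>The coordinates of X, with the parameter c of gl(1) in place k.\<close>
    let ?u = "pr (vc X) + c *s axis k 1"
    have "pr ?u = pr (vc X)" by (simp add: vec_eq_iff pr_nth axis_def)
    then have "tv ?u = X" using tv_pr [of ?u] tv_pr [of "vc X"] tv_vc [OF X(1)] by simp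
    moreover have "?u $ k = c" by (simp add: pr_nth axis_def)
    ultimately have "orbit_map f ?u = y" unfolding orbit_map_def using X(2) by simp
    then show ?thesis ..
  qed
  then have "surj (orbit_map f)" by (metis surjI)
  then have "inj (orbit_map f)" by (rule vec.linear_surj_imp_inj [OF orbit_map_linear [OF rep]])
  then show "orbit_map f u = 0 \<Longrightarrow> u = 0" using vec.linear_inj_iff_eq_0 [OF orbit_map_linear [OF rep]] by blast
qed

text \<open>The chart is the orbit map \<open>a \<mapsto> [H(a) e\<^sub>k]\<close> of the integrated representation, whose derivative
  in affine coordinates is \<open>orbit_map f\<close> modulo the line through \<open>e\<^sub>k\<close>.\<close>

lemma realize:
  assumes rep: "lie_hom LA gl_lie f" and fe: "f \<in> extensional TS"
    and tr: "\<And>\<xi>. \<xi> \<in> TS \<Longrightarrow> trace (f \<xi>) = 0"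
    and gen: "\<forall>y. \<exists>X\<in>TS. \<exists>c. f X *v axis k 1 + c *s axis k 1 = y"
  obtains \<A> where "\<A> \<in> IFPSs" "induces \<A> f"
proof -
  obtain r s H where r: "0 < r" "ball 0 r \<subseteq> \<Omega>0" and Hh: "\<forall>i j. hfun (nb r) (\<lambda>a. H a $ i $ j)"
    and H1: "H \<one> = mat 1" and s: "0 < s" "s \<le> r"
    and Hm: "\<forall>a\<in>nb s. \<forall>b\<in>nb s. a \<otimes> b \<in> nb r \<and> H (a \<otimes> b) = H a ** H b"
    and Hf: "\<forall>\<xi>\<in>TS. \<forall>i j. \<xi> (\<lambda>a. H a $ i $ j) = f \<xi> $ i $ j"
    by (rule integrate_group [OF rep])
  have Hr: "mfun H r" unfolding mfun_def by (rule Hh)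
  define E :: "complex^'m" where "E = axis k 1"
  have E0: "E \<noteq> 0" unfolding E_def by (simp add: axis_eq_0_iff)
  \<comment> \<open>H has to be invertible, and its entry (k, k) nonzero so that the orbit points
    lie in the affine chart k; within \<open>nb s\<close> it is multiplicative.\<close>
  have "openin T (nb s \<inter> ({a \<in> nb r. det (H a) \<in> - {0}} \<inter> {a \<in> nb r. H a $ k $ k \<in> - {0}}))"
    by (intro openin_Int open_nb holo_fun_open [OF cT] mfun_det Hr Hh [rule_format]) auto
  moreover have "\<one> \<in> nb s \<inter> ({a \<in> nb r. det (H a) \<in> - {0}} \<inter> {a \<in> nb r. H a $ k $ k \<in> - {0}})"
    using one_nb [OF s(1)] one_nb [OF r(1)] by (simp add: H1 mat_nth)
  ultimately obtain q where q: "0 < q" "ball 0 q \<subseteq> \<Omega>0"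
    and qs: "nb q \<subseteq> nb s \<inter> ({a \<in> nb r. det (H a) \<in> - {0}} \<inter> {a \<in> nb r. H a $ k $ k \<in> - {0}})"
    by (rule nbhd_nb)
  have qr: "nb q \<subseteq> nb r" "nb q \<subseteq> nb s" using qs by blast+
  have Hkk: "H a $ k $ k \<noteq> 0" and Hinv: "invertible (H a)" if "a \<in> nb q" for a
    using that qs by (auto simp: invertible_det_nz)
  have Hq: "hfun (nb q) (\<lambda>a. H a $ i $ j)" for i j
    by (rule holo_fun_subset [OF Hh [rule_format] open_nb qr(1)])
  define Q where "Q j a = H a $ j $ k / H a $ k $ k" for j a
  have Qh: "hfun (nb q) (Q j)" for j unfolding Q_def by (rule holo_fun_divide [OF cT Hq Hq Hkk])
  have Qhn: "Q j \<in> hn" for j by (rule hnI [OF Qh one_nb [OF q(1)]])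
  have Hhn: "(\<lambda>a. H a $ i $ j) \<in> hn" for i j by (rule hnI [OF Hq one_nb [OF q(1)]])
  have TSQ: "\<xi> (Q j) = f \<xi> $ j $ k" if \<xi>: "\<xi> \<in> TS" and j: "j \<noteq> k" for \<xi> j
  proof -
    have "\<xi> (\<lambda>a. Q j a * H a $ k $ k) = \<xi> (\<lambda>a. H a $ j $ k)"
      by (rule TS_germ [OF \<xi> hn_mult [OF Qhn Hhn] open_nb one_nb [OF q(1)]]) (simp add: Q_def Hkk)
    moreover have "Q j \<one> = 0" using j by (simp add: Q_def H1 mat_nth)
    ultimately show ?thesis using bspec [OF Hf \<xi>] by (simp add: TS_mult [OF \<xi> Qhn Hhn] H1 mat_nth)
  qed
  \<comment> \<open>Affine coordinates of the orbit map. Entry k would be the constant 0 and is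
    filled with \<open>x $ k\<close>, so that \<Psi> can be a local diffeomorphism of V.\<close>
  define \<Psi> :: "complex^'m \<Rightarrow> complex^'m" where "\<Psi> x = (\<chi> j. if j = k then x $ k else Q j (\<sigma> x))" for x
  have \<sigma>q: "\<sigma> x \<in> nb q" if "x \<in> ball 0 q" for x using that unfolding nb_image [OF q(2)] by blast
  have \<Psi>h: "holo (*s) (*s) \<Psi> (ball 0 q)"
    unfolding holo_vec_iff
  proof
    fix j
    show "holo (*s) (*) (\<lambda>x. \<Psi> x $ j) (ball 0 q)"
    proof (cases "j = k")
      case True
      then show ?thesis using holo_nth by (simp add: \<Psi>_def)
    next
      case False
      have "holo (*s) (*) (\<lambda>x. Q j (\<sigma> x)) (ball 0 q)"
        by (rule holo_subset [OF holo_pull [OF Qh]]) (use \<sigma>q q(2) in blast)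
      then show ?thesis using False by (simp add: \<Psi>_def)
    qed
  qed
  have z0: "0 \<in> ball (0::complex^'m) q" using q(1) by simp
  have d\<Psi>: "dd \<Psi> 0 v $ j = (if j = k then v $ k else f (tv v) $ j $ k)" for v j
  proof -
    have d: "((\<lambda>x. \<Psi> x $ j) has_derivative (\<lambda>v. dd \<Psi> 0 v $ j)) (at 0)"
      by (rule has_derivative_nth [OF holo_dd(1) [OF \<Psi>h open_ball z0]])
    show ?thesis
    proof (cases "j = k")
      case True
      have "((\<lambda>x::complex^'m. x $ k) has_derivative (\<lambda>v. v $ k)) (at 0)"
        by (rule bounded_linear_imp_has_derivative [OF bounded_linear_vec_nth])
      moreover have "((\<lambda>x::complex^'m. x $ k) has_derivative (\<lambda>v. dd \<Psi> 0 v $ k)) (at 0)"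
        using d True by (simp add: \<Psi>_def)
      ultimately have "(\<lambda>v. dd \<Psi> 0 v $ k) = (\<lambda>v. v $ k)" by (rule has_derivative_unique [rotated])
      from fun_cong [OF this] show ?thesis using True by simp
    next
      case False
      have "((\<lambda>x. Q j (\<sigma> x)) has_derivative (\<lambda>v. dd \<Psi> 0 v $ j)) (at 0)"
        using d False by (simp add: \<Psi>_def)
      from dd_eq [OF this] have "tv v (Q j) = dd \<Psi> 0 v $ j" by (simp add: tv_def Qhn)
      then show ?thesis using TSQ [OF tv_TS False, of v] False by simp
    qed
  qed
  have inj: "v = 0" if v: "dd \<Psi> 0 v = 0" for v
  proof -
    have vk: "v $ k = 0" using d\<Psi> [of v k] v by simp
    have fv: "f (tv v) $ j $ k = 0" if "j \<noteq> k" for j using d\<Psi> [of v j] v that by simp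
    \<comment> \<open>The parameter of gl(1) that cancels coordinate k of
      \<open>f (tv v) *v axis k 1\<close>, so that the corrected vector lies in the kernel of the
      orbit map.\<close>
    define \<beta> where "\<beta> = - f (tv v) $ k $ k"
    have "pr (v + \<beta> *s E) = pr v" by (simp add: vec_eq_iff pr_nth E_def axis_def)
    then have "tv (v + \<beta> *s E) = tv v" by (metis tv_pr)
    then have "orbit_map f (v + \<beta> *s E) $ j = 0" for j
      unfolding orbit_map_def vector_add_component matrix_axis_nth
      using vk fv [of j] by (cases "j = k") (simp_all add: E_def axis_def \<beta>_def)
    then have "orbit_map f (v + \<beta> *s E) = 0" by (simp add: vec_eq_iff)
    then have z: "v + \<beta> *s E = 0" by (rule orbit_map_inj [OF rep gen])
    then have "(v + \<beta> *s E) $ k = 0" by simp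
    then have "\<beta> = 0" using vk by (simp add: E_def axis_def)
    then show ?thesis using z by simp
  qed
  obtain U' V g where U': "open U'" "U' \<subseteq> ball 0 q" "0 \<in> U'" and V: "open V" "\<Psi> 0 \<in> V"
    and hom: "homeomorphism U' V \<Psi> g" and gh: "holo (*s) (*s) g V"
    by (rule holo_inverse_function [OF \<Psi>h open_ball z0 inj])
  have g\<Psi>: "g (\<Psi> x) = x" "\<Psi> x \<in> V" if "x \<in> U'" for x using hom that unfolding homeomorphism_def by blast+
  have \<Psi>g: "\<Psi> (g z) = z" "g z \<in> U'" if "z \<in> V" for z using hom that unfolding homeomorphism_def by blast+
  define W where "W = {a \<in> U0. \<kappa> a \<in> U'}"
  have oW: "openin T W" unfolding W_def by (rule open_\<kappa> [OF U'(1)])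
  have oneW: "\<one> \<in> W" unfolding W_def using one_U0 U'(3) by (simp add: \<kappa>_one)
  have Wq: "W \<subseteq> nb q" unfolding W_def nb_def using U'(2) by blast
  define \<phi> where "\<phi> = restrict (\<lambda>a. proj_pt (H a *v E)) W"
  have Hnz: "H a *v E \<noteq> 0" if "a \<in> W" for a by (rule matrix_vector_nonzero [OF Hinv E0]) (use that Wq in blast)
  have \<phi>dom: "\<phi> a \<in> aff_dom k" and \<phi>aff: "aff_map k k (\<phi> a) = \<Psi> (\<kappa> a)" if a: "a \<in> W" for a
  proof -
    have kk: "H a $ k $ k \<noteq> 0" by (rule Hkk) (use a Wq in blast)
    have aU: "a \<in> U0" using a unfolding W_def by blast
    show "\<phi> a \<in> aff_dom k" using a kk aff_dom_iff [OF Hnz [OF a]] by (simp add: \<phi>_def E_def matrix_axis_nth)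
    have "\<kappa> a $ k = 0" using \<kappa>_Cn [OF aU] by (simp add: Cn_def)
    then have "aff_map k k (\<phi> a) $ j = \<Psi> (\<kappa> a) $ j" for j
      using a kk by (simp add: \<phi>_def \<Psi>_def E_def aff_map_proj_pt matrix_axis_nth Q_def \<sigma>_\<kappa> [OF aU])
    then show "aff_map k k (\<phi> a) = \<Psi> (\<kappa> a)" by (simp add: vec_eq_iff)
  qed
  have retr: "\<sigma> (g (aff_map k k (\<phi> a))) = a" if a: "a \<in> W" for a
    using a g\<Psi>(1) unfolding \<phi>aff [OF a] W_def by (simp add: \<sigma>_\<kappa>)
  have inj\<phi>: "inj_on \<phi> W" by (rule inj_on_inverseI [where g="\<lambda>y. \<sigma> (g (aff_map k k y))"]) (rule retr)
  \<comment> \<open>\<Psi> keeps coordinate k, so its inverse g maps the hyperplane into itself and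
    passing through \<open>\<sigma>\<close> loses nothing.\<close>
  have fwd1: "\<sigma> (g (aff_map k k y)) \<in> W" "\<phi> (\<sigma> (g (aff_map k k y))) = y" "pr (g (aff_map k k y)) = g (aff_map k k y)"
    "\<kappa> (\<sigma> (g (aff_map k k y))) = g (aff_map k k y)"
    if y: "y \<in> aff_dom k" "aff_map k k y \<in> V" for y
  proof -
    define x where "x = g (aff_map k k y)"
    have x: "x \<in> U'" "\<Psi> x = aff_map k k y" unfolding x_def using \<Psi>g [OF y(2)] by simp_all
    have x\<Omega>: "x \<in> \<Omega>0" using x(1) U'(2) q(2) by blast
    have "x $ k = \<Psi> x $ k" by (simp add: \<Psi>_def)
    then have "x $ k = 0" unfolding x(2) using aff_map_Cn [of k k y] by (simp add: Cn_def)
    then show p: "pr (g (aff_map k k y)) = g (aff_map k k y)" unfolding x_def [symmetric] by (simp add: vec_eq_iff pr_nth)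
    then show ks: "\<kappa> (\<sigma> (g (aff_map k k y))) = g (aff_map k k y)" using \<kappa>_\<sigma> [OF x\<Omega>] unfolding x_def by simp
    show w: "\<sigma> (g (aff_map k k y)) \<in> W" unfolding W_def using ks \<sigma>_U0 [OF x\<Omega>] x(1) unfolding x_def by simp
    have "aff_map k k (\<phi> (\<sigma> (g (aff_map k k y)))) = aff_map k k y" unfolding \<phi>aff [OF w] ks using x(2) unfolding x_def .
    then show "\<phi> (\<sigma> (g (aff_map k k y))) = y" by (rule inj_onD [OF inj_aff_map _ \<phi>dom [OF w] y(1)])
  qed
  have im: "\<phi> ` W = {y \<in> aff_dom k. aff_map k k y \<in> V}"
  proof (intro equalityI subsetI)
    fix y assume "y \<in> \<phi> ` W"
    then obtain a where a: "a \<in> W" "y = \<phi> a" by blast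
    then show "y \<in> {y \<in> aff_dom k. aff_map k k y \<in> V}"
      using \<phi>dom [OF a(1)] \<phi>aff [OF a(1)] g\<Psi>(2) by (simp add: W_def)
  next
    fix y assume "y \<in> {y \<in> aff_dom k. aff_map k k y \<in> V}"
    then show "y \<in> \<phi> ` W" using fwd1(1,2) [of y] by (metis (no_types, lifting) image_eqI mem_Collect_eq)
  qed
  have im_open: "openin proj_topology (\<phi> ` W)" unfolding im by (rule cmfdD(4) [OF cmfd_proj aff_chart_mem V(1)])
  have chart: "pchart (W, \<phi>)"
    unfolding proj_chart_def biholomorphic_onto_open_def prod.case
  proof (intro conjI)
    show "\<phi> \<in> extensional W" unfolding \<phi>_def by (rule restrict_extensional)
    show "inj_on \<phi> W" by (rule inj\<phi>)
    have "holo_map T \<Phi> proj_topology (proj_atlas k) W (\<lambda>a. proj_pt (H a *v E))"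
    proof (rule holo_map_proj_pt [OF cT oW _ Hnz])
      show "hfun W (\<lambda>a. (H a *v E) $ j)" for j
        unfolding E_def matrix_axis_nth by (rule holo_fun_subset [OF Hq oW Wq])
    qed
    then show "holo_map T \<Phi> proj_topology (proj_atlas k) W \<phi>" by (rule holo_map_cong [OF cT]) (simp add: \<phi>_def)
    have "holo_map proj_topology (proj_atlas k) T \<Phi> (\<phi> ` W) (\<lambda>y. \<sigma> (g (aff_map k k y)))"
    proof (rule holo_map_into_chart [OF cmfd_proj cT U0 im_open])
      show "(\<lambda>y. \<sigma> (g (aff_map k k y))) ` \<phi> ` W \<subseteq> U0" using retr unfolding image_image by (auto simp: W_def)
      fix j
      have "holo (*s) (*) (\<lambda>z. g z $ j) V" using gh unfolding holo_vec_iff by blast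
      from holo_fun_chart [OF cmfd_proj aff_chart_mem this V(1)]
      have "holo_fun proj_topology (proj_atlas k) (\<phi> ` W) (\<lambda>y. g (aff_map k k y) $ j)" unfolding im .
      from holo_fun_add [OF this holo_fun_const [OF im_open, of _ "\<phi>0 \<one> $ j"]]
      show "holo_fun proj_topology (proj_atlas k) (\<phi> ` W) (\<lambda>y. \<phi>0 (\<sigma> (g (aff_map k k y))) $ j)"
      proof (rule holo_fun_cong [OF cmfd_proj])
        fix y assume "y \<in> \<phi> ` W"
        then have "\<kappa> (\<sigma> (g (aff_map k k y))) = g (aff_map k k y)" unfolding im by (intro fwd1(4)) auto
        then have "\<phi>0 (\<sigma> (g (aff_map k k y))) = g (aff_map k k y) + \<phi>0 \<one>" unfolding \<kappa>_def by (simp add: diff_eq_eq)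
        then show "g (aff_map k k y) $ j + \<phi>0 \<one> $ j = \<phi>0 (\<sigma> (g (aff_map k k y))) $ j" by simp
      qed
    qed
    then show "holo_map proj_topology (proj_atlas k) T \<Phi> (\<phi> ` W) (inv_into W \<phi>)"
    proof (rule holo_map_cong [OF cmfd_proj])
      fix y assume "y \<in> \<phi> ` W"
      then obtain a where a: "a \<in> W" "y = \<phi> a" by blast
      show "\<sigma> (g (aff_map k k y)) = inv_into W \<phi> y" unfolding a(2) retr [OF a(1)] inv_into_f_f [OF inj\<phi> a(1)] ..
    qed
  qed
  have eq: "\<phi> (a \<otimes> x) = pgl_of (H a) (\<phi> x)" if "a \<in> W" "x \<in> W" "a \<otimes> x \<in> W" for a x
  proof -
    have "a \<in> nb s" "x \<in> nb s" using that Wq qr(2) by blast+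
    then have "H (a \<otimes> x) = H a ** H x" using Hm by blast
    then show ?thesis using that by (simp add: \<phi>_def pgl_of_proj_pt [OF Hnz] matrix_vector_mul_assoc)
  qed
  have HinvW: "invertible (H a)" if "a \<in> W" for a by (rule Hinv) (use that Wq in blast)
  obtain \<A> where \<A>: "\<A> \<in> IFPSs" "(W, \<phi>) \<in> \<A>"
    by (rule atlas_of_local_hom [OF chart oneW HinvW eq])
  obtain t where t: "0 < t" "ball 0 t \<subseteq> \<Omega>0" "nb t \<subseteq> W" "\<forall>a\<in>nb t. \<forall>x\<in>nb t. a \<otimes> x \<in> W"
    by (rule mult_nb [OF oW oneW])
  have d: "dev W \<phi> H t"
    unfolding dev_def
  proof (intro conjI ballI t(1-3) H1)
    show "mfun H t" unfolding mfun_def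
      by (intro allI holo_fun_subset [OF Hq open_nb]) (use t(3) Wq in blast)
    fix a assume a: "a \<in> nb t"
    show "invertible (H a)" by (rule HinvW) (use a t(3) in blast)
    fix x assume x: "x \<in> nb t"
    show "a \<otimes> x \<in> W" using t(4) a x by blast
    then show "\<phi> (a \<otimes> x) = pgl_of (H a) (\<phi> x)" by (intro eq) (use a x t(3) in blast)+
  qed
  have "\<phi> \<one> = proj_pt (axis k 1)" using oneW by (simp add: \<phi>_def H1 E_def)
  then have "induces \<A> f"
  proof (rule dev_induces [OF \<A> _ d fe tr])
    fix \<xi> assume "\<xi> \<in> TS"
    then have "dH H \<xi> = f \<xi>" using Hf by (simp add: vec_eq_iff dH_nth)
    then show "gl_class (f \<xi>) = gl_class (dH H \<xi>)" by simp
  qed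
  then show thesis by (rule that [OF \<A>(1)])
qed

end

section \<open>The correspondence\<close>

lemma matrix_inv_unique:
  fixes A B :: "complex^'m::finite^'m"
  assumes "B ** A = mat 1"
  shows "matrix_inv A = B"
proof -
  have A: "invertible A" using assms invertible_left_inverse by blast
  have "B = B ** (A ** matrix_inv A)" by (simp add: matrix_inv [OF A])
  also have "\<dots> = matrix_inv A" unfolding matrix_mul_assoc assms by simp
  finally show ?thesis by simp
qed

lemma matrix_inv_mult:
  fixes A B :: "complex^'m::finite^'m"
  assumes "invertible A" "invertible B"
  shows "matrix_inv (A ** B) = matrix_inv B ** matrix_inv A"
proof (rule matrix_inv_unique)
  have "matrix_inv B ** matrix_inv A ** (A ** B) = matrix_inv B ** (matrix_inv A ** A) ** B" by (simp only: matrix_mul_assoc)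
  then show "matrix_inv B ** matrix_inv A ** (A ** B) = mat 1" by (simp add: matrix_inv [OF assms(1)] matrix_inv [OF assms(2)])
qed

lemma Ad_class_mult:
  assumes "invertible P" "invertible Q"
  shows "Ad_class P (Ad_class Q X) = Ad_class (P ** Q) X"
  unfolding Ad_class_def image_image matrix_inv_mult [OF assms] by (simp only: matrix_mul_assoc)

lemma Ad_class_one: "Ad_class (mat 1) X = X"
  for X :: "(complex^'m::finite^'m) set"
proof -
  have "matrix_inv (mat 1 :: complex^'m^'m) = mat 1" by (rule matrix_inv_unique) simp
  then show ?thesis unfolding Ad_class_def by simp
qed

section \<open>The equivalence relation on data and its classes\<close>

lemma rep_equiv_refl: "v \<noteq> 0 \<Longrightarrow> rep_equiv \<ll> f v f v"
  unfolding rep_equiv_def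
  by (intro exI [of _ "mat 1"]) (simp add: invertible_one Ad_class_one pgl_of_one proj_pt_in_space)

lemma rep_equiv_trans:
  assumes "rep_equiv \<ll> f v g w" "rep_equiv \<ll> g w h u" "v \<noteq> 0"
  shows "rep_equiv \<ll> f v h u"
proof -
  obtain P where P: "invertible P" "\<forall>X\<in>lie_carrier \<ll>. gl_class (g X) = Ad_class P (gl_class (f X))"
    "proj_pt w = pgl_of P (proj_pt v)" using assms(1) unfolding rep_equiv_def by blast
  obtain Q where Q: "invertible Q" "\<forall>X\<in>lie_carrier \<ll>. gl_class (h X) = Ad_class Q (gl_class (g X))"
    "proj_pt u = pgl_of Q (proj_pt w)" using assms(2) unfolding rep_equiv_def by blast
  show ?thesis
    unfolding rep_equiv_def
    by (intro exI [of _ "Q ** P"])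
       (use P Q in \<open>simp add: invertible_mult Ad_class_mult pgl_of_mult proj_pt_in_space assms(3)\<close>)
qed

lemma rep_equiv_sym:
  assumes "rep_equiv \<ll> f v g w" "v \<noteq> 0"
  shows "rep_equiv \<ll> g w f v"
proof -
  obtain P where P: "invertible P" "\<forall>X\<in>lie_carrier \<ll>. gl_class (g X) = Ad_class P (gl_class (f X))"
    "proj_pt w = pgl_of P (proj_pt v)" using assms(1) unfolding rep_equiv_def by blast
  have Pi: "invertible (matrix_inv P)" by (rule invertible_matrix_inv' [OF P(1)])
  show ?thesis
    unfolding rep_equiv_def
    by (intro exI [of _ "matrix_inv P"])
       (use P Pi in \<open>simp add: Ad_class_mult matrix_inv Ad_class_one pgl_of_inv proj_pt_in_space assms(2)\<close>)
qed

lemma generic_point_nonzero: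
  fixes v :: "complex^'m::finite"
  assumes "generic_point \<gg> \<rho> v"
  shows "v \<noteq> 0"
proof
  assume "v = 0"
  then have "(UNIV :: (complex^'m) set) \<subseteq> {0}" using assms unfolding generic_point_def by auto
  then have "axis undefined 1 = (0 :: complex^'m)" by blast
  then show False by (simp add: axis_eq_0_iff)
qed

text \<open>The pairs contain only the tensor product. As f is extensional, it is recovered from the
  arguments (X, 0), so the relation defined through f is a relation between pairs.\<close>

lemma tensor_inj:
  assumes f: "lie_rep \<ll> f" and g: "lie_rep \<ll> g" and eq: "tensor_Lambda1 \<ll> f = tensor_Lambda1 \<ll> g"
  shows "f = g"
proof (rule extensionalityI)
  show "f \<in> extensional (lie_carrier \<ll>)" "g \<in> extensional (lie_carrier \<ll>)" using f g unfolding lie_rep_def by blast+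
  fix X assume "X \<in> lie_carrier \<ll>"
  then show "f X = g X" using fun_cong [OF eq, of "(X, 0)"] by (simp add: tensor_Lambda1_def lie_sum_def gl1_lie_def)
qed

definition IFPS_datum :: "('g::ab_group_add) lie_data \<Rightarrow> ('g \<Rightarrow> complex^'m::finite^'m) \<Rightarrow> complex^'m \<Rightarrow> bool" where
  "IFPS_datum \<ll> f v \<longleftrightarrow> PV_type_IFPS \<ll> f \<and> generic_point (lie_sum \<ll> gl1_lie) (tensor_Lambda1 \<ll> f) v"

lemma IFPS_datum_inj:
  "IFPS_datum \<ll> f v \<Longrightarrow> IFPS_datum \<ll> g w \<Longrightarrow> tensor_Lambda1 \<ll> f = tensor_Lambda1 \<ll> g \<Longrightarrow> f = g"
  unfolding IFPS_datum_def PV_type_IFPS_def by (blast intro: tensor_inj)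

lemma IFPS_datum_nonzero: "IFPS_datum \<ll> f v \<Longrightarrow> v \<noteq> 0"
  unfolding IFPS_datum_def by (blast dest: generic_point_nonzero)

lemma IFPS_pairs_iff: "x \<in> IFPS_pairs \<ll> \<longleftrightarrow> (\<exists>f v. x = (tensor_Lambda1 \<ll> f, v) \<and> IFPS_datum \<ll> f v)"
  unfolding IFPS_pairs_def IFPS_datum_def by blast

lemma IFPS_equiv_iff: "z \<in> IFPS_equiv \<ll> \<longleftrightarrow> (\<exists>f v g w. z = ((tensor_Lambda1 \<ll> f, v), (tensor_Lambda1 \<ll> g, w)) \<and>
    IFPS_datum \<ll> f v \<and> IFPS_datum \<ll> g w \<and> rep_equiv \<ll> f v g w)"
  unfolding IFPS_equiv_def IFPS_datum_def by blast

text \<open>Membership asserts that some presentation of the two pairs is equivalent; by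
  \<open>IFPS_datum_inj\<close> that presentation is the given one.\<close>

lemma IFPS_equiv_pair:
  assumes "IFPS_datum \<ll> f v" "IFPS_datum \<ll> g w"
  shows "((tensor_Lambda1 \<ll> f, v), (tensor_Lambda1 \<ll> g, w)) \<in> IFPS_equiv \<ll> \<longleftrightarrow> rep_equiv \<ll> f v g w"
proof
  assume "((tensor_Lambda1 \<ll> f, v), (tensor_Lambda1 \<ll> g, w)) \<in> IFPS_equiv \<ll>"
  then obtain f' g' where "tensor_Lambda1 \<ll> f = tensor_Lambda1 \<ll> f'" "tensor_Lambda1 \<ll> g = tensor_Lambda1 \<ll> g'"
    "IFPS_datum \<ll> f' v" "IFPS_datum \<ll> g' w" "rep_equiv \<ll> f' v g' w" unfolding IFPS_equiv_iff by auto
  then show "rep_equiv \<ll> f v g w" using IFPS_datum_inj assms by metis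
qed (use assms IFPS_equiv_iff in blast)

lemma equiv_IFPS: "equiv (IFPS_pairs \<ll>) (IFPS_equiv \<ll>)"
proof (rule equivI)
  show "IFPS_equiv \<ll> \<subseteq> IFPS_pairs \<ll> \<times> IFPS_pairs \<ll>"
    by (auto simp: IFPS_equiv_iff IFPS_pairs_iff)
  show "refl_on (IFPS_pairs \<ll>) (IFPS_equiv \<ll>)"
    unfolding refl_on_def
    by (auto simp: IFPS_pairs_iff IFPS_equiv_pair rep_equiv_refl IFPS_datum_nonzero)
  show "sym (IFPS_equiv \<ll>)"
  proof (rule symI)
    fix x y assume "(x, y) \<in> IFPS_equiv \<ll>"
    then obtain f v g w where "x = (tensor_Lambda1 \<ll> f, v)" "y = (tensor_Lambda1 \<ll> g, w)"
      "IFPS_datum \<ll> f v" "IFPS_datum \<ll> g w" "rep_equiv \<ll> f v g w" unfolding IFPS_equiv_iff by auto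
    then show "(y, x) \<in> IFPS_equiv \<ll>" by (simp add: IFPS_equiv_pair rep_equiv_sym IFPS_datum_nonzero)
  qed
  show "trans (IFPS_equiv \<ll>)"
  proof (rule transI)
    fix x y z assume xy: "(x, y) \<in> IFPS_equiv \<ll>" and yz: "(y, z) \<in> IFPS_equiv \<ll>"
    obtain f v g w where 1: "x = (tensor_Lambda1 \<ll> f, v)" "y = (tensor_Lambda1 \<ll> g, w)"
      "IFPS_datum \<ll> f v" "IFPS_datum \<ll> g w" "rep_equiv \<ll> f v g w" using xy unfolding IFPS_equiv_iff by auto
    obtain h u where 2: "z = (tensor_Lambda1 \<ll> h, u)" "IFPS_datum \<ll> h u" using yz unfolding IFPS_equiv_iff by auto
    have "rep_equiv \<ll> g w h u" using yz unfolding 1 2 by (simp add: IFPS_equiv_pair 1 2)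
    then have "rep_equiv \<ll> f v h u" by (rule rep_equiv_trans [OF 1(5) _ IFPS_datum_nonzero [OF 1(3)]])
    then show "(x, z) \<in> IFPS_equiv \<ll>" unfolding 1 2 by (simp add: IFPS_equiv_pair 1 2)
  qed
qed

context clg_chart
begin

lemma induces_datum:
  assumes "\<A> \<in> IFPSs" "induces \<A> f"
  shows "IFPS_datum LA f (axis k 1)"
  unfolding IFPS_datum_def using PV_typeI [OF induces_lie_rep [OF assms] induces_generic [OF assms]] induces_generic [OF assms] by blast

text \<open>The datum is normalised before \<open>realize\<close> applies: conjugation moves v to
  \<open>axis k 1\<close>, and passing to the traceless part changes f by scalars only, which leaves
  the class unchanged and is absorbed by gl(1) in the genericity condition.\<close>

lemma datum_realized:
  fixes f :: "(('a \<Rightarrow> complex) \<Rightarrow> complex) \<Rightarrow> complex^'m^'m"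
  assumes "IFPS_datum LA f v"
  obtains \<A> f' where "\<A> \<in> IFPSs" "induces \<A> f'"
    "rep_equiv LA f v f' (axis k 1)"
proof -
  have rep: "lie_hom LA gl_lie f"
    and gen: "\<forall>y. \<exists>X\<in>TS. \<exists>c. f X *v v + c *s v = y"
    using assms unfolding IFPS_datum_def PV_type_IFPS_def lie_rep_def tensor_generic_iff lie_carrier_eq by blast+
  have v0: "v \<noteq> 0" by (rule IFPS_datum_nonzero [OF assms])
  obtain P :: "complex^'m^'m" where P: "invertible P" "P *v v = axis k 1"
    by (rule ex_matrix_map [OF v0, of "axis k 1"]) (simp add: axis_eq_0_iff)
  have f_add: "f (\<xi> + \<eta>) = f \<xi> + f \<eta>" and f_br: "f (br \<xi> \<eta>) = f \<xi> ** f \<eta> - f \<eta> ** f \<xi>"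
    and f_scale: "f (\<lambda>g. b * \<xi> g) = map_matrix ((*) b) (f \<xi>)" if "\<xi> \<in> TS" "\<eta> \<in> TS" for \<xi> \<eta> b
    using rep that unfolding lie_hom_def lie_carrier_eq lie_scale_eq lie_bracket_eq by (auto simp: gl_lie_def)
  define C where "C A = P ** A ** matrix_inv P" for A
  define f' where "f' = restrict (\<lambda>\<xi>. traceless (C (f \<xi>))) TS"
  have f': "f' \<xi> = traceless (C (f \<xi>))" if "\<xi> \<in> TS" for \<xi> using that by (simp add: f'_def)
  have C_add: "C (A + B) = C A + C B" "C (A - B) = C A - C B" for A B unfolding C_def by (simp_all add: matrix_bilinear_simps)
  have C_scale: "C (map_matrix ((*) b) A) = map_matrix ((*) b) (C A)" for b A
  unfolding C_def map_matrix_mult matrix_mul_assoc mat_mult_comm [of P] ..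
  have C_mult: "C (A ** B) = C A ** C B" for A B
  proof -
    have "C A ** C B = P ** A ** (matrix_inv P ** P) ** B ** matrix_inv P" unfolding C_def by (simp only: matrix_mul_assoc)
    then show ?thesis by (simp add: C_def matrix_inv [OF P(1)] matrix_mul_assoc)
  qed
  have t_add: "traceless (A + B) = traceless A + traceless B" for A B :: "complex^'m^'m"
    unfolding traceless_def by (simp add: vec_eq_iff trace_add mat_nth add_divide_distrib diff_divide_distrib)
  have t_scale: "traceless (map_matrix ((*) b) A) = map_matrix ((*) b) (traceless A)" for b and A :: "complex^'m^'m"
    unfolding traceless_def by (simp add: vec_eq_iff map_matrix_def trace_def mat_nth sum_distrib_left [symmetric] algebra_simps)
  \<comment> \<open>A commutator is already traceless and does not see scalars.\<close>
  have t_br: "traceless (A ** B - B ** A) = traceless A ** traceless B - traceless B ** traceless A" for A B :: "complex^'m^'m"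
  proof -
    have "traceless (A ** B - B ** A) = A ** B - B ** A"
      unfolding traceless_def trace_sub trace_mul_sym [of B A] by (simp add: vec_eq_iff mat_nth)
    then show ?thesis unfolding traceless_def [of A] traceless_def [of B] commutator_add_mat by simp
  qed
  have rep': "lie_hom LA gl_lie f'"
    unfolding lie_hom_def lie_carrier_eq lie_scale_eq lie_bracket_eq
    by (auto simp: gl_lie_def f' TS_plus TS_smult br_TS f_add f_scale f_br C_add C_scale C_mult t_add t_scale t_br)
  have gen': "\<exists>X\<in>TS. \<exists>c. f' X *v axis k 1 + c *s axis k 1 = y" for y
  proof -
    obtain X c where X: "X \<in> TS" and c: "f X *v v + c *s v = matrix_inv P *v y" using gen by blast
    obtain d where d: "f' X = C (f X) + mat d" unfolding f' [OF X] traceless_def by blast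
    have "matrix_inv P *v axis k 1 = v"
      unfolding P(2) [symmetric] by (simp add: matrix_vector_mul_assoc matrix_inv [OF P(1)])
    then have "C (f X) *v axis k 1 = P *v (f X *v v)" unfolding C_def by (simp add: matrix_vector_mul_assoc [symmetric])
    moreover have "P *v (f X *v v) + c *s axis k 1 = y"
    proof -
      have "P *v (f X *v v + c *s v) = P *v (f X *v v) + c *s axis k 1"
        by (simp add: matrix_vector_right_distrib vector_scalar_commute P(2))
      then show ?thesis unfolding c by (simp add: matrix_vector_mul_assoc matrix_inv [OF P(1)])
    qed
    \<comment> \<open>The scalar d added by \<open>traceless\<close> is compensated by the parameter
      of gl(1).\<close>
    ultimately have "f' X *v axis k 1 + (c - d) *s axis k 1 = y"
      unfolding d matrix_vector_mult_add_rdistrib mat_vec by (simp add: vector_sub_rdistrib algebra_simps)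
    then show ?thesis using X by blast
  qed
  obtain \<A> where \<A>: "\<A> \<in> IFPSs" "induces \<A> f'"
  proof (rule realize [OF rep'])
    show "f' \<in> extensional TS" unfolding f'_def by (rule restrict_extensional)
    show "trace (f' \<xi>) = 0" if "\<xi> \<in> TS" for \<xi> using that by (simp add: f' trace_traceless)
    show "\<forall>y. \<exists>X\<in>TS. \<exists>c. f' X *v axis k 1 + c *s axis k 1 = y" using gen' by blast
  qed
  have "rep_equiv LA f v f' (axis k 1)"
    unfolding rep_equiv_def lie_carrier_eq
    by (intro exI [of _ P])
       (simp add: P f' gl_class_traceless Ad_class_gl_class [OF P(1)] C_def pgl_of_proj_pt [OF v0])
  then show thesis by (rule that [OF \<A>])
qed

text \<open>F picks some f for each structure. \<open>induces_rep_equiv\<close> makes the class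
  independent of the choice, \<open>rep_equiv_eq\<close> gives injectivity and
  \<open>datum_realized\<close> surjectivity.\<close>

lemma correspondence:
  fixes F :: "('a, (complex^'m) set) chart set \<Rightarrow>
      (((('a \<Rightarrow> complex) \<Rightarrow> complex) \<times> complex \<Rightarrow> complex^'m^'m) \<times> (complex^'m)) set"
  defines "F \<equiv> \<lambda>\<A>. IFPS_equiv LA ``
      {(tensor_Lambda1 LA (SOME f. induces \<A> f), axis k 1)}"
  shows "bij_betw F IFPSs (IFPS_pairs LA // IFPS_equiv LA)"
    and "\<A> \<in> IFPSs \<Longrightarrow> induces \<A> f \<Longrightarrow>
      F \<A> = IFPS_equiv LA `` {(tensor_Lambda1 LA f, axis k 1)}"
proof -
  let ?\<ll> = "LA"
  have F: "F \<A> = IFPS_equiv ?\<ll> `` {(tensor_Lambda1 ?\<ll> f, axis k 1)}"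
    if \<A>: "\<A> \<in> IFPSs" and f: "induces \<A> f" for \<A> f
  proof -
    have s: "induces \<A> (SOME f. induces \<A> f)" by (rule someI [of _ f], rule f)
    show ?thesis unfolding F_def
      by (rule equiv_class_eq [OF equiv_IFPS])
         (unfold IFPS_equiv_pair [OF induces_datum [OF \<A> s] induces_datum [OF \<A> f]], rule induces_rep_equiv [OF \<A> s f])
  qed
  then show "\<A> \<in> IFPSs \<Longrightarrow> induces \<A> f \<Longrightarrow>
      F \<A> = IFPS_equiv ?\<ll> `` {(tensor_Lambda1 ?\<ll> f, axis k 1)}" .
  show "bij_betw F IFPSs (IFPS_pairs ?\<ll> // IFPS_equiv ?\<ll>)"
    unfolding bij_betw_def
  proof (intro conjI)
    show "inj_on F IFPSs"
    proof (rule inj_onI)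
      fix \<A> \<B> assume \<A>: "\<A> \<in> IFPSs" and \<B>: "\<B> \<in> IFPSs" and e: "F \<A> = F \<B>"
      obtain f where f: "induces \<A> f" using induces_exists [OF \<A>] by blast
      obtain g where g: "induces \<B> g" using induces_exists [OF \<B>] by blast
      have mem: "(tensor_Lambda1 ?\<ll> g, axis k 1) \<in> IFPS_pairs ?\<ll>" unfolding IFPS_pairs_iff using induces_datum [OF \<B> g] by blast
      have "((tensor_Lambda1 ?\<ll> f, axis k 1), (tensor_Lambda1 ?\<ll> g, axis k 1)) \<in> IFPS_equiv ?\<ll>"
        by (rule eq_equiv_class [OF e [unfolded F [OF \<A> f] F [OF \<B> g]] equiv_IFPS mem])
      then have "rep_equiv ?\<ll> f (axis k 1) g (axis k 1)"
        unfolding IFPS_equiv_pair [OF induces_datum [OF \<A> f] induces_datum [OF \<B> g]] .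
      then show "\<A> = \<B>" by (rule rep_equiv_eq [OF \<A> \<B> f g])
    qed
  next
    show "F ` IFPSs = IFPS_pairs ?\<ll> // IFPS_equiv ?\<ll>"
    proof (intro equalityI subsetI)
      fix X assume "X \<in> F ` IFPSs"
      then obtain \<A> where \<A>: "\<A> \<in> IFPSs" "X = F \<A>" by blast
      obtain f where f: "induces \<A> f" using induces_exists [OF \<A>(1)] by blast
      show "X \<in> IFPS_pairs ?\<ll> // IFPS_equiv ?\<ll>"
        unfolding \<A>(2) F [OF \<A>(1) f] by (rule quotientI) (use IFPS_pairs_iff induces_datum [OF \<A>(1) f] in blast)
    next
      fix X :: "(((('a \<Rightarrow> complex) \<Rightarrow> complex) \<times> complex \<Rightarrow> complex^'m^'m) \<times> (complex^'m)) set"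
      assume "X \<in> IFPS_pairs ?\<ll> // IFPS_equiv ?\<ll>"
      then obtain x where x: "x \<in> IFPS_pairs ?\<ll>" "X = IFPS_equiv ?\<ll> `` {x}" by (rule quotientE)
      obtain f v where fv: "x = (tensor_Lambda1 ?\<ll> f, v)" "IFPS_datum ?\<ll> f v" using x(1) unfolding IFPS_pairs_iff by blast
      obtain \<A> f' where \<A>: "\<A> \<in> IFPSs" "induces \<A> f'" and e: "rep_equiv ?\<ll> f v f' (axis k 1)"
        by (rule datum_realized [OF fv(2)])
      have "(x, (tensor_Lambda1 ?\<ll> f', axis k 1)) \<in> IFPS_equiv ?\<ll>"
        unfolding fv(1) IFPS_equiv_pair [OF fv(2) induces_datum [OF \<A>]] by (rule e)
      then have "X = F \<A>" unfolding x(2) F [OF \<A>] by (rule equiv_class_eq [OF equiv_IFPS])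
      then show "X \<in> F ` IFPSs" using \<A>(1) by blast
    qed
  qed
qed

end

theorem corollary5p4:
  fixes k :: "'m::finite"
    and L :: "('a, 'b) monoid_scheme"
    and T :: "'a topology"
    and \<Phi> :: "('a, complex^'m) chart set"
  assumes "complex_lie_group k L T \<Phi>"
  shows "\<exists>F :: ('a, (complex^'m) set) chart set \<Rightarrow>
             (((('a \<Rightarrow> complex) \<Rightarrow> complex) \<times> complex \<Rightarrow> complex^'m^'m) \<times> (complex^'m)) set.
    bij_betw F (complex_IFPSs k L T \<Phi>)
      (IFPS_pairs (lie_algebra_of L T \<Phi>) // IFPS_equiv (lie_algebra_of L T \<Phi>)) \<and>
    (\<forall>\<A>\<in>complex_IFPSs k L T \<Phi>.
       (\<exists>f. induces_rep k L T \<Phi> \<A> f) \<and>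
       (\<forall>f. induces_rep k L T \<Phi> \<A> f \<longrightarrow>
          F \<A> = IFPS_equiv (lie_algebra_of L T \<Phi>) ``
                  {(tensor_Lambda1 (lie_algebra_of L T \<Phi>) f, axis k 1)}))"
proof -
  interpret clg k L T \<Phi> by (rule clg.intro) (rule assms)
  have "\<one>\<^bsub>L\<^esub> \<in> topspace T" using one_closed carrier_top by simp
  \<comment> \<open>Only a chart at the unit is fixed; other points are reached by left
    translation.\<close>
  then obtain U0 \<phi>0 where "(U0, \<phi>0) \<in> \<Phi>" "\<one>\<^bsub>L\<^esub> \<in> U0" by (rule cmfd_cover [OF cT])
  then interpret clg_chart k L T \<Phi> U0 \<phi>0 by unfold_locales
  show ?thesis
    by (rule exI, rule conjI [OF correspondence(1)], intro ballI conjI allI impI)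
       (erule induces_exists, erule correspondence(2), assumption)
qed

end
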